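(* Let $m\ge2$, $\operatorname{Re}\omega>0$ and $c>-1$. Put $$K(x,y;\omega)=e^{-\frac{\coth\omega}{2}(|x|^2+|y|^2)}\left(A(z,w)+(\underline{x}\wedge\underline{y})\,B(z,w)\right)$$ with $$A(z,w)=\sum_{k=0}^{+\infty}\left(\alpha_k\frac{k+2\lambda}{2\lambda}z^{\frac{k}{1+c}}\widetilde{J}_{\frac{\gamma_k}{2}-1}\left(\frac{iz}{\sinh\omega}\right)+\frac{\alpha_{k-1}}{4\sinh\omega}\frac{k}{\lambda}z^{\frac{k+c}{1+c}}\widetilde{J}_{\frac{\gamma_{k-1}}{2}}\left(\frac{iz}{\sinh\omega}\right)\right)C_k^{\lambda}(w),$$ $$B(z,w)=\sum_{k=1}^{+\infty}\left(-\alpha_kz^{\frac{k}{1+c}-1}\widetilde{J}_{\frac{\gamma_k}{2}-1}\left(\frac{iz}{\sinh\omega}\right)+\frac{\alpha_{k-1}}{2\sinh\omega}z^{\frac{k+c}{1+c}-1}\widetilde{J}_{\frac{\gamma_{k-1}}{2}}\left(\frac{iz}{\sinh\omega}\right)\right)C_{k-1}^{\lambda+1}(w)$$ for $z=|x||y|$, $w=\langle x,y\rangle/z$, $\alpha_{-1}=0$ and $\alpha_k=2e^{\frac{\omega\delta}{2}}(2\sinh\omega)^{-\gamma_k/2}$. Then these series are convergent, and the integral transform defined on $\mathcal{L}^2_{0,c}(\mathbb{R}^m)$ by $$\mathcal{F}_{0,c}^{\omega}(f)(y)=\sigma_m^{-1}\int_{\mathbb{R}^m}K(x,y;\omega)f(x)h(|x|)\,dx$$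 coincides with the operator $\mathcal{F}_{\mathbf{D}}^{\omega}=e^{\omega\delta/2}\,e^{-\frac{\omega}{2(1+c)^2}\left(\mathbf{D}^2-(1+c)^2\underline{x}^2\right)}$ on the basis $\{\phi_{t,\ell,j}\}$.
   Context: $\mathcal{C}l_m$ is the real associative Clifford algebra generated by $e_1,\dots,e_m$ with $e_ie_j+e_je_i=0$ ($i\ne j$), $e_i^2=-1$. Functions take values in $\mathbb{C}\otimes\mathcal{C}l_m$. A point $x\in\mathbb{R}^m$ is identified with $\underline{x}=\sum_i e_ix_i$, $r=|x|$; $\underline{x}\wedge\underline{y}=\sum_{j<k}e_je_k(x_jy_k-x_ky_j)$. $\partial_{\underline{x}}=\sum_i e_i\partial_{x_i}$, $\mathbb{E}=\sum_i x_i\partial_{x_i}$, $\mathbf{D}=\partial_{\underline{x}}+c\,r^{-2}\underline{x}\,\mathbb{E}$. Constants: $\lambda=\frac{m-2}{2}$, $\sigma_m=2\pi^{m/2}/\Gamma(m/2)$, $\delta=1+\frac{m-1}{1+c}$, $\beta_\ell=-\frac{c}{1+c}\ell$, $\gamma_\ell=\frac{2}{1+c}\left(\ell+\frac{m-2}{2}\right)+\frac{c+2}{1+c}$. $\widetilde{J}_\nu(t)=(t/2)^{-\nu}J_\nu(t)$ (entire in $t$), $J_\nu$ the Bessel function; $C_k^\lambda$ the Gegenbauer polynomials. The power is taken as $(2\sinh\omega)^{p}=e^{\omega p}(1-e^{-2\omega})^{p}$ with the principal branch of $(1-e^{-2\omega})^{p}$. For $m=2$ ($\lambda=0$) the expressions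 with $\lambda$ in the denominator are limits $\lambda\to0$, using $\lim_{\lambda\to0}\lambda^{-1}C_k^\lambda(\cos\theta)=\frac2k\cos k\theta$ for $k\ge1$ (and $\frac{k+2\lambda}{2\lambda}C_k^\lambda=1$, $\frac{k}{\lambda}C_k^{\lambda}=0$ for $k=0$). Kernels are considered for $x,y\neq0$. $h(r)=r^{1-\frac{1+mc}{1+c}}$; $\mathcal{L}^2_{0,c}(\mathbb{R}^m)=L^2(\mathbb{R}^m,h(r)dx)\otimes\mathcal{C}l_m$, with inner product $\langle f,g\rangle=[\int\overline{f^c}g\,h\,dx]_0$ ($\overline{\,\cdot\,}$ the $\mathbb{C}$-linear anti-involution with $\overline{e_i}=-e_i$, $f^c$ complex conjugation of coefficients, $[\cdot]_0$ scalar part). $\mathcal{M}_\ell$ is the space of $\mathcal{C}l_m$-valued homogeneous polynomials $M$ of degree $\ell$ with $\partial_{\underline{x}}M=0$, with basis $\{M_\ell^{(j)}\}$ orthonormal for $[\int_{\mathbb{S}^{m-1}}\overline{M}N\,d\sigma]_0$. The functions ($L_t^\alpha$ generalized Laguerre polynomials) $$\phi_{2t,\ell,j}=2^{2t}(1+c)^{2t}t!\,L_t^{\frac{\gamma_\ell}{2}-1}(r^2)\,r^{\beta_\ell}M_\ell^{(j)}e^{-r^2/2},\qquad \phi_{2t+1,\ell,j}=-2^{2t+1}(1+c)^{2t+1}t!\,L_t^{\frac{\gamma_\ell}{2}}(r^2)\,\underline{x}\,r^{\beta_\ell}M_\ell^{(j)}e^{-r^2/2}$$ form an orthogonal basis of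 $\mathcal{L}^2_{0,c}(\mathbb{R}^m)$. The exponential $e^{-\frac{\omega}{2(1+c)^2}(\mathbf{D}^2-(1+c)^2\underline{x}^2)}$ is understood through the functional calculus of the selfadjoint closure of $\mathbf{D}^2-(1+c)^2\underline{x}^2$ defined on the linear span of the $\phi_{t,\ell,j}$. *)

theory Defs
  imports "HOL-Analysis.Analysis"
begin

section \<open>The complexified Clifford algebra\<close>

text \<open>
  The index type \<open>'n\<close> plays the role of \<open>{1,...,m}\<close>, with \<open>m = CARD('n)\<close>.  An element of the
  complexified Clifford algebra is given by its coordinates with respect to the basis
  \<open>e\<^sub>A = e\<^sub>i\<^sub>1 ... e\<^sub>i\<^sub>k\<close>, \<open>A = {i\<^sub>1 < ... < i\<^sub>k}\<close>.  The Clifford product is \<open>\<odot>\<close>; the operation \<open>*\<close> that the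
  library provides on this type is the componentwise product and is never used here.
\<close>

type_synonym 'n cliff = "(complex, 'n set) vec"

type_synonym 'n point = "(real, 'n) vec"

text \<open>
  \<open>e\<^sub>A e\<^sub>B = \<plusminus> e\<^sub>A\<^sub>\<Delta>\<^sub>B\<close>: every pair \<open>b < a\<close> costs a sign for a transposition and every common
  index costs a sign for \<open>e\<^sub>i\<^sup>2 = -1\<close>.
\<close>

definition cl_sign :: "'n::{finite,linorder} set \<Rightarrow> 'n set \<Rightarrow> complex" where
  "cl_sign A B = (-1) ^ card {(a, b). a \<in> A \<and> b \<in> B \<and> b \<le> a}"

definition cl_basis :: "'n::{finite,linorder} set \<Rightarrow> 'n cliff" where
  "cl_basis A = axis A 1"

definition cl_mult :: "'n::{finite,linorder} cliff \<Rightarrow> 'n cliff \<Rightarrow> 'n cliff" (infixl "\<odot>" 70) where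
  "a \<odot> b = (\<Sum>A\<in>UNIV. \<Sum>B\<in>UNIV. (cl_sign A B * a $ A * b $ B) *s cl_basis ((A - B) \<union> (B - A)))"

definition cl_one :: "'n::{finite,linorder} cliff" where
  "cl_one = cl_basis {}"

definition cl_gen :: "'n::{finite,linorder} \<Rightarrow> 'n cliff" where
  "cl_gen i = cl_basis {i}"

definition cl_scalar_part :: "'n::{finite,linorder} cliff \<Rightarrow> complex" where
  "cl_scalar_part a = a $ {}"

text \<open>Reversing \<open>e\<^sub>A\<close> and changing the sign of each factor gives \<open>(-1)\<^bsup>k(k-1)/2 + k\<^esup> e\<^sub>A\<close>, \<open>k = |A|\<close>.\<close>

definition cl_bar :: "'n::{finite,linorder} cliff \<Rightarrow> 'n cliff" where
  "cl_bar a = (\<chi> A. (-1) ^ (card A * (card A + 1) div 2) * a $ A)"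

definition cl_cnj :: "'n::{finite,linorder} cliff \<Rightarrow> 'n cliff" where
  "cl_cnj a = (\<chi> A. cnj (a $ A))"

text \<open>The real Clifford algebra inside its complexification.\<close>

definition cl_real :: "'n::{finite,linorder} cliff set" where
  "cl_real = {a. \<forall>A. a $ A \<in> \<real>}"

definition cl_vec :: "'n point \<Rightarrow> 'n::{finite,linorder} cliff" where
  "cl_vec x = (\<Sum>i\<in>UNIV. (x $ i) *\<^sub>R cl_gen i)"

definition cl_wedge :: "'n point \<Rightarrow> 'n point \<Rightarrow> 'n::{finite,linorder} cliff" where
  "cl_wedge x y = (\<Sum>(j, k)\<in>{(j, k). j < k}. (x $ j * y $ k - x $ k * y $ j) *\<^sub>R (cl_gen j \<odot> cl_gen k))"

text \<open>Sanity checks for the multiplication table.\<close>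

lemma cl_sign_prod:
  "cl_sign A B = (\<Prod>a\<in>A. \<Prod>b\<in>B. if b \<le> a then -1 else 1)"
proof -
  have "{(a, b). a \<in> A \<and> b \<in> B \<and> b \<le> a} = {p \<in> A \<times> B. snd p \<le> fst p}"
    by auto
  then have "cl_sign A B = (\<Prod>p\<in>{p \<in> A \<times> B. snd p \<le> fst p}. -1)"
    by (simp add: cl_sign_def)
  also have "\<dots> = (\<Prod>p\<in>A \<times> B. if snd p \<le> fst p then -1 else 1)"
    by (rule prod.inter_filter) simp
  also have "\<dots> = (\<Prod>a\<in>A. \<Prod>b\<in>B. if b \<le> a then -1 else 1)"
    by (simp add: prod.cartesian_product case_prod_unfold)
  finally show ?thesis .
qed

lemma prod_sym_diff:
  fixes f :: "'b::finite \<Rightarrow> 'a::comm_ring_1"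
  assumes "\<And>x. f x * f x = 1"
  shows "prod f ((A - B) \<union> (B - A)) = prod f A * prod f B"
proof -
  have "prod f A = prod f (A - B) * prod f (A \<inter> B)"
    by (subst prod.union_disjoint[symmetric]) (auto intro: prod.cong)
  moreover have "prod f B = prod f (B - A) * prod f (A \<inter> B)"
    by (subst prod.union_disjoint[symmetric]) (auto intro: prod.cong)
  moreover have "prod f ((A - B) \<union> (B - A)) = prod f (A - B) * prod f (B - A)"
    by (rule prod.union_disjoint) auto
  moreover have "prod f (A \<inter> B) * prod f (A \<inter> B) = 1"
    by (simp add: prod.distrib[symmetric] assms)
  moreover have "(u * i) * (v * i) = (u * v) * (i * i)" for u v i :: 'a
    by (simp only: mult_ac)
  ultimately show ?thesis by (metis mult.right_neutral)
qed

lemma cl_sign_left: "cl_sign ((A - B) \<union> (B - A)) C = cl_sign A C * cl_sign B C"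
  unfolding cl_sign_prod
  by (rule prod_sym_diff) (auto simp flip: prod.distrib intro: prod.neutral)

lemma cl_sign_right: "cl_sign A ((B - C) \<union> (C - B)) = cl_sign A B * cl_sign A C"
  unfolding cl_sign_prod
  by (simp add: prod_sym_diff prod.distrib)

lemma cl_basis_mult:
  "cl_basis A \<odot> cl_basis B = cl_sign A B *s cl_basis ((A - B) \<union> (B - A))"
proof -
  have "cl_basis A \<odot> cl_basis B = (\<Sum>A'\<in>UNIV. \<Sum>B'\<in>UNIV.
      if B' = B then if A' = A then cl_sign A B *s cl_basis ((A - B) \<union> (B - A)) else 0 else 0)"
    unfolding cl_mult_def by (intro sum.cong refl) (auto simp: cl_basis_def axis_def)
  then show ?thesis by simp
qed

lemma cl_expand: "a = (\<Sum>A\<in>UNIV. a $ A *s cl_basis A)"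
  by (simp add: vec_eq_iff cl_basis_def axis_def if_distrib cong: if_cong)

lemma cl_mult_add_left: "(a + b) \<odot> c = a \<odot> c + b \<odot> c"
  by (simp add: cl_mult_def vec_eq_iff algebra_simps sum.distrib)

lemma cl_mult_add_right: "a \<odot> (b + c) = a \<odot> b + a \<odot> c"
  by (simp add: cl_mult_def vec_eq_iff algebra_simps sum.distrib)

lemma cl_mult_scale_left: "(s *s a) \<odot> b = s *s (a \<odot> b)"
  by (simp add: cl_mult_def vec_eq_iff sum_distrib_left mult_ac)

lemma cl_mult_scale_right: "a \<odot> (s *s b) = s *s (a \<odot> b)"
  by (simp add: cl_mult_def vec_eq_iff sum_distrib_left mult_ac)

lemma cl_mult_zero [simp]: "0 \<odot> a = 0" "a \<odot> 0 = 0"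
  by (simp_all add: cl_mult_def vec_eq_iff)

lemma cl_mult_sum_left: "sum f I \<odot> b = (\<Sum>i\<in>I. f i \<odot> b)"
  by (induction I rule: infinite_finite_induct) (simp_all add: cl_mult_add_left)

lemma cl_mult_sum_right: "b \<odot> sum f I = (\<Sum>i\<in>I. b \<odot> f i)"
  by (induction I rule: infinite_finite_induct) (simp_all add: cl_mult_add_right)

lemma cl_mult_expand:
  "a \<odot> b = (\<Sum>A\<in>UNIV. \<Sum>B\<in>UNIV. (a $ A * b $ B) *s (cl_basis A \<odot> cl_basis B))"
  unfolding cl_basis_mult vector_smult_assoc by (simp add: cl_mult_def[of a b] mult_ac)

lemma cl_mult_assoc: "(a \<odot> b) \<odot> c = a \<odot> (b \<odot> c)"
proof -
  have basis: "(cl_basis A \<odot> cl_basis B) \<odot> cl_basis C = cl_basis A \<odot> (cl_basis B \<odot> cl_basis C)"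
    for A B C :: "'a set"
  proof -
    let ?S = "\<lambda>A B. (A - B) \<union> (B - A) :: 'a set"
    have "?S (?S A B) C = ?S A (?S B C)" by auto
    then show ?thesis
      by (simp add: cl_basis_mult cl_mult_scale_left cl_mult_scale_right cl_sign_left cl_sign_right
          vec.scale_scale mult_ac)
  qed
  have "(a \<odot> b) \<odot> c = (\<Sum>A\<in>UNIV. \<Sum>B\<in>UNIV. \<Sum>C\<in>UNIV.
      (a $ A * b $ B * c $ C) *s ((cl_basis A \<odot> cl_basis B) \<odot> cl_basis C))"
    unfolding cl_mult_expand[of a b]
    by (subst cl_expand[of c], unfold cl_mult_sum_left cl_mult_scale_left,
        unfold cl_mult_sum_right cl_mult_scale_right)
      (simp add: vec.scale_sum_right vector_smult_assoc mult_ac)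
  moreover have "a \<odot> (b \<odot> c) = (\<Sum>A\<in>UNIV. \<Sum>B\<in>UNIV. \<Sum>C\<in>UNIV.
      (a $ A * b $ B * c $ C) *s (cl_basis A \<odot> (cl_basis B \<odot> cl_basis C)))"
    unfolding cl_mult_expand[of b c]
    by (subst cl_expand[of a], unfold cl_mult_sum_left cl_mult_scale_left,
        unfold cl_mult_sum_right cl_mult_scale_right)
      (simp add: vec.scale_sum_right vector_smult_assoc mult_ac)
  ultimately show ?thesis by (simp only: basis)
qed

lemma cl_mult_one [simp]: "cl_one \<odot> a = a" "a \<odot> cl_one = a"
proof -
  have "cl_one \<odot> cl_basis A = cl_basis A" "cl_basis A \<odot> cl_one = cl_basis A" for A :: "'a set"
    by (simp_all add: cl_one_def cl_basis_mult cl_sign_def)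
  then show "cl_one \<odot> a = a" "a \<odot> cl_one = a"
    by (subst (1 2) cl_expand[of a], simp add: cl_mult_sum_left cl_mult_sum_right
        cl_mult_scale_left cl_mult_scale_right)+
qed

lemma cl_gen_square: "cl_gen i \<odot> cl_gen i = - cl_one"
proof -
  have "{(a, b). a = i \<and> b = i \<and> b \<le> a} = {(i, i)}" by auto
  then show ?thesis
    by (simp add: cl_gen_def cl_one_def cl_basis_mult cl_sign_def vec_eq_iff)
qed

lemma cl_gen_anticommute:
  assumes "i \<noteq> j"
  shows "cl_gen i \<odot> cl_gen j + cl_gen j \<odot> cl_gen i = 0"
proof -
  have 1: "{(a, b). a = u \<and> b = v \<and> b \<le> a} = (if v \<le> u then {(u, v)} else {})" for u v :: 'a
    by auto
  have "{i} - {j} \<union> ({j} - {i}) = {i, j}" "{j} - {i} \<union> ({i} - {j}) = {i, j}"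
    using assms by auto
  then show ?thesis
    using assms by (cases i j rule: linorder_cases)
      (simp_all add: cl_gen_def cl_basis_mult cl_sign_def vec_eq_iff 1)
qed


section \<open>Differential operators\<close>

definition partial :: "'n \<Rightarrow> ('n point \<Rightarrow> 'n::{finite,linorder} cliff) \<Rightarrow> 'n point \<Rightarrow> 'n cliff" where
  "partial i f x = vector_derivative (\<lambda>t. f (x + t *\<^sub>R axis i 1)) (at 0)"

definition dirac :: "('n point \<Rightarrow> 'n::{finite,linorder} cliff) \<Rightarrow> 'n point \<Rightarrow> 'n cliff" where
  "dirac f x = (\<Sum>i\<in>UNIV. cl_gen i \<odot> partial i f x)"

definition euler :: "('n point \<Rightarrow> 'n::{finite,linorder} cliff) \<Rightarrow> 'n point \<Rightarrow> 'n cliff" where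
  "euler f x = (\<Sum>i\<in>UNIV. (x $ i) *\<^sub>R partial i f x)"

definition rdef_dirac :: "real \<Rightarrow> ('n point \<Rightarrow> 'n::{finite,linorder} cliff) \<Rightarrow> 'n point \<Rightarrow> 'n cliff" where
  "rdef_dirac c f x = dirac f x + (c / (norm x)\<^sup>2) *\<^sub>R (cl_vec x \<odot> euler f x)"

definition oscillator :: "real \<Rightarrow> ('n point \<Rightarrow> 'n::{finite,linorder} cliff) \<Rightarrow> 'n point \<Rightarrow> 'n cliff" where
  "oscillator c f x =
     rdef_dirac c (rdef_dirac c f) x - (1 + c)\<^sup>2 *\<^sub>R (cl_vec x \<odot> (cl_vec x \<odot> f x))"


section \<open>Special functions and constants\<close>

text \<open>The Bessel function and its entire normalisation \<open>(t/2)\<^bsup>-\<nu>\<^esup> J\<^sub>\<nu>(t)\<close>.\<close>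

definition bessel_J :: "real \<Rightarrow> complex \<Rightarrow> complex" where
  "bessel_J \<nu> t = (\<Sum>j. (-1) ^ j * rGamma (of_real (real j + \<nu> + 1)) / fact j
      * (t / 2) powr of_real (2 * real j + \<nu>))"

definition bessel_Jt :: "real \<Rightarrow> complex \<Rightarrow> complex" where
  "bessel_Jt \<nu> t = (\<Sum>j. (-1) ^ j * rGamma (of_real (real j + \<nu> + 1)) / fact j * (t / 2) ^ (2 * j))"

definition gegenbauer :: "nat \<Rightarrow> real \<Rightarrow> real \<Rightarrow> real" where
  "gegenbauer k \<kappa> w = (\<Sum>j\<le>k div 2. (-1) ^ j * pochhammer \<kappa> (k - j) / (fact j * fact (k - 2 * j))
      * (2 * w) ^ (k - 2 * j))"

definition laguerre :: "nat \<Rightarrow> real \<Rightarrow> real \<Rightarrow> real" where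
  "laguerre t \<alpha> x = (\<Sum>i\<le>t. (-1) ^ i * ((real t + \<alpha>) gchoose (t - i)) * x ^ i / fact i)"

text \<open>\<open>(k + 2\<lambda>)/(2\<lambda>) C\<^sub>k\<^sup>\<lambda>(w)\<close> and \<open>(k/\<lambda>) C\<^sub>k\<^sup>\<lambda>(w)\<close>, extended to \<open>\<lambda> = 0\<close> by the limit.\<close>

definition gegen_a :: "nat \<Rightarrow> real \<Rightarrow> real \<Rightarrow> real" where
  "gegen_a k \<kappa> w = (if \<kappa> = 0 then Lim (at 0) (\<lambda>\<mu>. (real k + 2 * \<mu>) / (2 * \<mu>) * gegenbauer k \<mu> w)
     else (real k + 2 * \<kappa>) / (2 * \<kappa>) * gegenbauer k \<kappa> w)"

definition gegen_b :: "nat \<Rightarrow> real \<Rightarrow> real \<Rightarrow> real" where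
  "gegen_b k \<kappa> w = (if \<kappa> = 0 then Lim (at 0) (\<lambda>\<mu>. real k / \<mu> * gegenbauer k \<mu> w)
     else real k / \<kappa> * gegenbauer k \<kappa> w)"

definition lam :: "nat \<Rightarrow> real" where
  "lam m = (real m - 2) / 2"

definition sphere_area :: "nat \<Rightarrow> real" where
  "sphere_area m = 2 * pi powr (real m / 2) / Gamma (real m / 2)"

definition delta :: "nat \<Rightarrow> real \<Rightarrow> real" where
  "delta m c = 1 + (real m - 1) / (1 + c)"

definition beta :: "real \<Rightarrow> real \<Rightarrow> real" where
  "beta c l = - (c / (1 + c)) * l"

definition gam :: "nat \<Rightarrow> real \<Rightarrow> real \<Rightarrow> real" where
  "gam m c l = 2 / (1 + c) * (l + (real m - 2) / 2) + (c + 2) / (1 + c)"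

definition two_sinh_powr :: "complex \<Rightarrow> real \<Rightarrow> complex" where
  "two_sinh_powr \<omega> p = exp (\<omega> * of_real p) * (1 - exp (- 2 * \<omega>)) powr of_real p"

text \<open>Integer index, because \<open>\<alpha>\<^sub>k\<^sub>-\<^sub>1\<close> occurs for \<open>k = 0\<close>.\<close>

definition alpha :: "nat \<Rightarrow> real \<Rightarrow> complex \<Rightarrow> int \<Rightarrow> complex" where
  "alpha m c \<omega> k = (if k < 0 then 0
     else 2 * exp (\<omega> * of_real (delta m c) / 2) * two_sinh_powr \<omega> (- gam m c (of_int k) / 2))"

definition weight :: "nat \<Rightarrow> real \<Rightarrow> real \<Rightarrow> real" where
  "weight m c r = r powr (1 - (1 + real m * c) / (1 + c))"


section \<open>The kernel\<close>

definition A_term :: "nat \<Rightarrow> real \<Rightarrow> complex \<Rightarrow> real \<Rightarrow> real \<Rightarrow> nat \<Rightarrow> complex" where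
  "A_term m c \<omega> z w k =
     alpha m c \<omega> (int k) * of_real (gegen_a k (lam m) w) * of_real (z powr (real k / (1 + c)))
       * bessel_Jt (gam m c (real k) / 2 - 1) (\<i> * of_real z / sinh \<omega>)
   + alpha m c \<omega> (int k - 1) / (4 * sinh \<omega>) * of_real (gegen_b k (lam m) w)
       * of_real (z powr ((real k + c) / (1 + c)))
       * bessel_Jt (gam m c (real k - 1) / 2) (\<i> * of_real z / sinh \<omega>)"

definition B_term :: "nat \<Rightarrow> real \<Rightarrow> complex \<Rightarrow> real \<Rightarrow> real \<Rightarrow> nat \<Rightarrow> complex" where
  "B_term m c \<omega> z w k =
     (- alpha m c \<omega> (int k) * of_real (z powr (real k / (1 + c) - 1))
         * bessel_Jt (gam m c (real k) / 2 - 1) (\<i> * of_real z / sinh \<omega>)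
      + alpha m c \<omega> (int k - 1) / (2 * sinh \<omega>) * of_real (z powr ((real k + c) / (1 + c) - 1))
         * bessel_Jt (gam m c (real k - 1) / 2) (\<i> * of_real z / sinh \<omega>))
     * of_real (gegenbauer (k - 1) (lam m + 1) w)"

definition A_series :: "nat \<Rightarrow> real \<Rightarrow> complex \<Rightarrow> real \<Rightarrow> real \<Rightarrow> complex" where
  "A_series m c \<omega> z w = (\<Sum>k. A_term m c \<omega> z w k)"

definition B_series :: "nat \<Rightarrow> real \<Rightarrow> complex \<Rightarrow> real \<Rightarrow> real \<Rightarrow> complex" where
  "B_series m c \<omega> z w = (\<Sum>k. B_term m c \<omega> z w (Suc k))"

definition kernel :: "real \<Rightarrow> complex \<Rightarrow> 'n point \<Rightarrow> 'n point \<Rightarrow> 'n::{finite,linorder} cliff" where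
  "kernel c \<omega> x y =
     (let z = norm x * norm y; w = (x \<bullet> y) / z in
      exp (- (cosh \<omega> / sinh \<omega>) / 2 * of_real ((norm x)\<^sup>2 + (norm y)\<^sup>2)) *s
        (A_series CARD('n) c \<omega> z w *s cl_one + B_series CARD('n) c \<omega> z w *s cl_wedge x y))"


section \<open>The weighted \<open>L\<^sup>2\<close> space\<close>

text \<open>
  Elements of \<open>L\<^sup>2\<close> are represented by square integrable functions; operators are represented by
  their graphs, and identities between elements hold almost everywhere.
\<close>

definition wmeasure :: "real \<Rightarrow> 'n::{finite,linorder} point measure" where
  "wmeasure c = density lborel (\<lambda>x. ennreal (weight CARD('n) c (norm x)))"

definition L2 :: "real \<Rightarrow> ('n point \<Rightarrow> 'n::{finite,linorder} cliff) set" where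
  "L2 c = {f. f \<in> borel_measurable borel \<and> integrable (wmeasure c) (\<lambda>x. (norm (f x))\<^sup>2)}"

definition l2_inner ::
  "real \<Rightarrow> ('n point \<Rightarrow> 'n::{finite,linorder} cliff) \<Rightarrow> ('n point \<Rightarrow> 'n cliff) \<Rightarrow> complex" where
  "l2_inner c f g = cl_scalar_part (LINT x|wmeasure c. cl_bar (cl_cnj (f x)) \<odot> g x)"

definition l2_norm :: "real \<Rightarrow> ('n point \<Rightarrow> 'n::{finite,linorder} cliff) \<Rightarrow> real" where
  "l2_norm c f = sqrt (Re (l2_inner c f f))"

definition l2_eq ::
  "real \<Rightarrow> ('n point \<Rightarrow> 'n::{finite,linorder} cliff) \<Rightarrow> ('n point \<Rightarrow> 'n cliff) \<Rightarrow> bool" where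
  "l2_eq c f g \<longleftrightarrow> (AE x in wmeasure c. f x = g x)"

type_synonym 'n l2_graph = "(('n point \<Rightarrow> 'n cliff) \<times> ('n point \<Rightarrow> 'n cliff)) set"

definition graph_closure :: "real \<Rightarrow> 'n::{finite,linorder} l2_graph \<Rightarrow> 'n l2_graph" where
  "graph_closure c G = {(f, g). f \<in> L2 c \<and> g \<in> L2 c \<and>
     (\<exists>u v. (\<forall>n::nat. (u n, v n) \<in> G) \<and>
        (\<lambda>n. l2_norm c (\<lambda>x. u n x - f x)) \<longlonglongrightarrow> 0 \<and>
        (\<lambda>n. l2_norm c (\<lambda>x. v n x - g x)) \<longlonglongrightarrow> 0)}"


section \<open>Functional calculus of selfadjoint operators\<close>

text \<open>
  A resolution of the identity on \<open>L\<^sup>2\<close>.  Linearity and boundedness of each \<open>E S\<close>, as well as its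
  compatibility with equality almost everywhere, follow from \<open>\<langle>E S f, g\<rangle> = \<langle>f, E S g\<rangle>\<close>.
\<close>

definition resolution_of_identity ::
  "real \<Rightarrow> (real set \<Rightarrow> ('n point \<Rightarrow> 'n::{finite,linorder} cliff) \<Rightarrow> 'n point \<Rightarrow> 'n cliff) \<Rightarrow> bool" where
  "resolution_of_identity c E \<longleftrightarrow>
     (\<forall>S\<in>sets borel. \<forall>f\<in>L2 c. E S f \<in> L2 c) \<and>
     (\<forall>S\<in>sets borel. \<forall>f\<in>L2 c. \<forall>g\<in>L2 c. l2_inner c (E S f) g = l2_inner c f (E S g)) \<and>
     (\<forall>S\<in>sets borel. \<forall>S'\<in>sets borel. \<forall>f\<in>L2 c. l2_eq c (E (S \<inter> S') f) (E S (E S' f))) \<and>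
     (\<forall>f\<in>L2 c. l2_eq c (E UNIV f) f) \<and>
     (\<forall>S::nat \<Rightarrow> real set. range S \<subseteq> sets borel \<longrightarrow> disjoint_family S \<longrightarrow>
        (\<forall>f\<in>L2 c. \<forall>g\<in>L2 c. (\<lambda>n. l2_inner c f (E (S n) g)) sums l2_inner c f (E (\<Union>n. S n) g)))"

text \<open>The finite measure \<open>S \<mapsto> \<langle>f, E S f\<rangle> = \<parallel>E S f\<parallel>\<^sup>2\<close>.\<close>

definition vector_measure ::
  "real \<Rightarrow> (real set \<Rightarrow> ('n point \<Rightarrow> 'n::{finite,linorder} cliff) \<Rightarrow> 'n point \<Rightarrow> 'n cliff)
   \<Rightarrow> ('n point \<Rightarrow> 'n cliff) \<Rightarrow> real measure" where
  "vector_measure c E f = measure_of UNIV (sets borel) (\<lambda>S. ennreal (Re (l2_inner c f (E S f))))"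

text \<open>
  The graph of \<open>\<integral> \<psi> dE\<close>: \<open>g = (\<integral> \<psi> dE) f\<close> is the limit of \<open>\<Sum>a. a E(s\<^sub>n = a) f\<close> for simple functions
  \<open>s\<^sub>n\<close> converging to \<open>\<psi>\<close> in \<open>L\<^sup>2(\<langle>f, E f\<rangle>)\<close>.  Such \<open>s\<^sub>n\<close> exist iff \<open>\<integral> |\<psi>|\<^sup>2 d\<langle>f, E f\<rangle> < \<infinity>\<close>, so this gives
  the usual domain.
\<close>

definition spectral_integral ::
  "real \<Rightarrow> (real set \<Rightarrow> ('n point \<Rightarrow> 'n::{finite,linorder} cliff) \<Rightarrow> 'n point \<Rightarrow> 'n cliff)
   \<Rightarrow> (real \<Rightarrow> complex) \<Rightarrow> 'n l2_graph" where
  "spectral_integral c E \<psi> = {(f, g). f \<in> L2 c \<and> g \<in> L2 c \<and>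
     (\<exists>s. (\<forall>n::nat. simple_function borel (s n)) \<and>
        (\<lambda>n. \<integral>\<^sup>+ t. ennreal ((cmod (s n t - \<psi> t))\<^sup>2) \<partial>vector_measure c E f) \<longlonglongrightarrow> 0 \<and>
        (\<lambda>n. l2_norm c (\<lambda>x. (\<Sum>a\<in>range (s n). a *s E (s n -` {a}) f x) - g x)) \<longlonglongrightarrow> 0)}"

text \<open>
  The graph of \<open>\<psi>(T)\<close>, where \<open>T\<close> is the operator with graph \<open>G\<close>.  By the spectral theorem the
  resolution of the identity \<open>E\<close> with \<open>T = \<integral> t dE(t)\<close> is unique, and it exists iff \<open>T\<close> is selfadjoint;
  for other \<open>T\<close> the relation is empty.
\<close>

definition functional_calculus ::
  "real \<Rightarrow> 'n::{finite,linorder} l2_graph \<Rightarrow> (real \<Rightarrow> complex) \<Rightarrow> 'n l2_graph" where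
  "functional_calculus c G \<psi> = {(f, g). \<exists>E. resolution_of_identity c E \<and>
     G = spectral_integral c E of_real \<and> (f, g) \<in> spectral_integral c E \<psi>}"


section \<open>Spherical monogenics and the basis functions\<close>

text \<open>
  The surface measure of the unit sphere, as a measure on the whole space: \<open>\<sigma>(S)\<close> is \<open>m\<close> times the
  volume of the part of the unit ball lying on rays through \<open>S\<close> (note \<open>sgn x = x / |x|\<close>).
\<close>

definition sphere_measure :: "'n::{finite,linorder} point measure" where
  "sphere_measure = scale_measure (of_nat CARD('n))
     (distr (restrict_space lborel (ball 0 1)) borel sgn)"

definition monogenics :: "nat \<Rightarrow> ('n point \<Rightarrow> 'n::{finite,linorder} cliff) set" where
  "monogenics l = {M. polynomial_function M \<and> range M \<subseteq> cl_real \<and>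
     (\<forall>t x. M (t *\<^sub>R x) = t ^ l *\<^sub>R M x) \<and> (\<forall>x. dirac M x = 0)}"

definition sphere_inner ::
  "('n point \<Rightarrow> 'n::{finite,linorder} cliff) \<Rightarrow> ('n point \<Rightarrow> 'n cliff) \<Rightarrow> complex" where
  "sphere_inner M N = cl_scalar_part (LINT x|sphere_measure. cl_bar (M x) \<odot> N x)"

text \<open>\<open>M l 0, ..., M l (d l - 1)\<close> is an orthonormal basis of the real vector space of monogenics of degree \<open>l\<close>.\<close>

definition orthonormal_bases ::
  "(nat \<Rightarrow> nat) \<Rightarrow> (nat \<Rightarrow> nat \<Rightarrow> 'n point \<Rightarrow> 'n::{finite,linorder} cliff) \<Rightarrow> bool" where
  "orthonormal_bases d M \<longleftrightarrow> (\<forall>l.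
     (\<forall>j<d l. M l j \<in> monogenics l) \<and>
     (\<forall>i<d l. \<forall>j<d l. sphere_inner (M l i) (M l j) = (if i = j then 1 else 0)) \<and>
     (\<forall>N\<in>monogenics l. \<exists>a::nat \<Rightarrow> real. \<forall>x. N x = (\<Sum>j<d l. a j *\<^sub>R M l j x)))"

definition phi ::
  "real \<Rightarrow> (nat \<Rightarrow> nat \<Rightarrow> 'n point \<Rightarrow> 'n::{finite,linorder} cliff) \<Rightarrow> nat \<Rightarrow> nat \<Rightarrow> nat
   \<Rightarrow> 'n point \<Rightarrow> 'n cliff" where
  "phi c M n l j x =
     (let t = n div 2; \<gamma> = gam CARD('n) c (real l); r = norm x in
      if even n then
        (2 ^ n * (1 + c) ^ n * fact t * laguerre t (\<gamma> / 2 - 1) (r\<^sup>2) * r powr beta c (real l)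
           * exp (- r\<^sup>2 / 2)) *\<^sub>R M l j x
      else
        (- (2 ^ n) * (1 + c) ^ n * fact t * laguerre t (\<gamma> / 2) (r\<^sup>2) * r powr beta c (real l)
           * exp (- r\<^sup>2 / 2)) *\<^sub>R (cl_vec x \<odot> M l j x))"

definition phi_span ::
  "real \<Rightarrow> (nat \<Rightarrow> nat) \<Rightarrow> (nat \<Rightarrow> nat \<Rightarrow> 'n point \<Rightarrow> 'n::{finite,linorder} cliff)
   \<Rightarrow> ('n point \<Rightarrow> 'n cliff) set" where
  "phi_span c d M = {f. \<exists>I a. finite I \<and> I \<subseteq> {(n, l, j). j < d l} \<and>
     f = (\<lambda>x. \<Sum>(n, l, j)\<in>I. (a (n, l, j) :: complex) *s phi c M n l j x)}"

definition oscillator_graph ::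
  "real \<Rightarrow> (nat \<Rightarrow> nat) \<Rightarrow> (nat \<Rightarrow> nat \<Rightarrow> 'n point \<Rightarrow> 'n::{finite,linorder} cliff) \<Rightarrow> 'n l2_graph" where
  "oscillator_graph c d M = {(f, g). f \<in> L2 c \<and> g \<in> L2 c \<and>
     (\<exists>u\<in>phi_span c d M. l2_eq c f u \<and> l2_eq c g (oscillator c u))}"


section \<open>The two transforms\<close>

definition integral_transform ::
  "real \<Rightarrow> complex \<Rightarrow> ('n point \<Rightarrow> 'n::{finite,linorder} cliff) \<Rightarrow> 'n point \<Rightarrow> 'n cliff" where
  "integral_transform c \<omega> f y =
     inverse (sphere_area CARD('n)) *\<^sub>R
       (LINT x|lborel. weight CARD('n) c (norm x) *\<^sub>R (kernel c \<omega> x y \<odot> f x))"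

definition exponential_transform ::
  "real \<Rightarrow> complex \<Rightarrow> (nat \<Rightarrow> nat) \<Rightarrow> (nat \<Rightarrow> nat \<Rightarrow> 'n point \<Rightarrow> 'n::{finite,linorder} cliff)
   \<Rightarrow> 'n l2_graph" where
  "exponential_transform c \<omega> d M = {(f, g). g \<in> L2 c \<and> (\<exists>g\<^sub>0.
     (f, g\<^sub>0) \<in> functional_calculus c (graph_closure c (oscillator_graph c d M))
        (\<lambda>t. exp (- (\<omega> / (2 * (1 + of_real c)\<^sup>2)) * of_real t)) \<and>
     l2_eq c g (\<lambda>x. exp (\<omega> * of_real (delta CARD('n) c) / 2) *s g\<^sub>0 x))}"


section \<open>Further sanity checks\<close>

lemma card_pairs_le:
  fixes A :: "'a::linorder set"
  assumes "finite A"
  shows "card {(a, b). a \<in> A \<and> b \<in> A \<and> b \<le> a} = card A * (card A + 1) div 2"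
  using assms
proof (induction A rule: finite_linorder_max_induct)
  case empty
  then show ?case by simp
next
  case (insert m A)
  let ?P = "\<lambda>A. {(a, b). a \<in> A \<and> b \<in> A \<and> b \<le> a}"
  have eq: "?P (insert m A) = ?P A \<union> {m} \<times> insert m A"
    using insert.hyps by fastforce
  have fin: "finite (?P A)"
    by (rule finite_subset[of _ "A \<times> A"]) (use insert.hyps in auto)
  have nin: "m \<notin> A" using insert.hyps by auto
  have "card (?P (insert m A)) = card (?P A) + card ({m} \<times> insert m A)"
    unfolding eq by (rule card_Un_disjoint) (use fin nin insert.hyps in auto)
  also have "\<dots> = card A * (card A + 1) div 2 + (card A + 1)"
    using insert.IH insert.hyps nin by (simp add: card_cartesian_product)
  also have "\<dots> = card (insert m A) * (card (insert m A) + 1) div 2"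
    using insert.hyps nin by simp
  finally show ?case .
qed

lemma cl_sign_self: "cl_sign A A = (-1) ^ (card A * (card A + 1) div 2)"
  unfolding cl_sign_def by (subst card_pairs_le) simp_all

lemma cl_sign_square: "cl_sign A B * cl_sign A B = 1"
  by (simp add: cl_sign_def flip: power_mult_distrib)

lemma cl_bar_basis: "cl_bar (cl_basis A) = cl_sign A A *s cl_basis A"
  by (simp add: cl_bar_def cl_sign_self cl_basis_def axis_def vec_eq_iff)

lemma cl_bar_linear: "cl_bar (sum f I) = (\<Sum>i\<in>I. cl_bar (f i))" "cl_bar (s *s a) = s *s cl_bar a"
  by (simp_all add: cl_bar_def vec_eq_iff sum_distrib_left)

lemma cl_bar_bar: "cl_bar (cl_bar a) = a"
  by (simp add: cl_bar_def vec_eq_iff flip: mult.assoc power_mult_distrib)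

lemma cl_bar_gen: "cl_bar (cl_gen i) = - cl_gen i"
  by (simp add: cl_gen_def cl_bar_basis cl_sign_self vec_eq_iff)

lemma cl_bar_mult: "cl_bar (a \<odot> b) = cl_bar b \<odot> cl_bar a"
proof -
  have basis: "cl_bar (cl_basis A \<odot> cl_basis B) = cl_bar (cl_basis B) \<odot> cl_bar (cl_basis A)"
    for A B :: "'a set"
  proof -
    have *: "(B - A) \<union> (A - B) = (A - B) \<union> (B - A)" by auto
    have "cl_sign A B * (cl_sign A A * cl_sign A B * (cl_sign B A * cl_sign B B))
        = (cl_sign A B * cl_sign A B) * (cl_sign B B * cl_sign A A * cl_sign B A)"
      by (simp only: mult_ac)
    then have "cl_sign A B * (cl_sign A A * cl_sign A B * (cl_sign B A * cl_sign B B))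
        = cl_sign B B * cl_sign A A * cl_sign B A"
      by (simp only: cl_sign_square mult_1)
    then show ?thesis
      by (simp add: cl_basis_mult cl_bar_linear cl_bar_basis cl_mult_scale_left cl_mult_scale_right
          vector_smult_assoc cl_sign_left cl_sign_right * mult.assoc)
  qed
  have bar: "cl_bar u = (\<Sum>A\<in>UNIV. u $ A *s cl_bar (cl_basis A))" for u :: "'a cliff"
    by (subst (1) cl_expand[of u]) (simp only: cl_bar_linear)
  have "cl_bar (a \<odot> b) =
      (\<Sum>A\<in>UNIV. \<Sum>B\<in>UNIV. (a $ A * b $ B) *s (cl_bar (cl_basis B) \<odot> cl_bar (cl_basis A)))"
    unfolding cl_mult_expand[of a b] cl_bar_linear basis ..
  also have "\<dots> = cl_bar b \<odot> cl_bar a"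
    unfolding bar[of a] bar[of b]
    unfolding cl_mult_sum_right cl_mult_scale_right unfolding cl_mult_sum_left cl_mult_scale_left
    by (simp add: vec.scale_sum_right vector_smult_assoc mult_ac)
  finally show ?thesis .
qed

lemma cl_scalar_part_bar_mult:
  "cl_scalar_part (cl_bar (cl_cnj a) \<odot> b) = (\<Sum>A\<in>UNIV. cnj (a $ A) * b $ A)"
proof -
  have delta: "cl_basis ((A - B) \<union> (B - A)) $ {} = (if B = A then 1 else 0)" for A B :: "'a set"
    by (auto simp: cl_basis_def axis_def)
  have "cl_scalar_part (cl_bar (cl_cnj a) \<odot> b) =
      (\<Sum>A\<in>UNIV. \<Sum>B\<in>UNIV. if B = A then (cl_sign A A * cl_sign A A) * (cnj (a $ A) * b $ A) else 0)"
    unfolding cl_scalar_part_def cl_mult_def sum_component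
    by (intro sum.cong refl)
      (auto simp: delta cl_bar_def cl_cnj_def cl_sign_self)
  then show ?thesis by (simp add: cl_sign_square)
qed

lemma summable_bessel_Jt:
  fixes t :: complex
  shows "summable (\<lambda>j. (-1) ^ j * rGamma (of_real (real j + \<nu> + 1)) / fact j * (t / 2) ^ (2 * j))"
    (is "summable ?a")
proof -
  define N where "N = nat \<lceil>\<bar>\<nu>\<bar> + 2 * (cmod (t / 2))\<^sup>2\<rceil> + 1"
  show ?thesis
  proof (rule summable_ratio_test[of "1 / 2" N])
    fix j assume "N \<le> j"
    then have j: "real j \<ge> \<bar>\<nu>\<bar> + 2 * (cmod (t / 2))\<^sup>2" "j \<ge> 1"
      unfolding N_def by linarith+
    define q where "q = real j + \<nu> + 1"
    have q: "q \<ge> 1 + 2 * (cmod (t / 2))\<^sup>2" using j unfolding q_def by linarith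
    have pos: "q * real (Suc j) > 0"
      using q by (smt (verit) mult_pos_pos of_nat_0_less_iff zero_le_power2 zero_less_Suc)
    have rG: "of_real q * rGamma (of_real q + 1 :: complex) = rGamma (of_real q)"
      by (rule rGamma_plus1)
    have eq: "?a (Suc j) * of_real (q * real (Suc j)) = - ?a j * (t / 2)\<^sup>2"
    proof -
      have "of_real (real (Suc j) + \<nu> + 1) = (of_real q + 1 :: complex)"
        by (simp add: q_def)
      then have "?a (Suc j) * of_real (q * real (Suc j)) =
         - ((-1) ^ j * (of_real q * rGamma (of_real q + 1)) / fact j * (t / 2) ^ (2 * j) * (t / 2)\<^sup>2)"
        by (simp add: fact_Suc power2_eq_square divide_simps del: of_nat_Suc)
      also have "\<dots> = - ?a j * (t / 2)\<^sup>2"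
        unfolding rG by (simp add: q_def)
      finally show ?thesis .
    qed
    have "norm (?a (Suc j)) * (q * real (Suc j)) = norm (?a (Suc j) * of_real (q * real (Suc j)))"
      by (simp only: norm_mult norm_of_real abs_of_pos[OF pos])
    also have "\<dots> = norm (?a j) * (cmod (t / 2))\<^sup>2"
      unfolding eq by (simp only: norm_mult norm_minus_cancel norm_power)
    also have "\<dots> \<le> norm (?a j) * (1 / 2 * (q * real (Suc j)))"
    proof (rule mult_left_mono)
      have "2 * (cmod (t / 2))\<^sup>2 \<le> q * 1" using q by simp
      also have "\<dots> \<le> q * real (Suc j)"
        using q by (intro mult_left_mono) (auto intro: order_trans[OF _ q])
      finally show "(cmod (t / 2))\<^sup>2 \<le> 1 / 2 * (q * real (Suc j))" by simp
    qed simp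
    finally have "norm (?a (Suc j)) * (q * real (Suc j)) \<le> (1 / 2 * norm (?a j)) * (q * real (Suc j))"
      by (simp add: mult_ac)
    with pos show "norm (?a (Suc j)) \<le> 1 / 2 * norm (?a j)"
      using mult_le_cancel_right_pos by blast
  qed simp
qed

lemma bessel_Jt_eq:
  assumes "t \<noteq> 0"
  shows "bessel_Jt \<nu> t = (t / 2) powr (- of_real \<nu>) * bessel_J \<nu> t"
proof -
  let ?a = "\<lambda>j. (-1) ^ j * rGamma (of_real (real j + \<nu> + 1)) / fact j * (t / 2) ^ (2 * j) :: complex"
  have "(t / 2) powr of_real (2 * real j + \<nu>) = (t / 2) powr of_real \<nu> * (t / 2) ^ (2 * j)" for j
  proof -
    have "(t / 2) powr of_nat (2 * j) = (t / 2) ^ (2 * j)"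
      using assms by (intro powr_nat') auto
    then show ?thesis by (simp add: powr_add mult.commute)
  qed
  then have "bessel_J \<nu> t = (\<Sum>j. (t / 2) powr of_real \<nu> * ?a j)"
    unfolding bessel_J_def by (simp add: mult_ac)
  also have "\<dots> = (t / 2) powr of_real \<nu> * bessel_Jt \<nu> t"
    unfolding bessel_Jt_def by (rule suminf_mult) (rule summable_bessel_Jt)
  finally show ?thesis
    using assms by (simp add: powr_minus)
qed

lemma sphere_measure_total:
  "emeasure (sphere_measure :: 'n::{finite,linorder} point measure) UNIV = ennreal (sphere_area CARD('n))"
proof -
  have meas: "sgn \<in> restrict_space lborel (ball 0 1) \<rightarrow>\<^sub>M (borel :: 'n point measure)"
    by (rule measurable_restrict_space1) (simp add: sgn_div_norm[abs_def])
  have G: "Gamma (real CARD('n) / 2 + 1) = real CARD('n) / 2 * Gamma (real CARD('n) / 2)"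
    by (rule Gamma_plus1) (auto dest!: nonpos_Ints_nonpos)
  have "emeasure (distr (restrict_space lborel (ball 0 1)) borel sgn) (UNIV :: 'n point set)
      = emeasure lborel (ball (0 :: 'n point) 1)"
    by (subst emeasure_distr[OF meas]) (simp_all add: emeasure_restrict_space space_restrict_space)
  also have "\<dots> = ennreal (unit_ball_vol (real CARD('n)))"
    by (subst emeasure_ball) simp_all
  finally have "emeasure (sphere_measure :: 'n point measure) UNIV
      = ennreal (real CARD('n) * unit_ball_vol (real CARD('n)))"
    by (simp add: sphere_measure_def ennreal_mult' ennreal_of_nat_eq_real_of_nat)
  also have "real CARD('n) * unit_ball_vol (real CARD('n)) = sphere_area CARD('n)"
    by (simp add: unit_ball_vol_def sphere_area_def G)
  finally show ?thesis .
qed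

end

(*
  Everything is reduced to one identity: for each basis function, F(phi) = exp(-omega (n + l/(1+c))) phi.

  In the variable u = |x|^2 the deformed Dirac operator maps u^(beta/2) Q(u) M to 2(1+c) u^(beta/2) Q'(u) x M and
  u^(beta/2) Q(u) x M to -(1+c) u^(beta/2) (2 u Q' + gamma Q) M, so the Laguerre equation makes phi an eigenfunction of
  D^2 - (1+c)^2 x^2 with eigenvalue (1+c)^2 (2n + gamma).  The phi are orthogonal, and they are complete because moments
  against u^k determine a function of u, the Fischer decomposition then yields all polynomials, and moments determine
  the function on boxes.  Hence the closure of the operator is diagonal and its functional calculus is explicit.

  On the kernel side, the k-th terms of A and B combine into two zonal functions.  Their integrals over the sphere
  against a spherical monogenic follow from Gaussian integration by parts, and only one k survives.  What remains is a
  Hankel type integral of a Laguerre polynomial against a Bessel function, evaluated term by term.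
*)

theory Submission
  imports Defs "HOL-Probability.Probability"
begin

text \<open>The wedge accounts for the pairing of the two series. Under the integral it replaces a
  polynomial g'(<x,y>) by a scalar multiple of g(<x,y>), the scalar being -l on a monogenic M of
  degree l and l + m - 1 on x M. With these two eigenvalues the combinations \<open>zonal_p\<close>
  and \<open>zonal_m\<close> act as 1 and 0, or as 0 and 1. Gegenbauer polynomials are divided by
  lambda before anything else, so m = 2 is not a separate case later. Convergence rests on the decay
  of 1/Gamma, which beats every exponential in k; crude bounds like 32^k for the Gegenbauer factors
  therefore suffice. The remaining growth exp(D |x| |y|) is absorbed by the Gaussian because Re coth
  > 0. Complex omega enters through q = exp(-2 omega) with |q| < 1. Since 1 - q lies in the right
  half plane, principal powers behave, and a binomial series around a real rate replaces analytic
  continuation. The functional calculus is evaluated on eigenvectors only, where one constant simple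
  function is exact.\<close>

type_synonym 'n clfun = "'n point => 'n cliff"

abbreviation nsq :: "'a::real_normed_vector => real" where
 "nsq x == (norm x)\<^sup>2"

notation scaleR (infixr "*r" 75)

section \<open>The Clifford algebra as a Hilbert space\<close>

lemma scaleR_eq_smult: "r *r (a :: 'n::{finite,linorder} cliff) = complex_of_real r *s a"
 by (simp add: vec_eq_iff scaleR_conv_of_real[where 'a = complex])

lemma norm_smult: "norm (s *s (a :: 'n::{finite,linorder} cliff)) = cmod s * norm a"
 by (simp add: norm_vec_def norm_mult L2_set_right_distrib)

lemma smult_scaleR: "s *s (r *r (a :: 'n::{finite,linorder} cliff)) = r *r (s *s a)"
 by (simp add: vec_eq_iff)

lemma bounded_linear_smult: "bounded_linear (%a :: 'n::{finite,linorder} cliff. s *s a)"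
 by (rule bounded_linear_intro[where K = "cmod s"])
  (simp_all add: vector_add_ldistrib smult_scaleR norm_smult)

lemma bounded_bilinear_smult:
 "bounded_bilinear (%s (a :: 'n::{finite,linorder} cliff). s *s a)"
proof
 show "\<exists>K. \<forall>s (a :: 'n cliff). norm (s *s a) <= norm s * norm a * K"
  by (rule exI[of _ 1]) (simp add: norm_smult)
qed (simp_all add: vec_eq_iff algebra_simps)

lemma cl_mult_scaleR_left: "(r *r a) \<odot> b = r *r (a \<odot> b)"
 by (simp add: scaleR_eq_smult cl_mult_scale_left)

lemma cl_mult_scaleR_right: "a \<odot> (r *r b) = r *r (a \<odot> b)"
 by (simp add: scaleR_eq_smult cl_mult_scale_right)

lemma bounded_bilinear_cl_mult:
 "bounded_bilinear ((\<odot>) :: 'n::{finite,linorder} cliff => 'n cliff => 'n cliff)"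
 unfolding bilinear_conv_bounded_bilinear[symmetric] bilinear_def
 by (intro conjI allI linearI) (simp_all only: cl_mult_add_left cl_mult_add_right cl_mult_scaleR_left cl_mult_scaleR_right)

lemma cl_mult_minus_left: "(- a) \<odot> b = - (a \<odot> b)"
 and cl_mult_minus_right: "a \<odot> (- b) = - (a \<odot> b)"
 and cl_mult_diff_left: "(a - a') \<odot> b = a \<odot> b - a' \<odot> b"
 and cl_mult_diff_right: "a \<odot> (b - b') = a \<odot> b - a \<odot> b'"
 by (rule bounded_bilinear.minus_left[OF bounded_bilinear_cl_mult]
   bounded_bilinear.minus_right[OF bounded_bilinear_cl_mult]
   bounded_bilinear.diff_left[OF bounded_bilinear_cl_mult]
   bounded_bilinear.diff_right[OF bounded_bilinear_cl_mult])+

lemma bounded_linear_cl_vec: "bounded_linear (cl_vec :: 'n::{finite,linorder} clfun)"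
 unfolding cl_vec_def
 by (intro bounded_linear_sum bounded_linear_scaleR_const bounded_linear_vec_nth)

lemma cl_vec_add: "cl_vec (x + y) = cl_vec x + cl_vec y"
 and cl_vec_scaleR: "cl_vec (r *r x) = r *r cl_vec x"
 and cl_vec_zero: "cl_vec 0 = 0"
 by (rule linear_simps[OF bounded_linear_cl_vec])+

lemma cl_vec_axis: "cl_vec (axis i 1) = cl_gen i"
 by (simp add: cl_vec_def axis_def if_distrib[where f = "%t. t *r _"] cong: if_cong)

lemma cl_gen_anticomm:
 "cl_gen i \<odot> cl_gen j + cl_gen j \<odot> cl_gen i = (if i = j then - 2 else 0 :: real) *r cl_one"
proof (cases "i = j")
 case True
 then show ?thesis by (simp add: cl_gen_square vec_eq_iff scaleR_conv_of_real[where 'a = complex])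
next
 case False
 then show ?thesis using cl_gen_anticommute[of i j] by simp
qed

text \<open>The Clifford relation in polarised form: matching e_i e_j with e_j e_i in the two double
  sums leaves only the diagonal.\<close>

lemma cl_vec_anticomm:
 fixes x y :: "'n::{finite,linorder} point"
 shows "cl_vec x \<odot> cl_vec y + cl_vec y \<odot> cl_vec x = - (2 * (x \<bullet> y)) *r cl_one"
proof -
 have "cl_vec x \<odot> cl_vec y = (\<Sum>i\<in>UNIV. \<Sum>j\<in>UNIV. (x $ i * y $ j) *r (cl_gen i \<odot> cl_gen j))"
  unfolding cl_vec_def unfolding cl_mult_sum_left cl_mult_scaleR_left
  unfolding cl_mult_sum_right cl_mult_scaleR_right
  by (simp add: scaleR_sum_right)
 moreover have "cl_vec y \<odot> cl_vec x = (\<Sum>i\<in>UNIV. \<Sum>j\<in>UNIV. (x $ i * y $ j) *r (cl_gen j \<odot> cl_gen i))"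
  unfolding cl_vec_def unfolding cl_mult_sum_left cl_mult_scaleR_left
  unfolding cl_mult_sum_right cl_mult_scaleR_right
   scaleR_sum_right scaleR_scaleR
  by (rule trans[OF sum.swap]) (simp add: mult_ac)
 ultimately have "cl_vec x \<odot> cl_vec y + cl_vec y \<odot> cl_vec x = (\<Sum>i\<in>UNIV. \<Sum>j\<in>UNIV.
   (x $ i * y $ j) *r ((if i = j then - 2 else 0 :: real) *r cl_one))"
  unfolding cl_gen_anticomm[symmetric] by (simp add: sum.distrib scaleR_add_right)
 also have "... = (\<Sum>i\<in>UNIV. (x $ i * y $ i * - 2) *r cl_one)"
 proof (rule sum.cong[OF refl])
  fix i
  have "(\<Sum>j\<in>UNIV. (x $ i * y $ j) *r ((if i = j then - 2 else 0 :: real) *r (cl_one :: 'n cliff)))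
    = (\<Sum>j\<in>UNIV. if j = i then (x $ i * y $ i * - 2) *r cl_one else 0)"
   by (rule sum.cong) auto
  then show "(\<Sum>j\<in>UNIV. (x $ i * y $ j) *r ((if i = j then - 2 else 0 :: real) *r (cl_one :: 'n cliff)))
    = (x $ i * y $ i * - 2) *r cl_one" by simp
 qed
 also have "... = (- (2 * (x \<bullet> y))) *r cl_one"
  by (simp only: scaleR_left.sum[symmetric] inner_vec_def sum_distrib_left sum_negf[symmetric])
   (simp add: mult_ac)
 finally show ?thesis .
qed

lemma cl_vec_square: "cl_vec x \<odot> (cl_vec x \<odot> a) = - (nsq x *r a)"
proof -
 have "cl_vec x \<odot> cl_vec x = - (nsq x *r cl_one)"
 proof -
  have "2 *r (cl_vec x \<odot> cl_vec x) = - (2 * (x \<bullet> x)) *r cl_one"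
   unfolding scaleR_2 by (rule cl_vec_anticomm)
  also have "... = 2 *r (- (nsq x *r cl_one))"
   by (simp only: scaleR_minus_right scaleR_scaleR scaleR_minus_left power2_norm_eq_inner)
  finally show ?thesis by (simp only: scaleR_cancel_left) simp
 qed
 then show ?thesis
  by (simp add: cl_mult_assoc[symmetric] cl_mult_minus_left cl_mult_scaleR_left)
qed

lemma cl_gen_vec: "cl_gen i \<odot> (cl_vec x \<odot> a) = - (2 * x $ i) *r a - cl_vec x \<odot> (cl_gen i \<odot> a)"
proof -
 have "(cl_gen i \<odot> cl_vec x + cl_vec x \<odot> cl_gen i) \<odot> a = - (2 * x $ i) *r a"
  using cl_vec_anticomm[of "axis i 1" x]
  by (simp add: cl_vec_axis cl_mult_scaleR_left inner_axis' cl_mult_minus_left)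
 then show ?thesis by (simp add: cl_mult_add_left cl_mult_assoc algebra_simps)
qed

lemma cl_gen_gen: "cl_gen i \<odot> (cl_gen j \<odot> a) = (if i = j then - a else - (cl_gen j \<odot> (cl_gen i \<odot> a)))"
proof (cases "i = j")
 case True
 then show ?thesis by (simp add: cl_mult_assoc[symmetric] cl_gen_square cl_mult_minus_left)
next
 case False
 have "(cl_gen i \<odot> cl_gen j + cl_gen j \<odot> cl_gen i) \<odot> a = 0"
  using cl_gen_anticommute[OF False] by simp
 then show ?thesis using False
  by (simp add: cl_mult_add_left cl_mult_assoc eq_neg_iff_add_eq_0)
qed

text \<open>Generators with different indices anticommute, so the triangle j < k of the definition
  unfolds to all pairs j and k that differ. Adding the diagonal, where the squares are -1, completes
  the product of the two vectors.\<close>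

lemma cl_wedge_eq:
 fixes x y :: "'n::{finite,linorder} point"
 shows "cl_wedge x y = cl_vec x \<odot> cl_vec y + (x \<bullet> y) *r cl_one"
proof -
 let ?t = "%(j, k). (x $ j * y $ k) *r (cl_gen j \<odot> cl_gen k) :: 'n cliff"
 have "cl_wedge x y = (\<Sum>p\<in>{(j, k). j < k}. ?t p + ?t (prod.swap p))"
  unfolding cl_wedge_def
 proof (rule sum.cong)
  fix p :: "'n \<times> 'n" assume "p \<in> {(j, k). j < k}"
  then obtain j k where p: "p = (j, k)" "j ~= k" by auto
  then have "cl_gen k \<odot> cl_gen j = - (cl_gen j \<odot> cl_gen k)"
   using cl_gen_anticommute[of k j] by (simp add: eq_neg_iff_add_eq_0)
  then show "(case p of (j, k) => (x $ j * y $ k - x $ k * y $ j) *r (cl_gen j \<odot> cl_gen k))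
    = ?t p + ?t (prod.swap p)"
   by (simp add: p scaleR_diff_left)
 qed simp
 also have "... = sum ?t {(j, k). j < k} + sum ?t {(j, k). k < j}"
  unfolding sum.distrib
  by (intro arg_cong2[where f = "(+)"] refl sum.reindex_bij_witness[of _ prod.swap prod.swap]) auto
 also have "... = sum ?t ({(j, k). j < k} \<union> {(j, k). k < j})"
  by (rule sum.union_disjoint[symmetric]) auto
 also have "... = sum ?t UNIV - sum ?t {(j, k). j = k}"
  by (subst sum_diff[symmetric]) (auto intro!: sum.cong)
 also have "sum ?t UNIV = cl_vec x \<odot> cl_vec y"
  unfolding cl_vec_def UNIV_Times_UNIV[symmetric] sum.cartesian_product[symmetric]
  unfolding cl_mult_sum_left cl_mult_scaleR_left unfolding cl_mult_sum_right cl_mult_scaleR_right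
  by (simp add: scaleR_sum_right)
 also have "sum ?t {(j, k). j = k} = (\<Sum>i\<in>UNIV. (x $ i * y $ i) *r (- cl_one))"
  by (rule sum.reindex_bij_witness[of _ "%i. (i, i)" fst]) (auto simp: cl_gen_square)
 also have "... = - ((x \<bullet> y) *r cl_one)"
  by (simp add: inner_vec_def scaleR_left.sum sum_negf)
 finally show ?thesis by simp
qed

text \<open>Here \<open>y\<close> stands leftmost, so that for fixed \<open>y\<close> it can be
  pulled out of an integral over \<open>x\<close>.\<close>

lemma cl_wedge_mult:
 "cl_wedge x y \<odot> a = - (cl_vec y \<odot> (cl_vec x \<odot> a)) - (x \<bullet> y) *r a"
proof -
 have 1: "cl_vec x \<odot> cl_vec y = (- (2 * (x \<bullet> y))) *r cl_one - cl_vec y \<odot> cl_vec x"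
  using cl_vec_anticomm[of x y] by (metis add_diff_cancel_right')
 have "cl_wedge x y = - (cl_vec y \<odot> cl_vec x) - (x \<bullet> y) *r cl_one"
  unfolding cl_wedge_eq 1 by (simp add: scaleR_left_diff_distrib[symmetric] scaleR_minus_left[symmetric] del: scaleR_minus_left)
   (simp add: vec_eq_iff scaleR_conv_of_real[where 'a = complex])
 then show ?thesis
  by (simp add: cl_mult_diff_left cl_mult_minus_left cl_mult_scaleR_left cl_mult_assoc)
qed

text \<open>The Hermitian form behind \<open>l2_inner\<close>: by
  \<open>cl_scalar_part_bar_mult\<close> it is the scalar part occurring there, and its real part is
  the Euclidean inner product of the type.\<close>

definition cl_dot :: "'n::{finite,linorder} cliff => 'n cliff => complex" where
 "cl_dot a b = (\<Sum>A\<in>UNIV. cnj (a $ A) * b $ A)"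

lemma cl_dot_add: "cl_dot (a + b) d = cl_dot a d + cl_dot b d" "cl_dot d (a + b) = cl_dot d a + cl_dot d b"
 and cl_dot_diff: "cl_dot (a - b) d = cl_dot a d - cl_dot b d" "cl_dot d (a - b) = cl_dot d a - cl_dot d b"
 and cl_dot_minus: "cl_dot (- a) d = - cl_dot a d" "cl_dot d (- a) = - cl_dot d a"
 and cl_dot_smult: "cl_dot (s *s a) d = cnj s * cl_dot a d" "cl_dot d (s *s a) = s * cl_dot d a"
 and cl_dot_zero: "cl_dot 0 d = 0" "cl_dot d 0 = 0"
 by (simp_all add: cl_dot_def algebra_simps sum.distrib sum_subtractf sum_negf sum_distrib_left)

lemma cl_dot_scaleR: "cl_dot (r *r a) d = r *r cl_dot a d" "cl_dot d (r *r a) = r *r cl_dot d a"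
 by (simp_all add: scaleR_eq_smult cl_dot_smult scaleR_conv_of_real[where 'a = complex])

lemma cl_dot_cnj: "cnj (cl_dot a d) = cl_dot d a"
 by (simp add: cl_dot_def mult.commute)

lemma cl_dot_sum: "cl_dot (sum f I) d = (\<Sum>i\<in>I. cl_dot (f i) d)" "cl_dot d (sum f I) = (\<Sum>i\<in>I. cl_dot d (f i))"
 by (induction I rule: infinite_finite_induct) (simp_all add: cl_dot_add cl_dot_zero)

lemma Re_cl_dot: "Re (cl_dot a b) = a \<bullet> b"
 by (simp add: cl_dot_def inner_vec_def inner_complex_def)

lemma cl_dot_self: "cl_dot a a = of_real (nsq a)"
proof (rule complex_eqI)
 show "Im (cl_dot a a) = Im (of_real (nsq a))"
  using arg_cong[OF cl_dot_cnj[of a a], of Im] by simp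
qed (simp add: Re_cl_dot power2_norm_eq_inner)

lemma norm_cl_dot_le: "cmod (cl_dot a b) <= norm a * norm b"
proof -
 \<comment> \<open>A phase that makes the value real and nonnegative, so that the real
   Cauchy-Schwarz inequality applies. If the value is 0 then so is \<open>s\<close>, and nothing is
   lost.\<close>
 define s where "s = cnj (sgn (cl_dot a b))"
 have "s * cl_dot a b = of_real (cmod (cl_dot a b))"
  by (simp add: s_def sgn_div_norm scaleR_conv_of_real mult.assoc[symmetric] complex_norm_square[symmetric]
    field_simps power2_eq_square)
 then have "cmod (cl_dot a b) = Re (cl_dot a (s *s b))"
  by (simp add: cl_dot_smult)
 also have "... <= norm a * norm (s *s b)"
  unfolding Re_cl_dot by (rule norm_cauchy_schwarz)
 also have "... <= norm a * norm b"
  by (intro mult_left_mono) (auto simp: norm_smult s_def norm_sgn)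
 finally show ?thesis .
qed

lemma bounded_bilinear_cl_dot: "bounded_bilinear (cl_dot :: 'n::{finite,linorder} cliff => _)"
 by standard (auto simp: cl_dot_add cl_dot_scaleR intro!: exI[of _ 1] norm_cl_dot_le)

lemma cl_cnj_mult: "cl_cnj (a \<odot> b) = cl_cnj a \<odot> cl_cnj b"
proof -
 have "cnj (cl_basis S $ A) = cl_basis S $ A" for S A :: "'a set"
  by (simp add: cl_basis_def axis_def)
 then show ?thesis
  by (simp add: vec_eq_iff cl_cnj_def cl_mult_def cl_sign_def)
qed

text \<open>\<open>cl_bar\<close> reverses products and sends a generator to its negative, so left
  multiplication by a generator is skew-Hermitian.\<close>

lemma cl_dot_gen: "cl_dot (cl_gen i \<odot> a) b = - cl_dot a (cl_gen i \<odot> b)"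
proof -
 have g: "cl_cnj (cl_gen i) = cl_gen i"
  by (simp add: vec_eq_iff cl_cnj_def cl_gen_def cl_basis_def axis_def)
 have "cl_dot (cl_gen i \<odot> a) b = cl_scalar_part (cl_bar (cl_cnj (cl_gen i \<odot> a)) \<odot> b)"
  by (simp add: cl_dot_def cl_scalar_part_bar_mult)
 also have "... = - cl_scalar_part (cl_bar (cl_cnj a) \<odot> (cl_gen i \<odot> b))"
  by (simp add: cl_cnj_mult cl_bar_mult g cl_bar_gen cl_mult_minus_left cl_mult_minus_right cl_mult_assoc
    cl_scalar_part_def)
 finally show ?thesis by (simp add: cl_dot_def cl_scalar_part_bar_mult)
qed

lemma cl_dot_vec: "cl_dot (cl_vec x \<odot> a) b = - cl_dot a (cl_vec x \<odot> b)"
 unfolding cl_vec_def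
 by (simp add: cl_mult_sum_left cl_mult_scaleR_left cl_dot_sum cl_dot_scaleR cl_dot_gen sum_negf)

text \<open>Multiplication by a vector is skew-Hermitian with square -|x|^2, hence |x| times an
  isometry.\<close>

lemma norm_cl_vec_mult: "norm (cl_vec x \<odot> a) = norm x * norm a"
proof -
 have "cl_dot (cl_vec x \<odot> a) (cl_vec x \<odot> a) = nsq x *r cl_dot a a"
  by (simp add: cl_dot_vec cl_vec_square cl_dot_minus cl_dot_scaleR)
 then have "complex_of_real ((norm (cl_vec x \<odot> a))\<^sup>2) = of_real (nsq x * nsq a)"
  unfolding cl_dot_self by (simp add: scaleR_conv_of_real)
 then have "(norm (cl_vec x \<odot> a))\<^sup>2 = (norm x * norm a)\<^sup>2"
  unfolding power_mult_distrib by (simp only: of_real_eq_iff)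
 then show ?thesis by (simp add: power2_eq_iff_nonneg)
qed

section \<open>Homogeneous polynomials and the Fischer decomposition\<close>

text \<open>\<open>partial\<close> has an unspecified value where no derivative exists. The relation
  carries existence along and so obeys the calculus rules; the general codomain covers real, complex
  and Clifford valued factors.\<close>

definition has_pd :: "'n::finite => ('n point => 'b::real_normed_vector) => 'b => 'n point => bool" where
 "has_pd i f D x \<longleftrightarrow> ((%t. f (x + t *r axis i 1)) has_vector_derivative D) (at 0)"

lemma partial_eq: "has_pd i f D x ==> partial i f x = D"
 unfolding has_pd_def partial_def by (rule vector_derivative_at)

lemma has_pd_const: "has_pd i (%_. a) 0 x"
 by (simp add: has_pd_def)

lemma has_pd_add: "has_pd i f D x ==> has_pd i g E x ==> has_pd i (%x. f x + g x) (D + E) x"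
 unfolding has_pd_def by (rule has_vector_derivative_add)

lemma has_pd_sum: "(!!j. j \<in> J ==> has_pd i (f j) (D j) x) ==> has_pd i (%x. \<Sum>j\<in>J. f j x) (\<Sum>j\<in>J. D j) x"
 unfolding has_pd_def by (rule has_vector_derivative_sum)

lemma has_pd_linear: "bounded_linear T ==> has_pd i f D x ==> has_pd i (%x. T (f x)) (T D) x"
 unfolding has_pd_def by (rule bounded_linear.has_vector_derivative)

lemma has_pd_bilinear:
 assumes "bounded_bilinear B" "has_pd i f D x" "has_pd i g E x"
 shows "has_pd i (%x. B (f x) (g x)) (B (f x) E + B D (g x)) x"
 using bounded_bilinear.has_vector_derivative[OF assms(1) assms(2,3)[unfolded has_pd_def]]
 by (simp add: has_pd_def)

lemmas has_pd_scaleR = has_pd_bilinear[OF bounded_bilinear_scaleR]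

lemma has_pd_coord: "has_pd i (%x. x $ j) (if i = j then 1 else 0) x"
proof (cases "i = j")
 case True
 have "((%t. x $ j + t) has_vector_derivative 1) (at 0)"
  unfolding has_real_derivative_iff_has_vector_derivative[symmetric]
  by (auto intro!: derivative_eq_intros)
 then show ?thesis using True by (simp add: has_pd_def axis_def)
qed (simp add: has_pd_def axis_def)

lemma has_pd_chain:
 assumes "has_pd i u U x" "(g has_real_derivative G) (at (u x))"
 shows "has_pd i (%x. g (u x)) (G * U) x"
proof -
 have "((%t. u (x + t *r axis i 1)) has_real_derivative U) (at 0)"
  using assms(1) by (simp add: has_pd_def has_real_derivative_iff_has_vector_derivative)
 then have "((%t. g (u (x + t *r axis i 1))) has_real_derivative G * U) (at 0)"
  using assms(2) by (intro DERIV_chain2) auto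
 then show ?thesis by (simp add: has_pd_def has_real_derivative_iff_has_vector_derivative)
qed

lemma has_pd_normsq: "has_pd i (%x. nsq x) (2 * x $ i) x"
proof -
 have "has_pd i (%x. \<Sum>j\<in>UNIV. x $ j * x $ j)
   (\<Sum>j\<in>UNIV. x $ j * (if i = j then 1 else 0) + (if i = j then 1 else 0) * x $ j) x"
  by (intro has_pd_sum has_pd_bilinear[OF bounded_bilinear_mult] has_pd_coord)
 moreover have "(\<Sum>j\<in>UNIV. x $ j * (if i = j then 1 else 0) + (if i = j then 1 else 0) * x $ j)
   = (\<Sum>j\<in>UNIV. if j = i then 2 * x $ i else 0)"
  by (rule sum.cong) auto
 ultimately show ?thesis by (simp add: power2_norm_eq_inner inner_vec_def)
qed

lemma has_pd_inner: "has_pd i (%x. x \<bullet> y) (y $ i) x"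
proof -
 have "has_pd i (%x. \<Sum>j\<in>UNIV. x $ j * y $ j)
   (\<Sum>j\<in>UNIV. x $ j * 0 + (if i = j then 1 else 0) * y $ j) x"
  by (intro has_pd_sum has_pd_bilinear[OF bounded_bilinear_mult] has_pd_coord has_pd_const)
 moreover have "(\<Sum>j\<in>UNIV. x $ j * 0 + (if i = j then 1 else 0) * y $ j) = (\<Sum>j\<in>UNIV. if j = i then y $ i else 0)"
  by (rule sum.cong) auto
 ultimately show ?thesis by (simp add: inner_vec_def)
qed

text \<open>Homogeneous polynomials given as a closure, so that facts on derivatives go by rule
  induction. The zero function belongs to every degree, because sums and derivatives may
  vanish.\<close>

inductive hpoly :: "nat => ('n::{finite,linorder} clfun) => bool" where
 const: "hpoly 0 (%_. a)"
| zero: "hpoly k (%_. 0)"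
| add: "hpoly k f ==> hpoly k g ==> hpoly k (%x. f x + g x)"
| coord: "hpoly k f ==> hpoly (Suc k) (%x. (x $ i) *r f x)"

lemma hpoly_linear:
 assumes "hpoly k f" "linear T"
 shows "hpoly k (%x. T (f x))"
 using assms(1)
 by induction (simp_all add: linear_0[OF assms(2)] linear_add[OF assms(2)] linear_scale[OF assms(2)] hpoly.intros)

lemma hpoly_sum: "(!!i. i \<in> I ==> hpoly k (f i)) ==> hpoly k (%x. \<Sum>i\<in>I. f i x)"
proof (induction I rule: infinite_finite_induct)
 case (insert i I)
 then have "hpoly k (%x. f i x + (\<Sum>i\<in>I. f i x))" by (intro hpoly.add) auto
 then show ?case using insert.hyps by simp
qed (simp_all add: hpoly.zero)

lemma hpoly_scaleR: "hpoly k f ==> hpoly k (%x. r *r f x)"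
 by (rule hpoly_linear[where T = "%a. r *r a"]) (simp_all add: bounded_linear.linear[OF bounded_linear_scaleR_right])

lemma hpoly_smult: "hpoly k f ==> hpoly k (%x. s *s f x)"
 by (rule hpoly_linear[where T = "%b. s *s b"])
  (simp_all add: bounded_linear.linear[OF bounded_linear_smult])

lemma hpoly_mult: "hpoly k f ==> hpoly k (%x. a \<odot> f x)"
 by (rule hpoly_linear[where T = "%b. a \<odot> b"])
  (simp_all add: bounded_linear.linear[OF bounded_bilinear.bounded_linear_right[OF bounded_bilinear_cl_mult]])

lemma cl_vec_mult_sum: "cl_vec x \<odot> a = (\<Sum>i\<in>UNIV. (x $ i) *r (cl_gen i \<odot> a))"
 by (simp add: cl_vec_def cl_mult_sum_left cl_mult_scaleR_left)

lemma hpoly_vec: "hpoly k f ==> hpoly (Suc k) (%x. cl_vec x \<odot> f x)"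
 unfolding cl_vec_mult_sum by (intro hpoly_sum hpoly.coord hpoly_mult)

lemma hpoly_inner:
 assumes "hpoly k f" shows "hpoly (Suc k) (%x. (x \<bullet> y) *r f x)"
proof -
 have "hpoly (Suc k) (%x. \<Sum>i\<in>UNIV. y $ i *r (x $ i *r f x))"
  by (intro hpoly_sum hpoly_scaleR hpoly.coord assms)
 then show ?thesis by (simp add: inner_vec_def scaleR_left.sum mult.commute)
qed

lemma hpoly_inner_power: "hpoly k f ==> hpoly (n + k) (%x. (x \<bullet> y) ^ n *r f x)"
proof (induction n)
 case (Suc n)
 from hpoly_inner[OF Suc.IH[OF Suc.prems], of y] show ?case by (simp add: mult_ac)
qed simp

text \<open>The clause for \<open>k = 0\<close> makes the truncated \<open>k - 1\<close> harmless:
  in the \<open>coord\<close> case the product of x_j with a derivative of nominal degree 0 would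
  otherwise have degree 1 where degree 0 is required.\<close>

lemma hpoly_partial_aux:
 assumes "hpoly k f"
 shows "\<exists>f'. hpoly (k - 1) f' \<and> (\<forall>x. has_pd i f (f' x) x) \<and> (k = 0 --> f' = (%_. 0))"
 using assms
proof induction
 case (const a)
 show ?case by (rule exI[of _ "%_. 0"]) (auto intro: hpoly.intros has_pd_const)
next
 case (zero k)
 show ?case by (rule exI[of _ "%_. 0"]) (auto intro: hpoly.intros has_pd_const)
next
 case (add k f g)
 then obtain f' g' where "hpoly (k - 1) f'" "\<forall>x. has_pd i f (f' x) x" "k = 0 --> f' = (%_. 0)"
  "hpoly (k - 1) g'" "\<forall>x. has_pd i g (g' x) x" "k = 0 --> g' = (%_. 0)"
  by blast
 then show ?case by (intro exI[of _ "%x. f' x + g' x"]) (auto intro: hpoly.intros has_pd_add)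
next
 case (coord k f j)
 then obtain f' where f': "hpoly (k - 1) f'" "!!x. has_pd i f (f' x) x" "k = 0 --> f' = (%_. 0)"
  by blast
 have "hpoly k (%x. x $ j *r f' x)"
 proof (cases k)
  case 0
  then show ?thesis using f'(3) by (auto intro: hpoly.intros)
 next
  case (Suc k')
  then show ?thesis using f'(1) by (auto intro: hpoly.intros)
 qed
 then have "hpoly k (%x. x $ j *r f' x + (if i = j then 1 else 0) *r f x)"
  by (intro hpoly.add hpoly_scaleR coord)
 moreover have "\<forall>x. has_pd i (%x. x $ j *r f x) (x $ j *r f' x + (if i = j then 1 else 0) *r f x) x"
  by (intro allI has_pd_scaleR has_pd_coord f')
 ultimately show ?case
  by (intro exI[of _ "%x. x $ j *r f' x + (if i = j then 1 else 0) *r f x"] conjI) simp_all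
qed

lemma hpoly_has_pd: "hpoly k f ==> has_pd i f (partial i f x) x"
 using hpoly_partial_aux[of k f i] partial_eq by metis

lemma hpoly_partial: "hpoly k f ==> hpoly (k - 1) (partial i f)"
proof -
 assume f: "hpoly k f"
 then obtain f' where f': "hpoly (k - 1) f'" "\<forall>x. has_pd i f (f' x) x" using hpoly_partial_aux by blast
 then have "partial i f = f'" using partial_eq by blast
 then show ?thesis using f' by simp
qed

lemma hpoly_0_partial: "hpoly 0 f ==> partial i f x = 0"
 using hpoly_partial_aux[of 0 f i] partial_eq by metis

lemma partial_coord: "hpoly k f ==>
  partial i (%x. x $ j *r f x) = (%x. x $ j *r partial i f x + (if i = j then 1 else 0) *r f x)"
 by (rule ext) (intro partial_eq has_pd_scaleR has_pd_coord hpoly_has_pd)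

lemma partial_add: "hpoly k f ==> hpoly l g ==>
  partial i (%x. f x + g x) = (%x. partial i f x + partial i g x)"
 by (rule ext) (intro partial_eq has_pd_add hpoly_has_pd)

lemma partial_sum: "(!!j. j \<in> J ==> hpoly k (f j)) ==>
  partial i (%x. \<Sum>j\<in>J. f j x) = (%x. \<Sum>j\<in>J. partial i (f j) x)"
 by (rule ext) (intro partial_eq has_pd_sum hpoly_has_pd)

lemma partial_linear: "hpoly k f ==> bounded_linear T ==> partial i (%x. T (f x)) = (%x. T (partial i f x))"
 by (rule ext, rule partial_eq, erule has_pd_linear, erule hpoly_has_pd)

lemma partial_const: "partial i (%_. a) = (%_. 0)"
 by (rule ext) (intro partial_eq has_pd_const)

lemma partial_commute: "hpoly k f ==> partial i (partial j f) = partial j (partial i f)"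
proof (induction rule: hpoly.induct)
 case (add k f g)
 then show ?case
  by (simp add: partial_add[of k f k g] partial_add[OF hpoly_partial hpoly_partial, of k f k g])
next
 case (coord k f l)
 note p = hpoly_partial[OF coord.hyps]
 have "partial i (partial j (%x. x $ l *r f x)) = (%x. (x $ l *r partial i (partial j f) x
   + (if i = l then 1 else 0) *r partial j f x) + (if j = l then 1 else 0) *r partial i f x)" for i j
  unfolding partial_coord[OF coord.hyps]
  by (rule ext) (intro partial_eq has_pd_add has_pd_scaleR has_pd_coord hpoly_has_pd[OF p]
    has_pd_linear[OF bounded_linear_scaleR_right] hpoly_has_pd[OF coord.hyps])
 from this[of i j] this[of j i] show ?case by (simp add: coord.IH add_ac)
qed (simp_all add: partial_const)

lemma hpoly_euler: "hpoly k f ==> euler f x = real k *r f x"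
proof (induction rule: hpoly.induct)
 case (add k f g)
 then show ?case by (simp add: euler_def partial_add[of k f k g] algebra_simps sum.distrib)
next
 case (coord k f j)
 have "euler (%x. x $ j *r f x) x = x $ j *r euler f x
   + (\<Sum>i\<in>UNIV. if i = j then x $ i *r f x else 0)"
  unfolding euler_def partial_coord[OF coord.hyps] scaleR_sum_right sum.distrib[symmetric]
  by (intro sum.cong refl) (simp add: algebra_simps)
 then show ?case by (simp add: coord.IH algebra_simps)
qed (simp_all add: euler_def partial_const)

lemma hpoly_scale_arg: "hpoly k f ==> f (t *r x) = t ^ k *r f x"
 by (induction rule: hpoly.induct) (simp_all add: algebra_simps)

lemma hpoly_continuous: "hpoly k f ==> continuous_on S f"
 by (induction rule: hpoly.induct) (auto intro!: continuous_intros)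

lemma hpoly_measurable: "hpoly k f ==> f \<in> borel_measurable borel"
 by (intro borel_measurable_continuous_onI hpoly_continuous)

lemma hpoly_bound: "hpoly k f ==> \<exists>C\<ge>0. \<forall>x. norm (f x) <= C * norm x ^ k"
proof (induction rule: hpoly.induct)
 case (const a)
 show ?case by (rule exI[of _ "norm a"]) auto
next
 case (zero k)
 show ?case by (rule exI[of _ 0]) auto
next
 case (add k f g)
 then obtain C D where "C \<ge> 0" "\<forall>x. norm (f x) <= C * norm x ^ k" "D \<ge> 0" "\<forall>x. norm (g x) <= D * norm x ^ k"
  by blast
 then show ?case
  by (intro exI[of _ "C + D"]) (auto simp: distrib_right intro!: norm_triangle_mono)
next
 case (coord k f i)
 then obtain C where C: "C \<ge> 0" "!!x. norm (f x) <= C * norm x ^ k" by blast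
 have "norm (x $ i *r f x) <= C * norm x ^ Suc k" for x
 proof -
  have "norm (x $ i *r f x) <= norm x * (C * norm x ^ k)"
   using C component_le_norm_cart[of x i] by (auto intro!: mult_mono)
  then show ?thesis by (simp add: mult_ac)
 qed
 then show ?case using C(1) by blast
qed

lemma hpoly_dirac: "hpoly k f ==> hpoly (k - 1) (dirac f)"
 unfolding dirac_def[abs_def] by (intro hpoly_sum hpoly_mult hpoly_partial)

lemma dirac_add: "hpoly k f ==> hpoly l g ==> dirac (%x. f x + g x) x = dirac f x + dirac g x"
 by (simp add: dirac_def partial_add cl_mult_add_right sum.distrib)

lemma dirac_linear:
 assumes "hpoly k f" "bounded_linear T" "!!i a. T (cl_gen i \<odot> a) = cl_gen i \<odot> T a"
 shows "dirac (%x. T (f x)) x = T (dirac f x)"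
 by (simp add: dirac_def partial_linear[OF assms(1,2)] assms(3)
   linear_sum[OF bounded_linear.linear[OF assms(2)]])

lemma dirac_scaleR: "hpoly k f ==> dirac (%x. r *r f x) x = r *r dirac f x"
 by (rule dirac_linear[where T = "%a. r *r a"]) (simp_all add: cl_mult_scaleR_right bounded_linear_scaleR_right)

text \<open>The anticommutator of the Dirac operator with the vector variable is -(m + 2 E), and the
  Euler operator E acts on \<open>f\<close> as its degree \<open>k\<close>.\<close>

lemma dirac_vec:
 fixes f :: "'n::{finite,linorder} clfun"
 assumes f: "hpoly k f"
 shows "dirac (%x. cl_vec x \<odot> f x) x = - (real CARD('n) + 2 * real k) *r f x - cl_vec x \<odot> dirac f x"
proof -
 have pd: "partial i (%x. cl_vec x \<odot> f x) x = cl_vec x \<odot> partial i f x + cl_gen i \<odot> f x" for i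
 proof (rule partial_eq)
  have "has_pd i (%x. x) (axis i 1) x"
   by (auto simp: has_pd_def intro!: derivative_eq_intros)
  from has_pd_linear[OF bounded_linear_cl_vec this]
  have "has_pd i (%x. cl_vec x) (cl_gen i) x" by (simp only: cl_vec_axis)
  then show "has_pd i (%x. cl_vec x \<odot> f x) (cl_vec x \<odot> partial i f x + cl_gen i \<odot> f x) x"
   by (intro has_pd_bilinear[OF bounded_bilinear_cl_mult] hpoly_has_pd[OF f])
 qed
 have "dirac (%x. cl_vec x \<odot> f x) x =
   (\<Sum>i\<in>UNIV. (((-2) * x $ i) *r partial i f x - cl_vec x \<odot> (cl_gen i \<odot> partial i f x)) - f x)"
  unfolding dirac_def pd by (simp add: cl_mult_add_right cl_gen_vec cl_gen_gen[of i i for i])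
 also have "... = (-2) *r euler f x - cl_vec x \<odot> dirac f x - real CARD('n) *r f x"
  by (simp only: sum_subtractf scaleR_sum_right scaleR_scaleR[symmetric] euler_def dirac_def cl_mult_sum_right
    sum_constant_scaleR)
 also have "... = - (real CARD('n) + 2 * real k) *r f x - cl_vec x \<odot> dirac f x"
  unfolding hpoly_euler[OF f] scaleR_scaleR
  by (simp only: scaleR_left_distrib scaleR_left.minus minus_add_distrib mult_minus_left)
   (simp add: algebra_simps)
 finally show ?thesis .
qed

lemma double_cancel: "a + a = b + b ==> a = (b :: 'n::{finite,linorder} cliff)"
 by (metis scaleR_2 scaleR_cancel_left zero_neq_numeral)

section \<open>Laplacian, powers of the vector variable and the Fischer decomposition\<close>

definition lap :: "('n::{finite,linorder} clfun) => 'n clfun" where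
 "lap f x = (\<Sum>i\<in>UNIV. partial i (partial i f) x)"

text \<open>The double sum is added to its transpose: partial derivatives commute and generators
  anticommute, so only the diagonal remains, and \<open>double_cancel\<close> removes the factor
  2.\<close>

lemma dirac_dirac:
 assumes f: "hpoly k f"
 shows "dirac (dirac f) x = - lap f x"
proof -
 let ?S = "\<Sum>i\<in>UNIV. \<Sum>j\<in>UNIV. cl_gen i \<odot> (cl_gen j \<odot> partial i (partial j f) x)"
 have S: "dirac (dirac f) x = ?S"
 proof -
  have "partial i (dirac f) x = (\<Sum>j\<in>UNIV. cl_gen j \<odot> partial i (partial j f) x)" for i
   unfolding dirac_def[abs_def]
   by (intro partial_eq has_pd_sum has_pd_linear[OF bounded_bilinear.bounded_linear_right[OF bounded_bilinear_cl_mult]]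
     hpoly_has_pd[OF hpoly_partial[OF f]])
  then show ?thesis by (simp add: dirac_def[of "dirac f"] cl_mult_sum_right)
 qed
 have "?S + ?S = (\<Sum>i\<in>UNIV. \<Sum>j\<in>UNIV. cl_gen i \<odot> (cl_gen j \<odot> partial i (partial j f) x)
   + cl_gen j \<odot> (cl_gen i \<odot> partial i (partial j f) x))"
  unfolding sum.distrib
  by (subst (3) sum.swap) (simp add: partial_commute[OF f])
 also have "... = (\<Sum>i\<in>UNIV. \<Sum>j\<in>UNIV. if j = i then - partial i (partial i f) x - partial i (partial i f) x else 0)"
 proof (intro sum.cong refl)
  fix i j
  show "cl_gen i \<odot> (cl_gen j \<odot> partial i (partial j f) x) + cl_gen j \<odot> (cl_gen i \<odot> partial i (partial j f) x)
    = (if j = i then - partial i (partial i f) x - partial i (partial i f) x else 0)"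
   using cl_gen_gen[of i j "partial i (partial j f) x"] by auto
 qed
 also have "... = - lap f x + - lap f x"
  by (simp only: sum.delta finite_class.finite_UNIV UNIV_I if_True lap_def sum.distrib sum_negf diff_conv_add_uminus)
 finally show ?thesis unfolding S by (rule double_cancel)
qed

definition vpow :: "nat => 'n point => 'n::{finite,linorder} cliff => 'n cliff" where
 "vpow s x = ((%a. cl_vec x \<odot> a) ^^ s)"

lemma vpow_0 [simp]: "vpow 0 x a = a" and vpow_Suc: "vpow (Suc s) x a = cl_vec x \<odot> vpow s x a"
 by (simp_all add: vpow_def)

lemma hpoly_vpow: "hpoly k f ==> hpoly (s + k) (%x. vpow s x (f x))"
 by (induction s) (auto simp: vpow_Suc hpoly_vec)

text \<open>The anticommutator is used once per factor with alternating sign, whence the split by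
  parity. The factor is never 0, and this makes the Dirac operator surjective in
  \<open>fischer_preimage\<close>.\<close>

lemma dirac_vpow:
 fixes f :: "'n::{finite,linorder} clfun"
 assumes f: "hpoly l f" "!!x. dirac f x = 0"
 shows "dirac (%x. vpow (Suc s) x (f x)) x
   = - (if even s then real CARD('n) + 2 * real l + real s else real s + 1) *r vpow s x (f x)"
proof (induction s)
 case 0
 show ?case using dirac_vec[OF f(1), of x] f(2) by (simp add: vpow_Suc)
next
 case (Suc s)
 have "dirac (%x. vpow (Suc (Suc s)) x (f x)) x =
   - (real CARD('n) + 2 * real (Suc s + l)) *r vpow (Suc s) x (f x)
   - cl_vec x \<odot> dirac (%x. vpow (Suc s) x (f x)) x"
  unfolding vpow_Suc[of "Suc s"] by (rule dirac_vec[OF hpoly_vpow[OF f(1)]])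
 then show ?case
  unfolding Suc.IH by (simp add: cl_mult_scaleR_right cl_mult_minus_right vpow_Suc[symmetric])
   (simp add: scaleR_left_diff_distrib[symmetric] scaleR_left_distrib[symmetric] flip: scaleR_minus_left)
qed

inductive fischer :: "nat => ('n::{finite,linorder} clfun) => bool" where
 vpow: "hpoly l f ==> (!!x. dirac f x = 0) ==> fischer (s + l) (%x. vpow s x (f x))"
| add: "fischer k f ==> fischer k g ==> fischer k (%x. f x + g x)"

lemma fischer_hpoly: "fischer k f ==> hpoly k f"
 by (induction rule: fischer.induct) (simp_all add: hpoly_vpow hpoly.add)

lemma fischer_preimage:
 fixes f :: "'n::{finite,linorder} clfun"
 assumes "fischer k f"
 shows "\<exists>g. fischer (Suc k) g \<and> (\<forall>x. dirac g x = f x)"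
 using assms
proof induction
 case (vpow l f s)
 define c where "c = - (if even s then real CARD('n) + 2 * real l + real s else real s + 1)"
 have c: "c ~= 0" by (auto simp: c_def add_nonneg_eq_0_iff)
 have l: "vpow (Suc s) x (r *r a) = r *r vpow (Suc s) x a" for x :: "'n point" and r a
  unfolding vpow_def by (induction s) (auto simp: cl_mult_scaleR_right)
 have h: "hpoly l (%x. (1 / c) *r f x)" "!!x. dirac (%x. (1 / c) *r f x) x = 0"
  using vpow by (auto intro: hpoly_scaleR simp: dirac_scaleR)
 have "dirac (%x. vpow (Suc s) x ((1 / c) *r f x)) x = (1 / c) *r (c *r vpow s x (f x))" for x
  unfolding l dirac_scaleR[OF hpoly_vpow[OF vpow(1)]] dirac_vpow[OF vpow] c_def by (rule refl)
 then show ?case using fischer.vpow[OF h, of "Suc s"] c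
  by (intro exI[of _ "%x. vpow (Suc s) x ((1 / c) *r f x)"]) simp
next
 case (add k f g)
 then obtain f' g' where "fischer (Suc k) f'" "\<forall>x. dirac f' x = f x" "fischer (Suc k) g'" "\<forall>x. dirac g' x = g x"
  by blast
 then show ?case
  by (intro exI[of _ "%x. f' x + g' x"]) (auto intro: fischer.add simp: dirac_add[OF fischer_hpoly fischer_hpoly])
qed

text \<open>Induction on the degree through the Dirac operator: some Fischer sum \<open>g\<close>
  has the same Dirac image as \<open>f\<close>, and then \<open>f - g\<close> is monogenic.\<close>

lemma fischer_decomposition: "hpoly k f ==> fischer k f"
proof (induction k arbitrary: f)
 case 0
 then have "dirac f x = 0" for x by (simp add: dirac_def hpoly_0_partial)
 then show ?case using fischer.vpow[of 0 f 0] 0 by simp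
next
 case (Suc k)
 then have "fischer k (dirac f)" using hpoly_dirac[of "Suc k" f] by simp
 then obtain g where g: "fischer (Suc k) g" "!!x. dirac g x = dirac f x"
  using fischer_preimage by blast
 have m: "hpoly (Suc k) (%x. (-1) *r g x)" using g(1) by (intro hpoly_scaleR fischer_hpoly)
 have "dirac (%x. f x + (-1) *r g x) x = 0" for x
  unfolding dirac_add[OF Suc.prems m] dirac_scaleR[OF fischer_hpoly[OF g(1)]] g(2) by simp
 then have "fischer (Suc k) (%x. f x + (-1) *r g x)"
  using fischer.vpow[of "Suc k" "%x. f x + (-1) *r g x" 0] hpoly.add[OF Suc.prems m] by simp
 from fischer.add[OF this g(1)] show ?case by simp
qed

lemma hpoly_polynomial_function: "hpoly k f ==> polynomial_function f"
proof (induction rule: hpoly.induct)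
 case (coord k f i)
 have "polynomial_function (%x :: 'a point. x $ i)"
  by (intro polynomial_function_bounded_linear bounded_linear_vec_nth)
 from polynomial_function_mult[OF this coord.IH] show ?case .
qed (simp_all add: polynomial_function_add)

lemma polynomial_function_hpoly_sum:
 fixes f :: "'n::{finite,linorder} clfun"
 assumes "polynomial_function f"
 shows "\<exists>N P. (\<forall>k. hpoly k (P k)) \<and> (\<forall>x. f x = (\<Sum>k\<le>N. P k x))"
proof -
 \<comment> \<open>The cut-off past which \<open>P\<close> vanishes lets two families be extended to
   a common range and added.\<close>
 define S where "S = {f :: 'n clfun. \<exists>P N. (\<forall>k. hpoly k (P k)) \<and> (\<forall>k>N. P k = (%_. 0)) \<and> (\<forall>x. f x = (\<Sum>k\<le>N. P k x))}"
 have S_base: "f \<in> S" if "hpoly k f" for k f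
  unfolding S_def using that
  by (intro CollectI exI[of _ "%j. if j = k then f else (%_. 0)"] exI[of _ k])
   (auto intro: hpoly.zero simp: if_distrib[where f = "%g. g _"] cong: if_cong)
 have S_add: "(%x. f x + g x) \<in> S" if fS: "f \<in> S" and gS: "g \<in> S" for f g
 proof -
  obtain P N where P: "\<forall>k. hpoly k (P k)" "\<forall>k>N. P k = (%_. 0)" "\<forall>x. f x = (\<Sum>k\<le>N. P k x)"
   using fS unfolding S_def by blast
  obtain Q K where Q: "\<forall>k. hpoly k (Q k)" "\<forall>k>K. Q k = (%_. 0)" "\<forall>x. g x = (\<Sum>k\<le>K. Q k x)"
   using gS unfolding S_def by blast
  have f: "f x = (\<Sum>k\<le>max N K. P k x)" for x
   unfolding P(3)[rule_format] using P(2) by (intro sum.mono_neutral_left) (auto simp: not_le)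
  have g: "g x = (\<Sum>k\<le>max N K. Q k x)" for x
   unfolding Q(3)[rule_format] using Q(2) by (intro sum.mono_neutral_left) (auto simp: not_le)
  have "\<forall>k. hpoly k (%x. P k x + Q k x)" using P(1) Q(1) by (blast intro: hpoly.add)
  moreover have "\<forall>k>max N K. (%x. P k x + Q k x) = (%_. 0)" using P(2) Q(2) by simp
  moreover have "\<forall>x. f x + g x = (\<Sum>k\<le>max N K. P k x + Q k x)"
   unfolding f g by (simp add: sum.distrib)
  ultimately show ?thesis unfolding S_def mem_Collect_eq
   by (intro exI[of _ "%k x. P k x + Q k x"] exI[of _ "max N K"] conjI)
 qed
 have S_sum: "(%x. \<Sum>i\<in>I. F i x) \<in> S" if "!!i. i \<in> I ==> F i \<in> S" for I :: "'b set" and F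
  using that
 proof (induction I rule: infinite_finite_induct)
  case (insert i I)
  then have "(%x. F i x + (\<Sum>i\<in>I. F i x)) \<in> S" by (intro S_add) auto
  then show ?case using insert.hyps by simp
 qed (simp_all add: S_base[OF hpoly.zero])
 have S_coord: "(%x. (x $ i) *r f x) \<in> S" and S_scale: "(%x. r *r f x) \<in> S" if fS: "f \<in> S" for f i r
 proof -
  obtain P N where P: "\<forall>k. hpoly k (P k)" "\<forall>x. f x = (\<Sum>k\<le>N. P k x)"
   using fS unfolding S_def by blast
  have "(%x. \<Sum>k\<le>N. (x $ i) *r P k x) \<in> S" "(%x. \<Sum>k\<le>N. r *r P k x) \<in> S"
   by (rule S_sum, rule S_base, rule hpoly.coord, rule P(1)[rule_format])
    (rule S_sum, rule S_base, rule hpoly_scaleR, rule P(1)[rule_format])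
  then show "(%x. (x $ i) *r f x) \<in> S" "(%x. r *r f x) \<in> S"
   unfolding P(2)[rule_format] scaleR_sum_right by simp_all
 qed
 \<comment> \<open>Stated for \<open>p\<close> times an arbitrary member of \<open>S\<close>, so
   that the product case is the hypothesis applied twice.\<close>
 have real: "(%x. p x *r f x) \<in> S" if "real_polynomial_function p" "f \<in> S" for p :: "'n point => real" and f
  using that
 proof (induction p arbitrary: f)
  case (linear h)
  have h: "h x = (\<Sum>i\<in>UNIV. x $ i * h (axis i 1))" for x
   by (subst (1) basis_expansion[symmetric, of x])
    (simp add: linear_sum[OF bounded_linear.linear[OF linear(1)]]
     linear_scale[OF bounded_linear.linear[OF linear(1)]] scalar_mult_eq_scaleR)
  have "h x *r f x = (\<Sum>i\<in>UNIV. h (axis i 1) *r (x $ i *r f x))" for x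
   by (subst (1) h) (simp only: scaleR_left.sum scaleR_scaleR mult.commute)
  then have "(%x. h x *r f x) = (%x. \<Sum>i\<in>UNIV. h (axis i 1) *r (x $ i *r f x))" by (rule ext)
  moreover have "(%x. \<Sum>i\<in>UNIV. h (axis i 1) *r (x $ i *r f x)) \<in> S"
   by (rule S_sum, rule S_scale, rule S_coord, rule linear)
  ultimately show ?case by simp
 next
  case (const c)
  then show ?case by (intro S_scale)
 next
  case (add p q)
  then show ?case by (simp add: scaleR_left_distrib S_add)
 next
  case (mult p q)
  from mult(3)[OF mult(4)[OF mult(5)]] show ?case by simp
 qed
 have "(%x. \<Sum>b\<in>Basis. (f x \<bullet> b) *r b) \<in> S"
 proof (rule S_sum, rule real)
  fix b show "real_polynomial_function (%x. f x \<bullet> b)"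
   using assms bounded_linear_inner_left[of b] unfolding polynomial_function_def comp_def by blast
 next
  fix b show "(%_. b) \<in> S" by (rule S_base[OF hpoly.const])
 qed
 then have "f \<in> S" by (simp add: euclidean_representation)
 then show ?thesis unfolding S_def by blast
qed

text \<open>Along each ray f(t x) is a polynomial in \<open>t\<close> in two ways. Comparing
  coefficients leaves only the part of degree \<open>l\<close>.\<close>

lemma hpoly_of_polynomial_function:
 fixes f :: "'n::{finite,linorder} clfun"
 assumes "polynomial_function f" and hom: "!!t x. f (t *r x) = t ^ l *r f x"
 shows "hpoly l f"
proof -
 obtain N P where P: "!!k. hpoly k (P k)" "!!x. f x = (\<Sum>k\<le>N. P k x)"
  using polynomial_function_hpoly_sum[OF assms(1)] by blast
 have "f x = (if l <= N then P l x else 0)" for x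
 proof (rule euclidean_eqI)
  fix b :: "'n cliff"
  define q where "q k = (if k <= N then P k x \<bullet> b else 0) - (if k = l then f x \<bullet> b else 0)" for k
  have "(\<Sum>k\<le>max N l. q k * t ^ k) = 0" for t
  proof -
   have "t ^ l * (f x \<bullet> b) = f (t *r x) \<bullet> b" by (simp add: hom)
   also have "... = (\<Sum>k\<le>N. (P k x \<bullet> b) * t ^ k)"
    by (simp add: P(2) hpoly_scale_arg[OF P(1)] inner_sum_left mult.commute)
   also have "... = (\<Sum>k\<le>max N l. (if k <= N then P k x \<bullet> b else 0) * t ^ k)"
    by (intro sum.mono_neutral_cong_left) auto
   finally have 1: "(\<Sum>k\<le>max N l. (if k <= N then P k x \<bullet> b else 0) * t ^ k) = t ^ l * (f x \<bullet> b)" by simp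
   have "(\<Sum>k\<le>max N l. (if k = l then f x \<bullet> b else 0) * t ^ k) = (\<Sum>k\<le>max N l. if k = l then t ^ l * (f x \<bullet> b) else 0)"
    by (rule sum.cong) auto
   then show ?thesis using 1 by (simp add: q_def left_diff_distrib sum_subtractf)
  qed
  then have "q l = 0" using polyfun_eq_0[of q "max N l"] by auto
  then show "f x \<bullet> b = (if l <= N then P l x else 0) \<bullet> b" by (auto simp: q_def split: if_splits)
 qed
 then have "f = (if l <= N then P l else (%_. 0))" by auto
 then show ?thesis using P(1) by (auto intro: hpoly.zero)
qed

lemma monogenics_iff:
 "M \<in> monogenics l \<longleftrightarrow> hpoly l M \<and> range M \<subseteq> cl_real \<and> (\<forall>x. dirac M x = 0)"
proof
 assume "M \<in> monogenics l"
 then show "hpoly l M \<and> range M \<subseteq> cl_real \<and> (\<forall>x. dirac M x = 0)"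
  using hpoly_of_polynomial_function[of M l] by (simp add: monogenics_def)
next
 assume "hpoly l M \<and> range M \<subseteq> cl_real \<and> (\<forall>x. dirac M x = 0)"
 then show "M \<in> monogenics l"
  using hpoly_polynomial_function[of l M] hpoly_scale_arg[of l M] by (simp add: monogenics_def)
qed

section \<open>Polar coordinates and Gaussian integrals\<close>

text \<open>The measure r^(m-1) dr written in u = r^2, the variable of the Laguerre
  polynomials.\<close>

definition radial :: "nat => real measure" where
 "radial m = density lborel (%u. ennreal (indicator {0<..} u * (u powr (real m / 2 - 1) / 2)))"

lemma sets_radial [measurable_cong, simp]: "sets (radial m) = sets borel"
 by (simp add: radial_def)

lemma space_radial [simp]: "space (radial m) = UNIV"
 by (simp add: radial_def)

lemma sets_sphere_measure [measurable_cong, simp]: "sets sphere_measure = sets borel"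
 by (simp add: sphere_measure_def)

lemma space_sphere_measure [simp]: "space sphere_measure = UNIV"
 by (simp add: sphere_measure_def space_scale_measure)

lemma finite_sphere_measure: "finite_measure sphere_measure"
 by (rule finite_measureI) (simp add: sphere_measure_total)

lemma sigma_finite_radial: "sigma_finite_measure (radial m)"
 unfolding radial_def by (subst sigma_finite_measure.sigma_finite_iff_density_finite[OF sigma_finite_lborel]) auto

lemma emeasure_radial_lessThan:
 assumes "m > 0"
 shows "emeasure (radial m) {..<r} = ennreal (if r > 0 then r powr (real m / 2) / real m else 0)"
proof (cases "r > 0")
 case True
 have "((%x. x powr (real m / 2 - 1)) has_integral (r powr (real m / 2 - 1 + 1) / (real m / 2 - 1 + 1))) {0..r}"
  using assms True by (intro has_integral_powr_from_0) auto
 from has_integral_divide[OF this, of 2]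
 have "((%x. x powr (real m / 2 - 1) / 2) has_integral (r powr (real m / 2) / real m)) {0<..<r}"
  using assms by (simp add: has_integral_Icc_iff_Ioo)
 then have "((%x. if x \<in> {0<..<r} then x powr (real m / 2 - 1) / 2 else 0) has_integral (r powr (real m / 2) / real m)) UNIV"
  by (subst has_integral_restrict_UNIV)
 then have "(\<integral>\<^sup>+x. ennreal (if x \<in> {0<..<r} then x powr (real m / 2 - 1) / 2 else 0) \<partial>lborel) = ennreal (r powr (real m / 2) / real m)"
  by (intro nn_integral_has_integral_lborel) auto
 moreover have "emeasure (radial m) {..<r}
   = (\<integral>\<^sup>+x. ennreal (if x \<in> {0<..<r} then x powr (real m / 2 - 1) / 2 else 0) \<partial>lborel)"
  unfolding radial_def by (subst emeasure_density) (auto intro!: nn_integral_cong split: split_indicator)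
 ultimately show ?thesis using True by simp
next
 case False
 have "emeasure (radial m) {..<r} = (\<integral>\<^sup>+x. ennreal (indicator {0<..} x * (x powr (real m / 2 - 1) / 2)) * indicator {..<r} x \<partial>lborel)"
  unfolding radial_def by (rule emeasure_density) auto
 also have "... = (\<integral>\<^sup>+(x :: real). 0 \<partial>lborel)"
  by (rule nn_integral_cong) (use False in \<open>auto split: split_indicator\<close>)
 finally have "emeasure (radial m) {..<r} = (\<integral>\<^sup>+(x :: real). 0 \<partial>lborel)" .
 then show ?thesis using False by simp
qed

lemma sgn_scaleR_pos: "s > 0 ==> sgn (s *r x) = sgn (x :: 'a::real_normed_vector)"
 by (simp add: sgn_scaleR)

lemma measurable_sgn_point [measurable]: "(sgn :: 'n::finite point => _) \<in> borel_measurable borel"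
 by (simp add: sgn_div_norm[abs_def])

text \<open>\<open>sgn\<close> is invariant under positive scaling, so a truncated cone is a dilate
  of the one in the unit ball.\<close>

lemma emeasure_cone:
 fixes B :: "'n::finite point set"
 assumes B: "B \<in> sets borel" and s: "s > 0"
 shows "emeasure lborel {x. norm x < s \<and> sgn x \<in> B}
   = ennreal (s ^ CARD('n)) * emeasure lborel {x. norm x < 1 \<and> sgn x \<in> B}"
proof -
 let ?X = "%s. {x :: 'n point. norm x < s \<and> sgn x \<in> B}"
 have m: "?X t \<in> sets borel" for t using B by measurable
 have "emeasure lborel (?X s) = emeasure (density (distr lborel borel (%x. 0 + s *r x)) (%_. ennreal (\<bar>s\<bar> ^ DIM('n point)))) (?X s)"
  using s by (subst lborel_affine[of s 0]) auto
 also have "... = ennreal (s ^ CARD('n)) * emeasure (distr lborel borel (%x. 0 + s *r x)) (?X s)"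
  using s m by (subst emeasure_density_const) auto
 also have "emeasure (distr lborel borel (%x. 0 + s *r x)) (?X s) = emeasure lborel ((%x. 0 + s *r x) -` ?X s \<inter> space lborel)"
  by (rule emeasure_distr) (use m in auto)
 also have "(%x. 0 + s *r x) -` ?X s \<inter> space lborel = ?X 1"
  using s by (auto simp: sgn_scaleR_pos)
 finally show ?thesis .
qed

lemma emeasure_sphere_measure:
 fixes B :: "'n::{finite,linorder} point set"
 assumes B: "B \<in> sets borel"
 shows "emeasure sphere_measure B = of_nat CARD('n) * emeasure lborel {x. norm x < 1 \<and> sgn x \<in> B}"
proof -
 have "emeasure (distr (restrict_space lborel (ball 0 1)) borel sgn) B
   = emeasure (restrict_space lborel (ball 0 1)) (sgn -` B \<inter> space (restrict_space lborel (ball (0 :: 'n point) 1)))"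
  by (rule emeasure_distr) (use B in \<open>auto intro: measurable_restrict_space1\<close>)
 also have "... = emeasure lborel (sgn -` B \<inter> ball (0 :: 'n point) 1)"
  by (subst emeasure_restrict_space) (auto simp: space_restrict_space)
 also have "sgn -` B \<inter> ball (0 :: 'n point) 1 = {x. norm x < 1 \<and> sgn x \<in> B}" by auto
 finally show ?thesis by (simp add: sphere_measure_def)
qed

text \<open>Rectangles suffice. With the angular set \<open>B\<close> fixed, both sides become
  measures \<open>N1\<close> and \<open>N2\<close> in the radial set; they agree on the half lines
  {..<r} by \<open>emeasure_cone\<close>, and these generate the Borel sets.\<close>

lemma polar_measure:
 "radial CARD('n) \<Otimes>\<^sub>M sphere_measure
   = distr lborel (borel \<Otimes>\<^sub>M borel) (%x :: 'n::{finite,linorder} point. (nsq x, sgn x))"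
proof (rule pair_measure_eqI)
 show "sigma_finite_measure (radial CARD('n))" by (rule sigma_finite_radial)
 show "sigma_finite_measure (sphere_measure :: 'n point measure)"
  using finite_sphere_measure by (rule finite_measure.axioms)
 show "sets (radial CARD('n) \<Otimes>\<^sub>M sphere_measure)
   = sets (distr lborel (borel \<Otimes>\<^sub>M borel) (%x :: 'n point. (nsq x, sgn x)))"
  by (simp cong: sets_pair_measure_cong)
next
 fix A :: "real set" and B :: "'n point set"
 assume "A \<in> sets (radial CARD('n))" "B \<in> sets sphere_measure"
 then have A: "A \<in> sets borel" and B: "B \<in> sets borel" by auto
 let ?P = "%x :: 'n point. nsq x"
 define V where "V = emeasure lborel {x :: 'n point. norm x < 1 \<and> sgn x \<in> B}"
 define N1 where "N1 = scale_measure (emeasure sphere_measure B) (radial CARD('n))"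
 define N2 where "N2 = distr (density lborel (indicator (sgn -` B))) borel ?P"
 have sB: "sgn -` B \<in> sets (borel :: 'n point measure)"
  using measurable_sets[OF measurable_sgn_point B] by simp
 have N2: "emeasure N2 X = emeasure lborel {x. ?P x \<in> X \<and> sgn x \<in> B}" if "X \<in> sets borel" for X
 proof -
  have "emeasure N2 X = emeasure (density lborel (indicator (sgn -` B))) (?P -` X)"
   unfolding N2_def using that by (subst emeasure_distr) auto
  also have "... = (\<integral>\<^sup>+x. indicator (sgn -` B) x * indicator (?P -` X) x \<partial>lborel)"
  proof (rule emeasure_density)
   show "indicator (sgn -` B) \<in> borel_measurable lborel" using sB by simp
   have "?P \<in> borel \<rightarrow>\<^sub>M borel" by measurable
   from measurable_sets[OF this that] show "?P -` X \<in> sets lborel" by simp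
  qed
  also have "... = (\<integral>\<^sup>+x. indicator {x. ?P x \<in> X \<and> sgn x \<in> B} x \<partial>lborel)"
   by (intro nn_integral_cong) (auto split: split_indicator)
  also have "... = emeasure lborel {x. ?P x \<in> X \<and> sgn x \<in> B}"
   by (rule nn_integral_indicator) (use B that in measurable)
  finally show ?thesis .
 qed
 have fin: "emeasure sphere_measure B < \<infinity>"
  using finite_measure.emeasure_finite[OF finite_sphere_measure, of B] by (simp add: top.not_eq_extremum)
 have "N1 = N2"
 proof (rule measure_eqI_generator_eq[where E = "range lessThan" and \<Omega> = UNIV and A = "%i. {..<real i}"])
  show "Int_stable (range lessThan :: real set set)"
   by (rule Int_stableI_image, rule_tac x = "min i j" in bexI) auto
  fix X :: "real set" assume "X \<in> range lessThan"
  then obtain r where X: "X = {..<r}" by auto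
  have e1: "emeasure N1 X = of_nat CARD('n) * V * ennreal (if r > 0 then r powr (real CARD('n) / 2) / real CARD('n) else 0)"
   unfolding N1_def X emeasure_scale_measure emeasure_sphere_measure[OF B] V_def
   by (subst emeasure_radial_lessThan) simp_all
  show "emeasure N1 X = emeasure N2 X"
  proof (cases "r > 0")
   case True
   have "emeasure N2 X = emeasure lborel {x :: 'n point. norm x < sqrt r \<and> sgn x \<in> B}"
   proof -
    have "nsq x < r \<longleftrightarrow> norm x < sqrt r" for x :: "'n point"
     by (metis real_sqrt_less_iff real_sqrt_abs abs_norm_cancel)
    then show ?thesis unfolding X by (subst N2) simp_all
   qed
   also have "... = ennreal (sqrt r ^ CARD('n)) * V"
    using True by (subst emeasure_cone[OF B]) (auto simp: V_def)
   also have "sqrt r ^ CARD('n) = r powr (real CARD('n) / 2)"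
    using True by (simp add: powr_half_sqrt[symmetric] powr_powr flip: powr_realpow)
   finally have e2: "emeasure N2 X = ennreal (r powr (real CARD('n) / 2)) * V" .
   have "of_nat CARD('n) * ennreal (r powr (real CARD('n) / 2) / real CARD('n)) = ennreal (r powr (real CARD('n) / 2))"
    by (simp add: ennreal_of_nat_eq_real_of_nat ennreal_mult[symmetric])
   then show ?thesis unfolding e1 e2 using True by (simp add: mult_ac)
  next
   case False
   have E: "{x :: 'n point. ?P x \<in> X \<and> sgn x \<in> B} = {}" using False
   proof -
    have "\<not> ?P x < r" for x using False zero_le_power2[of "norm x"] by linarith
    then show ?thesis by (simp add: X)
   qed
   moreover note E
   moreover have "emeasure N2 X = emeasure lborel {x :: 'n point. ?P x \<in> X \<and> sgn x \<in> B}"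
    by (rule N2) (simp add: X)
   ultimately show ?thesis unfolding e1 E using False by simp
  qed
 next
  have "sets (borel :: real measure) = sigma_sets UNIV (range lessThan)"
   by (subst borel_Iio) (rule sets_measure_of, simp)
  then show "sets N1 = sigma_sets UNIV (range lessThan)" "sets N2 = sigma_sets UNIV (range lessThan)"
   by (simp_all add: N1_def N2_def)
  show "(\<Union>i. {..<real i}) = UNIV" by (auto intro: reals_Archimedean2)
  fix i
  show "emeasure N1 {..<real i} ~= \<infinity>"
   using fin by (auto simp: N1_def emeasure_radial_lessThan ennreal_mult_eq_top_iff)
 qed auto
 then have "emeasure N1 A = emeasure N2 A" by simp
 also have "... = emeasure (distr lborel (borel \<Otimes>\<^sub>M borel) (%x. (?P x, sgn x))) (A \<times> B)"
  using A B by (subst N2) (auto simp: emeasure_distr intro!: arg_cong[where f = "emeasure lborel"])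
 finally show "emeasure (radial CARD('n)) A * emeasure sphere_measure B
   = emeasure (distr lborel (borel \<Otimes>\<^sub>M borel) (%x. (?P x, sgn x))) (A \<times> B)"
  by (simp add: N1_def mult.commute)
qed

lemma pair_integral_bilinear:
 fixes B :: "'a::{banach,second_countable_topology} => 'b::{banach,second_countable_topology}
  => 'd::{banach,second_countable_topology}"
 assumes M: "sigma_finite_measure M1" "sigma_finite_measure M2" and B: "bounded_bilinear B"
  and F: "integrable M1 F" and G: "integrable M2 G"
 shows "integrable (M1 \<Otimes>\<^sub>M M2) (%(u, v). B (F u) (G v))"
  and "integral\<^sup>L (M1 \<Otimes>\<^sub>M M2) (%(u, v). B (F u) (G v)) = B (integral\<^sup>L M1 F) (integral\<^sup>L M2 G)"
proof -
 interpret pair_sigma_finite M1 M2 using M by (rule pair_sigma_finite.intro)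
 have [measurable]: "F \<in> borel_measurable M1" "G \<in> borel_measurable M2" using F G by auto
 have cont: "continuous_on UNIV (%x. B (fst x) (snd x))"
  by (intro bounded_bilinear.continuous_on[OF B] continuous_intros)
 have meas: "(%(u, v). B (F u) (G v)) \<in> borel_measurable (M1 \<Otimes>\<^sub>M M2)"
  unfolding split_beta' by (rule borel_measurable_continuous_Pair[OF _ _ cont]) measurable
 obtain K where K: "!!a b. norm (B a b) <= norm a * norm b * K"
  using bounded_bilinear.bounded[OF B] by blast
 have N: "integrable (M1 \<Otimes>\<^sub>M M2) (%(u, v). norm (F u) * norm (G v) * K)"
  by (rule Fubini_integrable) (use F G in \<open>auto simp: abs_mult\<close>)
 show int: "integrable (M1 \<Otimes>\<^sub>M M2) (%(u, v). B (F u) (G v))"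
  by (rule Bochner_Integration.integrable_bound[OF N meas])
   (auto intro!: AE_I2 order_trans[OF K] simp: abs_if)
 have "integral\<^sup>L (M1 \<Otimes>\<^sub>M M2) (%(u, v). B (F u) (G v)) = (\<integral>u. (\<integral>v. B (F u) (G v) \<partial>M2) \<partial>M1)"
  using integral_fst'[OF int] by simp
 also have "... = (\<integral>u. B (F u) (integral\<^sup>L M2 G) \<partial>M1)"
  by (intro Bochner_Integration.integral_cong refl integral_bounded_linear
    bounded_bilinear.bounded_linear_right[OF B] G)
 also have "... = B (integral\<^sup>L M1 F) (integral\<^sup>L M2 G)"
  by (rule integral_bounded_linear[OF bounded_bilinear.bounded_linear_left[OF B] F])
 finally show "integral\<^sup>L (M1 \<Otimes>\<^sub>M M2) (%(u, v). B (F u) (G v)) = B (integral\<^sup>L M1 F) (integral\<^sup>L M2 G)" .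
qed

text \<open>The product stays abstract because the radial factor is later a real number, a real
  scalar or a complex scalar acting on the angular value.\<close>

lemma polar_bilinear:
 fixes B :: "'a::{banach,second_countable_topology} => 'b::{banach,second_countable_topology}
  => 'd::{banach,second_countable_topology}" and G :: "'n::{finite,linorder} point => 'b"
 assumes B: "bounded_bilinear B" and F: "integrable (radial CARD('n)) F" and G: "integrable sphere_measure G"
 shows "integrable lborel (%x. B (F (nsq x)) (G (sgn x)))"
  and "(LINT x|lborel. B (F (nsq x)) (G (sgn x))) = B (integral\<^sup>L (radial CARD('n)) F) (integral\<^sup>L sphere_measure G)"
proof -
 note P = pair_integral_bilinear[OF sigma_finite_radial finite_measure.axioms(1)[OF finite_sphere_measure] B F G]
 have m: "(%x :: 'n point. (nsq x, sgn x)) \<in> lborel \<rightarrow>\<^sub>M borel \<Otimes>\<^sub>M borel" by measurable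
 have h: "(%(u, v). B (F u) (G v)) \<in> borel_measurable (borel \<Otimes>\<^sub>M borel)"
  using borel_measurable_integrable[OF P(1)] by (simp cong: measurable_cong_sets sets_pair_measure_cong)
 show "integrable lborel (%x. B (F (nsq x)) (G (sgn x)))"
  using integrable_distr[OF m P(1)[unfolded polar_measure]] by simp
 show "(LINT x|lborel. B (F (nsq x)) (G (sgn x))) = B (integral\<^sup>L (radial CARD('n)) F) (integral\<^sup>L sphere_measure G)"
  using P(2)[unfolded polar_measure integral_distr[OF m h]] by simp
qed

lemma integrable_radial_iff:
 fixes F :: "real => 'b::{banach,second_countable_topology}"
 assumes [measurable]: "F \<in> borel_measurable borel"
 shows "integrable (radial m) F \<longleftrightarrow> integrable lborel (%u. (indicator {0<..} u * (u powr (real m / 2 - 1) / 2)) *r F u)"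
 unfolding radial_def by (rule integrable_density) auto

lemma integral_radial:
 fixes F :: "real => 'b::{banach,second_countable_topology}"
 assumes [measurable]: "F \<in> borel_measurable borel"
 shows "integral\<^sup>L (radial m) F = (LINT u|lborel. (indicator {0<..} u * (u powr (real m / 2 - 1) / 2)) *r F u)"
 unfolding radial_def by (rule integral_density) auto

section \<open>Integrability of powers times exponentials and Gaussians\<close>

lemma integrable_powr_exp:
 fixes a kp :: real
 assumes "a > -1" "kp > 0"
 shows "integrable lborel (%u. indicator {0<..} u * (u powr a * exp (- kp * u)))"
proof -
 have "(%t. complex_of_real t powr (of_real (a + 1) - 1) / of_real (exp (kp * t))) absolutely_integrable_on {0<..}"
  using assms by (intro absolutely_integrable_Gamma_integral) auto
 then have "integrable lebesgue (%t. norm (indicator {0<..} t *r (complex_of_real t powr (of_real (a + 1) - 1) / of_real (exp (kp * t)))))"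
  unfolding set_integrable_def by (rule integrable_norm)
 also have "(%t. norm (indicator {0<..} t *r (complex_of_real t powr (of_real (a + 1) - 1) / of_real (exp (kp * t)))))
   = (%u. indicator {0<..} u * (u powr a * exp (- kp * u)))"
  by (auto simp: fun_eq_iff indicator_def norm_divide norm_powr_real_powr exp_minus field_simps)
 finally show ?thesis by (subst integrable_completion[symmetric]) simp_all
qed

text \<open>Completing the square: a linear exponent costs a constant and a share of the
  Gaussian.\<close>

lemma absorb_linear: "kp > 0 ==> b * r <= kp * r\<^sup>2 + b\<^sup>2 / (4 * kp :: real)"
proof -
 assume k: "kp > 0"
 have "0 <= (2 * kp * r - b)\<^sup>2 / (4 * kp)" using k by simp
 also have "... = kp * r\<^sup>2 + b\<^sup>2 / (4 * kp) - b * r" using k by (simp add: field_simps power2_eq_square)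
 finally show ?thesis by simp
qed

lemma integrable_norm_powr_gauss:
 assumes s: "s > - real CARD('n)" and k: "kp > 0"
 shows "integrable lborel (%x :: 'n::{finite,linorder} point. norm x powr s * exp (b * norm x - kp * nsq x))"
proof -
 define F where "F u = u powr (s / 2) * exp (- (kp / 2) * u)" for u :: real
 have [measurable]: "F \<in> borel_measurable borel" unfolding F_def by measurable
 have "integrable lborel (%u. (1 / 2) * (indicator {0<..} u * (u powr (s / 2 + real CARD('n) / 2 - 1) * exp (- (kp / 2) * u))))"
  using s k by (intro integrable_mult_right integrable_powr_exp) auto
 also have "(%u. (1 / 2) * (indicator {0<..} u * (u powr (s / 2 + real CARD('n) / 2 - 1) * exp (- (kp / 2) * u))))
   = (%u. (indicator {0<..} u * (u powr (real CARD('n) / 2 - 1) / 2)) *r F u)"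
  by (auto simp: fun_eq_iff F_def indicator_def powr_add[symmetric] field_simps)
 finally have "integrable (radial CARD('n)) F" by (subst integrable_radial_iff) auto
 moreover have "integrable sphere_measure (%_ :: 'n point. 1 :: real)"
  using finite_measure.integrable_const[OF finite_sphere_measure] .
 ultimately have I: "integrable lborel (%x :: 'n point. F (nsq x) * 1)"
  by (rule polar_bilinear(1)[OF bounded_bilinear_mult])
 have J: "integrable lborel (%x :: 'n point. exp (b\<^sup>2 / (2 * kp)) * (F (nsq x) * 1))"
  using I by (rule integrable_mult_right)
 show ?thesis
 proof (rule Bochner_Integration.integrable_bound[OF J])
  show "(%x :: 'n point. norm x powr s * exp (b * norm x - kp * nsq x)) \<in> borel_measurable lborel"
   by measurable
  show "AE x :: 'n point in lborel. norm (norm x powr s * exp (b * norm x - kp * nsq x))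
    <= norm (exp (b\<^sup>2 / (2 * kp)) * (F (nsq x) * 1))"
  proof (rule AE_I2)
   fix x :: "'n point"
   have "b * norm x <= kp / 2 * nsq x + b\<^sup>2 / (2 * kp)"
    using absorb_linear[of "kp / 2" b "norm x"] k by simp
   then have "exp (b * norm x - kp * nsq x) <= exp (b\<^sup>2 / (2 * kp)) * exp (- (kp / 2) * nsq x)"
    by (simp add: exp_add[symmetric])
   moreover have "nsq x powr (s / 2) = norm x powr s"
    by (cases "x = 0") (auto simp: powr_powr simp flip: powr_numeral)
   ultimately show "norm (norm x powr s * exp (b * norm x - kp * nsq x))
    <= norm (exp (b\<^sup>2 / (2 * kp)) * (F (nsq x) * 1))"
    by (simp add: F_def abs_mult mult_left_mono mult.left_commute)
  qed
 qed
qed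

text \<open>Translation invariance replaces decay at infinity. F(x + e) - F(x) has integral 0; it is
  also the integral of F'(x + s e) over s in [0, 1], and by Fubini the integral over
  \<open>x\<close> of that is the integral of F'.\<close>

lemma integral_pd_zero:
 fixes F :: "'n::finite point => 'b::euclidean_space"
 assumes pd: "!!x. has_pd i F (F' x) x" and F: "integrable lborel F" and F': "integrable lborel F'"
  and cont: "continuous_on UNIV F'"
 shows "integral\<^sup>L lborel F' = 0"
proof -
 define e where "e = (axis i 1 :: 'n point)"
 have [measurable]: "F' \<in> borel_measurable borel" "F \<in> borel_measurable borel" using F F' by auto
 have tr: "distr lborel borel (%x. x + a) = (lborel :: 'n point measure)" for a
  using lborel_distr_plus[of a] by (simp add: add.commute[of _ a])
 have int_tr: "integrable lborel (%x. g (x + a))" "(LINT x|lborel. g (x + a)) = integral\<^sup>L lborel g"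
  if "integrable lborel g" for a :: "'n point" and g :: "'n point => 'c::euclidean_space"
 proof -
  have m: "(%x :: 'n point. x + a) \<in> lborel \<rightarrow>\<^sub>M borel" by measurable
  have "integrable (distr lborel borel (%x. x + a)) g" using that by (simp add: tr)
  then show "integrable lborel (%x. g (x + a))" by (rule integrable_distr[OF m])
  have "g \<in> borel_measurable borel" using that by auto
  from integral_distr[OF m this] show "(LINT x|lborel. g (x + a)) = integral\<^sup>L lborel g" by (simp add: tr)
 qed
 have ftc: "(LINT s|lborel. indicator {0..1} s *r F' (x + s *r e)) = F (x + e) - F x" for x
 proof -
  have "((%s. F (x + s *r e)) has_vector_derivative F' (x + t *r e)) (at t)" for t
  proof -
   have 1: "((%s. F ((x + t *r e) + s *r e)) has_vector_derivative F' (x + t *r e)) (at 0)"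
    using pd[of "x + t *r e"] by (simp add: has_pd_def e_def)
   have 2: "((%s. s - t) has_vector_derivative 1) (at t)"
    by (auto intro!: derivative_eq_intros)
   have "((%s. F ((x + t *r e) + s *r e)) \<circ> (%s. s - t) has_vector_derivative (1 *r F' (x + t *r e))) (at t)"
    using 1 2 by (intro vector_diff_chain_at) auto
   moreover have "(%s. F ((x + t *r e) + s *r e)) \<circ> (%s. s - t) = (%s. F (x + s *r e))"
    by (auto simp: fun_eq_iff algebra_simps)
   ultimately show ?thesis by simp
  qed
  note hvd = this
  have "(LINT s|lborel. indicator {0..1} s *r F' (x + s *r e)) = F (x + 1 *r e) - F (x + 0 *r e)"
  proof (rule integral_FTC_Icc)
   show "((%s. F (x + s *r e)) has_vector_derivative F' (x + t *r e)) (at t within {0..1})" for t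
    by (rule has_vector_derivative_at_within[OF hvd])
   show "continuous_on {0..1} (%s. F' (x + s *r e))"
    by (rule continuous_on_compose2[OF cont, where f = "%s. x + s *r e"]) (auto intro!: continuous_intros)
  qed auto
  then show ?thesis by simp
 qed
 define H where "H = (%(s, x). indicator {0..1 :: real} s *r F' (x + s *r e))"
 have Hm: "H \<in> borel_measurable (lborel \<Otimes>\<^sub>M lborel)" unfolding H_def by measurable
 have H: "integrable (lborel \<Otimes>\<^sub>M lborel) H"
 proof (rule lborel_pair.Fubini_integrable[OF Hm])
  have "(LINT x|lborel. norm (H (s, x))) = indicator {0..1} s * (LINT x|lborel. norm (F' x))" for s
   using int_tr(2)[OF integrable_norm[OF F'], of "s *r e"] by (simp add: H_def indicator_def)
  then show "integrable lborel (%s. LINT x|lborel. norm (H (s, x)))"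
   by (simp add: integrable_mult_left_iff lborel_integrable_real_affine_iff
     integrable_real_indicator del: integral_mult_left_zero integral_indicator)
  show "AE s in lborel. integrable lborel (%x. H (s, x))"
   by (rule AE_I2) (auto simp: H_def intro!: integrable_scaleR_right int_tr(1)[OF F'])
 qed
 have "(LINT x|lborel. LINT s|lborel. H (s, x)) = (LINT s|lborel. LINT x|lborel. H (s, x))"
  using lborel_pair.Fubini_integral[of "%s x. H (s, x)"] H by simp
 moreover have "(LINT x|lborel. LINT s|lborel. H (s, x)) = (LINT x|lborel. F (x + e) - F x)"
  using ftc by (simp add: H_def)
 moreover have "(LINT x|lborel. F (x + e) - F x) = 0"
  using int_tr[OF F, of e] F by simp
 moreover have "(LINT s|lborel. LINT x|lborel. H (s, x)) = (LINT s|lborel. indicator {0..1 :: real} s *r integral\<^sup>L lborel F')"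
  by (rule Bochner_Integration.integral_cong[OF refl]) (simp add: H_def int_tr(2)[OF F'])
 ultimately show ?thesis by simp
qed

section \<open>Gaussian integration by parts\<close>

definition gauss :: "'n::finite point => real" where
 "gauss x = exp (- nsq x / 2)"

text \<open>A class that contains the polynomials, is closed under sums and bounded bilinear
  products, and is integrable against the Gaussian.\<close>

definition exp_bounded :: "('n::finite point => 'b::real_normed_vector) => bool" where
 "exp_bounded f \<longleftrightarrow> continuous_on UNIV f \<and> (\<exists>C b. \<forall>x. norm (f x) <= C * exp (b * norm x))"

lemma exp_boundedI: "continuous_on UNIV f ==> (!!x. norm (f x) <= C * exp (b * norm x)) ==> exp_bounded f"
 unfolding exp_bounded_def by blast

lemma exp_bounded_bilinear:
 assumes B: "bounded_bilinear B" and "exp_bounded f" "exp_bounded g"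
 shows "exp_bounded (%x. B (f x) (g x))"
proof -
 obtain C b D d where c: "continuous_on UNIV f" "continuous_on UNIV g"
  and f: "!!x. norm (f x) <= C * exp (b * norm x)" and g: "!!x. norm (g x) <= D * exp (d * norm x)"
  using assms(2,3) unfolding exp_bounded_def by blast
 obtain K where K: "K \<ge> 0" "!!a b. norm (B a b) <= norm a * norm b * K"
  using bounded_bilinear.nonneg_bounded[OF B] by blast
 show ?thesis
 proof (rule exp_boundedI)
  show "continuous_on UNIV (%x. B (f x) (g x))" by (intro bounded_bilinear.continuous_on[OF B] c)
  fix x
  have "norm (B (f x) (g x)) <= norm (f x) * norm (g x) * K" by (rule K(2))
  also have "... <= (C * exp (b * norm x)) * (D * exp (d * norm x)) * K"
   using K(1) order_trans[OF norm_ge_zero f[of x]] order_trans[OF norm_ge_zero g[of x]]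
   by (intro mult_right_mono mult_mono f g) auto
  also have "... = C * D * K * exp ((b + d) * norm x)" by (simp add: exp_add algebra_simps)
  finally show "norm (B (f x) (g x)) <= C * D * K * exp ((b + d) * norm x)" .
 qed
qed

lemma exp_bounded_add:
 assumes "exp_bounded f" "exp_bounded g"
 shows "exp_bounded (%x. f x + g x)"
proof -
 obtain C b D d where c: "continuous_on UNIV f" "continuous_on UNIV g"
  and f: "!!x. norm (f x) <= C * exp (b * norm x)" and g: "!!x. norm (g x) <= D * exp (d * norm x)"
  using assms unfolding exp_bounded_def by blast
 show ?thesis
 proof (rule exp_boundedI)
  show "continuous_on UNIV (%x. f x + g x)" by (intro continuous_intros c)
  fix x :: "'a point"
  have "C * exp (b * norm x) <= \<bar>C\<bar> * exp (max b d * norm x)" "D * exp (d * norm x) <= \<bar>D\<bar> * exp (max b d * norm x)"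
   by (auto intro!: mult_mono mult_right_mono)
  then show "norm (f x + g x) <= (\<bar>C\<bar> + \<bar>D\<bar>) * exp (max b d * norm x)"
   using f[of x] g[of x] norm_triangle_ineq[of "f x" "g x"] by (simp add: distrib_right)
 qed
qed

lemma exp_bounded_coord: "exp_bounded (%x :: 'n::finite point. x $ i)"
proof (rule exp_boundedI[where C = 1 and b = 1])
 show "norm (x $ i) <= 1 * exp (1 * norm x)" for x :: "'n point"
  using component_le_norm_cart[of x i] exp_ge_add_one_self[of "norm x"] by (simp del: exp_ge_add_one_self)
qed (intro continuous_intros)

text \<open>A single term of the exponential series is at most its sum.\<close>

lemma power_le_fact_exp: "(r :: real) \<ge> 0 ==> r ^ k <= fact k * exp r"
proof -
 assume r: "r \<ge> 0"
 have "r ^ k / fact k <= exp r"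
  using sum_le_suminf[of "%n. r ^ n /\<^sub>R fact n" "{k}"] r summable_exp_generic[of r]
  by (simp add: exp_def divide_inverse mult.commute)
 then show ?thesis by (simp add: field_simps)
qed

lemma hpoly_exp_bounded: "hpoly k f ==> exp_bounded f"
proof -
 assume f: "hpoly k f"
 then obtain C where C: "C \<ge> 0" "!!x. norm (f x) <= C * norm x ^ k" using hpoly_bound by blast
 have "norm (f x) <= C * fact k * exp (1 * norm x)" for x
  using C(2)[of x] mult_left_mono[OF power_le_fact_exp[of "norm x" k] C(1)] by (simp add: mult_ac)
 then show ?thesis by (rule exp_boundedI[OF hpoly_continuous[OF f]])
qed

lemma integrable_gauss:
 fixes f :: "'n::{finite,linorder} point => 'b::euclidean_space"
 assumes "exp_bounded f"
 shows "integrable lborel (%x. gauss x *r f x)"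
proof -
 obtain C b where c: "continuous_on UNIV f" and f: "!!x. norm (f x) <= C * exp (b * norm x)"
  using assms unfolding exp_bounded_def by blast
 have [measurable]: "f \<in> borel_measurable borel" using c by (rule borel_measurable_continuous_onI)
 have I: "integrable lborel (%x :: 'n point. C * (norm x powr 0 * exp (b * norm x - (1/2) * nsq x)))"
  by (intro integrable_mult_right integrable_norm_powr_gauss) auto
 show ?thesis
 proof (rule Bochner_Integration.integrable_bound[OF I])
  show "(%x. gauss x *r f x) \<in> borel_measurable lborel" unfolding gauss_def by measurable
  have "AE x :: 'n point in lborel. x ~= 0" by (rule AE_lborel_singleton)
  then show "AE x in lborel. norm (gauss x *r f x)
    <= norm (C * (norm x powr 0 * exp (b * norm x - (1/2) * nsq x)))"
  proof eventually_elim
   fix x :: "'n point" assume "x ~= 0"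
   have "norm (gauss x *r f x) <= exp (- nsq x / 2) * (C * exp (b * norm x))"
    using f[of x] by (auto simp: gauss_def)
   also have "... = C * exp (b * norm x - (1/2) * nsq x)"
    by (simp add: exp_add[symmetric] algebra_simps)
   finally show "norm (gauss x *r f x) <= norm (C * (norm x powr 0 * exp (b * norm x - (1/2) * nsq x)))"
    using \<open>x ~= 0\<close> by simp
  qed
 qed
qed

lemma gauss_ibp:
 fixes f :: "'n::{finite,linorder} point => 'b::euclidean_space"
 assumes pd: "!!x. has_pd i f (f' x) x" and f: "exp_bounded f" and f': "exp_bounded f'"
 shows "(LINT x|lborel. gauss x *r (x $ i *r f x)) = (LINT x|lborel. gauss x *r f' x)"
proof -
 have xf: "exp_bounded (%x. x $ i *r f x)"
  by (rule exp_bounded_bilinear[OF bounded_bilinear_scaleR exp_bounded_coord f])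
 have g: "has_pd i gauss (- exp (- nsq x / 2) / 2 * (2 * x $ i)) x" for x :: "'n point"
  unfolding gauss_def
  by (rule has_pd_chain[where g = "%u. exp (- u / 2)" and u = "%x. nsq x", OF has_pd_normsq])
   (auto intro!: derivative_eq_intros)
 let ?F' = "%x. gauss x *r f' x - gauss x *r (x $ i *r f x)"
 have "integral\<^sup>L lborel ?F' = 0"
 proof (rule integral_pd_zero)
  show "has_pd i (%x. gauss x *r f x) (?F' x) x" for x
   using has_pd_scaleR[OF g pd, of x] by (simp add: gauss_def)
  show "continuous_on UNIV ?F'"
   using f f' xf unfolding exp_bounded_def gauss_def by (intro continuous_intros) auto
 qed (intro integrable_gauss Bochner_Integration.integrable_diff f f' xf)+
 then show ?thesis using integrable_gauss[OF f'] integrable_gauss[OF xf] by simp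
qed

section \<open>Laguerre polynomials\<close>

lemma Gamma_integral_rate:
 fixes s R :: real
 assumes s: "s > 0" and R: "R > 0"
 shows "(LINT u|lborel. indicator {0<..} u * (u powr (s - 1) * exp (- R * u))) = Gamma s / R powr s"
proof -
 define f where "f t = indicator {0<..} t * (t powr (s - 1) * exp (- 1 * t))" for t :: real
 have f_int: "integrable lborel f" unfolding f_def using s by (intro integrable_powr_exp) auto
 have "((%t. if t \<in> {0..} then t powr (s - 1) / exp t else 0) has_integral Gamma s) UNIV"
  using Gamma_integral_real[OF s] by (subst has_integral_restrict_UNIV)
 moreover have "(%t. if t \<in> {0..} then t powr (s - 1) / exp t else 0) = f"
  by (auto simp: fun_eq_iff f_def exp_minus divide_inverse indicator_def)
 ultimately have "(f has_integral Gamma s) UNIV" by simp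
 with has_integral_integral_lborel[OF f_int] have G: "integral\<^sup>L lborel f = Gamma s"
  by (rule has_integral_unique)
 have "integral\<^sup>L lborel f = \<bar>R\<bar> *r (LINT x|lborel. f (0 + R * x))"
  using R by (intro lborel_integral_real_affine) auto
 also have "(LINT x|lborel. f (0 + R * x))
   = (LINT u|lborel. R powr (s - 1) * (indicator {0<..} u * (u powr (s - 1) * exp (- R * u))))"
  using R by (intro Bochner_Integration.integral_cong refl)
   (auto simp: f_def indicator_def powr_mult zero_less_mult_iff)
 also have "... = R powr (s - 1) * (LINT u|lborel. indicator {0<..} u * (u powr (s - 1) * exp (- R * u)))"
  by simp
 finally have "Gamma s = R powr s * (LINT u|lborel. indicator {0<..} u * (u powr (s - 1) * exp (- R * u)))"
  using R G by (simp add: powr_diff)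
 then show ?thesis using R by (simp add: field_simps)
qed

lemma integrable_Gamma_complex_rate:
 fixes s :: real and p :: complex
 assumes s: "s > 0" and p: "Re p > 0"
 shows "integrable lborel (%u. (indicator {0<..} u * u powr (s - 1)) *r exp (- p * of_real u))"
proof (rule Bochner_Integration.integrable_bound)
 show "integrable lborel (%u. indicator {0<..} u * (u powr (s - 1) * exp (- Re p * u)))"
  using assms by (intro integrable_powr_exp) auto
 show "(%u. (indicator {0<..} u * u powr (s - 1)) *r exp (- p * of_real u)) \<in> borel_measurable lborel"
  by measurable
qed (auto simp: indicator_def norm_mult)

text \<open>Writing exp(-p u) = exp(-R u) exp((R - p) u) with real R and expanding the second factor
  gives Gamma integrals with real rate; their sum is the binomial series of p/R to the power
  -s.\<close>

lemma Gamma_integral_complex_rate: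
 fixes s :: real and p :: complex
 assumes s: "s > 0" and p: "Re p > 0"
 shows "(LINT u|lborel. (indicator {0<..} u * u powr (s - 1)) *r exp (- p * of_real u))
   = of_real (Gamma s) * p powr (- of_real s)"
proof -
 \<comment> \<open>Any R with 2 R Re p > |p|^2 has |R - p| < R. This choice gives |R - p|^2 = R^2 -
   |p|^2.\<close>
 define R where "R = (cmod p)\<^sup>2 / Re p"
 have p0: "p ~= 0" using p by auto
 have R: "R > 0" using p p0 by (simp add: R_def)
 have "(cmod (of_real R - p))\<^sup>2 = R\<^sup>2 - 2 * (R * Re p) + (cmod p)\<^sup>2"
  by (simp add: cmod_power2 power2_diff)
 also have "R * Re p = (cmod p)\<^sup>2" using p by (simp add: R_def)
 also have "R\<^sup>2 - 2 * (cmod p)\<^sup>2 + (cmod p)\<^sup>2 < R\<^sup>2" using p0 by simp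
 finally have lt: "cmod (of_real R - p) < R" using R by (simp add: power_less_imp_less_base)
 \<comment> \<open>The binomial series of \<open>(p / R)\<close> to the power \<open>-s\<close> converges because \<open>p\<close> lies in the disc of radius \<open>R\<close> around \<open>R\<close>.\<close>
 define h where "h n u = indicator {0<..} u * (u powr (s + real n - 1) * exp (- R * u))" for n and u :: real
 define f where "f n u = ((of_real R - p) ^ n / fact n) * complex_of_real (h n u)" for n u
 have h_int: "integrable lborel (h n)" for n
  unfolding h_def using s R integrable_powr_exp[of "s + real n - 1" R] by simp
 have f_int: "integrable lborel (f n)" for n
  unfolding f_def by (intro integrable_mult_right integrable_of_real h_int)
 have h_val: "integral\<^sup>L lborel (h n) = pochhammer s n * Gamma s / R powr (s + real n)" for n
 proof -
  have "integral\<^sup>L lborel (h n) = Gamma (s + real n) / R powr (s + real n)"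
   unfolding h_def using s R Gamma_integral_rate[of "s + real n" R] by simp
  moreover have "Gamma (s + real n) = pochhammer s n * Gamma s"
  proof -
   have "s \<notin> \<int>\<^sub>\<le>\<^sub>0" using s by (auto dest: nonpos_Ints_nonpos)
   moreover have "Gamma s ~= 0" using s by (metis Gamma_real_pos less_irrefl)
   ultimately show ?thesis by (simp add: pochhammer_Gamma)
  qed
  ultimately show ?thesis by simp
 qed
 have h_nonneg: "h n u \<ge> 0" for n u by (simp add: h_def)
 have sums_u: "(%n. f n u) sums ((indicator {0<..} u * u powr (s - 1)) *r exp (- p * of_real u))"
  and abs_u: "summable (%n. norm (f n u))" for u
 proof -
  let ?z = "(of_real R - p) * of_real u"
  define g where "g = indicator {0<..} u * (u powr (s - 1) * exp (- R * u))"
  have fg: "f n u = of_real g * (?z ^ n /\<^sub>R fact n)" for n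
  proof -
   have "h n u = g * u ^ n"
   proof (cases "u > 0")
    case True
    then have "u powr (s + real n - 1) = u powr (s - 1) * u ^ n"
     using powr_add[of u "s - 1" "real n"] by (simp add: powr_realpow add_diff_eq algebra_simps)
    then show ?thesis by (simp add: h_def g_def)
   qed (simp add: h_def g_def)
   then show ?thesis
    by (simp add: f_def power_mult_distrib scaleR_conv_of_real divide_inverse mult_ac)
  qed
  have "(%n. f n u) sums (of_real g * exp ?z)"
   unfolding fg by (intro sums_mult exp_converges)
  moreover have "of_real g * exp ?z = (indicator {0<..} u * u powr (s - 1)) *r exp (- p * of_real u)"
   by (simp add: g_def scaleR_conv_of_real exp_of_real[symmetric] exp_add[symmetric] algebra_simps)
  ultimately show "(%n. f n u) sums ((indicator {0<..} u * u powr (s - 1)) *r exp (- p * of_real u))"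
   by simp
  show "summable (%n. norm (f n u))"
   unfolding fg norm_mult by (intro summable_mult summable_norm_exp)
 qed
 have abs_int: "summable (%n. LINT u|lborel. norm (f n u))"
 proof -
  have "norm (- (cmod (of_real R - p) / R)) < 1" using lt R by simp
  from gen_binomial_real[OF this[unfolded real_norm_def], of "- s"]
  have "summable (%n. Gamma s / R powr s * ((- s gchoose n) * (- (cmod (of_real R - p) / R)) ^ n))"
   by (intro summable_mult) (rule sums_summable)
  also have "(%n. Gamma s / R powr s * ((- s gchoose n) * (- (cmod (of_real R - p) / R)) ^ n))
    = (%n. LINT u|lborel. norm (f n u))"
  proof
   fix n
   have "(LINT u|lborel. norm (f n u)) = (cmod (of_real R - p) ^ n / fact n) * integral\<^sup>L lborel (h n)"
    by (simp add: f_def norm_mult norm_divide norm_power h_nonneg)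
   then show "Gamma s / R powr s * ((- s gchoose n) * (- (cmod (of_real R - p) / R)) ^ n) = (LINT u|lborel. norm (f n u))"
   proof -
    have "(- (cmod (of_real R - p) / R)) ^ n = (-1) ^ n * (cmod (of_real R - p) ^ n / R ^ n)"
     by (simp add: power_minus[of "cmod (of_real R - p) / R"] power_divide)
    moreover have "(- s gchoose n) = (-1) ^ n * (pochhammer s n / fact n)"
     by (simp add: gbinomial_pochhammer)
    moreover have "(-1) ^ n * (-1) ^ n = (1 :: real)" by (simp flip: power_mult_distrib)
    moreover have "(ep * P) * (ep * Q) = P * Q" if "ep * ep = 1" for ep P Q :: real
    proof -
     have "(ep * P) * (ep * Q) = (ep * ep) * (P * Q)" by (simp only: mult_ac)
     then show ?thesis using that by simp
    qed
    ultimately have "(- s gchoose n) * (- (cmod (of_real R - p) / R)) ^ n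
      = pochhammer s n / fact n * (cmod (of_real R - p) ^ n / R ^ n)" by simp
    then show ?thesis using R \<open>(LINT u|lborel. norm (f n u)) = _\<close>
     by (simp add: h_val powr_add powr_realpow mult_ac)
   qed
  qed
  finally show ?thesis .
 qed
 have "norm (- ((of_real R - p) / of_real R)) < 1" using lt R by (simp add: norm_divide)
 from gen_binomial_complex[OF this, of "- of_real s"]
 have "(%n. of_real (Gamma s / R powr s) * ((- of_real s gchoose n) * (- ((of_real R - p) / of_real R)) ^ n))
   sums (of_real (Gamma s / R powr s) * (1 + - ((of_real R - p) / of_real R)) powr (- of_real s))"
  by (rule sums_mult)
 also have "(%n. of_real (Gamma s / R powr s) * ((- of_real s gchoose n) * (- ((of_real R - p) / of_real R)) ^ n))
   = (%n. integral\<^sup>L lborel (f n))"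
 proof
  fix n
  have 1: "integral\<^sup>L lborel (f n) = ((of_real R - p) ^ n / fact n) * of_real (integral\<^sup>L lborel (h n))"
   unfolding f_def by simp
  have 2: "(- ((of_real R - p) / of_real R)) ^ n = (-1) ^ n * (of_real R - p) ^ n / of_real R ^ n"
   by (simp add: power_minus[of "(of_real R - p) / of_real R"] power_divide)
  have 3: "(- of_real s gchoose n :: complex) = (-1) ^ n * of_real (pochhammer s n) / fact n"
   by (simp add: gbinomial_pochhammer pochhammer_of_real)
  have 4: "R powr (s + real n) = R powr s * R ^ n" using R by (simp add: powr_add powr_realpow)
  have 5: "(ep * P / a) * (ep * Q / b) = P / a * (Q / b)" if "ep * ep = 1" for ep P Q a b :: complex
  proof -
   have "(ep * P / a) * (ep * Q / b) = (ep * ep) * (P / a * (Q / b))" by (simp only: divide_inverse mult_ac)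
   then show ?thesis using that by simp
  qed
  have "(- of_real s gchoose n) * (- ((of_real R - p) / of_real R)) ^ n
    = of_real (pochhammer s n) / fact n * ((of_real R - p) ^ n / of_real R ^ n)"
   unfolding 2 3 by (rule 5) (simp flip: power_mult_distrib)
  then show "of_real (Gamma s / R powr s) * ((- of_real s gchoose n) * (- ((of_real R - p) / of_real R)) ^ n)
    = integral\<^sup>L lborel (f n)"
   unfolding 1 by (simp add: h_val 4 mult_ac)
 qed
 also have "of_real (Gamma s / R powr s) * (1 + - ((of_real R - p) / of_real R)) powr (- of_real s)
   = of_real (Gamma s) * p powr (- of_real s)"
 proof -
  have "1 + - ((of_real R - p) / of_real R) = p / of_real R" using R by (simp add: field_simps)
  moreover have "(p / of_real R) powr (- of_real s) = p powr (- of_real s) * of_real (R powr s)"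
   using R p0 by (simp add: powr_def Ln_divide_of_real exp_add[symmetric] exp_of_real[symmetric] algebra_simps)
  ultimately show ?thesis using R by simp
 qed
 finally have "(%n. integral\<^sup>L lborel (f n)) sums (of_real (Gamma s) * p powr (- of_real s))" .
 moreover have "(%n. integral\<^sup>L lborel (f n)) sums (LINT u|lborel. (\<Sum>n. f n u))"
  by (rule sums_integral[OF f_int _ abs_int]) (simp add: abs_u)
 moreover have "(%u. \<Sum>n. f n u) = (%u. (indicator {0<..} u * u powr (s - 1)) *r exp (- p * of_real u))"
  using sums_u by (auto simp: sums_iff fun_eq_iff)
 ultimately show ?thesis by (simp add: sums_unique2)
qed

text \<open>(j choose k) / j! = 1 / (k! (j - k)!), so the series is a shifted exponential series. It
  sums the Bessel index after the Laguerre moments have been brought to binomial form.\<close>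

lemma choose_exp_sums:
 fixes x :: "'a::{real_normed_field,banach}"
 shows "(%j. of_nat (j choose k) * x ^ j / fact j) sums (x ^ k / fact k * exp x)"
proof -
 have "(%n. x ^ k / fact k * (x ^ n /\<^sub>R fact n)) sums (x ^ k / fact k * exp x)"
  by (intro sums_mult exp_converges)
 also have "(%n. x ^ k / fact k * (x ^ n /\<^sub>R fact n)) = (%n. of_nat ((n + k) choose k) * x ^ (n + k) / fact (n + k))"
 proof
  fix n
  have "(of_nat ((n + k) choose k) :: 'a) = fact (n + k) / (fact k * fact n)"
   using binomial_fact[of k "n + k", where 'a = 'a] by simp
  then show "x ^ k / fact k * (x ^ n /\<^sub>R fact n) = of_nat ((n + k) choose k) * x ^ (n + k) / fact (n + k)"
   by (simp add: power_add scaleR_conv_of_real field_simps)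
 qed
 finally have "(%n. of_nat ((n + k) choose k) * x ^ (n + k) / fact (n + k)) sums (x ^ k / fact k * exp x)" .
 moreover have "(\<Sum>i<k. of_nat (i choose k) * x ^ i / fact i) = 0"
  by (rule sum.neutral) auto
 ultimately show ?thesis
  by (subst sums_iff_shift'[of _ k, symmetric]) simp_all
qed

text \<open>The left side is what the moments of a Laguerre polynomial at rate 1/(1 - q) produce;
  the right side isolates (j choose i), so that a sum over j has a closed form. Both are compared as
  polynomials in r = 1 - q.\<close>

lemma laguerre_binomial_identity:
 fixes a q :: "'a::field_char_0"
 shows "(\<Sum>i\<le>t. (-1) ^ i * ((of_nat t + a) gchoose (t - i)) * ((a + of_nat j + of_nat i) gchoose i) * (1 - q) ^ i)
   = (\<Sum>i\<le>t. of_nat (j choose i) * (-1) ^ i * ((of_nat t + a) gchoose (t - i)) * (1 - q) ^ i * q ^ (t - i))"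
proof -
 define A where "A = of_nat t + a"
 define r where "r = 1 - q"
 have "(\<Sum>i\<le>t. of_nat (j choose i) * (-1) ^ i * (A gchoose (t - i)) * r ^ i * q ^ (t - i))
   = (\<Sum>i\<le>t. \<Sum>k\<le>t - i. (-r) ^ (i + k) * (of_nat (j choose i) * ((A gchoose (t - i)) * of_nat ((t - i) choose k))))"
 proof (rule sum.cong[OF refl])
  fix i
  have "q ^ (t - i) = (- r + 1) ^ (t - i)" by (simp add: r_def)
  also have "... = (\<Sum>k\<le>t - i. of_nat ((t - i) choose k) * (- r) ^ k)"
   unfolding binomial_ring by simp
  finally have "q ^ (t - i) = (\<Sum>k\<le>t - i. of_nat ((t - i) choose k) * (- r) ^ k)" .
  moreover have "(-1) ^ i * r ^ i = (- r) ^ i" by (simp flip: power_mult_distrib)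
  moreover have "of_nat (j choose i) * (-1) ^ i * (A gchoose (t - i)) * r ^ i * q ^ (t - i)
    = (of_nat (j choose i) * (A gchoose (t - i))) * ((-1) ^ i * r ^ i) * q ^ (t - i)" by (simp only: mult_ac)
  ultimately have "of_nat (j choose i) * (-1) ^ i * (A gchoose (t - i)) * r ^ i * q ^ (t - i)
    = (of_nat (j choose i) * (A gchoose (t - i))) * (-r) ^ i * (\<Sum>k\<le>t - i. of_nat ((t - i) choose k) * (- r) ^ k)"
   by simp
  then show "of_nat (j choose i) * (-1) ^ i * (A gchoose (t - i)) * r ^ i * q ^ (t - i)
    = (\<Sum>k\<le>t - i. (-r) ^ (i + k) * (of_nat (j choose i) * ((A gchoose (t - i)) * of_nat ((t - i) choose k))))"
   by (simp only: sum_distrib_left power_add mult_ac)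
 qed
 also have "... = (\<Sum>(i, k)\<in>{(i, k). i + k <= t}. (-r) ^ (i + k) * (of_nat (j choose i) * ((A gchoose (t - i)) * of_nat ((t - i) choose k))))"
  by (subst sum.Sigma) (auto intro!: sum.cong)
 also have "... = (\<Sum>n\<le>t. \<Sum>i\<le>n. (-r) ^ (i + (n - i)) * (of_nat (j choose i) * ((A gchoose (t - i)) * of_nat ((t - i) choose (n - i)))))"
  by (rule sum.triangle_reindex_eq)
 also have "... = (\<Sum>n\<le>t. (-r) ^ n * ((A gchoose (t - n)) * ((a + of_nat j + of_nat n) gchoose n)))"
 proof (rule sum.cong[OF refl])
  fix n assume "n \<in> {..t}"
  then have n: "n <= t" by simp
  \<comment> \<open>Trinomial revision frees one binomial from \<open>i\<close>; what is left is a
    Vandermonde sum.\<close>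
  have "(A gchoose (t - i)) * of_nat ((t - i) choose (n - i)) = (A gchoose (t - n)) * ((a + of_nat n) gchoose (n - i))"
   if "i <= n" for i
  proof -
   have "(t - i) choose (n - i) = (t - i) choose (t - n)"
    using that n binomial_symmetric[of "n - i" "t - i"] by simp
   moreover have "(A gchoose (t - i)) * (of_nat (t - i) gchoose (t - n)) = (A gchoose (t - n)) * ((A - of_nat (t - n)) gchoose ((t - i) - (t - n)))"
    using that n by (intro gbinomial_trinomial_revision) auto
   moreover have "A - of_nat (t - n) = a + of_nat n" "(t - i) - (t - n) = n - i"
    using that n by (auto simp: A_def of_nat_diff)
   ultimately show ?thesis by (simp add: binomial_gbinomial)
  qed
  then have "(\<Sum>i\<le>n. (-r) ^ (i + (n - i)) * (of_nat (j choose i) * ((A gchoose (t - i)) * of_nat ((t - i) choose (n - i)))))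
    = (\<Sum>i\<le>n. (-r) ^ n * ((A gchoose (t - n)) * ((of_nat j gchoose i) * ((a + of_nat n) gchoose (n - i)))))"
   by (intro sum.cong refl) (simp add: binomial_gbinomial mult_ac)
  also have "... = (-r) ^ n * ((A gchoose (t - n)) * (\<Sum>i\<le>n. (of_nat j gchoose i) * ((a + of_nat n) gchoose (n - i))))"
   by (simp add: sum_distrib_left)
  also have "(\<Sum>i\<le>n. (of_nat j gchoose i) * ((a + of_nat n) gchoose (n - i))) = (a + of_nat j + of_nat n) gchoose n"
   using gbinomial_Vandermonde[of "of_nat j" "a + of_nat n" n] by (simp add: atLeast0AtMost add_ac)
  finally show "(\<Sum>i\<le>n. (-r) ^ (i + (n - i)) * (of_nat (j choose i) * ((A gchoose (t - i)) * of_nat ((t - i) choose (n - i)))))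
    = (-r) ^ n * ((A gchoose (t - n)) * ((a + of_nat j + of_nat n) gchoose n))" .
 qed
 also have "... = (\<Sum>i\<le>t. (-1) ^ i * (A gchoose (t - i)) * ((a + of_nat j + of_nat i) gchoose i) * r ^ i)"
  by (intro sum.cong refl) (simp add: power_minus[of r] mult_ac)
 finally show ?thesis by (simp add: A_def r_def)
qed

definition laguerre_coeff :: "nat => real => nat => real" where
 "laguerre_coeff t av i = (-1) ^ i * ((real t + av) gchoose (t - i)) / fact i"

lemma laguerre_eq: "laguerre t av x = (\<Sum>i\<le>t. laguerre_coeff t av i * x ^ i)"
 by (simp add: laguerre_def laguerre_coeff_def)

lemma laguerre_measurable [measurable]: "laguerre t av \<in> borel_measurable borel"
 unfolding laguerre_eq[abs_def] by measurable

text \<open>The two-term recurrence of the coefficients, which is Laguerre's equation read off power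
  by power.\<close>

lemma laguerre_coeff_Suc:
 assumes "i < t"
 shows "(real i + 1) * (real i + 1 + av) * laguerre_coeff t av (Suc i) = - (real t - real i) * laguerre_coeff t av i"
proof -
 define k where "k = t - Suc i"
 have k: "t - i = Suc k" "real t - real i = real (Suc k)" using assms by (auto simp: k_def)
 have "of_nat (Suc k) * ((real t + av) gchoose (Suc k)) = (real t + av - real k) * ((real t + av) gchoose k)"
  using gbinomial_mult_1[of "real t + av" k] by (simp add: algebra_simps)
 moreover have "real t + av - real k = real i + 1 + av" using k by simp
 ultimately have e: "real (Suc k) * ((real t + av) gchoose (Suc k)) = (real i + 1 + av) * ((real t + av) gchoose k)"
  by simp
 have "(real i + 1) * (real i + 1 + av) * laguerre_coeff t av (Suc i)
   = - ((-1) ^ i / fact i * ((real i + 1 + av) * ((real t + av) gchoose k)))"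
 proof -
  define d where "d = real i + 1"
  have "fact (Suc i) = d * fact i" "d ~= 0" by (simp_all add: fact_Suc d_def algebra_simps)
  then show ?thesis
   unfolding laguerre_coeff_def k_def[symmetric] d_def[symmetric] by simp
 qed
 also have "... = - (real t - real i) * laguerre_coeff t av i"
  unfolding e[symmetric] by (simp add: laguerre_coeff_def k del: of_nat_Suc)
 finally show ?thesis .
qed

definition laguerre_d1 :: "nat => real => real => real" where
 "laguerre_d1 t av x = (\<Sum>i\<le>t. laguerre_coeff t av i * (real i * x ^ (i - 1)))"

definition laguerre_d2 :: "nat => real => real => real" where
 "laguerre_d2 t av x = (\<Sum>i\<le>t. laguerre_coeff t av i * (real i * (real (i - 1) * x ^ (i - 2))))"

lemma DERIV_laguerre: "(laguerre t av has_real_derivative laguerre_d1 t av x) (at x)"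
 unfolding laguerre_eq[abs_def] laguerre_d1_def by (auto intro!: derivative_eq_intros sum.cong)

lemma DERIV_laguerre_d1: "(laguerre_d1 t av has_real_derivative laguerre_d2 t av x) (at x)"
 unfolding laguerre_d1_def[abs_def] laguerre_d2_def
 by (auto intro!: derivative_eq_intros sum.cong simp: numeral_2_eq_2)

lemma laguerre_ode:
 "x * laguerre_d2 t av x + (av + 1 - x) * laguerre_d1 t av x + real t * laguerre t av x = 0"
proof -
 let ?l = "laguerre_coeff t av"
 have 1: "x * (real i * (real (i - 1) * x ^ (i - 2))) = real i * (real i - 1) * x ^ (i - 1)" for i
  by (cases i; cases "i - 1") (auto simp: numeral_2_eq_2)
 have 2: "x * (real i * x ^ (i - 1)) = real i * x ^ i" for i by (cases i) auto
 have "x * laguerre_d2 t av x + (av + 1 - x) * laguerre_d1 t av x + real t * laguerre t av x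
   = (\<Sum>i\<le>t. x * (?l i * (real i * (real (i - 1) * x ^ (i - 2)))) + ((av + 1) * (?l i * (real i * x ^ (i - 1)))
     - x * (?l i * (real i * x ^ (i - 1)))) + real t * (?l i * x ^ i))"
  by (simp only: laguerre_d1_def laguerre_d2_def laguerre_eq sum.distrib sum_subtractf sum_distrib_left
    left_diff_distrib)
 also have "... = (\<Sum>i\<le>t. ?l i * (real i * (real i + av) * x ^ (i - 1)) + (real t - real i) * ?l i * x ^ i)"
 proof (rule sum.cong[OF refl])
  fix i
  have "x * (?l i * (real i * (real (i - 1) * x ^ (i - 2)))) = ?l i * (real i * (real i - 1) * x ^ (i - 1))"
   using 1[of i] by (simp only: mult.left_commute[of x "?l i"])
  moreover have "x * (?l i * (real i * x ^ (i - 1))) = ?l i * (real i * x ^ i)"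
   using 2[of i] by (simp only: mult.left_commute[of x "?l i"])
  ultimately show "x * (?l i * (real i * (real (i - 1) * x ^ (i - 2)))) + ((av + 1) * (?l i * (real i * x ^ (i - 1)))
     - x * (?l i * (real i * x ^ (i - 1)))) + real t * (?l i * x ^ i)
    = ?l i * (real i * (real i + av) * x ^ (i - 1)) + (real t - real i) * ?l i * x ^ i"
   by (simp only:) (simp add: algebra_simps)
 qed
 also have "... = (\<Sum>i<t. ?l (Suc i) * (real (Suc i) * (real (Suc i) + av) * x ^ i)) + (\<Sum>i<t. (real t - real i) * ?l i * x ^ i)"
 proof -
  have "(\<Sum>i<Suc t. ?l i * (real i * (real i + av) * x ^ (i - 1)))
    = (\<Sum>i<t. ?l (Suc i) * (real (Suc i) * (real (Suc i) + av) * x ^ i))"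
   by (subst sum.lessThan_Suc_shift) simp
  moreover have "(\<Sum>i<Suc t. (real t - real i) * ?l i * x ^ i) = (\<Sum>i<t. (real t - real i) * ?l i * x ^ i)"
   by simp
  ultimately show ?thesis unfolding sum.distrib lessThan_Suc_atMost[symmetric] by simp
 qed
 also have "... = (\<Sum>i<t. ((real i + 1) * (real i + 1 + av) * ?l (Suc i) + (real t - real i) * ?l i) * x ^ i)"
  by (simp add: sum.distrib[symmetric] algebra_simps)
 also have "... = 0"
 proof (rule sum.neutral, rule ballI)
  fix i assume "i \<in> {..<t}"
  then have "(real i + 1) * (real i + 1 + av) * ?l (Suc i) + (real t - real i) * ?l i = 0"
   using laguerre_coeff_Suc[of i t av] by (simp add: left_diff_distrib)
  then show "((real i + 1) * (real i + 1 + av) * ?l (Suc i) + (real t - real i) * ?l i) * x ^ i = 0" by simp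
 qed
 finally show ?thesis .
qed

lemma Gamma_shift_binomial:
 assumes "av > -1"
 shows "Gamma (av + real j + real i + 1) = fact i * ((av + real j + real i) gchoose i) * Gamma (av + real j + 1)"
proof -
 have pos: "av + real j + 1 > 0" using assms by simp
 then have nz: "Gamma (av + real j + 1) ~= 0" by (metis Gamma_real_pos less_irrefl)
 have "pochhammer (av + real j + 1) i = Gamma (av + real j + 1 + real i) / Gamma (av + real j + 1)"
  using pos by (intro pochhammer_Gamma) (auto dest: nonpos_Ints_nonpos)
 moreover have "((av + real j + real i) gchoose i) = pochhammer (av + real j + 1) i / fact i"
  unfolding gbinomial_pochhammer' by (simp add: add_ac)
 ultimately show ?thesis using nz by (simp add: field_simps)
qed

lemma of_real_gbinomial: "of_real (x gchoose k) = (of_real x gchoose k :: complex)"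
 using pochhammer_of_real[of "- x" k, where 'a = complex] by (simp add: gbinomial_pochhammer)

text \<open>The sum is left in the form of the left side of
  \<open>laguerre_binomial_identity\<close> with 1 - q = 1/p.\<close>

lemma laguerre_moment_integrable:
 fixes p :: complex
 assumes av: "av > -1" and p: "Re p > 0"
 shows "integrable lborel (%u. (indicator {0<..} u * (u powr (av + real j) * laguerre t av u)) *r exp (- p * of_real u))"
  and "(LINT u|lborel. (indicator {0<..} u * (u powr (av + real j) * laguerre t av u)) *r exp (- p * of_real u))
   = of_real (Gamma (av + real j + 1)) * p powr (- of_real (av + 1 + real j))
    * (\<Sum>i\<le>t. (-1) ^ i * ((of_nat t + of_real av) gchoose (t - i)) * ((of_real av + of_nat j + of_nat i) gchoose i) * (1 / p) ^ i)"
proof -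
 let ?g = "%i u. (indicator {0<..} u * u powr ((av + real j + real i + 1) - 1)) *r exp (- p * of_real u)"
 have s: "av + real j + real i + 1 > 0" for i using av by simp
 have p0: "p ~= 0" using p by auto
 have eq: "(%u. (indicator {0<..} u * (u powr (av + real j) * laguerre t av u)) *r exp (- p * of_real u))
   = (%u. \<Sum>i\<le>t. laguerre_coeff t av i *r ?g i u)"
 proof
  fix u :: real
  show "(indicator {0<..} u * (u powr (av + real j) * laguerre t av u)) *r exp (- p * of_real u)
    = (\<Sum>i\<le>t. laguerre_coeff t av i *r ?g i u)"
  proof (cases "u > 0")
   case True
   have "u powr (av + real j) * laguerre t av u = (\<Sum>i\<le>t. laguerre_coeff t av i * u powr (av + real j + real i))"
    using True by (simp add: laguerre_eq sum_distrib_left powr_add[of u "av + real j"] powr_realpow mult_ac)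
   then show ?thesis using True by (simp add: scaleR_left.sum)
  qed simp
 qed
 have int: "integrable lborel (?g i)" for i using integrable_Gamma_complex_rate[OF s p] .
 show "integrable lborel (%u. (indicator {0<..} u * (u powr (av + real j) * laguerre t av u)) *r exp (- p * of_real u))"
  unfolding eq by (intro Bochner_Integration.integrable_sum integrable_scaleR_right int)
 have "(LINT u|lborel. (\<Sum>i\<le>t. laguerre_coeff t av i *r ?g i u)) = (\<Sum>i\<le>t. (LINT u|lborel. laguerre_coeff t av i *r ?g i u))"
  by (intro Bochner_Integration.integral_sum integrable_scaleR_right int)
 also have "... = (\<Sum>i\<le>t. laguerre_coeff t av i *r (of_real (Gamma (av + real j + real i + 1)) * p powr (- of_real (av + real j + real i + 1))))"
  unfolding Gamma_integral_complex_rate[OF s p, symmetric] by (intro sum.cong refl integral_scaleR_right)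
 also have "... = (\<Sum>i\<le>t. of_real (Gamma (av + real j + 1)) * p powr (- of_real (av + 1 + real j))
    * ((-1) ^ i * ((of_nat t + of_real av) gchoose (t - i)) * ((of_real av + of_nat j + of_nat i) gchoose i) * (1 / p) ^ i))"
 proof (rule sum.cong[OF refl])
  fix i
  have "p powr (- of_real (av + real j + real i + 1)) = p powr (- of_real (av + 1 + real j) - of_nat i)"
   by (simp add: algebra_simps)
  also have "... = p powr (- of_real (av + 1 + real j)) * (1 / p) ^ i"
   using p0 by (simp add: powr_diff powr_nat' power_one_over divide_inverse power_inverse)
  finally have pw: "p powr (- of_real (av + real j + real i + 1)) = p powr (- of_real (av + 1 + real j)) * (1 / p) ^ i" .
  have co: "of_real (laguerre_coeff t av i * Gamma (av + real j + real i + 1))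
    = of_real (Gamma (av + real j + 1)) * ((-1) ^ i * ((of_nat t + of_real av) gchoose (t - i)) * ((of_real av + of_nat j + of_nat i) gchoose i) :: complex)"
   unfolding Gamma_shift_binomial[OF av] laguerre_coeff_def
   using of_real_gbinomial[of "real t + av" "t - i"] of_real_gbinomial[of "av + real j + real i" i]
   by (simp add: field_simps)
  show "laguerre_coeff t av i *r (of_real (Gamma (av + real j + real i + 1)) * p powr (- of_real (av + real j + real i + 1)))
   = of_real (Gamma (av + real j + 1)) * p powr (- of_real (av + 1 + real j))
    * ((-1) ^ i * ((of_nat t + of_real av) gchoose (t - i)) * ((of_real av + of_nat j + of_nat i) gchoose i) * (1 / p) ^ i)"
   unfolding pw scaleR_conv_of_real mult.assoc[symmetric] of_real_mult[symmetric] co by (simp add: mult_ac)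
 qed
 finally show "(LINT u|lborel. (indicator {0<..} u * (u powr (av + real j) * laguerre t av u)) *r exp (- p * of_real u))
   = of_real (Gamma (av + real j + 1)) * p powr (- of_real (av + 1 + real j))
    * (\<Sum>i\<le>t. (-1) ^ i * ((of_nat t + of_real av) gchoose (t - i)) * ((of_real av + of_nat j + of_nat i) gchoose i) * (1 / p) ^ i)"
  unfolding eq by (simp add: sum_distrib_left)
qed

text \<open>Rate 1 is the case q = 0 of the binomial identity, where 0^(t - i) keeps only i = t. The
  factor \<open>j choose t\<close> vanishes for j < t, and this gives the orthogonality
  relations.\<close>

lemma laguerre_moment:
 assumes av: "av > -1"
 shows "integrable lborel (%u. indicator {0<..} u * (u powr (av + real j) * laguerre t av u * exp (- u)))"
  and "(LINT u|lborel. indicator {0<..} u * (u powr (av + real j) * laguerre t av u * exp (- u)))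
   = Gamma (av + real j + 1) * (-1) ^ t * real (j choose t)"
proof -
 have eq: "(%u. (indicator {0<..} u * (u powr (av + real j) * laguerre t av u)) *r exp (- (1::complex) * of_real u))
   = (%u. complex_of_real (indicator {0<..} u * (u powr (av + real j) * laguerre t av u * exp (- u))))"
  by (auto simp: fun_eq_iff scaleR_conv_of_real exp_of_real[symmetric])
 note I = laguerre_moment_integrable[OF av, of 1 j t, unfolded eq]
 show "integrable lborel (%u. indicator {0<..} u * (u powr (av + real j) * laguerre t av u * exp (- u)))"
  using I(1) by (simp only: complex_of_real_integrable_eq) simp
 have "(\<Sum>i\<le>t. (-1) ^ i * ((of_nat t + of_real av) gchoose (t - i)) * ((of_real av + of_nat j + of_nat i) gchoose i) * (1 - 0 :: complex) ^ i)
   = (\<Sum>i\<le>t. if i = t then of_nat (j choose t) * (-1) ^ t else 0)"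
  unfolding laguerre_binomial_identity[of t "of_real av" j 0] by (rule sum.cong) auto
 then have S: "(\<Sum>i\<le>t. (-1) ^ i * ((of_nat t + of_real av) gchoose (t - i)) * ((of_real av + of_nat j + of_nat i) gchoose i) * (1 / 1 :: complex) ^ i)
   = of_nat (j choose t) * (-1) ^ t" by simp
 have "(of_real (LINT u|lborel. indicator {0<..} u * (u powr (av + real j) * laguerre t av u * exp (- u))) :: complex)
   = of_real (Gamma (av + real j + 1)) * 1 powr (- of_real (av + 1 + real j)) * (of_nat (j choose t) * (-1) ^ t)"
  unfolding S[symmetric] integral_complex_of_real[symmetric] by (rule I(2)) simp
 then have "of_real (LINT u|lborel. indicator {0<..} u * (u powr (av + real j) * laguerre t av u * exp (- u)))
   = (of_real (Gamma (av + real j + 1) * (-1) ^ t * real (j choose t)) :: complex)"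
  by simp
 then show "(LINT u|lborel. indicator {0<..} u * (u powr (av + real j) * laguerre t av u * exp (- u)))
   = Gamma (av + real j + 1) * (-1) ^ t * real (j choose t)"
  by (simp only: of_real_eq_iff)
qed

section \<open>The Laguerre-Bessel integral\<close>

text \<open>A power series converges absolutely inside the radius of any point of convergence. The
  farther point \<open>?y\<close> is reached through an argument of
  \<open>summable_bessel_Jt\<close> whose square cancels the sign (-1)^j.\<close>

lemma bessel_Jt_abs_summable:
 fixes x :: complex
 shows "summable (%j. norm (rGamma (of_real (real j + \<nu> + 1)) / fact j * x ^ j))"
proof (rule powser_insidea)
 let ?y = "of_real (cmod x + 1) :: complex"
 have "summable (%j. (-1) ^ j * rGamma (of_real (real j + \<nu> + 1)) / fact j * ((2 * csqrt (- ?y)) / 2) ^ (2 * j))"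
  by (rule summable_bessel_Jt)
 also have "(%j. (-1) ^ j * rGamma (of_real (real j + \<nu> + 1)) / fact j * ((2 * csqrt (- ?y)) / 2) ^ (2 * j))
   = (%j. rGamma (of_real (real j + \<nu> + 1)) / fact j * ?y ^ j)"
 proof
  fix j
  have "((2 * csqrt (- ?y)) / 2) ^ (2 * j) = (- ?y) ^ j" by (simp add: power_mult)
  also have "... = (-1) ^ j * ?y ^ j" by (rule power_minus)
  finally have 1: "((2 * csqrt (- ?y)) / 2) ^ (2 * j) = (-1) ^ j * ?y ^ j" .
  have "(-1) ^ j * (-1) ^ j = (1 :: complex)" by (simp flip: power_mult_distrib)
  then show "(-1) ^ j * rGamma (of_real (real j + \<nu> + 1)) / fact j * ((2 * csqrt (- ?y)) / 2) ^ (2 * j)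
    = rGamma (of_real (real j + \<nu> + 1)) / fact j * ?y ^ j"
   unfolding 1 by (simp add: mult.assoc[symmetric])
 qed
 finally show "summable (%j. rGamma (of_real (real j + \<nu> + 1)) / fact j * ?y ^ j)" .
 show "norm x < norm ?y" unfolding norm_of_real by simp
qed

text \<open>On the imaginary axis the alternating sign disappears; this is the series of the
  modified Bessel function.\<close>

lemma bessel_Jt_imaginary_sums:
 fixes z :: real and \<sigma> :: complex
 shows "(%j. rGamma (of_real (real j + \<nu> + 1)) / fact j * (of_real (z\<^sup>2) / (2 * \<sigma>)\<^sup>2) ^ j)
  sums bessel_Jt \<nu> (\<i> * of_real z / \<sigma>)"
proof -
 have "(%j. (-1) ^ j * rGamma (of_real (real j + \<nu> + 1)) / fact j * ((\<i> * of_real z / \<sigma>) / 2) ^ (2 * j))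
   sums bessel_Jt \<nu> (\<i> * of_real z / \<sigma>)"
  unfolding bessel_Jt_def by (rule summable_sums[OF summable_bessel_Jt])
 also have "(%j. (-1) ^ j * rGamma (of_real (real j + \<nu> + 1)) / fact j * ((\<i> * of_real z / \<sigma>) / 2) ^ (2 * j))
   = (%j. rGamma (of_real (real j + \<nu> + 1)) / fact j * (of_real (z\<^sup>2) / (2 * \<sigma>)\<^sup>2) ^ j)"
 proof
  fix j
  have "((\<i> * of_real z / \<sigma>) / 2) ^ (2 * j) = (- (of_real (z\<^sup>2) / (2 * \<sigma>)\<^sup>2)) ^ j"
   unfolding power_mult by (simp add: power_divide power_mult_distrib mult.commute)
  also have "... = (-1) ^ j * (of_real (z\<^sup>2) / (2 * \<sigma>)\<^sup>2) ^ j" by (rule power_minus)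
  finally have 1: "((\<i> * of_real z / \<sigma>) / 2) ^ (2 * j) = (-1) ^ j * (of_real (z\<^sup>2) / (2 * \<sigma>)\<^sup>2) ^ j" .
  have "(-1) ^ j * (-1) ^ j = (1 :: complex)" by (simp flip: power_mult_distrib)
  moreover have "(ep * a / b) * (ep * d) = (ep * ep) * (a / b * d)" for ep a b d :: complex
   by (simp only: divide_inverse mult_ac)
  ultimately show "(-1) ^ j * rGamma (of_real (real j + \<nu> + 1)) / fact j * ((\<i> * of_real z / \<sigma>) / 2) ^ (2 * j)
   = rGamma (of_real (real j + \<nu> + 1)) / fact j * (of_real (z\<^sup>2) / (2 * \<sigma>)\<^sup>2) ^ j"
   unfolding 1 by simp
 qed
 finally show ?thesis .
qed

context
 fixes om :: complex
 assumes om: "Re om > 0"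
begin

lemma norm_exp_m2_lt_1: "norm (exp (- 2 * om)) < 1"
 using om by simp

lemma Re_one_minus_exp: "Re (1 - exp (- 2 * om)) > 0"
 using norm_exp_m2_lt_1 complex_Re_le_cmod[of "exp (- 2 * om)"] by (simp del: Re_exp norm_exp_eq_Re)

lemma one_minus_exp_nz: "1 - exp (- 2 * om) ~= 0"
 using Re_one_minus_exp by auto

lemma two_sinh: "2 * sinh om = exp om * (1 - exp (- 2 * om))"
 by (simp add: sinh_field_def right_diff_distrib exp_add[symmetric])

lemma inverse_two_sinh_square: "1 / (2 * sinh om)\<^sup>2 = exp (- 2 * om) / (1 - exp (- 2 * om))\<^sup>2"
proof -
 have "(exp om)\<^sup>2 * exp (- 2 * om) = 1"
  by (simp add: power2_eq_square exp_add[symmetric])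
 then show ?thesis
  unfolding two_sinh power_mult_distrib using one_minus_exp_nz by (simp add: field_simps)
qed

lemma Re_inverse_one_minus_exp: "Re (1 / (1 - exp (- 2 * om))) > 0"
 using Re_one_minus_exp unfolding Re_divide
 by (auto simp: complex_eq_iff intro!: divide_pos_pos add_pos_nonneg simp del: Re_exp Im_exp)

text \<open>The splitting of the kernel's Gaussian: with q = exp(-2 om), the 1/2 joins the exp(-u/2)
  of a basis function and makes the total rate q/(1 - q) + 1 = 1/(1 - q).\<close>

lemma coth_half: "cosh om / sinh om / 2 = exp (- 2 * om) / (1 - exp (- 2 * om)) + 1 / 2"
proof -
 have c: "2 * cosh om = exp om * (1 + exp (- 2 * om))"
  by (simp add: cosh_field_def distrib_left exp_add[symmetric])
 have "cosh om / sinh om = (1 + exp (- 2 * om)) / (1 - exp (- 2 * om))"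
  using c two_sinh by (metis exp_not_eq_zero mult_divide_mult_cancel_left zero_neq_numeral)
 then show ?thesis unfolding \<open>cosh om / sinh om = _\<close> using one_minus_exp_nz by (simp add: field_simps)
qed

text \<open>coth = 2/(1 - q) - 1, and |q| < 1 gives |1 - q|^2 < 2 Re (1 - q), that is Re (1/(1 - q))
  > 1/2.\<close>

lemma Re_coth: "Re (cosh om / sinh om) > 0"
proof -
 let ?q = "exp (- 2 * om)"
 have "cosh om / sinh om = 2 * (1 / (1 - ?q)) - 1"
  using coth_half one_minus_exp_nz by (simp add: field_simps)
 moreover have "Re (1 / (1 - ?q)) > 1 / 2"
 proof -
  have d: "(cmod (1 - ?q))\<^sup>2 > 0" using one_minus_exp_nz by simp
  have "(cmod (1 - ?q))\<^sup>2 = 1 - 2 * Re ?q + (cmod ?q)\<^sup>2"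
   by (simp only: cmod_power2) (simp add: power2_diff del: Re_exp Im_exp)
  also have "... < 2 * Re (1 - ?q)"
   using norm_exp_m2_lt_1 power_strict_mono[of "cmod ?q" 1 2] by (simp del: Re_exp norm_exp_eq_Re)
  finally have "(cmod (1 - ?q))\<^sup>2 < 2 * Re (1 - ?q)" .
  moreover have "Re (1 / (1 - ?q)) = Re (1 - ?q) / (cmod (1 - ?q))\<^sup>2"
   by (simp only: Re_divide cmod_power2) simp
  ultimately show ?thesis using d by (simp add: pos_less_divide_eq del: Re_exp norm_exp_eq_Re minus_complex.sel)
 qed
 moreover have "Re (2 * z - 1) = 2 * Re z - 1" for z by simp
 ultimately show ?thesis by (simp only:)
qed

text \<open>1 - q lies in the right half plane, where the principal logarithm is compatible with
  inversion.\<close>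

lemma inverse_powr_minus:
 "(1 / (1 - exp (- 2 * om))) powr (- a) = (1 - exp (- 2 * om)) powr a"
proof -
 have "1 - exp (- 2 * om) \<notin> \<real>\<^sub>\<le>\<^sub>0" using Re_one_minus_exp by (auto simp: complex_nonpos_Reals_iff simp del: minus_complex.sel)
 then have "Ln (inverse (1 - exp (- 2 * om))) = - Ln (1 - exp (- 2 * om))" by (rule Ln_inverse)
 then show ?thesis using one_minus_exp_nz by (simp add: powr_def inverse_eq_divide)
qed

context
 fixes av v :: real and t :: nat
 assumes av: "av > -1" and v: "v \<ge> 0"
begin

private abbreviation "q \<equiv> exp (- 2 * om)"
text \<open>\<open>p\<close> is the exponential rate, \<open>s\<close> is 1/(2 sinh om)^2 by
  \<open>inverse_two_sinh_square\<close>, and \<open>X\<close> is the exponent left after summation.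
  \<open>f j\<close> is the j-th Bessel term of the integrand.\<close>

private definition "p = 1 / (1 - q)"
private definition "s = q / (1 - q)\<^sup>2"
private definition "X = of_real v * q / (1 - q)"
private definition "C j = rGamma (of_real (real j + av + 1)) / fact j * (of_real v * s) ^ j" for j
private definition "f j u = C j * ((indicator {0<..} u * (u powr (av + real j) * laguerre t av u)) *r exp (- p * of_real u))" for j u

private lemma p: "Re p > 0" "p ~= 0"
 using Re_inverse_one_minus_exp one_minus_exp_nz by (simp_all add: p_def)

private lemma f_eq: "f j u = (indicator {0<..} u * (u powr av * laguerre t av u)) *r
  (exp (- p * of_real u) * (rGamma (of_real (real j + av + 1)) / fact j * (of_real (u * v) * s) ^ j))"
proof (cases "u > 0")
 case True
 then have "u powr (av + real j) = u powr av * u ^ j" by (simp add: powr_add powr_realpow)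
 then show ?thesis
  by (simp add: f_def C_def scaleR_conv_of_real power_mult_distrib mult_ac)
qed (simp add: f_def)

private lemma f_sums:
 "(%j. f j u) sums ((indicator {0<..} u * (u powr av * laguerre t av u)) *r
   (exp (- p * of_real u) * bessel_Jt av (\<i> * of_real (sqrt (u * v)) / sinh om)))"
proof (cases "u > 0")
 case True
 then have "(sqrt (u * v))\<^sup>2 = u * v" using v by simp
 moreover have "of_real (u * v) / (2 * sinh om)\<^sup>2 = of_real (u * v) * s"
  unfolding s_def inverse_two_sinh_square[symmetric] by simp
 ultimately have "(%j. rGamma (of_real (real j + av + 1)) / fact j * (of_real (u * v) * s) ^ j)
   sums bessel_Jt av (\<i> * of_real (sqrt (u * v)) / sinh om)"
  using bessel_Jt_imaginary_sums[of av "sqrt (u * v)" "sinh om"] by simp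
 then show ?thesis unfolding f_eq by (intro sums_scaleR_right sums_mult)
qed (simp add: f_def)

private lemma f_abs: "summable (%j. norm (f j u))"
 unfolding f_eq norm_scaleR norm_mult[of "exp _"] by (intro summable_mult bessel_Jt_abs_summable)

private lemma f_int: "integrable lborel (f j)"
 unfolding f_def by (intro integrable_mult_right laguerre_moment_integrable(1) av p)

private lemma f_integral:
 "integral\<^sup>L lborel (f j) = (\<Sum>i\<le>t. ((1 - q) powr of_real (av + 1) * ((-1) ^ i * ((of_nat t + of_real av) gchoose (t - i)) * (1 - q) ^ i * q ^ (t - i)))
   * (of_nat (j choose i) * X ^ j / fact j))"
proof -
 have G: "rGamma (of_real (real j + av + 1)) * of_real (Gamma (av + real j + 1)) = (1 :: complex)"
 proof -
  have "Gamma (av + real j + 1) ~= 0" using av Gamma_real_pos[of "av + real j + 1"] by force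
  then have "rGamma (real j + av + 1) * Gamma (av + real j + 1) = 1"
   by (simp add: rGamma_inverse_Gamma add_ac)
  then show ?thesis unfolding rGamma_complex_of_real of_real_mult[symmetric] by simp
 qed
 have P: "p powr (- of_real (av + 1 + real j)) = (1 - q) powr of_real (av + 1) * (1 - q) ^ j"
  unfolding p_def inverse_powr_minus of_real_add[of "av + 1"] powr_add of_real_of_nat_eq
  using one_minus_exp_nz by (simp add: powr_nat')
 have Xj: "(of_real v * s) ^ j * (1 - q) ^ j = X ^ j"
  unfolding power_mult_distrib[symmetric] X_def s_def using one_minus_exp_nz
  by (simp add: power2_eq_square)
 have p1: "1 / p = 1 - q" by (simp add: p_def)
 have "integral\<^sup>L lborel (f j) = C j * (of_real (Gamma (av + real j + 1)) * p powr (- of_real (av + 1 + real j))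
    * (\<Sum>i\<le>t. (-1) ^ i * ((of_nat t + of_real av) gchoose (t - i)) * ((of_real av + of_nat j + of_nat i) gchoose i) * (1 - q) ^ i))"
  unfolding f_def p1[symmetric] laguerre_moment_integrable(2)[OF av p(1), symmetric]
  by (rule integral_mult_right_zero)
 also have "... = (rGamma (of_real (real j + av + 1)) * of_real (Gamma (av + real j + 1))) * ((of_real v * s) ^ j * (1 - q) ^ j) / fact j
   * ((1 - q) powr of_real (av + 1) * (\<Sum>i\<le>t. of_nat (j choose i) * (-1) ^ i * ((of_nat t + of_real av) gchoose (t - i)) * (1 - q) ^ i * q ^ (t - i)))"
  unfolding laguerre_binomial_identity P C_def by (simp only: divide_inverse mult_ac)
 also have "... = (\<Sum>i\<le>t. ((1 - q) powr of_real (av + 1) * ((-1) ^ i * ((of_nat t + of_real av) gchoose (t - i)) * (1 - q) ^ i * q ^ (t - i)))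
   * (of_nat (j choose i) * X ^ j / fact j))"
  unfolding G Xj mult_1 sum_distrib_left by (simp only: divide_inverse mult_ac)
 finally show ?thesis .
qed

text \<open>The sum over j of (j choose i) X^j / j! is X^i / i! exp X. As (1 - q) X = v q, the
  remaining finite sum over i is q^t times the Laguerre polynomial at \<open>v\<close>.\<close>

private lemma f_integral_sums:
 "(%j. integral\<^sup>L lborel (f j)) sums ((1 - q) powr of_real (av + 1) * q ^ t * of_real (laguerre t av v) * exp X)"
proof -
 have "(%j. integral\<^sup>L lborel (f j)) sums (\<Sum>i\<le>t. ((1 - q) powr of_real (av + 1) * ((-1) ^ i * ((of_nat t + of_real av) gchoose (t - i)) * (1 - q) ^ i * q ^ (t - i)))
   * (X ^ i / fact i * exp X))"
  unfolding f_integral by (intro sums_sum sums_mult choose_exp_sums)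
 also have "(\<Sum>i\<le>t. ((1 - q) powr of_real (av + 1) * ((-1) ^ i * ((of_nat t + of_real av) gchoose (t - i)) * (1 - q) ^ i * q ^ (t - i)))
   * (X ^ i / fact i * exp X))
   = (\<Sum>i\<le>t. (1 - q) powr of_real (av + 1) * q ^ t * of_real (laguerre_coeff t av i * v ^ i) * exp X)"
 proof (rule sum.cong[OF refl])
  fix i assume "i \<in> {..t}"
  then have qt: "q ^ t = q ^ (t - i) * q ^ i" by (simp add: power_add[symmetric])
  have "(1 - q) ^ i * X ^ i = of_real v ^ i * q ^ i"
   unfolding power_mult_distrib[symmetric] X_def using one_minus_exp_nz by simp
  then have "((1 - q) powr of_real (av + 1) * ((-1) ^ i * ((of_nat t + of_real av) gchoose (t - i)) * (1 - q) ^ i * q ^ (t - i))) * (X ^ i / fact i * exp X)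
   = (1 - q) powr of_real (av + 1) * ((-1) ^ i * ((of_nat t + of_real av) gchoose (t - i))) * q ^ (t - i) * (of_real v ^ i * q ^ i) / fact i * exp X"
   by (simp add: mult_ac)
  also have "... = (1 - q) powr of_real (av + 1) * q ^ t * of_real (laguerre_coeff t av i * v ^ i) * exp X"
   unfolding qt laguerre_coeff_def using of_real_gbinomial[of "real t + av" "t - i"] by (simp add: mult_ac)
  finally show "((1 - q) powr of_real (av + 1) * ((-1) ^ i * ((of_nat t + of_real av) gchoose (t - i)) * (1 - q) ^ i * q ^ (t - i))) * (X ^ i / fact i * exp X)
   = (1 - q) powr of_real (av + 1) * q ^ t * of_real (laguerre_coeff t av i * v ^ i) * exp X" .
 qed
 also have "... = (1 - q) powr of_real (av + 1) * q ^ t * of_real (laguerre t av v) * exp X"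
  unfolding laguerre_eq of_real_sum sum_distrib_left sum_distrib_right ..
 finally show ?thesis .
qed

text \<open>Inside absolute values the Laguerre polynomial is replaced by the moduli of its
  coefficients. Vandermonde turns the quotients of Gamma values into binomials in j, and
  \<open>choose_exp_sums\<close> sums the majorant.\<close>

private lemma f_abs_integral: "summable (%j. LINT u|lborel. norm (f j u))"
proof -
 define P where "P = Re p"
 have P: "P > 0" using p by (simp add: P_def)
 define Y where "Y = cmod (of_real v * s) / P"
 define K where "K i = \<bar>laguerre_coeff t av i\<bar> * fact i / P powr (av + real i + 1)" for i
 let ?g = "%j i u. indicator {0<..} u * (u powr ((av + real j + real i + 1) - 1) * exp (- P * u))"
 have g: "integrable lborel (?g j i)" for j i
  using av P by (intro integrable_powr_exp) auto
 have bound: "(LINT u|lborel. norm (f j u)) <= (\<Sum>i\<le>t. K i * (\<Sum>k\<le>i. ((av + real i) gchoose (i - k)) * (of_nat (j choose k) * Y ^ j / fact j)))" for j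
 proof -
  have C: "cmod (C j) = cmod (of_real v * s) ^ j / (fact j * Gamma (av + real j + 1))"
  proof -
   have "av + real j + 1 > 0" using av by simp
   then have "rGamma (real j + av + 1) = inverse (Gamma (av + real j + 1))" "Gamma (av + real j + 1) > 0"
    by (simp_all add: rGamma_inverse_Gamma add_ac Gamma_real_pos)
   then have "cmod (of_real (rGamma (real j + av + 1))) = inverse (Gamma (av + real j + 1))"
    by (simp only: norm_of_real) simp
   then show ?thesis
    unfolding C_def rGamma_complex_of_real norm_mult[of _ "_ ^ j"] norm_divide norm_power
    by (simp add: divide_inverse mult_ac)
  qed
  have "(LINT u|lborel. norm (f j u)) <= (LINT u|lborel. cmod (C j) * (\<Sum>i\<le>t. \<bar>laguerre_coeff t av i\<bar> * ?g j i u))"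
  proof (rule integral_mono)
   show "integrable lborel (%u. norm (f j u))" by (rule integrable_norm[OF f_int])
   show "integrable lborel (%u. cmod (C j) * (\<Sum>i\<le>t. \<bar>laguerre_coeff t av i\<bar> * ?g j i u))"
    by (intro integrable_mult_right Bochner_Integration.integrable_sum g)
   fix u :: real
   show "norm (f j u) <= cmod (C j) * (\<Sum>i\<le>t. \<bar>laguerre_coeff t av i\<bar> * ?g j i u)"
   proof (cases "u > 0")
    case True
    have "\<bar>laguerre t av u\<bar> <= (\<Sum>i\<le>t. \<bar>laguerre_coeff t av i\<bar> * u ^ i)"
     unfolding laguerre_eq by (rule order_trans[OF sum_abs]) (use True in \<open>auto simp: abs_mult intro!: sum_mono\<close>)
    have "norm (f j u) = cmod (C j) * (u powr (av + real j) * \<bar>laguerre t av u\<bar> * exp (- P * u))"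
     using True by (simp add: f_def norm_mult abs_mult P_def mult_ac)
    also have "... <= cmod (C j) * (u powr (av + real j) * (\<Sum>i\<le>t. \<bar>laguerre_coeff t av i\<bar> * u ^ i) * exp (- P * u))"
     by (intro mult_left_mono mult_right_mono \<open>\<bar>laguerre t av u\<bar> <= _\<close>) auto
    also have "... = cmod (C j) * (\<Sum>i\<le>t. \<bar>laguerre_coeff t av i\<bar> * ?g j i u)"
     using True by (simp add: sum_distrib_left sum_distrib_right powr_add[of u "av + real j"] powr_realpow mult_ac)
    finally show ?thesis .
   qed (simp add: f_def)
  qed
  also have "... = cmod (C j) * (\<Sum>i\<le>t. \<bar>laguerre_coeff t av i\<bar> * (LINT u|lborel. ?g j i u))"
   using g by (subst integral_mult_right_zero, subst Bochner_Integration.integral_sum) (auto simp: g)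
  also have "... = (\<Sum>i\<le>t. cmod (C j) * (\<bar>laguerre_coeff t av i\<bar> * (Gamma (av + real j + real i + 1) / P powr (av + real j + real i + 1))))"
   unfolding sum_distrib_left using av P
   by (intro sum.cong refl arg_cong2[where f = "(*)"] Gamma_integral_rate) auto
  also have "... = (\<Sum>i\<le>t. K i * (\<Sum>k\<le>i. ((av + real i) gchoose (i - k)) * (of_nat (j choose k) * Y ^ j / fact j)))"
  proof (rule sum.cong[OF refl])
   fix i
   have V: "(av + real j + real i) gchoose i = (\<Sum>k\<le>i. of_nat (j choose k) * ((av + real i) gchoose (i - k)))"
    using gbinomial_Vandermonde[of "of_nat j" "av + real i" i] by (simp add: atLeast0AtMost binomial_gbinomial add_ac)
   have "Gamma (av + real j + 1) ~= 0" using av Gamma_real_pos[of "av + real j + 1"] by force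
   moreover have "P powr (av + real j + real i + 1) = P powr (av + real i + 1) * P ^ j"
    using P by (simp add: powr_realpow[symmetric] powr_add[symmetric] add_ac)
   ultimately have "cmod (C j) * (\<bar>laguerre_coeff t av i\<bar> * (Gamma (av + real j + real i + 1) / P powr (av + real j + real i + 1)))
    = K i * (((av + real j + real i) gchoose i) * (Y ^ j / fact j))"
    unfolding C Gamma_shift_binomial[OF av] K_def Y_def power_divide by (simp add: mult_ac)
   then show "cmod (C j) * (\<bar>laguerre_coeff t av i\<bar> * (Gamma (av + real j + real i + 1) / P powr (av + real j + real i + 1)))
    = K i * (\<Sum>k\<le>i. ((av + real i) gchoose (i - k)) * (of_nat (j choose k) * Y ^ j / fact j))"
    unfolding V by (simp only: sum_distrib_left sum_distrib_right mult_ac times_divide_eq_right times_divide_eq_left)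
  qed
  finally show ?thesis .
 qed
 have nonneg: "(LINT u|lborel. norm (f j u)) \<ge> 0" for j
  by (rule Bochner_Integration.integral_nonneg) simp
 have "summable (%j. \<Sum>i\<le>t. K i * (\<Sum>k\<le>i. ((av + real i) gchoose (i - k)) * (of_nat (j choose k) * Y ^ j / fact j)))"
  by (intro summable_sum summable_mult sums_summable[OF choose_exp_sums])
 then show ?thesis
 proof (rule summable_comparison_test'[where N = 0])
  fix j
  show "norm (LINT u|lborel. norm (f j u)) <= (\<Sum>i\<le>t. K i * (\<Sum>k\<le>i. ((av + real i) gchoose (i - k)) * (of_nat (j choose k) * Y ^ j / fact j)))"
   unfolding real_norm_def abs_of_nonneg[OF nonneg] by (rule bound)
 qed
qed

text \<open>A Hankel type formula: the Laguerre polynomial comes back in \<open>v\<close>,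
  multiplied by q^t with q = exp(-2 om). This is how the eigenvalue of the transform comes to depend
  on t.\<close>

lemma laguerre_bessel_integrable:
 "integrable lborel (%u. (indicator {0<..} u * (u powr av * laguerre t av u)) *r
   (exp (- (1 / (1 - exp (- 2 * om))) * of_real u) * bessel_Jt av (\<i> * of_real (sqrt (u * v)) / sinh om)))"
 and laguerre_bessel_integral:
 "(LINT u|lborel. (indicator {0<..} u * (u powr av * laguerre t av u)) *r
   (exp (- (1 / (1 - exp (- 2 * om))) * of_real u) * bessel_Jt av (\<i> * of_real (sqrt (u * v)) / sinh om)))
  = (1 - exp (- 2 * om)) powr of_real (av + 1) * exp (- 2 * om) ^ t * of_real (laguerre t av v)
   * exp (of_real v * exp (- 2 * om) / (1 - exp (- 2 * om)))"
proof -
 have S: "(%u. \<Sum>j. f j u) = (%u. (indicator {0<..} u * (u powr av * laguerre t av u)) *r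
   (exp (- p * of_real u) * bessel_Jt av (\<i> * of_real (sqrt (u * v)) / sinh om)))"
  using f_sums by (auto simp: sums_iff fun_eq_iff)
 have ae: "AE u in lborel. summable (%j. norm (f j u))" by (simp add: f_abs)
 show "integrable lborel (%u. (indicator {0<..} u * (u powr av * laguerre t av u)) *r
   (exp (- (1 / (1 - exp (- 2 * om))) * of_real u) * bessel_Jt av (\<i> * of_real (sqrt (u * v)) / sinh om)))"
  using integrable_suminf[OF f_int ae f_abs_integral] unfolding S p_def .
 have "(%j. integral\<^sup>L lborel (f j)) sums (LINT u|lborel. (\<Sum>j. f j u))"
  by (rule sums_integral[OF f_int ae f_abs_integral])
 from sums_unique2[OF this f_integral_sums]
 show "(LINT u|lborel. (indicator {0<..} u * (u powr av * laguerre t av u)) *r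
   (exp (- (1 / (1 - exp (- 2 * om))) * of_real u) * bessel_Jt av (\<i> * of_real (sqrt (u * v)) / sinh om)))
  = (1 - exp (- 2 * om)) powr of_real (av + 1) * exp (- 2 * om) ^ t * of_real (laguerre t av v)
   * exp (of_real v * exp (- 2 * om) / (1 - exp (- 2 * om)))"
  unfolding S p_def X_def .
qed

end

end

section \<open>Spherical harmonics and zonal functions\<close>

definition gint :: "('n::{finite,linorder} point => 'b::euclidean_space) => 'b" where
 "gint f = (LINT x|lborel. gauss x *r f x)"

lemma gint_add: "exp_bounded f ==> exp_bounded g ==> gint (%x. f x + g x) = gint f + gint g"
 unfolding gint_def scaleR_add_right by (intro Bochner_Integration.integral_add integrable_gauss)

lemma gint_linear:
 assumes T: "bounded_linear T" and f: "exp_bounded f"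
 shows "gint (%x. T (f x)) = T (gint f)"
proof -
 have "gint (%x. T (f x)) = (LINT x|lborel. T (gauss x *r f x))"
  unfolding gint_def by (simp only: linear_scale[OF bounded_linear.linear[OF T]])
 also have "... = T (gint f)"
  unfolding gint_def by (rule integral_bounded_linear[OF T integrable_gauss[OF f]])
 finally show ?thesis .
qed

lemma gint_scaleR: "exp_bounded f ==> gint (%x. r *r f x) = r *r gint f"
 by (rule gint_linear[OF bounded_linear_scaleR_right])

lemma gint_sum: "(!!i. i \<in> I ==> exp_bounded (f i)) ==> gint (%x. \<Sum>i\<in>I. f i x) = (\<Sum>i\<in>I. gint (f i))"
 unfolding gint_def scaleR_sum_right by (intro Bochner_Integration.integral_sum integrable_gauss)

lemma gint_coord: "hpoly k f ==> gint (%x. x $ i *r f x) = gint (partial i f)"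
 unfolding gint_def
 by (intro gauss_ibp hpoly_has_pd hpoly_exp_bounded[of k f] hpoly_exp_bounded[OF hpoly_partial])

definition dird :: "'n point => ('n::{finite,linorder} clfun) => 'n clfun" where
 "dird y f x = (\<Sum>i\<in>UNIV. y $ i *r partial i f x)"

lemma hpoly_dird: "hpoly k f ==> hpoly (k - 1) (dird y f)"
 unfolding dird_def[abs_def] by (intro hpoly_sum hpoly_scaleR hpoly_partial)

lemma dird_self: "hpoly k f ==> dird y f y = real k *r f y"
 using hpoly_euler[of k f y] by (simp add: euler_def dird_def)

lemma partial_inner_power:
 assumes f: "hpoly k f"
 shows "partial i (%x. (x \<bullet> y) ^ n *r f x)
   = (%x. (x \<bullet> y) ^ n *r partial i f x + (real n * (x \<bullet> y) ^ (n - 1) * y $ i) *r f x)"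
proof (rule ext, rule partial_eq)
 fix x
 have "has_pd i (%x. (x \<bullet> y) ^ n) (real n * (x \<bullet> y) ^ (n - 1) * y $ i) x"
  by (rule has_pd_chain[where g = "%t. t ^ n" and u = "%x. x \<bullet> y", OF has_pd_inner])
   (auto intro!: derivative_eq_intros)
 from has_pd_scaleR[OF this hpoly_has_pd[OF f]]
 show "has_pd i (%x. (x \<bullet> y) ^ n *r f x) ((x \<bullet> y) ^ n *r partial i f x + (real n * (x \<bullet> y) ^ (n - 1) * y $ i) *r f x) x" .
qed

lemma exp_bounded_inner_power: "hpoly k f ==> exp_bounded (%x. (x \<bullet> y) ^ n *r f x)"
 by (rule hpoly_exp_bounded[OF hpoly_inner_power])

text \<open>One factor <x,y> is integrated by parts. The derivative hits either the other factors,
  giving n |y|^2, or \<open>f\<close>, giving its derivative in direction \<open>y\<close>.\<close>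

lemma gint_inner_step:
 assumes f: "hpoly k f"
 shows "gint (%x. (x \<bullet> y) ^ Suc n *r f x)
  = (real n * nsq y) *r gint (%x. (x \<bullet> y) ^ (n - 1) *r f x) + gint (%x. (x \<bullet> y) ^ n *r dird y f x)"
proof -
 let ?g = "%x. (x \<bullet> y) ^ n *r f x"
 have g: "hpoly (n + k) ?g" by (rule hpoly_inner_power[OF f])
 have "gint (%x. (x \<bullet> y) ^ Suc n *r f x) = gint (%x. \<Sum>i\<in>UNIV. y $ i *r (x $ i *r ?g x))"
  by (rule arg_cong[where f = gint]) (simp add: fun_eq_iff inner_vec_def scaleR_left.sum[symmetric] sum_distrib_right mult_ac)
 also have "... = (\<Sum>i\<in>UNIV. y $ i *r gint (partial i ?g))"
 proof -
  have "gint (%x. y $ i *r (x $ i *r ?g x)) = y $ i *r gint (partial i ?g)" for i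
   using gint_scaleR[OF hpoly_exp_bounded[OF hpoly.coord[OF g]]] gint_coord[OF g] by metis
  moreover have "gint (%x. \<Sum>i\<in>UNIV. y $ i *r (x $ i *r ?g x)) = (\<Sum>i\<in>UNIV. gint (%x. y $ i *r (x $ i *r ?g x)))"
   by (rule gint_sum) (rule hpoly_exp_bounded[OF hpoly_scaleR[OF hpoly.coord[OF g]]])
  ultimately show ?thesis by simp
 qed
 also have "... = gint (%x. \<Sum>i\<in>UNIV. y $ i *r partial i ?g x)"
 proof -
  have "gint (%x. \<Sum>i\<in>UNIV. y $ i *r partial i ?g x) = (\<Sum>i\<in>UNIV. gint (%x. y $ i *r partial i ?g x))"
   by (rule gint_sum) (rule hpoly_exp_bounded[OF hpoly_scaleR[OF hpoly_partial[OF g]]])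
  then show ?thesis by (simp only: gint_scaleR[OF hpoly_exp_bounded[OF hpoly_partial[OF g]]])
 qed
 also have "... = gint (%x. (real n * nsq y) *r ((x \<bullet> y) ^ (n - 1) *r f x) + (x \<bullet> y) ^ n *r dird y f x)"
 proof (rule arg_cong[where f = gint], rule ext)
  fix x
  have "(\<Sum>i\<in>UNIV. y $ i *r partial i ?g x)
    = (\<Sum>i\<in>UNIV. (x \<bullet> y) ^ n *r (y $ i *r partial i f x)) + (\<Sum>i\<in>UNIV. (y $ i * y $ i) *r ((real n * (x \<bullet> y) ^ (n - 1)) *r f x))"
   unfolding partial_inner_power[OF f] sum.distrib[symmetric]
   by (intro sum.cong refl) (simp add: scaleR_add_right mult_ac)
  also have "... = (x \<bullet> y) ^ n *r dird y f x + nsq y *r ((real n * (x \<bullet> y) ^ (n - 1)) *r f x)"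
   by (simp only: scaleR_sum_right[symmetric] scaleR_left.sum[symmetric] dird_def power2_norm_eq_inner inner_vec_def inner_real_def)
  finally show "(\<Sum>i\<in>UNIV. y $ i *r partial i ?g x) = (real n * nsq y) *r ((x \<bullet> y) ^ (n - 1) *r f x) + (x \<bullet> y) ^ n *r dird y f x"
   by (simp add: mult_ac add.commute)
 qed
 also have "... = (real n * nsq y) *r gint (%x. (x \<bullet> y) ^ (n - 1) *r f x) + gint (%x. (x \<bullet> y) ^ n *r dird y f x)"
  unfolding gint_add[OF hpoly_exp_bounded[OF hpoly_scaleR[OF hpoly_inner_power[OF f]]] exp_bounded_inner_power[OF hpoly_dird[OF f]]]
   gint_scaleR[OF exp_bounded_inner_power[OF f]] by (rule refl)
 finally show ?thesis .
qed

definition harmonic :: "nat => ('n::{finite,linorder} clfun) => bool" where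
 "harmonic l f \<longleftrightarrow> hpoly l f \<and> (\<forall>x. lap f x = 0)"

lemma harmonic_hpoly: "harmonic l f ==> hpoly l f"
 by (simp add: harmonic_def)

text \<open>A derivative with constant coefficients commutes with the Laplacian.\<close>

lemma harmonic_dird:
 assumes f: "harmonic l f"
 shows "harmonic (l - 1) (dird y f)"
proof -
 have h: "hpoly l f" using f by (rule harmonic_hpoly)
 have p: "partial i (dird y g) = (%x. \<Sum>j\<in>UNIV. y $ j *r partial i (partial j g) x)" if g: "hpoly k g" for i g k
  unfolding dird_def[abs_def]
 proof (rule ext, rule partial_eq, rule has_pd_sum)
  fix x j
  show "has_pd i (%x. y $ j *r partial j g x) (y $ j *r partial i (partial j g) x) x"
   by (rule has_pd_linear[OF bounded_linear_scaleR_right hpoly_has_pd[OF hpoly_partial[OF g]]])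
 qed
 have "lap (dird y f) x = 0" for x
 proof -
  have pp: "partial i (partial i (dird y f)) = (%x. \<Sum>j\<in>UNIV. y $ j *r partial j (partial i (partial i f)) x)" for i
  proof -
   have "partial i (dird y f) = dird y (partial i f)"
    by (rule ext) (simp only: p[OF h] dird_def partial_commute[OF h, of i])
   then show ?thesis
    by (simp only: p[OF hpoly_partial[OF h]] partial_commute[OF hpoly_partial[OF h], of i])
  qed
  have "lap (dird y f) x = (\<Sum>j\<in>UNIV. y $ j *r (\<Sum>i\<in>UNIV. partial j (partial i (partial i f)) x))"
   unfolding lap_def pp scaleR_sum_right by (rule sum.swap)
  also have "... = (\<Sum>j\<in>UNIV. y $ j *r partial j (lap f) x)"
   unfolding lap_def[abs_def]
   by (subst partial_sum[OF hpoly_partial[OF hpoly_partial[OF h]]]) simp_all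
  also have "lap f = (%_. 0)" using f by (auto simp: harmonic_def)
  finally show ?thesis by (simp add: partial_const)
 qed
 then show ?thesis using hpoly_dird[OF h] by (simp add: harmonic_def)
qed

text \<open>By Euler's relation and integration by parts, \<open>l\<close> times the integral of
  \<open>f\<close> is the integral of its Laplacian.\<close>

lemma gint_harmonic:
 assumes f: "harmonic l f" and l: "l > 0"
 shows "gint f = 0"
proof -
 have h: "hpoly l f" using f by (rule harmonic_hpoly)
 have "real l *r gint f = gint (%x. \<Sum>i\<in>UNIV. x $ i *r partial i f x)"
  unfolding gint_scaleR[OF hpoly_exp_bounded[OF h], symmetric] by (simp add: hpoly_euler[OF h, symmetric] euler_def)
 also have "... = gint (%x. lap f x)"
  unfolding lap_def
  by (simp add: gint_sum hpoly_exp_bounded[OF hpoly.coord[OF hpoly_partial[OF h]]] gint_coord[OF hpoly_partial[OF h]]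
   hpoly_exp_bounded[OF hpoly_partial[OF hpoly_partial[OF h]]])
 also have "... = 0" using f by (simp add: harmonic_def gint_def)
 finally show ?thesis using l by simp
qed

text \<open>\<open>\<integral> \<langle>x,y\<rangle>\<^sup>n H(x) e\<^bsup>-|x|\<^sup>2/2\<^esup> dx\<close> is \<open>n! |y|\<^bsup>n-l\<^esup> / (2\<^sup>i i!)\<close> times \<open>H(y)\<close>, \<open>n = l + 2 i\<close>, up to the total mass.\<close>

definition gmom :: "real => nat => nat => real" where
 "gmom s l n = (if l <= n \<and> even (n - l) then fact n / (2 ^ ((n - l) div 2) * fact ((n - l) div 2)) * s ^ ((n - l) div 2) else 0)"

text \<open>The recursion of \<open>gint_inner_step\<close>: the directional derivative at
  \<open>y\<close> brings the factor l by Euler's relation. The guard is there because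
  \<open>l - 1\<close> truncates at 0.\<close>

lemma gmom_rec:
 "gmom s l (Suc n) = real n * s * gmom s l (n - 1) + (if l = 0 then 0 else real l * gmom s (l - 1) n)"
proof (cases "l <= Suc n \<and> even (Suc n - l)")
 case True
 then obtain i where i: "Suc n = l + 2 * i" by (metis dvdE le_add_diff_inverse)
 show ?thesis
 proof (cases i)
  case 0
  then have "l = Suc n" using i by simp
  then show ?thesis by (simp add: gmom_def)
 next
  case (Suc j)
  then have n: "n = l + 2 * j + 1" using i by simp
  \<comment> \<open>The common factor of all three terms. The two terms on the right contribute 2 (j
    + 1) and l, which add up to n + 1.\<close>
  define E where "E = s ^ Suc j / (2 ^ Suc j * fact (Suc j))"
  have a: "gmom s l (Suc n) = fact (Suc n) * E"
   by (simp add: gmom_def n E_def del: power_Suc fact_Suc)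
  have b: "gmom s l (n - 1) = fact (n - 1) / (2 ^ j * fact j) * s ^ j" by (simp add: gmom_def n)
  have c: "(if l = 0 then 0 else real l * gmom s (l - 1) n) = real l * fact n * E"
   by (cases l) (simp_all add: gmom_def n E_def del: power_Suc fact_Suc)
  have e: "2 ^ Suc j * fact (Suc j) = real (2 * Suc j) * (2 ^ j * fact j)" by simp
  have f: "fact n = real n * fact (n - 1)" using n by (simp add: fact_reduce)
  have "real n * s * gmom s l (n - 1) = (real n * fact (n - 1)) * (s ^ Suc j / (2 ^ j * fact j))"
   unfolding b by (simp add: mult_ac)
  also have "s ^ Suc j / (2 ^ j * fact j) = real (2 * Suc j) * E"
   unfolding E_def e by (simp del: power_Suc of_nat_Suc of_nat_mult)
  finally have d: "real n * s * gmom s l (n - 1) = fact n * (real (2 * Suc j) * E)" unfolding f .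
  have "fact (Suc n) = (real (2 * Suc j) + real l) * fact n" by (simp add: n)
  then show ?thesis unfolding a c d by (simp only:) (simp add: algebra_simps del: fact_Suc of_nat_Suc of_nat_mult)
 qed
next
 case False
 have 1: "\<not> (l <= n - 1 \<and> even (n - 1 - l))" if "n > 0"
 proof
  assume "l <= n - 1 \<and> even (n - 1 - l)"
  then have "l <= Suc n" "Suc n - l = (n - 1 - l) + 2" using that by auto
  then show False using False \<open>l <= n - 1 \<and> even (n - 1 - l)\<close> by simp
 qed
 have 2: "\<not> (l - 1 <= n \<and> even (n - (l - 1)))" if "l > 0"
  using False that by (cases l) auto
 show ?thesis using False 1 2 by (cases "n = 0"; cases "l = 0") (auto simp: gmom_def)
qed

lemma hpoly_0_const: "hpoly 0 f ==> f x = f y"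
 using hpoly_scale_arg[of 0 f 0 x] hpoly_scale_arg[of 0 f 0 y] by simp

text \<open>A Funk-Hecke formula for powers. The induction on \<open>n\<close> ranges over all
  degrees \<open>l\<close> at once, because the directional derivative is again harmonic, of degree
  \<open>l - 1\<close>.\<close>

lemma gint_inner_harmonic:
 assumes "harmonic l f"
 shows "gint (%x. (x \<bullet> y) ^ n *r f x) = (gmom (nsq y) l n * (LINT x|lborel. gauss (x :: 'n::{finite,linorder} point))) *r f (y :: 'n point)"
 using assms
proof (induction n arbitrary: l f rule: less_induct)
 case (less n)
 note h = harmonic_hpoly[OF less.prems]
 show ?case
 proof (cases n)
  case 0
  show ?thesis
  proof (cases "l = 0")
   case True
   have "gint f = (LINT x|lborel. gauss (x :: 'n point) *r f y)"
    unfolding gint_def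
   proof (rule Bochner_Integration.integral_cong[OF refl])
    fix x :: "'n point" show "gauss x *r f x = gauss x *r f y" using hpoly_0_const[of f x y] h True by simp
   qed
   also have "... = (LINT x|lborel. gauss (x :: 'n point)) *r f y"
   proof (rule integral_scaleR_left)
    have "exp_bounded (%_ :: 'n point. 1 :: real)" by (rule exp_boundedI[where C = 1 and b = 0]) simp_all
    from integrable_gauss[OF this] show "integrable lborel (gauss :: 'n point => real)" by simp
   qed
   finally show ?thesis using 0 True by (simp add: gmom_def)
  next
   case False
   then show ?thesis using gint_harmonic[OF less.prems] 0 by (simp add: gmom_def)
  qed
 next
  case (Suc k)
  let ?Z = "LINT x|lborel. gauss (x :: 'n point)"
  have "gint (%x. (x \<bullet> y) ^ k *r dird y f x) = (gmom (nsq y) (l - 1) k * ?Z) *r dird y f y"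
   using less.IH[of k "l - 1" "dird y f"] Suc harmonic_dird[OF less.prems] by simp
  then have 1: "gint (%x. (x \<bullet> y) ^ k *r dird y f x) = ((if l = 0 then 0 else real l * gmom (nsq y) (l - 1) k) * ?Z) *r f y"
   by (simp add: dird_self[OF h] mult_ac)
  have 2: "(real k * nsq y) *r gint (%x. (x \<bullet> y) ^ (k - 1) *r f x) = (real k * nsq y * gmom (nsq y) l (k - 1) * ?Z) *r f y"
   using less.IH[of "k - 1" l f] less.prems Suc by (cases "k = 0") auto
  show ?thesis unfolding Suc gint_inner_step[OF h] 1 2 gmom_rec scaleR_add_left[symmetric]
   by (simp add: distrib_right)
 qed
qed

section \<open>Integrals over the unit sphere\<close>

abbreviation sint :: "('n::{finite,linorder} point => 'b::{banach,second_countable_topology}) => 'b" where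
 "sint f \<equiv> integral\<^sup>L sphere_measure f"

text \<open>\<open>sphere_measure\<close> is a measure on the whole space. Among the points of the
  unit ball only the origin has a direction of norm other than 1, as
  \<open>sgn 0 = 0\<close>.\<close>

lemma AE_sphere_norm: "AE \<xi> :: 'n::{finite,linorder} point in sphere_measure. norm \<xi> = 1"
proof (rule AE_I)
 let ?N = "{\<xi> :: 'n point. norm \<xi> ~= 1}"
 show N: "?N \<in> sets sphere_measure" by simp
 have "{x :: 'n point. norm x < 1 \<and> sgn x \<in> ?N} = {0}" by (auto simp: norm_sgn)
 then show "emeasure sphere_measure ?N = 0"
  using N by (subst emeasure_sphere_measure) (auto simp del: mem_Collect_eq)
qed auto

lemma sphere_integrable:
 fixes f :: "'n::{finite,linorder} point => 'b::{banach,second_countable_topology}"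
 assumes "continuous_on UNIV f"
 shows "integrable sphere_measure f"
proof -
 have "compact (f ` cball 0 1)"
  by (intro compact_continuous_image continuous_on_subset[OF assms]) auto
 then obtain B where B: "!!x. x \<in> cball 0 1 ==> norm (f x) <= B"
  by (meson bounded_iff compact_imp_bounded image_eqI)
 show ?thesis
 proof (rule finite_measure.integrable_const_bound[OF finite_sphere_measure])
  show "AE x in sphere_measure. norm (f x) <= B"
   using AE_sphere_norm by eventually_elim (auto intro: B)
  show "f \<in> borel_measurable sphere_measure"
   using borel_measurable_continuous_onI[OF assms] by simp
 qed
qed

lemma sint_cong: "(!!\<xi>. norm \<xi> = 1 ==> f \<xi> = g \<xi>) ==> f \<in> borel_measurable borel ==> g \<in> borel_measurable borel ==> sint f = sint g"
 by (rule integral_cong_AE) (use AE_sphere_norm in \<open>auto elim: eventually_mono\<close>)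

lemma sint_1: "sint (%_ :: 'n::{finite,linorder} point. 1 :: real) = sphere_area CARD('n)"
proof -
 have "sphere_area CARD('n) \<ge> 0" by (simp add: sphere_area_def Gamma_real_pos less_imp_le)
 then show ?thesis by (simp add: measure_def sphere_measure_total)
qed

lemma sphere_area_pos: "m > 0 ==> sphere_area m > 0"
 by (simp add: sphere_area_def Gamma_real_pos)

text \<open>The radial factor of the Gaussian integral of a function homogeneous of degree
  \<open>k\<close>. Dividing by it turns Gaussian integrals into integrals over the sphere.\<close>

definition rad_gauss :: "nat => nat => real" where
 "rad_gauss m k = integral\<^sup>L (radial m) (%u. u powr (real k / 2) * exp (- u / 2))"

lemma
 assumes m: "m > 0"
 shows rad_gauss_integrable: "integrable (radial m) (%u. u powr (real k / 2) * exp (- u / 2))"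
  and rad_gauss_eq: "rad_gauss m k = Gamma ((real m + real k) / 2) * 2 powr ((real m + real k) / 2) / 2"
proof -
 define s where "s = (real m + real k) / 2"
 have s: "s > 0" using m by (simp add: s_def)
 have eq: "(%u. (indicator {0<..} u * (u powr (real m / 2 - 1) / 2)) *r (u powr (real k / 2) * exp (- u / 2)))
   = (%u. (1 / 2) * (indicator {0<..} u * (u powr (s - 1) * exp (- (1 / 2) * u))))"
 proof
  fix u :: real
  show "(indicator {0<..} u * (u powr (real m / 2 - 1) / 2)) *r (u powr (real k / 2) * exp (- u / 2))
   = (1 / 2) * (indicator {0<..} u * (u powr (s - 1) * exp (- (1 / 2) * u)))"
  proof (cases "u > 0")
   case True
   have "s - 1 = (real m / 2 - 1) + real k / 2" by (simp add: s_def add_divide_distrib)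
   then have "u powr (s - 1) = u powr (real m / 2 - 1) * u powr (real k / 2)" by (simp only: powr_add)
   then show ?thesis using True by simp
  qed simp
 qed
 show "integrable (radial m) (%u. u powr (real k / 2) * exp (- u / 2))"
  by (subst integrable_radial_iff, measurable, unfold eq) (intro integrable_mult_right integrable_powr_exp, use s in auto)
 have "rad_gauss m k = (LINT u|lborel. (1 / 2) * (indicator {0<..} u * (u powr (s - 1) * exp (- (1 / 2) * u))))"
  unfolding rad_gauss_def by (subst integral_radial, measurable, unfold eq, rule refl)
 also have "... = (1 / 2) * (Gamma s / (1 / 2) powr s)"
  using Gamma_integral_rate[OF s, of "1 / 2"] by simp
 finally show "rad_gauss m k = Gamma ((real m + real k) / 2) * 2 powr ((real m + real k) / 2) / 2"
  by (simp add: s_def powr_divide)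
qed

lemma rad_gauss_pos: "m > 0 ==> rad_gauss m k > 0"
 by (simp add: rad_gauss_eq Gamma_real_pos)

lemma rad_gauss_even:
 assumes m: "m > 0"
 shows "rad_gauss m (2 * j) = rad_gauss m 0 * 2 ^ j * pochhammer (real m / 2) j"
proof -
 have "real m / 2 \<notin> \<int>\<^sub>\<le>\<^sub>0" using m by (auto dest: nonpos_Ints_nonpos)
 then have "pochhammer (real m / 2) j = Gamma (real m / 2 + real j) / Gamma (real m / 2)"
  by (rule pochhammer_Gamma)
 moreover have "Gamma (real m / 2) > 0" using m by (simp add: Gamma_real_pos)
 moreover have e1: "rad_gauss m (2 * j) = Gamma (real m / 2 + real j) * 2 powr (real m / 2 + real j) / 2"
 proof -
  have "(real m + real (2 * j)) / 2 = real m / 2 + real j" by simp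
  then show ?thesis by (simp only: rad_gauss_eq[OF m])
 qed
 moreover have e2: "rad_gauss m 0 = Gamma (real m / 2) * 2 powr (real m / 2) / 2"
  by (simp add: rad_gauss_eq[OF m])
 ultimately show ?thesis unfolding e1 e2 by (simp add: powr_add powr_realpow)
qed

lemma gint_polar:
 fixes f :: "'n::{finite,linorder} point => 'b::euclidean_space"
 assumes c: "continuous_on UNIV f" and hom: "!!t x. t > 0 ==> f (t *r x) = t ^ k *r f x"
 shows "gint f = rad_gauss CARD('n) k *r sint f"
proof -
 have "rad_gauss CARD('n) k *r sint f
   = (LINT x|lborel. ((nsq x) powr (real k / 2) * exp (- nsq x / 2)) *r f (sgn x))"
  unfolding rad_gauss_def
  by (rule polar_bilinear(2)[OF bounded_bilinear_scaleR rad_gauss_integrable sphere_integrable[OF c], symmetric]) simp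
 also have "... = gint f"
  unfolding gint_def
 proof (rule integral_cong_AE)
  have [measurable]: "f \<in> borel_measurable borel" using c by (rule borel_measurable_continuous_onI)
  show "(%x. ((nsq x) powr (real k / 2) * exp (- nsq x / 2)) *r f (sgn x)) \<in> borel_measurable lborel"
   by measurable
  show "(%x. gauss x *r f x) \<in> borel_measurable lborel" unfolding gauss_def by measurable
  have "AE x :: 'n point in lborel. x ~= 0" by (rule AE_lborel_singleton)
  then show "AE x in lborel. ((nsq x) powr (real k / 2) * exp (- nsq x / 2)) *r f (sgn x) = gauss x *r f x"
  proof eventually_elim
   fix x :: "'n point" assume x: "x ~= 0"
   have "f x = f (norm x *r sgn x)" using x by (simp add: sgn_div_norm)
   also have "... = norm x ^ k *r f (sgn x)" using x by (intro hom) simp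
   finally have "f x = norm x ^ k *r f (sgn x)" .
   moreover have "(nsq x) powr (real k / 2) = norm x ^ k"
    using x by (simp add: powr_powr powr_realpow flip: powr_numeral)
   ultimately show "((nsq x) powr (real k / 2) * exp (- nsq x / 2)) *r f (sgn x) = gauss x *r f x"
    by (simp add: gauss_def mult.commute)
  qed
 qed
 finally show ?thesis ..
qed

lemma gint_polar_hpoly: "hpoly k f ==> gint f = rad_gauss CARD('n) k *r sint (f :: 'n::{finite,linorder} point => _)"
 by (rule gint_polar[OF hpoly_continuous hpoly_scale_arg])

lemma gauss_total: "(LINT x|lborel. gauss (x :: 'n::{finite,linorder} point)) = rad_gauss CARD('n) 0 * sphere_area CARD('n)"
 using gint_polar[of "%_ :: 'n point. 1 :: real" 0] unfolding sint_1 by (simp add: gint_def)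

text \<open>\<open>gmom 1 l n\<close> times the quotient of \<open>rad_gauss m 0\<close> by
  \<open>rad_gauss m (n + l)\<close>, written with Pochhammer symbols.\<close>

definition smom :: "nat => nat => nat => real" where
 "smom m l n = (if l <= n \<and> even (n - l)
   then fact n / (2 ^ n * fact ((n - l) div 2) * pochhammer (real m / 2) (l + (n - l) div 2)) else 0)"

lemma sphere_moment:
 assumes f: "harmonic l f" and \<eta>: "norm (\<eta> :: 'n::{finite,linorder} point) = 1"
 shows "sint (%\<xi>. (\<xi> \<bullet> \<eta>) ^ n *r f \<xi>) = (sphere_area CARD('n) * smom CARD('n) l n) *r f \<eta>"
proof -
 let ?m = "CARD('n)"
 have m: "?m > 0" by simp
 have "rad_gauss ?m (n + l) *r sint (%\<xi>. (\<xi> \<bullet> \<eta>) ^ n *r f \<xi>) = gint (%x. (x \<bullet> \<eta>) ^ n *r f x)"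
  using gint_polar_hpoly[OF hpoly_inner_power[OF harmonic_hpoly[OF f]]] by simp
 also have "... = (gmom 1 l n * (rad_gauss ?m 0 * sphere_area ?m)) *r f \<eta>"
  using gint_inner_harmonic[OF f, of \<eta> n] by (simp add: \<eta> gauss_total)
 also have "gmom 1 l n * (rad_gauss ?m 0 * sphere_area ?m) = rad_gauss ?m (n + l) * (sphere_area ?m * smom ?m l n)"
 proof (cases "l <= n \<and> even (n - l)")
  case True
  then obtain i where i: "n = l + 2 * i" by (metis dvdE le_add_diff_inverse)
  have "n + l = 2 * (l + i)" by (simp add: i)
  moreover have "pochhammer (real ?m / 2) (l + i) > 0" by (rule pochhammer_pos) simp
  moreover have "(2 ^ i)\<^sup>2 = (4 :: real) ^ i" by (simp add: power2_eq_square flip: power_mult_distrib)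
  ultimately show ?thesis
   by (simp only: rad_gauss_even[OF m]) (simp add: gmom_def smom_def i power_add power_mult field_simps power_mult_distrib[symmetric])
 qed (auto simp: gmom_def smom_def)
 finally have "rad_gauss ?m (n + l) *r sint (%\<xi>. (\<xi> \<bullet> \<eta>) ^ n *r f \<xi>)
   = rad_gauss ?m (n + l) *r ((sphere_area ?m * smom ?m l n) *r f \<eta>)" by simp
 then show ?thesis using rad_gauss_pos[OF m, of "n + l"] by (subst (asm) scaleR_cancel_left) auto
qed

section \<open>The wedge under Gaussian and spherical integrals\<close>

lemma gint_vec:
 assumes f: "hpoly k f"
 shows "gint (%x. cl_vec x \<odot> f x) = gint (dirac f)"
proof -
 have "gint (%x. cl_vec x \<odot> f x) = (\<Sum>i\<in>UNIV. gint (%x. x $ i *r (cl_gen i \<odot> f x)))"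
  unfolding cl_vec_mult_sum by (rule gint_sum) (rule hpoly_exp_bounded[OF hpoly.coord[OF hpoly_mult[OF f]]])
 also have "... = (\<Sum>i\<in>UNIV. gint (%x. cl_gen i \<odot> partial i f x))"
  by (simp only: gint_coord[OF hpoly_mult[OF f]]
    partial_linear[OF f bounded_bilinear.bounded_linear_right[OF bounded_bilinear_cl_mult]])
 also have "... = gint (dirac f)"
  unfolding dirac_def by (rule gint_sum[symmetric]) (rule hpoly_exp_bounded[OF hpoly_mult[OF hpoly_partial[OF f]]])
 finally show ?thesis .
qed

text \<open>Integration by parts turns the vector \<open>x\<close> into the Dirac operator. The term
  with <x,y>^(n-1), where \<open>y\<close> occurs squared, cancels against the one in
  \<open>gint_inner_step\<close>.\<close>

lemma gint_wedge:
 assumes f: "hpoly k f"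
 shows "gint (%x. cl_wedge x y \<odot> ((x \<bullet> y) ^ n *r f x))
  = - gint (%x. (x \<bullet> y) ^ n *r dird y f x) - cl_vec y \<odot> gint (%x. (x \<bullet> y) ^ n *r dirac f x)"
proof -
 let ?g = "%x. (x \<bullet> y) ^ n *r f x"
 have g: "hpoly (n + k) ?g" by (rule hpoly_inner_power[OF f])
 have Y: "bounded_linear (%a. - (cl_vec y \<odot> a))"
  by (intro bounded_linear_minus bounded_bilinear.bounded_linear_right[OF bounded_bilinear_cl_mult])
 have eb1: "exp_bounded (%x. - (cl_vec y \<odot> (cl_vec x \<odot> ?g x)))"
  using hpoly_exp_bounded[OF hpoly_scaleR[OF hpoly_mult[OF hpoly_vec[OF g]], of "-1"]] by simp
 have eb2: "exp_bounded (%x. (-1) *r ((x \<bullet> y) ^ Suc n *r f x))"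
  by (rule hpoly_exp_bounded[OF hpoly_scaleR[OF hpoly_inner_power[OF f]]])
 have "gint (%x. cl_wedge x y \<odot> ?g x) = gint (%x. - (cl_vec y \<odot> (cl_vec x \<odot> ?g x)) + (-1) *r ((x \<bullet> y) ^ Suc n *r f x))"
  by (simp add: cl_wedge_mult)
 also have "... = - (cl_vec y \<odot> gint (%x. cl_vec x \<odot> ?g x)) + (-1) *r gint (%x. (x \<bullet> y) ^ Suc n *r f x)"
  unfolding gint_add[OF eb1 eb2] gint_linear[OF Y hpoly_exp_bounded[OF hpoly_vec[OF g]]]
   gint_scaleR[OF exp_bounded_inner_power[OF f]] ..
 also have "gint (%x. cl_vec x \<odot> ?g x) = gint (dirac ?g)" by (rule gint_vec[OF g])
 also have "dirac ?g = (%x. (x \<bullet> y) ^ n *r dirac f x + real n *r (cl_vec y \<odot> ((x \<bullet> y) ^ (n - 1) *r f x)))"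
 proof
  fix x
  have "dirac ?g x = (\<Sum>i\<in>UNIV. (x \<bullet> y) ^ n *r (cl_gen i \<odot> partial i f x)
    + (real n * (x \<bullet> y) ^ (n - 1)) *r (y $ i *r (cl_gen i \<odot> f x)))"
   unfolding dirac_def partial_inner_power[OF f] by (intro sum.cong refl) (simp add: cl_mult_add_right cl_mult_scaleR_right)
  also have "... = (x \<bullet> y) ^ n *r dirac f x + (real n * (x \<bullet> y) ^ (n - 1)) *r (cl_vec y \<odot> f x)"
   unfolding sum.distrib dirac_def cl_vec_mult_sum scaleR_sum_right ..
  finally show "dirac ?g x = (x \<bullet> y) ^ n *r dirac f x + real n *r (cl_vec y \<odot> ((x \<bullet> y) ^ (n - 1) *r f x))"
   by (simp add: cl_mult_scaleR_right)
 qed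
 also have "gint (%x. (x \<bullet> y) ^ n *r dirac f x + real n *r (cl_vec y \<odot> ((x \<bullet> y) ^ (n - 1) *r f x)))
   = gint (%x. (x \<bullet> y) ^ n *r dirac f x) + real n *r (cl_vec y \<odot> gint (%x. (x \<bullet> y) ^ (n - 1) *r f x))"
  unfolding gint_add[OF exp_bounded_inner_power[OF hpoly_dirac[OF f]] hpoly_exp_bounded[OF hpoly_scaleR[OF hpoly_mult[OF hpoly_inner_power[OF f]]]]]
   gint_scaleR[OF hpoly_exp_bounded[OF hpoly_mult[OF hpoly_inner_power[OF f]]]]
   gint_linear[OF bounded_bilinear.bounded_linear_right[OF bounded_bilinear_cl_mult] exp_bounded_inner_power[OF f]] ..
 finally show ?thesis
  unfolding gint_inner_step[OF f]
  by (simp add: cl_mult_add_right cl_mult_scaleR_right cl_vec_square)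
qed

lemma gmom_shift: "l > 0 ==> real (Suc n) * gmom s (l - 1) n = gmom s l (Suc n)"
 by (cases l) (auto simp: gmom_def)

text \<open>Unlike \<open>monogenics\<close>, this admits complex coefficients.\<close>

definition monogenic :: "nat => ('n::{finite,linorder} clfun) => bool" where
 "monogenic l f \<longleftrightarrow> hpoly l f \<and> (\<forall>x. dirac f x = 0)"

lemma monogenic_harmonic: "monogenic l f ==> harmonic l f"
proof -
 assume "monogenic l f"
 then have f: "hpoly l f" "dirac f = (%_. 0)" by (auto simp: monogenic_def)
 have "dirac (%_. 0 :: 'a cliff) x = 0" for x by (simp add: dirac_def partial_const)
 then show ?thesis using dirac_dirac[OF f(1)] f by (simp add: harmonic_def)
qed

lemma monogenic_dirac_vec:
 fixes f :: "'n::{finite,linorder} point => _"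
 shows "monogenic l f ==> dirac (%x. cl_vec x \<odot> f x) = (%x. - (real CARD('n) + 2 * real l) *r f x)"
 by (rule ext, subst dirac_vec[of l]) (auto simp: monogenic_def)

lemma monogenic_vec_harmonic:
 fixes f :: "'n::{finite,linorder} point => _"
 assumes f: "monogenic l f"
 shows "harmonic (Suc l) (%x. cl_vec x \<odot> f x)"
proof -
 have h: "hpoly l f" using f by (simp add: monogenic_def)
 have "lap (%x. cl_vec x \<odot> f x) x = 0" for x
  using dirac_dirac[OF hpoly_vec[OF h], of x] f
  unfolding monogenic_dirac_vec[OF f] dirac_scaleR[OF h] by (simp add: monogenic_def)
 then show ?thesis using hpoly_vec[OF h] by (simp add: harmonic_def)
qed

text \<open>Only the directional derivative in \<open>gint_wedge\<close> survives, and it yields the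
  wedge eigenvalue -l. The factor n + 1 relates <x,y>^(n+1) to its derivative, so that the identity
  extends linearly to a polynomial and its derivative.\<close>

lemma gint_wedge_monogenic:
 assumes f: "monogenic l f"
 shows "real (Suc n) *r gint (%x. cl_wedge x y \<odot> ((x \<bullet> y) ^ n *r f x)) = (- real l) *r gint (%x. (x \<bullet> y) ^ Suc n *r f x)"
proof (cases "l = 0")
 case True
 have h: "hpoly l f" using f by (simp add: monogenic_def)
 have "dird y f = (%_. 0)" using h True by (auto simp: dird_def hpoly_0_partial)
 then show ?thesis using gint_wedge[OF h, of y n] f True by (simp add: monogenic_def gint_def)
next
 case False
 have h: "hpoly l f" using f by (simp add: monogenic_def)
 note H = monogenic_harmonic[OF f]
 have "gint (%x. cl_wedge x y \<odot> ((x \<bullet> y) ^ n *r f x)) = - gint (%x. (x \<bullet> y) ^ n *r dird y f x)"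
  using gint_wedge[OF h, of y n] f by (simp add: monogenic_def gint_def)
 then show ?thesis
  using gmom_shift[of l n "nsq y"] False
  by (simp add: gint_inner_harmonic[OF harmonic_dird[OF H]] gint_inner_harmonic[OF H] dird_self[OF h] mult_ac
    del: power_Suc of_nat_Suc)
qed

text \<open>Two contributions make the eigenvalue: -(l + 1) from the directional derivative, the
  degree now being l + 1, and m + 2 l from the Dirac image of x M.\<close>

lemma gint_wedge_vec_monogenic:
 fixes f :: "'n::{finite,linorder} point => _"
 assumes f: "monogenic l f"
 shows "real (Suc n) *r gint (%x. cl_wedge x y \<odot> ((x \<bullet> y) ^ n *r (cl_vec x \<odot> f x)))
  = (real l + real CARD('n) - 1) *r gint (%x. (x \<bullet> y) ^ Suc n *r (cl_vec x \<odot> f x))"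
proof -
 have h: "hpoly l f" using f by (simp add: monogenic_def)
 note H = monogenic_vec_harmonic[OF f]
 let ?N = "%x. cl_vec x \<odot> f x"
 define Z where "Z = (LINT x|lborel. gauss (x :: 'n point))"
 have s: "real (Suc n) * gmom (nsq y) l n = gmom (nsq y) (Suc l) (Suc n)"
  using gmom_shift[of "Suc l" n "nsq y"] by simp
 have 1: "gint (%x. (x \<bullet> y) ^ n *r dird y ?N x) = (gmom (nsq y) l n * Z * real (Suc l)) *r ?N y"
  using gint_inner_harmonic[OF harmonic_dird[OF H], where y = y and n = n] dird_self[OF hpoly_vec[OF h], of y]
  by (simp add: Z_def del: of_nat_Suc)
 have 2: "gint (%x. (x \<bullet> y) ^ n *r dirac ?N x) = (- (real CARD('n) + 2 * real l)) *r ((gmom (nsq y) l n * Z) *r f y)"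
  unfolding monogenic_dirac_vec[OF f] scaleR_left_commute[of "(_ \<bullet> y) ^ n"] gint_scaleR[OF exp_bounded_inner_power[OF h]]
   gint_inner_harmonic[OF monogenic_harmonic[OF f]] Z_def ..
 have "real (Suc n) *r gint (%x. cl_wedge x y \<odot> ((x \<bullet> y) ^ n *r ?N x))
   = real (Suc n) *r ((gmom (nsq y) l n * Z * (real l + real CARD('n) - 1)) *r ?N y)"
  unfolding gint_wedge[OF hpoly_vec[OF h]] 1 2 unfolding cl_mult_scaleR_right scaleR_scaleR
  by (simp add: scaleR_left_diff_distrib[symmetric] scaleR_minus_left[symmetric] del: scaleR_minus_left)
   (simp add: algebra_simps)
 also have "... = (real l + real CARD('n) - 1) *r ((gmom (nsq y) (Suc l) (Suc n) * Z) *r ?N y)"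
  unfolding s[symmetric] scaleR_scaleR by (simp only: mult_ac)
 finally show ?thesis unfolding gint_inner_harmonic[OF H] Z_def .
qed

lemma continuous_wedge: "continuous_on UNIV f ==> continuous_on UNIV (%x. cl_wedge x y \<odot> f x)"
 unfolding cl_wedge_mult
 by (intro continuous_on_diff continuous_on_minus bounded_bilinear.continuous_on[OF bounded_bilinear_cl_mult]
   continuous_on_const linear_continuous_on[OF bounded_linear_cl_vec] continuous_on_scaleR continuous_on_inner continuous_on_id)

text \<open>Both integrands are homogeneous of degree n + 1 + k, so the same radial factor divides
  out.\<close>

lemma sint_wedge_of_gint:
 fixes f :: "'n::{finite,linorder} point => _"
 assumes h: "hpoly k f"
  and G: "real (Suc n) *r gint (%x. cl_wedge x y \<odot> ((x \<bullet> y) ^ n *r f x)) = \<tau> *r gint (%x. (x \<bullet> y) ^ Suc n *r f x)"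
 shows "real (Suc n) *r sint (%x. cl_wedge x y \<odot> ((x \<bullet> y) ^ n *r f x)) = \<tau> *r sint (%x. (x \<bullet> y) ^ Suc n *r f x)"
proof -
 let ?r = "rad_gauss CARD('n) (Suc n + k)"
 have "gint (%x. (x \<bullet> y) ^ Suc n *r f x) = ?r *r sint (%x. (x \<bullet> y) ^ Suc n *r f x)"
  by (rule gint_polar_hpoly[OF hpoly_inner_power[OF h]])
 moreover have "gint (%x. cl_wedge x y \<odot> ((x \<bullet> y) ^ n *r f x)) = ?r *r sint (%x. cl_wedge x y \<odot> ((x \<bullet> y) ^ n *r f x))"
 proof (rule gint_polar)
  show "continuous_on UNIV (%x. cl_wedge x y \<odot> ((x \<bullet> y) ^ n *r f x))"
   by (rule continuous_wedge[OF hpoly_continuous[OF hpoly_inner_power[OF h]]])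
  fix t :: real and x
  show "cl_wedge (t *r x) y \<odot> (((t *r x) \<bullet> y) ^ n *r f (t *r x)) = t ^ (Suc n + k) *r (cl_wedge x y \<odot> ((x \<bullet> y) ^ n *r f x))"
   unfolding cl_wedge_mult hpoly_scale_arg[OF h]
   by (simp add: cl_vec_scaleR cl_mult_scaleR_left cl_mult_scaleR_right power_mult_distrib power_add scaleR_diff_right mult_ac)
 qed
 ultimately have "?r *r (real (Suc n) *r sint (%x. cl_wedge x y \<odot> ((x \<bullet> y) ^ n *r f x)))
   = ?r *r (\<tau> *r sint (%x. (x \<bullet> y) ^ Suc n *r f x))"
  using G by (simp only: scaleR_left_commute[of ?r])
 moreover have "?r ~= 0" using rad_gauss_pos[of "CARD('n)" "Suc n + k"] by simp
 ultimately show ?thesis by (simp only: scaleR_cancel_left) simp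
qed

text \<open>An N-th finite difference annihilates a polynomial of degree r < N. The induction takes
  one difference by Pascal's rule.\<close>

lemma alternating_sum_gbinomial:
 fixes x :: real
 shows "r < N ==> (\<Sum>j\<le>N. (-1) ^ j * real (N choose j) * ((x - real j) gchoose r)) = 0"
proof (induction N arbitrary: x r)
 case (Suc N)
 define f where "f j = ((x - real j) gchoose r)" for j
 have "(\<Sum>j\<le>Suc N. (-1) ^ j * real (Suc N choose j) * f j)
   = f 0 + (\<Sum>j\<le>N. (-1) ^ Suc j * real (N choose Suc j) * f (Suc j)) + (\<Sum>j\<le>N. (-1) ^ Suc j * real (N choose j) * f (Suc j))"
  unfolding sum.atMost_Suc_shift by (simp add: sum.distrib[symmetric] algebra_simps)
 also have "f 0 + (\<Sum>j\<le>N. (-1) ^ Suc j * real (N choose Suc j) * f (Suc j)) = (\<Sum>j\<le>Suc N. (-1) ^ j * real (N choose j) * f j)"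
  unfolding sum.atMost_Suc_shift by simp
 also have "... = (\<Sum>j\<le>N. (-1) ^ j * real (N choose j) * f j)" by (simp add: binomial_eq_0)
 finally have e: "(\<Sum>j\<le>Suc N. (-1) ^ j * real (Suc N choose j) * f j) = (\<Sum>j\<le>N. (-1) ^ j * real (N choose j) * (f j - f (Suc j)))"
  by (simp add: sum.distrib[symmetric] algebra_simps sum_subtractf)
 show ?case
 proof (cases r)
  case 0
  then show ?thesis using e by (simp add: f_def)
 next
  case (Suc r')
  have "f j - f (Suc j) = ((x - 1) - real j gchoose r')" for j
   using gbinomial_Suc_Suc[of "x - 1 - real j" r'] by (simp add: f_def Suc diff_diff_eq algebra_simps)
  then show ?thesis using e Suc.IH[of r' "x - 1"] Suc.prems Suc by (simp add: f_def)
 qed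
qed simp

text \<open>The Pochhammer symbol of kp of positive length has the factor kp. Taking it out leaves a
  coefficient that is regular at kp = 0.\<close>

definition gegen_coeff :: "nat => real => nat => real" where
 "gegen_coeff k kp j = (-1) ^ j * pochhammer (kp + 1) (k - j - 1) / (fact j * fact (k - 2 * j)) * 2 ^ (k - 2 * j)"

text \<open>\<open>C\<^sub>k\<^sup>\<kappa>(w) / \<kappa>\<close>, including the limit \<open>\<kappa> = 0\<close>.\<close>

definition gegen_quot :: "nat => real => real => real" where
 "gegen_quot k kp w = (\<Sum>j\<le>k div 2. gegen_coeff k kp j * w ^ (k - 2 * j))"

lemma gegenbauer_quot:
 assumes "k > 0"
 shows "gegenbauer k kp w = kp * gegen_quot k kp w"
 unfolding gegenbauer_def gegen_quot_def sum_distrib_left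
proof (rule sum.cong[OF refl])
 fix j assume "j \<in> {..k div 2}"
 then have "k - j = Suc (k - j - 1)" using assms by auto
 then have "pochhammer kp (k - j) = kp * pochhammer (kp + 1) (k - j - 1)" by (metis pochhammer_rec)
 then show "(-1) ^ j * pochhammer kp (k - j) / (fact j * fact (k - 2 * j)) * (2 * w) ^ (k - 2 * j)
   = kp * (gegen_coeff k kp j * w ^ (k - 2 * j))"
  by (simp add: gegen_coeff_def power_mult_distrib)
qed

lemma gegen_quot_tendsto: "((%\<mu>. gegen_quot k \<mu> w) \<longlongrightarrow> gegen_quot k 0 w) (at 0)"
 unfolding gegen_quot_def gegen_coeff_def pochhammer_prod by (intro tendsto_intros) auto

text \<open>One formula for every kp, the limit at kp = 0 included, so that m = 2 is covered from
  here on. Degree 0 is apart because C_0 = 1 has no factor kp.\<close>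

lemma gegen_a_eq: "k > 0 ==> gegen_a k kp w = (real k + 2 * kp) / 2 * gegen_quot k kp w"
proof (cases "kp = 0")
 case True
 assume k: "k > 0"
 have "((%\<mu>. (real k + 2 * \<mu>) / 2 * gegen_quot k \<mu> w) \<longlongrightarrow> (real k + 2 * 0) / 2 * gegen_quot k 0 w) (at 0)"
  by (intro tendsto_intros gegen_quot_tendsto) auto
 moreover have "\<forall>\<^sub>F \<mu> in at 0. (real k + 2 * \<mu>) / 2 * gegen_quot k \<mu> w = (real k + 2 * \<mu>) / (2 * \<mu>) * gegenbauer k \<mu> w"
  by (rule eventually_at_topological[THEN iffD2], rule exI[of _ UNIV]) (auto simp: gegenbauer_quot[OF k])
 ultimately have "((%\<mu>. (real k + 2 * \<mu>) / (2 * \<mu>) * gegenbauer k \<mu> w) \<longlongrightarrow> (real k + 2 * 0) / 2 * gegen_quot k 0 w) (at 0)"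
  by (rule Lim_transform_eventually)
 then show ?thesis using True by (simp add: gegen_a_def tendsto_Lim)
qed (simp add: gegen_a_def gegenbauer_quot)

lemma gegen_b_eq: "k > 0 ==> gegen_b k kp w = real k * gegen_quot k kp w"
proof (cases "kp = 0")
 case True
 assume k: "k > 0"
 have "((%\<mu>. real k * gegen_quot k \<mu> w) \<longlongrightarrow> real k * gegen_quot k 0 w) (at 0)"
  by (intro tendsto_intros gegen_quot_tendsto)
 moreover have "\<forall>\<^sub>F \<mu> in at 0. real k * gegen_quot k \<mu> w = real k / \<mu> * gegenbauer k \<mu> w"
  by (rule eventually_at_topological[THEN iffD2], rule exI[of _ UNIV]) (auto simp: gegenbauer_quot[OF k])
 ultimately have "((%\<mu>. real k / \<mu> * gegenbauer k \<mu> w) \<longlongrightarrow> real k * gegen_quot k 0 w) (at 0)"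
  by (rule Lim_transform_eventually)
 then show ?thesis using True by (simp add: gegen_b_def tendsto_Lim)
qed (simp add: gegen_b_def gegenbauer_quot)

lemma gegen_a_0: "gegen_a 0 kp w = 1"
proof (cases "kp = 0")
 case True
 have "((%\<mu>. (real 0 + 2 * \<mu>) / (2 * \<mu>) * gegenbauer 0 \<mu> w) \<longlongrightarrow> 1) (at 0)"
  by (rule Lim_transform_eventually[OF tendsto_const], rule eventually_at_topological[THEN iffD2], rule exI[of _ UNIV])
   (auto simp: gegenbauer_def)
 then show ?thesis using True by (simp add: gegen_a_def tendsto_Lim)
qed (simp add: gegen_a_def gegenbauer_def)

lemma gegen_b_0: "gegen_b 0 kp w = 0"
 by (simp add: gegen_b_def tendsto_Lim)

text \<open>The derivative rule for Gegenbauer polynomials: the left side is half the derivative of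
  \<open>gegen_quot k kp\<close>. The index set drops the constant term, which occurs for even
  k.\<close>

lemma gegenbauer_deriv:
 assumes k: "k > 0"
 shows "gegenbauer (k - 1) (kp + 1) w = (\<Sum>j\<in>{j. 2 * j < k}. gegen_coeff k kp j * (real (k - 2 * j) / 2) * w ^ (k - 2 * j - 1))"
 unfolding gegenbauer_def
proof (rule sum.cong)
 show "{..(k - 1) div 2} = {j. 2 * j < k}" using k by auto
 fix j assume "j \<in> {j. 2 * j < k}"
 then obtain i where i: "k - 2 * j = Suc i" "k - 1 - 2 * j = i" "k - 2 * j - 1 = i"
  by (metis Suc_diff_1 diff_commute mem_Collect_eq zero_less_diff)
 show "(-1) ^ j * pochhammer (kp + 1) (k - 1 - j) / (fact j * fact (k - 1 - 2 * j)) * (2 * w) ^ (k - 1 - 2 * j)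
   = gegen_coeff k kp j * (real (k - 2 * j) / 2) * w ^ (k - 2 * j - 1)"
  unfolding gegen_coeff_def i by (simp add: power_mult_distrib diff_commute[of k 1 j] del: of_nat_Suc)
qed

text \<open>For k = l + 2 N the summand is (-1)^j (N choose j) times a polynomial in j of degree N -
  1 when N > 0, so the sum is an N-th difference and vanishes. Only N = 0 remains.\<close>

lemma gegen_moment_sum:
 assumes m: "m > 0" and k: "k > 0"
 shows "(\<Sum>j\<le>k div 2. gegen_coeff k (lam m) j * smom m l (k - 2 * j)) = (if k = l then 1 / (real k + lam m) else 0)"
proof -
 define a where "a = lam m + 1"
 have a: "real m / 2 = a" "a > 0" using m by (simp_all add: a_def lam_def field_simps)
 have p: "pochhammer a n > 0" for n by (rule pochhammer_pos[OF a(2)])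
 show ?thesis
 proof (cases "l <= k \<and> even (k - l)")
  case False
  have "smom m l (k - 2 * j) = 0" if "j <= k div 2" for j
  proof -
   from that have j: "2 * j <= k" by simp
   have "\<not> (l <= k - 2 * j \<and> even (k - 2 * j - l))"
   proof
    assume *: "l <= k - 2 * j \<and> even (k - 2 * j - l)"
    have "even (k - l)"
    proof -
     have "k - l = (k - 2 * j - l) + 2 * j" using conjunct1[OF *] j by arith
     then show ?thesis using * by simp
    qed
    then show False using False * by auto
   qed
   then show ?thesis by (auto simp: smom_def)
  qed
  then show ?thesis using False by auto
 next
  case True
  then obtain N where N: "k = l + 2 * N" by (metis dvdE le_add_diff_inverse)
  have "(\<Sum>j\<le>k div 2. gegen_coeff k (lam m) j * smom m l (k - 2 * j))
    = (\<Sum>j\<le>N. gegen_coeff k (lam m) j * smom m l (k - 2 * j))"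
  proof (rule sum.mono_neutral_right)
   show "\<forall>j\<in>{..k div 2} - {..N}. gegen_coeff k (lam m) j * smom m l (k - 2 * j) = 0"
    by (auto simp: smom_def N)
  qed (auto simp: N)
  also have "... = (\<Sum>j\<le>N. ((-1) ^ j * (N choose j)) * (pochhammer a (k - j - 1) / pochhammer a (k - N - j)) / fact N)"
  proof (rule sum.cong[OF refl])
   fix j assume "j \<in> {..N}"
   then have j: "j <= N" by simp
   have 1: "l <= k - 2 * j" "k - 2 * j - l = 2 * (N - j)" "l + (N - j) = k - N - j" using j N by auto
   have 2: "real (N choose j) = fact N / (fact j * fact (N - j))" using j by (rule binomial_fact)
   show "gegen_coeff k (lam m) j * smom m l (k - 2 * j) = ((-1) ^ j * (N choose j)) * (pochhammer a (k - j - 1) / pochhammer a (k - N - j)) / fact N"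
    unfolding gegen_coeff_def smom_def a(1) a_def[symmetric] using 1 2 by simp
  qed
  also have "... = (if k = l then 1 / (real k + lam m) else 0)"
  proof (cases N)
   case 0
   then have "k = l" using N by simp
   moreover have "pochhammer a k = pochhammer a (k - 1) * (real k + lam m)"
    using k pochhammer_Suc[of a "k - 1"] by (simp add: a_def of_nat_diff algebra_simps)
   ultimately show ?thesis using 0 p[of "k - 1"] by simp
  next
   case (Suc r)
   have "((-1) ^ j * (N choose j)) * (pochhammer a (k - j - 1) / pochhammer a (k - N - j)) / fact N
     = fact r / fact N * ((-1) ^ j * real (N choose j) * (((a + real k - 2) - real j) gchoose r))" if j: "j <= N" for j
   proof -
    have "k - N - j <= k - j - 1" "k - j - 1 - (k - N - j) = r" using j N Suc k by auto
    then have "pochhammer a (k - j - 1) = pochhammer a (k - N - j) * pochhammer (a + real (k - N - j)) r"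
     using pochhammer_product[of "k - N - j" "k - j - 1" a] by simp
    moreover have "((a + real k - 2) - real j) gchoose r = pochhammer (a + real (k - N - j)) r / fact r"
     unfolding gbinomial_pochhammer' using j N Suc by (simp add: algebra_simps of_nat_diff)
    ultimately show ?thesis using p[of "k - N - j"] by simp
   qed
   then have "(\<Sum>j\<le>N. ((-1) ^ j * (N choose j)) * (pochhammer a (k - j - 1) / pochhammer a (k - N - j)) / fact N)
     = fact r / fact N * (\<Sum>j\<le>N. (-1) ^ j * real (N choose j) * (((a + real k - 2) - real j) gchoose r))"
    unfolding sum_distrib_left by (intro sum.cong refl) auto
   also have "... = 0" using alternating_sum_gbinomial[of r N "a + real k - 2"] Suc by simp
   finally show ?thesis using Suc N by simp
  qed
  finally show ?thesis .
 qed
qed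

section \<open>Gegenbauer polynomials against harmonics on the sphere\<close>

lemma sint_gegen_quot:
 assumes f: "harmonic l f" and \<eta>: "norm (\<eta> :: 'n::{finite,linorder} point) = 1" and k: "k > 0"
 shows "sint (%\<xi>. gegen_quot k (lam CARD('n)) (\<xi> \<bullet> \<eta>) *r f \<xi>)
  = (if k = l then sphere_area CARD('n) / (real k + lam CARD('n)) else 0) *r f \<eta>"
proof -
 let ?m = "CARD('n)"
 have int: "integrable sphere_measure (%\<xi>. (\<xi> \<bullet> \<eta>) ^ n *r f \<xi>)" for n
  by (rule sphere_integrable[OF hpoly_continuous[OF hpoly_inner_power[OF harmonic_hpoly[OF f]]]])
 have "sint (%\<xi>. gegen_quot k (lam ?m) (\<xi> \<bullet> \<eta>) *r f \<xi>)
   = sint (%\<xi>. \<Sum>j\<le>k div 2. gegen_coeff k (lam ?m) j *r ((\<xi> \<bullet> \<eta>) ^ (k - 2 * j) *r f \<xi>))"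
  by (simp add: gegen_quot_def scaleR_left.sum)
 also have "... = (\<Sum>j\<le>k div 2. sint (%\<xi>. gegen_coeff k (lam ?m) j *r ((\<xi> \<bullet> \<eta>) ^ (k - 2 * j) *r f \<xi>)))"
  by (rule Bochner_Integration.integral_sum) (intro integrable_scaleR_right int)
 also have "... = (\<Sum>j\<le>k div 2. gegen_coeff k (lam ?m) j *r sint (%\<xi>. (\<xi> \<bullet> \<eta>) ^ (k - 2 * j) *r f \<xi>))"
  by (simp only: integral_scaleR_right)
 also have "... = (sphere_area ?m * (\<Sum>j\<le>k div 2. gegen_coeff k (lam ?m) j * smom ?m l (k - 2 * j))) *r f \<eta>"
  unfolding sphere_moment[OF f \<eta>] sum_distrib_left scaleR_left.sum by (simp add: mult_ac)
 finally show ?thesis unfolding gegen_moment_sum[OF zero_less_card_finite k] by simp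
qed

text \<open>By \<open>W\<close> each power in the derivative of \<open>gegen_quot\<close> is traded
  for the power one higher, times \<tau>. To complete the sum of \<open>gegen_moment_sum\<close> the
  constant term is added back: its moment is 0 for L > 0, and \<open>L0\<close> covers L =
  0.\<close>

lemma sint_wedge_gegenbauer:
 assumes h: "harmonic L f" and \<eta>: "norm (\<eta> :: 'n::{finite,linorder} point) = 1" and k: "k > 0" and L0: "L = 0 ==> \<tau> = 0"
  and W: "!!n. real (Suc n) *r sint (%x. cl_wedge x \<eta> \<odot> ((x \<bullet> \<eta>) ^ n *r f x)) = \<tau> *r sint (%x. (x \<bullet> \<eta>) ^ Suc n *r f x)"
 shows "sint (%\<xi>. gegenbauer (k - 1) (lam CARD('n) + 1) (\<xi> \<bullet> \<eta>) *r (cl_wedge \<xi> \<eta> \<odot> f \<xi>))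
  = (if k = L then \<tau> * sphere_area CARD('n) / (2 * (real k + lam CARD('n))) else 0) *r f \<eta>"
proof -
 let ?m = "CARD('n)" and ?J = "{j. 2 * j < k}"
 have fin: "finite ?J" by (rule finite_subset[of _ "{..k}"]) auto
 have int: "integrable sphere_measure (%\<xi>. cl_wedge \<xi> \<eta> \<odot> ((\<xi> \<bullet> \<eta>) ^ n *r f \<xi>))" for n
  by (rule sphere_integrable[OF continuous_wedge[OF hpoly_continuous[OF hpoly_inner_power[OF harmonic_hpoly[OF h]]]]])
 have "sint (%\<xi>. gegenbauer (k - 1) (lam ?m + 1) (\<xi> \<bullet> \<eta>) *r (cl_wedge \<xi> \<eta> \<odot> f \<xi>))
   = sint (%\<xi>. \<Sum>j\<in>?J. (gegen_coeff k (lam ?m) j * (real (k - 2 * j) / 2)) *r (cl_wedge \<xi> \<eta> \<odot> ((\<xi> \<bullet> \<eta>) ^ (k - 2 * j - 1) *r f \<xi>)))"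
  unfolding gegenbauer_deriv[OF k] by (simp add: scaleR_left.sum cl_mult_scaleR_right)
 also have "... = (\<Sum>j\<in>?J. (gegen_coeff k (lam ?m) j * (real (k - 2 * j) / 2)) *r sint (%\<xi>. cl_wedge \<xi> \<eta> \<odot> ((\<xi> \<bullet> \<eta>) ^ (k - 2 * j - 1) *r f \<xi>)))"
  by (subst Bochner_Integration.integral_sum) (auto intro!: integrable_scaleR_right int)
 also have "... = (\<Sum>j\<in>?J. (\<tau> / 2 * sphere_area ?m * (gegen_coeff k (lam ?m) j * smom ?m L (k - 2 * j))) *r f \<eta>)"
 proof (rule sum.cong[OF refl])
  fix j assume "j \<in> ?J"
  then obtain i where i: "k - 2 * j = Suc i" by (metis Suc_diff_1 mem_Collect_eq zero_less_diff)
  have "(gegen_coeff k (lam ?m) j * (real (Suc i) / 2)) *r sint (%\<xi>. cl_wedge \<xi> \<eta> \<odot> ((\<xi> \<bullet> \<eta>) ^ i *r f \<xi>))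
    = (gegen_coeff k (lam ?m) j / 2) *r (real (Suc i) *r sint (%\<xi>. cl_wedge \<xi> \<eta> \<odot> ((\<xi> \<bullet> \<eta>) ^ i *r f \<xi>)))"
   by (simp del: of_nat_Suc)
  also have "... = (\<tau> / 2 * sphere_area ?m * (gegen_coeff k (lam ?m) j * smom ?m L (Suc i))) *r f \<eta>"
   unfolding W sphere_moment[OF h \<eta>] by (simp add: mult_ac)
  finally show "(gegen_coeff k (lam ?m) j * (real (k - 2 * j) / 2)) *r sint (%\<xi>. cl_wedge \<xi> \<eta> \<odot> ((\<xi> \<bullet> \<eta>) ^ (k - 2 * j - 1) *r f \<xi>))
    = (\<tau> / 2 * sphere_area ?m * (gegen_coeff k (lam ?m) j * smom ?m L (k - 2 * j))) *r f \<eta>"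
   unfolding i diff_Suc_1 .
 qed
 also have "... = (\<Sum>j\<le>k div 2. (\<tau> / 2 * sphere_area ?m * (gegen_coeff k (lam ?m) j * smom ?m L (k - 2 * j))) *r f \<eta>)"
 proof (rule sum.mono_neutral_left)
  show "\<forall>j\<in>{..k div 2} - ?J. (\<tau> / 2 * sphere_area ?m * (gegen_coeff k (lam ?m) j * smom ?m L (k - 2 * j))) *r f \<eta> = 0"
  proof
   fix j assume "j \<in> {..k div 2} - ?J"
   then have "k - 2 * j = 0" by auto
   then show "(\<tau> / 2 * sphere_area ?m * (gegen_coeff k (lam ?m) j * smom ?m L (k - 2 * j))) *r f \<eta> = 0"
    using L0 by (cases "L = 0") (auto simp: smom_def)
  qed
 qed auto
 also have "... = (\<tau> / 2 * sphere_area ?m * (\<Sum>j\<le>k div 2. gegen_coeff k (lam ?m) j * smom ?m L (k - 2 * j))) *r f \<eta>"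
  unfolding sum_distrib_left scaleR_left.sum ..
 also have "\<tau> / 2 * sphere_area ?m * (\<Sum>j\<le>k div 2. gegen_coeff k (lam ?m) j * smom ?m L (k - 2 * j))
   = (if k = L then \<tau> * sphere_area ?m / (2 * (real k + lam ?m)) else 0)"
 proof -
  have r: "\<tau> / 2 * s * (1 / D) = \<tau> * s / (2 * D)" for s D :: real by simp
  show ?thesis unfolding gegen_moment_sum[OF zero_less_card_finite k] using r by (cases "k = L") simp_all
 qed
 finally show ?thesis .
qed

text \<open>Up to the factor \<open>sphere_area\<close>, \<open>zonal_p k\<close> and
  \<open>zonal_m k\<close> are the reproducing kernels on the sphere of the monogenics of degree k
  and of x times those of degree k - 1, applied to a Clifford value. The case k = 0 guards the
  truncated \<open>k - 1\<close>.\<close>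

definition zonal_p :: "nat => 'n point => 'n point => 'n::{finite,linorder} cliff => 'n cliff" where
 "zonal_p k \<xi> \<eta> a = gegen_a k (lam CARD('n)) (\<xi> \<bullet> \<eta>) *r a
   - (if k = 0 then 0 else gegenbauer (k - 1) (lam CARD('n) + 1) (\<xi> \<bullet> \<eta>) *r (cl_wedge \<xi> \<eta> \<odot> a))"

definition zonal_m :: "nat => 'n point => 'n point => 'n::{finite,linorder} cliff => 'n cliff" where
 "zonal_m k \<xi> \<eta> a = (gegen_b k (lam CARD('n)) (\<xi> \<bullet> \<eta>) / 2) *r a
   + (if k = 0 then 0 else gegenbauer (k - 1) (lam CARD('n) + 1) (\<xi> \<bullet> \<eta>) *r (cl_wedge \<xi> \<eta> \<odot> a))"

lemma continuous_gegen:
 "continuous_on UNIV (%\<xi>. gegen_quot k kp (\<xi> \<bullet> \<eta>))" "continuous_on UNIV (%\<xi>. gegenbauer k kp (\<xi> \<bullet> \<eta>))"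
 unfolding gegen_quot_def gegenbauer_def by (intro continuous_intros; simp)+

text \<open>\<tau> is the wedge eigenvalue: -k for a monogenic of degree k, and k + 2 lam for x M of
  degree k. For k > 0 the two quotients below are then 1 and 0, respectively 0 and 1.\<close>

lemma zonal_aux:
 assumes h: "harmonic L f" and \<eta>: "norm (\<eta> :: 'n::{finite,linorder} point) = 1" and L0: "L = 0 ==> \<tau> = 0"
  and W: "!!n. real (Suc n) *r sint (%x. cl_wedge x \<eta> \<odot> ((x \<bullet> \<eta>) ^ n *r f x)) = \<tau> *r sint (%x. (x \<bullet> \<eta>) ^ Suc n *r f x)"
  and m: "CARD('n) \<ge> 2"
 shows "integrable sphere_measure (%\<xi>. zonal_p k \<xi> \<eta> (f \<xi>))" "integrable sphere_measure (%\<xi>. zonal_m k \<xi> \<eta> (f \<xi>))"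
  "sint (%\<xi>. zonal_p k \<xi> \<eta> (f \<xi>)) = (if k = L then sphere_area CARD('n) * (if k = 0 then 1 else (real k + 2 * lam CARD('n) - \<tau>) / (2 * (real k + lam CARD('n)))) else 0) *r f \<eta>"
  "sint (%\<xi>. zonal_m k \<xi> \<eta> (f \<xi>)) = (if k = L \<and> k ~= 0 then sphere_area CARD('n) * ((real k + \<tau>) / (2 * (real k + lam CARD('n)))) else 0) *r f \<eta>"
proof -
 let ?m = "CARD('n)" and ?l = "lam CARD('n)"
 note hp = harmonic_hpoly[OF h]
 have i1: "integrable sphere_measure (%\<xi>. gegen_quot k ?l (\<xi> \<bullet> \<eta>) *r f \<xi>)"
  by (intro sphere_integrable continuous_on_scaleR continuous_gegen hpoly_continuous[OF hp])
 have i2: "integrable sphere_measure (%\<xi>. gegenbauer (k - 1) (?l + 1) (\<xi> \<bullet> \<eta>) *r (cl_wedge \<xi> \<eta> \<odot> f \<xi>))"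
  by (intro sphere_integrable continuous_on_scaleR continuous_gegen continuous_wedge hpoly_continuous[OF hp])
 have i0: "integrable sphere_measure f" by (rule sphere_integrable[OF hpoly_continuous[OF hp]])
 have lam: "?l \<ge> 0" using m by (simp add: lam_def)
 consider "k = 0" | "k > 0" by blast
 then have "integrable sphere_measure (%\<xi>. zonal_p k \<xi> \<eta> (f \<xi>)) \<and> integrable sphere_measure (%\<xi>. zonal_m k \<xi> \<eta> (f \<xi>))
  \<and> sint (%\<xi>. zonal_p k \<xi> \<eta> (f \<xi>)) = (if k = L then sphere_area ?m * (if k = 0 then 1 else (real k + 2 * ?l - \<tau>) / (2 * (real k + ?l))) else 0) *r f \<eta>
  \<and> sint (%\<xi>. zonal_m k \<xi> \<eta> (f \<xi>)) = (if k = L \<and> k ~= 0 then sphere_area ?m * ((real k + \<tau>) / (2 * (real k + ?l))) else 0) *r f \<eta>"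
 proof cases
  case 1
  have "sint f = (if L = 0 then sphere_area ?m else 0) *r f \<eta>"
   using sphere_moment[OF h \<eta>, of 0] by (simp add: smom_def)
  then show ?thesis using 1 i0 by (auto simp: zonal_p_def zonal_m_def gegen_a_0 gegen_b_0)
 next
  case 2
  have p: "(%\<xi>. zonal_p k \<xi> \<eta> (f \<xi>)) = (%\<xi>. ((real k + 2 * ?l) / 2) *r (gegen_quot k ?l (\<xi> \<bullet> \<eta>) *r f \<xi>)
    - gegenbauer (k - 1) (?l + 1) (\<xi> \<bullet> \<eta>) *r (cl_wedge \<xi> \<eta> \<odot> f \<xi>))"
   and q: "(%\<xi>. zonal_m k \<xi> \<eta> (f \<xi>)) = (%\<xi>. (real k / 2) *r (gegen_quot k ?l (\<xi> \<bullet> \<eta>) *r f \<xi>)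
    + gegenbauer (k - 1) (?l + 1) (\<xi> \<bullet> \<eta>) *r (cl_wedge \<xi> \<eta> \<odot> f \<xi>))"
   using 2 by (simp_all add: zonal_p_def zonal_m_def gegen_a_eq gegen_b_eq)
  have W': "sint (%\<xi>. gegenbauer (k - 1) (?l + 1) (\<xi> \<bullet> \<eta>) *r (cl_wedge \<xi> \<eta> \<odot> f \<xi>))
    = (if k = L then \<tau> * sphere_area ?m / (2 * (real k + ?l)) else 0) *r f \<eta>"
   by (rule sint_wedge_gegenbauer[OF h \<eta> 2 _ W]) (rule L0)
  note S = sint_gegen_quot[OF h \<eta> 2] W'
  have r: "p / 2 * (s / D) - t * s / (2 * D) = s * ((p - t) / (2 * D))" "p / 2 * (s / D) + t * s / (2 * D) = s * ((p + t) / (2 * D))"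
   for p s D t :: real by (simp_all add: field_simps add_divide_distrib diff_divide_distrib)
  have "integrable sphere_measure (%\<xi>. zonal_p k \<xi> \<eta> (f \<xi>))" "integrable sphere_measure (%\<xi>. zonal_m k \<xi> \<eta> (f \<xi>))"
   unfolding p q by (intro Bochner_Integration.integrable_diff Bochner_Integration.integrable_add integrable_scaleR_right i1 i2)+
  moreover have "sint (%\<xi>. zonal_p k \<xi> \<eta> (f \<xi>)) = ((real k + 2 * ?l) / 2) *r sint (%\<xi>. gegen_quot k ?l (\<xi> \<bullet> \<eta>) *r f \<xi>)
    - sint (%\<xi>. gegenbauer (k - 1) (?l + 1) (\<xi> \<bullet> \<eta>) *r (cl_wedge \<xi> \<eta> \<odot> f \<xi>))"
   unfolding p by (simp only: Bochner_Integration.integral_diff[OF integrable_scaleR_right[OF i1] i2] integral_scaleR_right)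
  moreover have "sint (%\<xi>. zonal_m k \<xi> \<eta> (f \<xi>)) = (real k / 2) *r sint (%\<xi>. gegen_quot k ?l (\<xi> \<bullet> \<eta>) *r f \<xi>)
    + sint (%\<xi>. gegenbauer (k - 1) (?l + 1) (\<xi> \<bullet> \<eta>) *r (cl_wedge \<xi> \<eta> \<odot> f \<xi>))"
   unfolding q by (simp only: Bochner_Integration.integral_add[OF integrable_scaleR_right[OF i1] i2] integral_scaleR_right)
  ultimately show ?thesis unfolding S scaleR_scaleR scaleR_left_diff_distrib[symmetric] scaleR_left_distrib[symmetric]
   using 2 by (cases "k = L") (simp_all only: r if_True if_False HOL.simp_thms mult_zero_right diff_0_right add_0_right less_numeral_extra(3), simp_all)
 qed
 then show "integrable sphere_measure (%\<xi>. zonal_p k \<xi> \<eta> (f \<xi>))" "integrable sphere_measure (%\<xi>. zonal_m k \<xi> \<eta> (f \<xi>))"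
  "sint (%\<xi>. zonal_p k \<xi> \<eta> (f \<xi>)) = (if k = L then sphere_area CARD('n) * (if k = 0 then 1 else (real k + 2 * lam CARD('n) - \<tau>) / (2 * (real k + lam CARD('n)))) else 0) *r f \<eta>"
  "sint (%\<xi>. zonal_m k \<xi> \<eta> (f \<xi>)) = (if k = L \<and> k ~= 0 then sphere_area CARD('n) * ((real k + \<tau>) / (2 * (real k + lam CARD('n)))) else 0) *r f \<eta>"
  by simp_all
qed

lemma
 fixes f :: "'n::{finite,linorder} point => _"
 assumes f: "monogenic l f" and \<eta>: "norm \<eta> = 1" and m: "CARD('n) \<ge> 2"
 shows zonal_monogenic_integrable: "integrable sphere_measure (%\<xi>. zonal_p k \<xi> \<eta> (f \<xi>))" "integrable sphere_measure (%\<xi>. zonal_m k \<xi> \<eta> (f \<xi>))"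
  and zonal_p_monogenic: "sint (%\<xi>. zonal_p k \<xi> \<eta> (f \<xi>)) = (if k = l then sphere_area CARD('n) else 0) *r f \<eta>"
  and zonal_m_monogenic: "sint (%\<xi>. zonal_m k \<xi> \<eta> (f \<xi>)) = 0"
proof -
 have h: "hpoly l f" using f by (simp add: monogenic_def)
 have lam: "lam CARD('n) \<ge> 0" using m by (simp add: lam_def)
 note Z = zonal_aux[OF monogenic_harmonic[OF f] \<eta> _ sint_wedge_of_gint[OF h gint_wedge_monogenic[OF f]] m, of k]
 show "integrable sphere_measure (%\<xi>. zonal_p k \<xi> \<eta> (f \<xi>))" "integrable sphere_measure (%\<xi>. zonal_m k \<xi> \<eta> (f \<xi>))"
  using Z(1,2) by auto
 show "sint (%\<xi>. zonal_p k \<xi> \<eta> (f \<xi>)) = (if k = l then sphere_area CARD('n) else 0) *r f \<eta>"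
  using Z(3) lam by (cases "k = l"; cases "l = 0") (auto simp: field_simps)
 show "sint (%\<xi>. zonal_m k \<xi> \<eta> (f \<xi>)) = 0"
  using Z(4) by auto
qed

lemma
 fixes f :: "'n::{finite,linorder} point => _"
 assumes f: "monogenic l f" and \<eta>: "norm \<eta> = 1" and m: "CARD('n) \<ge> 2"
 shows zonal_vec_monogenic_integrable: "integrable sphere_measure (%\<xi>. zonal_p k \<xi> \<eta> (cl_vec \<xi> \<odot> f \<xi>))" "integrable sphere_measure (%\<xi>. zonal_m k \<xi> \<eta> (cl_vec \<xi> \<odot> f \<xi>))"
  and zonal_p_vec_monogenic: "sint (%\<xi>. zonal_p k \<xi> \<eta> (cl_vec \<xi> \<odot> f \<xi>)) = 0"
  and zonal_m_vec_monogenic: "sint (%\<xi>. zonal_m k \<xi> \<eta> (cl_vec \<xi> \<odot> f \<xi>)) = (if k = Suc l then sphere_area CARD('n) else 0) *r (cl_vec \<eta> \<odot> f \<eta>)"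
proof -
 have h: "hpoly l f" using f by (simp add: monogenic_def)
 have lam: "real CARD('n) = 2 * lam CARD('n) + 2" "lam CARD('n) \<ge> 0" using m by (simp_all add: lam_def field_simps)
 note Z = zonal_aux[OF monogenic_vec_harmonic[OF f] \<eta> _ sint_wedge_of_gint[OF hpoly_vec[OF h] gint_wedge_vec_monogenic[OF f]] m, of k]
 show "integrable sphere_measure (%\<xi>. zonal_p k \<xi> \<eta> (cl_vec \<xi> \<odot> f \<xi>))" "integrable sphere_measure (%\<xi>. zonal_m k \<xi> \<eta> (cl_vec \<xi> \<odot> f \<xi>))"
  using Z(1,2) by auto
 show "sint (%\<xi>. zonal_p k \<xi> \<eta> (cl_vec \<xi> \<odot> f \<xi>)) = 0"
  using Z(3) lam(1) by (cases "k = Suc l") auto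
 have "(1 + (real l + (real l + (2 * lam CARD('n) + 1)))) / (2 * (1 + real l + lam CARD('n))) = 1"
  using lam(2) by (simp add: field_simps)
 then show "sint (%\<xi>. zonal_m k \<xi> \<eta> (cl_vec \<xi> \<odot> f \<xi>)) = (if k = Suc l then sphere_area CARD('n) else 0) *r (cl_vec \<eta> \<odot> f \<eta>)"
  using Z(4) lam(1) by (cases "k = Suc l") (auto simp: algebra_simps)
qed

section \<open>Bounds for the kernel series\<close>

text \<open>Keep only the interval [X, X + 1] of the Gamma integral.\<close>

lemma Gamma_ge:
 fixes S X :: real
 assumes S: "S \<ge> 1" and X: "X \<ge> 1"
 shows "X powr (S - 1) * exp (- (X + 1)) <= Gamma S"
proof -
 have "X powr (S - 1) * exp (- (X + 1)) = (LINT t|lborel. indicator {X..X + 1} t *r (X powr (S - 1) * exp (- (X + 1))))"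
  by simp
 also have "... <= (LINT t|lborel. indicator {0<..} t * (t powr (S - 1) * exp (- 1 * t)))"
 proof (rule integral_mono)
  show "integrable lborel (%t. indicator {0<..} t * (t powr (S - 1) * exp (- 1 * t)))"
   using S by (intro integrable_powr_exp) auto
  fix t :: real
  show "indicator {X..X + 1} t *r (X powr (S - 1) * exp (- (X + 1))) <= indicator {0<..} t * (t powr (S - 1) * exp (- 1 * t))"
   using S X by (auto simp: indicator_def intro!: mult_mono powr_mono2)
 qed (auto intro!: integrable_mult_left integrable_real_indicator)
 also have "... = Gamma S" using Gamma_integral_rate[of S 1] S by simp
 finally show ?thesis .
qed

text \<open>The bound is uniform in \<open>s\<close>, which is how 1/Gamma beats every exponential.
  \<open>Gamma_ge\<close> costs exp(X + 1), and X \<le> exp X pays for the shift of the exponent; if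
  s + b < 1, Gamma is first moved up by one.\<close>

lemma powr_div_Gamma_le:
 fixes s b X :: real
 assumes s: "s \<ge> 0" and b: "b > 0" and X: "X \<ge> 1"
 shows "X powr s / Gamma (s + b) <= exp (2 * X + 1)"
proof -
 have G: "Gamma (s + b) > 0" using s b by (intro Gamma_real_pos) simp
 have Xe: "X <= exp X" using exp_ge_add_one_self[of X] X by linarith
 have "X powr s <= exp (2 * X + 1) * Gamma (s + b)"
 proof (cases "s + b \<ge> 1")
  case True
  have "X powr s <= X powr (s + b - 1) * X"
  proof -
   have "X powr s <= X powr ((s + b - 1) + 1)" using X b by (intro powr_mono) auto
   then show ?thesis using X by (simp only: powr_add) simp
  qed
  also have "... <= X powr (s + b - 1) * exp X" using Xe by (intro mult_left_mono) auto
  also have "... = exp (2 * X + 1) * (X powr (s + b - 1) * exp (- (X + 1)))"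
   by (simp add: exp_add[symmetric] mult.left_commute)
  also have "... <= exp (2 * X + 1) * Gamma (s + b)"
   by (intro mult_left_mono Gamma_ge True X) simp
  finally show ?thesis .
 next
  case False
  have "X powr s <= X powr (s + b)" using X b by (intro powr_mono) auto
  also have "... <= exp X * X powr (s + b)" using X by simp
  also have "... = exp (2 * X + 1) * (X powr ((s + b + 1) - 1) * exp (- (X + 1)))"
   by (simp add: exp_add[symmetric] mult.left_commute mult.commute)
  also have "... <= exp (2 * X + 1) * Gamma (s + b + 1)"
   using s b X by (intro mult_left_mono Gamma_ge) auto
  also have "Gamma (s + b + 1) = (s + b) * Gamma (s + b)"
   using s b by (intro Gamma_plus1) (auto dest: nonpos_Ints_nonpos)
  also have "exp (2 * X + 1) * ((s + b) * Gamma (s + b)) <= exp (2 * X + 1) * (1 * Gamma (s + b))"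
   using False G by (intro mult_left_mono mult_right_mono) auto
  finally show ?thesis by simp
 qed
 then show ?thesis using G by (simp add: pos_divide_le_eq)
qed

text \<open>Whatever the rate \<open>h\<close>, the factor h^k is beaten: powers X^(j + k a) over
  Gamma(j + k a + b) are bounded uniformly in j and k.\<close>

lemma bessel_mode_bound:
 fixes a b h \<tau> :: real
 assumes a: "a > 0" and b: "b > 0" and h: "h \<ge> 0" and \<tau>: "\<tau> \<ge> 0"
 shows "\<exists>C D. \<forall>k z x. z \<ge> 0 --> cmod x = (z * \<tau>)\<^sup>2 -->
  h ^ k * z powr (real k * a) * (\<Sum>j. norm (rGamma (of_real (real j + (real k * a + b - 1) + 1)) / fact j * x ^ j)) <= C * exp (D * z) * (1 / 2) ^ k"
proof -
 \<comment> \<open>With X = L (z + 1) in place of z, the bound 2 h \<le> L^a yields the factor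
   (1/2)^k and 2 \<tau> \<le> L yields (1/2)^j.\<close>
 define L where "L = max 1 (max (2 * \<tau>) ((2 * h) powr (1 / a)))"
 have L: "L \<ge> 1" "2 * \<tau> <= L" "2 * h <= L powr a"
 proof -
  show "L \<ge> 1" "2 * \<tau> <= L" by (auto simp: L_def)
  have "2 * h = ((2 * h) powr (1 / a)) powr a" using a h by (simp add: powr_powr)
  also have "... <= L powr a" using a by (intro powr_mono2) (auto simp: L_def)
  finally show "2 * h <= L powr a" .
 qed
 have main: "h ^ k * z powr (real k * a) * (\<Sum>j. norm (rGamma (of_real (real j + (real k * a + b - 1) + 1)) / fact j * x ^ j))
   <= 2 * exp (2 * L + 1) * exp ((\<tau> + 2 * L) * z) * (1 / 2) ^ k"
  if z: "z \<ge> 0" and x: "cmod x = (z * \<tau>)\<^sup>2" for k z and x :: complex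
 proof -
  define X where "X = L * (z + 1)"
  have X: "X \<ge> 1" using L z by (simp add: X_def) (metis mult_mono' mult_1 add_increasing order_refl zero_le_one)
  let ?B = "exp (z * \<tau>) * exp (2 * X + 1) * (1 / 2) ^ k"
  let ?t = "%j. norm (rGamma (of_real (real j + (real k * a + b - 1) + 1)) / fact j * x ^ j)"
  have bound_term: "h ^ k * z powr (real k * a) * ?t j <= ?B * (1 / 2) ^ j" for j
  proof -
   define s where "s = real j + real k * a"
   have s: "s \<ge> 0" using a by (simp add: s_def)
   have G: "Gamma (s + b) > 0" using s b by (intro Gamma_real_pos) simp
   have r: "norm (rGamma (of_real (real j + (real k * a + b - 1) + 1)) :: complex) = 1 / Gamma (s + b)"
   proof -
    have e: "real j + (real k * a + b - 1) + 1 = s + b" by (simp add: s_def)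
    show ?thesis
     unfolding e rGamma_complex_of_real norm_of_real unfolding rGamma_inverse_Gamma
     using G by (simp add: inverse_eq_divide)
   qed
   \<comment> \<open>Of the two factors (z \<tau>)^j in |x|^j one is spent on the factorial; the
     other is kept for the geometric decay in j.\<close>
   have "(z * \<tau>) ^ j / fact j <= exp (z * \<tau>)"
    using power_le_fact_exp[of "z * \<tau>" j] z \<tau> by (simp add: field_simps)
   moreover have "cmod x ^ j = (z * \<tau>) ^ j * (z * \<tau>) ^ j" unfolding x by (simp add: power2_eq_square power_mult_distrib)
   ultimately have t: "?t j <= exp (z * \<tau>) * (z * \<tau>) ^ j / Gamma (s + b)"
   proof -
    assume e: "(z * \<tau>) ^ j / fact j <= exp (z * \<tau>)" and xx: "cmod x ^ j = (z * \<tau>) ^ j * (z * \<tau>) ^ j"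
    have "?t j = ((z * \<tau>) ^ j / fact j) * (z * \<tau>) ^ j / Gamma (s + b)"
     unfolding norm_mult norm_divide norm_power r xx by simp
    also have "... <= exp (z * \<tau>) * (z * \<tau>) ^ j / Gamma (s + b)"
     using G z \<tau> by (intro divide_right_mono mult_right_mono e) auto
    finally show ?thesis .
   qed
   have "(z * \<tau>) ^ j <= (X / 2) ^ j"
   proof (rule power_mono)
    have "z * (2 * \<tau>) <= (z + 1) * L" using z L \<tau> by (intro mult_mono) auto
    then show "z * \<tau> <= X / 2" by (simp add: X_def mult_ac)
   qed (use z \<tau> in simp)
   then have 1: "(z * \<tau>) ^ j <= X powr real j * (1 / 2) ^ j"
    using X by (simp add: powr_realpow power_divide)
   have "h ^ k * z powr (real k * a) <= (L powr a / 2) ^ k * (z + 1) powr (real k * a)"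
    using L h z a by (intro mult_mono power_mono powr_mono2) auto
   also have "... = X powr (real k * a) * (1 / 2) ^ k"
   proof -
    have "(L powr a) ^ k = L powr (real k * a)"
     using L by (simp add: powr_realpow[symmetric] powr_powr mult.commute)
    moreover have "X powr (real k * a) = L powr (real k * a) * (z + 1) powr (real k * a)"
     using L z by (simp add: X_def powr_mult)
    ultimately show ?thesis by (simp add: power_divide)
   qed
   finally have 2: "h ^ k * z powr (real k * a) <= X powr (real k * a) * (1 / 2) ^ k" .
   have "h ^ k * z powr (real k * a) * ?t j
     <= (X powr (real k * a) * (1 / 2) ^ k) * (exp (z * \<tau>) * (X powr real j * (1 / 2) ^ j) / Gamma (s + b))"
   proof (rule mult_mono[OF 2])
    show "?t j <= exp (z * \<tau>) * (X powr real j * (1 / 2) ^ j) / Gamma (s + b)"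
     using G by (intro order_trans[OF t] divide_right_mono mult_left_mono 1) auto
   qed (use X in auto)
   also have "... = exp (z * \<tau>) * (X powr s / Gamma (s + b)) * (1 / 2) ^ k * (1 / 2) ^ j"
    using X by (simp add: s_def powr_add)
   also have "... <= exp (z * \<tau>) * exp (2 * X + 1) * (1 / 2) ^ k * (1 / 2) ^ j"
    by (intro mult_right_mono mult_left_mono powr_div_Gamma_le s b X) auto
   finally show ?thesis .
  qed
  have sum: "summable (%j. ?t j)" by (rule bessel_Jt_abs_summable)
  have geo: "(%j. ?B * (1 / 2) ^ j) sums (?B * 2)"
   using geometric_sums[of "1 / 2 :: real"] by (intro sums_mult) simp
  have "h ^ k * z powr (real k * a) * (\<Sum>j. ?t j) = (\<Sum>j. h ^ k * z powr (real k * a) * ?t j)"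
   by (rule suminf_mult[OF sum, symmetric])
  also have "... <= (\<Sum>j. ?B * (1 / 2) ^ j)"
   by (intro suminf_le bound_term summable_mult sum sums_summable[OF geo])
  also have "... = ?B * 2" using geo by (rule sums_unique[symmetric])
  also have "... = 2 * exp (2 * L + 1) * exp ((\<tau> + 2 * L) * z) * (1 / 2) ^ k"
   by (simp add: X_def exp_add[symmetric] algebra_simps)
  finally show ?thesis .
 qed
 then show ?thesis by blast
qed

lemma choose_le_power2: "real (n choose k) <= 2 ^ n"
 using of_nat_mono[OF binomial_le_pow2[of n k], where 'a = real] by simp

lemma gegen_coeff_bound:
 assumes kp: "0 <= kp" "kp <= real N" and k: "k > 0" and j: "j <= k div 2"
 shows "\<bar>gegen_coeff k kp j\<bar> <= 2 ^ N * 8 ^ k"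
proof -
 define n where "n = k - j - 1"
 have n: "n <= k - j" "Suc n = k - j" using k j by (auto simp: n_def)
 have "pochhammer (kp + 1) n <= pochhammer (real N + 1) n"
  unfolding pochhammer_prod using kp by (intro prod_mono) auto
 also have "... = fact (N + n) / fact N"
  using pochhammer_product[of N "N + n" "1 :: real"] by (simp add: pochhammer_fact[symmetric] add.commute)
 also have "... = real ((N + n) choose N) * fact n"
  by (simp add: binomial_fact)
 also have "... <= 2 ^ (N + n) * fact n"
  by (intro mult_right_mono choose_le_power2) auto
 also have "... <= 2 ^ (N + k) * fact (k - j)"
  using n j by (intro mult_mono power_increasing fact_mono) auto
 finally have p: "pochhammer (kp + 1) n <= 2 ^ (N + k) * fact (k - j)" .
 have p0: "pochhammer (kp + 1) n \<ge> 0" using kp by (intro less_imp_le pochhammer_pos) simp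
 have b: "fact (k - j) / (fact j * fact (k - 2 * j)) = real ((k - j) choose j)"
  using j by (subst binomial_fact) (auto simp: diff_diff_eq mult_2)
 have "\<bar>gegen_coeff k kp j\<bar> = pochhammer (kp + 1) n / (fact j * fact (k - 2 * j)) * 2 ^ (k - 2 * j)"
  using p0 by (simp add: gegen_coeff_def n_def abs_mult)
 also have "... <= 2 ^ (N + k) * fact (k - j) / (fact j * fact (k - 2 * j)) * 2 ^ k"
  using p by (intro mult_mono divide_right_mono power_increasing) auto
 also have "... = 2 ^ (N + k) * real ((k - j) choose j) * 2 ^ k"
  unfolding b[symmetric] by simp
 also have "... <= 2 ^ (N + k) * 2 ^ k * 2 ^ k"
 proof -
  have "real ((k - j) choose j) <= 2 ^ (k - j)" by (rule choose_le_power2)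
  also have "... <= 2 ^ k" by (intro power_increasing) auto
  finally show ?thesis by (intro mult_right_mono mult_left_mono) auto
 qed
 also have "... = 2 ^ N * 8 ^ k"
  by (simp add: power_add power_mult_distrib[symmetric] mult.assoc)
 finally show ?thesis .
qed

text \<open>Crude on purpose: 8^k for a coefficient, 2^k for the number of terms and 2^k for the
  linear factors. The modes decay fast enough to pay for it.\<close>

lemma gegen_bounds:
 assumes kp: "0 <= kp"
 shows "\<exists>C\<ge>0. \<forall>k w. \<bar>w\<bar> <= 1 --> \<bar>gegen_a k kp w\<bar> <= C * 32 ^ k \<and> \<bar>gegen_b k kp w\<bar> <= C * 32 ^ k
   \<and> (k > 0 --> \<bar>gegenbauer (k - 1) (kp + 1) w\<bar> <= C * 32 ^ k)"
proof -
 obtain N where N: "kp <= real N" using real_arch_simple by blast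
 define C where "C = (1 + kp) * 2 ^ N"
 have C: "C \<ge> 1" unfolding C_def using kp by (metis mult_mono' le_add_same_cancel1 mult_1 one_le_power one_le_numeral order_refl zero_le_one add_nonneg_nonneg)
 have "\<bar>gegen_a k kp w\<bar> <= C * 32 ^ k \<and> \<bar>gegen_b k kp w\<bar> <= C * 32 ^ k
   \<and> (k > 0 --> \<bar>gegenbauer (k - 1) (kp + 1) w\<bar> <= C * 32 ^ k)" if w: "\<bar>w\<bar> <= 1" for k w
 proof (cases "k = 0")
  case True
  then show ?thesis using C by (simp add: gegen_a_0 gegen_b_0)
 next
  case False
  then have k: "k > 0" by simp
  have wp: "\<bar>w\<bar> ^ n <= 1" for n using w by (intro power_le_one) auto
  have k2: "real (k + 1) <= 2 ^ k"
  proof -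
   have "k + 1 <= 2 ^ k" using Suc_leI[OF less_exp[of k]] by simp
   then show ?thesis by (metis of_nat_le_iff of_nat_numeral of_nat_power)
  qed
  have kd: "real (k div 2 + 1) <= 2 ^ k" using k2 by (meson add_mono div_le_dividend of_nat_le_iff order_refl order_trans)
  have q: "\<bar>gegen_quot k kp w\<bar> <= 2 ^ N * 16 ^ k"
  proof -
   have "\<bar>gegen_quot k kp w\<bar> <= (\<Sum>j\<le>k div 2. \<bar>gegen_coeff k kp j\<bar> * \<bar>w\<bar> ^ (k - 2 * j))"
    unfolding gegen_quot_def by (rule order_trans[OF sum_abs]) (simp add: abs_mult power_abs)
   also have "... <= (\<Sum>j\<le>k div 2. 2 ^ N * 8 ^ k * 1)"
    by (intro sum_mono mult_mono gegen_coeff_bound[OF kp N k] wp) auto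
   also have "... = (2 ^ N * 8 ^ k) * real (k div 2 + 1)" by simp
   also have "... <= (2 ^ N * 8 ^ k) * 2 ^ k" by (intro mult_left_mono kd) auto
   also have "... = 2 ^ N * 16 ^ k" by (simp add: power_mult_distrib[symmetric])
   finally show ?thesis .
  qed
  have g: "\<bar>gegenbauer (k - 1) (kp + 1) w\<bar> <= 2 ^ N * 32 ^ k"
  proof -
   have "\<bar>gegenbauer (k - 1) (kp + 1) w\<bar> <= (\<Sum>j\<in>{j. 2 * j < k}. \<bar>gegen_coeff k kp j\<bar> * (real (k - 2 * j) / 2) * \<bar>w\<bar> ^ (k - 2 * j - 1))"
    unfolding gegenbauer_deriv[OF k] by (rule order_trans[OF sum_abs]) (simp add: abs_mult power_abs)
   also have "... <= (\<Sum>j\<in>{j. 2 * j < k}. 2 ^ N * 8 ^ k * 2 ^ k * 1)"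
   proof (intro sum_mono mult_mono wp)
    fix j assume "j \<in> {j. 2 * j < k}"
    then show "\<bar>gegen_coeff k kp j\<bar> <= 2 ^ N * 8 ^ k" by (intro gegen_coeff_bound[OF kp N k]) auto
    have "real (k - 2 * j) / 2 <= real (k + 1)" by simp
    then show "real (k - 2 * j) / 2 <= 2 ^ k" using k2 by (rule order_trans)
   qed auto
   also have "... = (2 ^ N * 8 ^ k * 2 ^ k) * real (card {j. 2 * j < k})" by simp
   also have "... <= (2 ^ N * 8 ^ k * 2 ^ k) * 2 ^ k"
   proof (rule mult_left_mono)
    have "card {j. 2 * j < k} <= card {..k}" by (rule card_mono) auto
    then have "real (card {j. 2 * j < k}) <= real (k + 1)" unfolding of_nat_le_iff by simp
    then show "real (card {j. 2 * j < k}) <= 2 ^ k" using k2 by (rule order_trans)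
   qed auto
   also have "... = 2 ^ N * 32 ^ k" by (simp add: power_mult_distrib[symmetric])
   finally show ?thesis .
  qed
  have 1: "(real k + 2 * kp) / 2 <= (1 + kp) * 2 ^ k" "real k <= (1 + kp) * 2 ^ k"
  proof -
   have "(1 + kp) * real (k + 1) <= (1 + kp) * 2 ^ k" using kp k2 by (intro mult_left_mono) auto
   moreover have "(real k + 2 * kp) / 2 <= (1 + kp) * real (k + 1)" "real k <= (1 + kp) * real (k + 1)"
    using kp by (auto simp: algebra_simps)
   ultimately show "(real k + 2 * kp) / 2 <= (1 + kp) * 2 ^ k" "real k <= (1 + kp) * 2 ^ k" by linarith+
  qed
  have "\<bar>gegen_a k kp w\<bar> <= ((1 + kp) * 2 ^ k) * (2 ^ N * 16 ^ k)"
   unfolding gegen_a_eq[OF k] abs_mult using 1 q kp by (intro mult_mono) auto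
  moreover have "\<bar>gegen_b k kp w\<bar> <= ((1 + kp) * 2 ^ k) * (2 ^ N * 16 ^ k)"
   unfolding gegen_b_eq[OF k] abs_mult using 1 q kp by (intro mult_mono) auto
  moreover have "((1 + kp) * 2 ^ k) * (2 ^ N * 16 ^ k) = C * 32 ^ k"
  proof -
   have "(2 :: real) ^ k * 16 ^ k = 32 ^ k" by (simp add: power_mult_distrib[symmetric])
   then show ?thesis by (simp add: C_def)
  qed
  moreover have "2 ^ N * 32 ^ k <= C * 32 ^ k"
   unfolding C_def using kp by (intro mult_right_mono) auto
  ultimately show ?thesis using g by linarith
 qed
 then show ?thesis using C by (intro exI[of _ C]) auto
qed

text \<open>The radial factors that go with \<open>zonal_p\<close> and \<open>zonal_m\<close>.
  \<open>mode_m\<close> is normalised after the B series, whence the halved \<open>gegen_b\<close>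
  in the A series.\<close>

definition mode_p :: "nat => real => complex => nat => real => complex" where
 "mode_p m c om k z = alpha m c om (int k) * of_real (z powr (real k / (1 + c)))
   * bessel_Jt (gam m c (real k) / 2 - 1) (\<i> * of_real z / sinh om)"

definition mode_m :: "nat => real => complex => nat => real => complex" where
 "mode_m m c om k z = alpha m c om (int k - 1) / (2 * sinh om) * of_real (z powr ((real k + c) / (1 + c)))
   * bessel_Jt (gam m c (real k - 1) / 2) (\<i> * of_real z / sinh om)"

lemma A_term_modes:
 "A_term m c om z w k = mode_p m c om k z * of_real (gegen_a k (lam m) w) + mode_m m c om k z * of_real (gegen_b k (lam m) w / 2)"
 by (simp add: A_term_def mode_p_def mode_m_def mult_ac)

text \<open>The factor z is the scale of the wedge of \<open>x\<close> and \<open>y\<close> relative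
  to the wedge of their directions; it removes the exponent -1.\<close>

lemma B_term_modes:
 assumes z: "z > 0"
 shows "of_real z * B_term m c om z w k = (- mode_p m c om k z + mode_m m c om k z) * of_real (gegenbauer (k - 1) (lam m + 1) w)"
proof -
 have pw: "z powr (p - 1) = z powr p / z" for p using z by (simp add: powr_diff)
 show ?thesis unfolding B_term_def mode_p_def mode_m_def pw using z by (simp add: field_simps)
qed

section \<open>Growth of the radial modes\<close>

lemma gam_half: "c > -1 ==> gam m c l / 2 = l / (1 + c) + delta m c / 2"
 by (simp add: gam_def delta_def divide_simps) (simp add: algebra_simps)

lemma delta_pos: "c > -1 ==> m \<ge> 2 ==> delta m c > 0"
 by (simp add: delta_def add_pos_nonneg)

lemma two_sinh_powr_add:
 assumes "Re om > 0"
 shows "two_sinh_powr om (p + p') = two_sinh_powr om p * two_sinh_powr om p'"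
 by (simp add: two_sinh_powr_def powr_add distrib_left exp_add mult_ac)

lemma two_sinh_powr_times:
 assumes "Re om > 0"
 shows "two_sinh_powr om (real k * p) = two_sinh_powr om p ^ k"
proof (induction k)
 case 0
 show ?case using one_minus_exp_nz[OF assms] by (simp add: two_sinh_powr_def)
next
 case (Suc k)
 have "real (Suc k) * p = p + real k * p" by (simp add: algebra_simps)
 then show ?case using Suc by (simp only: two_sinh_powr_add[OF assms] power_Suc)
qed

text \<open>gamma_k is affine in k, so |alpha_k| = K g^k and \<open>bessel_mode_bound\<close>
  applies with h = 32 g. The surplus 32^k is reserved for the Gegenbauer factors.\<close>

lemma mode_bounds:
 assumes om: "Re om > 0" and c: "c > -1" and m: "m \<ge> 2"
 shows "\<exists>C D. \<forall>k z. z > 0 --> 32 ^ k * norm (mode_p m c om k z) <= C * exp (D * z) * (1 / 2) ^ k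
   \<and> 32 ^ k * norm (mode_m m c om k z) <= C * exp (D * z) * (1 / 2) ^ k"
proof -
 define a where "a = 1 / (1 + c)"
 define b where "b = delta m c / 2"
 define g where "g = cmod (two_sinh_powr om (- a))"
 define K where "K = cmod (2 * exp (om * of_real (delta m c) / 2) * two_sinh_powr om (- b))"
 define \<tau> where "\<tau> = 1 / cmod (2 * sinh om)"
 have a: "a > 0" and b: "b > 0" using c delta_pos[OF c m] by (simp_all add: a_def b_def)
 have g0: "32 * g \<ge> 0" and \<tau>: "\<tau> \<ge> 0" by (simp_all add: g_def \<tau>_def)
 have K0: "K \<ge> 0" by (simp add: K_def)
 have ga: "gam m c l / 2 = l * a + b" for l using gam_half[OF c] by (simp add: a_def b_def)
 have al: "norm (alpha m c om (int k)) = K * g ^ k" for k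
 proof -
  have "- gam m c (real k) / 2 = - b + real k * (- a)" using ga[of "real k"] by simp
  then have "two_sinh_powr om (- gam m c (real k) / 2) = two_sinh_powr om (- b) * two_sinh_powr om (- a) ^ k"
   by (simp only: two_sinh_powr_add[OF om] two_sinh_powr_times[OF om])
  then show ?thesis by (simp add: alpha_def K_def g_def norm_mult norm_power)
 qed
 obtain C D where P: "!!k z x. z \<ge> 0 ==> cmod x = (z * \<tau>)\<^sup>2 ==>
  (32 * g) ^ k * z powr (real k * a) * (\<Sum>j. norm (rGamma (of_real (real j + (real k * a + b - 1) + 1)) / fact j * x ^ j)) <= C * exp (D * z) * (1 / 2) ^ k"
  using bessel_mode_bound[OF a b g0 \<tau>] by blast
 have b1: "b + 1 > 0" using b by simp
 obtain C' D' where Q: "!!k z x. z \<ge> 0 ==> cmod x = (z * \<tau>)\<^sup>2 ==>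
  (32 * g) ^ k * z powr (real k * a) * (\<Sum>j. norm (rGamma (of_real (real j + (real k * a + (b + 1) - 1) + 1)) / fact j * x ^ j)) <= C' * exp (D' * z) * (1 / 2) ^ k"
  using bessel_mode_bound[OF a b1 g0 \<tau>] by blast
 have J: "norm (bessel_Jt \<nu> (\<i> * of_real z / sinh om)) <= (\<Sum>j. norm (rGamma (of_real (real j + \<nu> + 1)) / fact j * (of_real (z\<^sup>2) / (2 * sinh om)\<^sup>2) ^ j))" for \<nu> z
  unfolding sums_unique[OF bessel_Jt_imaginary_sums] by (rule summable_norm[OF bessel_Jt_abs_summable])
 have x: "cmod (of_real (z\<^sup>2) / (2 * sinh om)\<^sup>2) = (z * \<tau>)\<^sup>2" for z :: real
  unfolding norm_divide norm_power norm_of_real \<tau>_def by (simp add: power_divide power_mult_distrib)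
 \<comment> \<open>\<open>mode_m\<close> at k = l + 1 is estimated through l: 64 is 32 from 32^k =
   32 * 32^l times 2 from (1/2)^l. The \<open>D' + 1\<close> pays for an extra factor z \<le> exp
   z.\<close>
 define CC where "CC = max (K * \<bar>C\<bar>) (64 * K * \<tau> * \<bar>C'\<bar>)"
 define DD where "DD = max D (D' + 1)"
 have CC: "K * \<bar>C\<bar> <= CC" "64 * K * \<tau> * \<bar>C'\<bar> <= CC" "0 <= CC"
  using K0 by (auto simp: CC_def le_max_iff_disj)
 have "32 ^ k * norm (mode_p m c om k z) <= CC * exp (DD * z) * (1 / 2) ^ k" if z: "z > 0" for k z
 proof -
  have "32 ^ k * norm (mode_p m c om k z) = K * ((32 * g) ^ k * z powr (real k * a) * norm (bessel_Jt (real k * a + b - 1) (\<i> * of_real z / sinh om)))"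
   unfolding mode_p_def norm_mult al ga by (simp add: power_mult_distrib a_def mult_ac)
  also have "... <= K * (C * exp (D * z) * (1 / 2) ^ k)"
   using z by (intro mult_left_mono K0 order_trans[OF mult_left_mono[OF J] P[OF _ x]]) (auto simp: g_def)
  also have "... <= (K * \<bar>C\<bar>) * exp (D * z) * (1 / 2) ^ k"
   using K0 by (simp add: mult.assoc mult_left_mono mult_right_mono)
  also have "... <= CC * exp (DD * z) * (1 / 2) ^ k"
   using z CC by (intro mult_right_mono mult_mono) (auto simp: DD_def)
  finally show ?thesis .
 qed
 moreover have "32 ^ k * norm (mode_m m c om k z) <= CC * exp (DD * z) * (1 / 2) ^ k" if z: "z > 0" for k z
 proof (cases k)
  case 0
  show ?thesis using 0 CC(3) by (simp add: mode_m_def alpha_def)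
 next
  case (Suc l)
  have e: "(real k + c) / (1 + c) = real l * a + 1" using Suc c by (simp add: a_def field_simps)
  have i: "int k - 1 = int l" "real k - 1 = real l" using Suc by auto
  have nu: "gam m c (real l) / 2 = real l * a + (b + 1) - 1" using ga[of "real l"] by simp
  have pw: "z powr (real l * a + 1) = z powr (real l * a) * z" using z by (simp add: powr_add)
  have mm: "mode_m m c om k z = alpha m c om (int l) / (2 * sinh om) * of_real (z powr (real l * a) * z)
    * bessel_Jt (real l * a + (b + 1) - 1) (\<i> * of_real z / sinh om)"
   unfolding mode_m_def i nu e pw ..
  have "32 ^ k * norm (mode_m m c om k z) = 32 * K * \<tau> * z * ((32 * g) ^ l * z powr (real l * a) * norm (bessel_Jt (real l * a + (b + 1) - 1) (\<i> * of_real z / sinh om)))"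
   unfolding mm norm_mult[of "_ * _"] norm_mult[of "_ / _"] norm_divide al \<tau>_def norm_of_real
   using z by (simp add: Suc power_mult_distrib abs_mult)
  also have "... <= 32 * K * \<tau> * z * (C' * exp (D' * z) * (1 / 2) ^ l)"
   using z K0 \<tau> by (intro mult_left_mono order_trans[OF mult_left_mono[OF J] Q[OF _ x]]) (auto simp: g_def)
  also have "... <= 32 * K * \<tau> * z * (\<bar>C'\<bar> * exp (D' * z) * (1 / 2) ^ l)"
   using z K0 \<tau> by (intro mult_left_mono mult_right_mono) auto
  also have "... <= 32 * K * \<tau> * exp z * (\<bar>C'\<bar> * exp (D' * z) * (1 / 2) ^ l)"
  proof (intro mult_right_mono mult_left_mono)
   show "z <= exp z" using exp_ge_add_one_self[of z] by linarith
  qed (use K0 \<tau> in auto)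
  also have "... = (64 * K * \<tau> * \<bar>C'\<bar>) * exp ((D' + 1) * z) * (1 / 2) ^ k"
   by (simp add: Suc exp_add[symmetric] algebra_simps)
  also have "... <= CC * exp (DD * z) * (1 / 2) ^ k"
   using z CC by (intro mult_right_mono mult_mono) (auto simp: DD_def)
  finally show ?thesis .
 qed
 ultimately show ?thesis by blast
qed

section \<open>The weighted space\<close>

lemma L2_measurable: "f \<in> L2 c ==> f \<in> borel_measurable borel"
 by (simp add: L2_def)

lemma sets_wmeasure [measurable_cong, simp]: "sets (wmeasure c) = sets borel"
 by (simp add: wmeasure_def)

lemma space_wmeasure [simp]: "space (wmeasure c) = UNIV"
 by (simp add: wmeasure_def)

lemma cl_dot_measurable [measurable]:
 assumes "f \<in> borel_measurable M" "g \<in> borel_measurable M"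
 shows "(%x. cl_dot (f x) (g x)) \<in> borel_measurable M"
 by (rule borel_measurable_continuous_Pair[OF assms, where H = cl_dot])
  (intro bounded_bilinear.continuous_on[OF bounded_bilinear_cl_dot] continuous_intros)

lemma smult_measurable [measurable]:
 assumes "f \<in> borel_measurable M"
 shows "(%x. s *s (f x :: 'n::{finite,linorder} cliff)) \<in> borel_measurable M"
 by (rule borel_measurable_continuous_on[OF linear_continuous_on[OF bounded_linear_smult] assms])

lemma L2_zero: "(%_. 0) \<in> L2 c"
 by (simp add: L2_def)

lemma L2_smult: "f \<in> L2 c ==> (%x. s *s f x) \<in> L2 c"
 by (simp add: L2_def norm_smult power_mult_distrib smult_measurable)

lemma L2_add: "f \<in> L2 c ==> g \<in> L2 c ==> (%x. f x + g x) \<in> L2 c"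
proof -
 assume f: "f \<in> L2 c" and g: "g \<in> L2 c"
 have [measurable]: "f \<in> borel_measurable borel" "g \<in> borel_measurable borel"
  using f g by (auto simp: L2_def)
 have "integrable (wmeasure c) (%x. 2 * (norm (f x))\<^sup>2 + 2 * (norm (g x))\<^sup>2)"
  using f g by (simp add: L2_def)
 then have "integrable (wmeasure c) (%x. (norm (f x + g x))\<^sup>2)"
 proof (rule Bochner_Integration.integrable_bound)
  show "AE x in wmeasure c. norm ((norm (f x + g x))\<^sup>2) <= norm (2 * (norm (f x))\<^sup>2 + 2 * (norm (g x))\<^sup>2)"
  proof (rule AE_I2)
   fix x
   have "(norm (f x + g x))\<^sup>2 <= (norm (f x) + norm (g x))\<^sup>2"
    by (intro power_mono norm_triangle_ineq) auto
   also have "... <= 2 * (norm (f x))\<^sup>2 + 2 * (norm (g x))\<^sup>2"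
    using sum_squares_bound[of "norm (f x)" "norm (g x)"] by (simp add: power2_sum)
   finally show "norm ((norm (f x + g x))\<^sup>2) <= norm (2 * (norm (f x))\<^sup>2 + 2 * (norm (g x))\<^sup>2)" by simp
  qed
 qed measurable
 then show ?thesis by (simp add: L2_def)
qed

lemma L2_diff: "f \<in> L2 c ==> g \<in> L2 c ==> (%x. f x - g x) \<in> L2 c"
 using L2_add[of f c "%x. (-1) *s g x"] L2_smult[of g c "-1"] by (simp add: vector_sneg_minus1[symmetric])

lemma L2_sum: "(!!i. i \<in> I ==> f i \<in> L2 c) ==> (%x. \<Sum>i\<in>I. f i x) \<in> L2 c"
proof (induction I rule: infinite_finite_induct)
 case (insert i I)
 then have "(%x. f i x + (\<Sum>i\<in>I. f i x)) \<in> L2 c" by (intro L2_add) auto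
 then show ?case using insert.hyps by simp
qed (simp_all add: L2_zero)

lemma L2_integrable_norm_mult:
 assumes f: "f \<in> L2 c" and g: "g \<in> L2 c"
 shows "integrable (wmeasure c) (%x. norm (f x) * norm (g x))"
proof -
 have [measurable]: "f \<in> borel_measurable borel" "g \<in> borel_measurable borel"
  using f g by (auto simp: L2_def)
 have "integrable (wmeasure c) (%x. (norm (f x))\<^sup>2 + (norm (g x))\<^sup>2)"
  using f g by (simp add: L2_def)
 then show ?thesis
 proof (rule Bochner_Integration.integrable_bound)
  show "AE x in wmeasure c. norm (norm (f x) * norm (g x)) <= norm ((norm (f x))\<^sup>2 + (norm (g x))\<^sup>2)"
  proof (rule AE_I2)
   fix x
   have "2 * norm (f x) * norm (g x) <= (norm (f x))\<^sup>2 + (norm (g x))\<^sup>2" by (rule sum_squares_bound)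
   moreover have "0 <= norm (f x) * norm (g x)" by simp
   ultimately show "norm (norm (f x) * norm (g x)) <= norm ((norm (f x))\<^sup>2 + (norm (g x))\<^sup>2)"
    unfolding real_norm_def by linarith
  qed
 qed measurable
qed

lemma L2_integrable_dot:
 assumes f: "f \<in> L2 c" and g: "g \<in> L2 c"
 shows "integrable (wmeasure c) (%x. cl_dot (f x) (g x))"
proof (rule Bochner_Integration.integrable_bound[OF L2_integrable_norm_mult[OF f g]])
 have [measurable]: "f \<in> borel_measurable borel" "g \<in> borel_measurable borel"
  using f g by (auto simp: L2_def)
 show "(%x. cl_dot (f x) (g x)) \<in> borel_measurable (wmeasure c)" by measurable
qed (simp add: norm_cl_dot_le)

lemma bounded_linear_cl_cnj: "bounded_linear (cl_cnj :: 'n::{finite,linorder} cliff => _)"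
 and bounded_linear_cl_bar: "bounded_linear (cl_bar :: 'n::{finite,linorder} cliff => _)"
 unfolding linear_conv_bounded_linear[symmetric]
 by (rule linearI; simp add: cl_cnj_def cl_bar_def vec_eq_iff algebra_simps)+

lemma bounded_linear_scalar_part: "bounded_linear (cl_scalar_part :: 'n::{finite,linorder} cliff => _)"
 unfolding linear_conv_bounded_linear[symmetric] by (rule linearI) (simp_all add: cl_scalar_part_def)

lemma bounded_bilinear_bar_cnj_mult:
 "bounded_bilinear (%a b :: 'n::{finite,linorder} cliff. cl_bar (cl_cnj a) \<odot> b)"
 by (rule bounded_bilinear.comp1[OF bounded_bilinear_cl_mult bounded_linear_compose[OF bounded_linear_cl_bar bounded_linear_cl_cnj]])

lemma l2_inner_eq:
 fixes f g :: "'n::{finite,linorder} clfun"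
 assumes f: "f \<in> L2 c" and g: "g \<in> L2 c"
 shows "l2_inner c f g = (LINT x|wmeasure c. cl_dot (f x) (g x))"
proof -
 have [measurable]: "f \<in> borel_measurable borel" "g \<in> borel_measurable borel"
  using f g by (auto simp: L2_def)
 obtain K where K: "!!a b :: 'n cliff. norm (cl_bar (cl_cnj a) \<odot> b) <= norm a * norm b * K"
  using bounded_bilinear.bounded[OF bounded_bilinear_bar_cnj_mult] by blast
 have "integrable (wmeasure c) (%x. cl_bar (cl_cnj (f x)) \<odot> g x)"
 proof (rule Bochner_Integration.integrable_bound)
  show "integrable (wmeasure c) (%x. norm (f x) * norm (g x) * K)"
   using L2_integrable_norm_mult[OF f g] by simp
  show "(%x. cl_bar (cl_cnj (f x)) \<odot> g x) \<in> borel_measurable (wmeasure c)"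
  proof (rule borel_measurable_continuous_Pair[where H = "%a b. cl_bar (cl_cnj a) \<odot> b"])
   show "continuous_on UNIV (%x. cl_bar (cl_cnj (fst x)) \<odot> snd x)"
    by (intro bounded_bilinear.continuous_on[OF bounded_bilinear_bar_cnj_mult] continuous_intros)
  qed measurable
  show "AE x in wmeasure c. norm (cl_bar (cl_cnj (f x)) \<odot> g x) <= norm (norm (f x) * norm (g x) * K)"
  proof (rule AE_I2)
   fix x
   have "norm (cl_bar (cl_cnj (f x)) \<odot> g x) <= norm (f x) * norm (g x) * K" by (rule K)
   also have "... <= norm (norm (f x) * norm (g x) * K)" by simp
   finally show "norm (cl_bar (cl_cnj (f x)) \<odot> g x) <= norm (norm (f x) * norm (g x) * K)" .
  qed
 qed
 from integral_bounded_linear[OF bounded_linear_scalar_part this]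
 show ?thesis by (simp add: l2_inner_def cl_scalar_part_bar_mult cl_dot_def)
qed

lemma l2_inner_add_right: "f \<in> L2 c ==> g \<in> L2 c ==> h \<in> L2 c ==>
  l2_inner c f (%x. g x + h x) = l2_inner c f g + l2_inner c f h"
 by (simp add: l2_inner_eq L2_add cl_dot_add L2_integrable_dot)

lemma l2_inner_diff_right: "f \<in> L2 c ==> g \<in> L2 c ==> h \<in> L2 c ==>
  l2_inner c f (%x. g x - h x) = l2_inner c f g - l2_inner c f h"
 by (simp add: l2_inner_eq L2_diff cl_dot_diff L2_integrable_dot)

lemma l2_inner_smult_right: "f \<in> L2 c ==> g \<in> L2 c ==> l2_inner c f (%x. s *s g x) = s * l2_inner c f g"
 by (simp add: l2_inner_eq L2_smult cl_dot_smult)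

lemma l2_inner_cnj:
 assumes f: "f \<in> L2 c" and g: "g \<in> L2 c"
 shows "cnj (l2_inner c f g) = l2_inner c g f"
proof -
 have "l2_inner c g f = (LINT x|wmeasure c. cnj (cl_dot (f x) (g x)))"
  unfolding l2_inner_eq[OF g f] cl_dot_cnj ..
 also have "... = cnj (l2_inner c f g)"
  unfolding l2_inner_eq[OF f g] by (rule Bochner_Integration.integral_cnj)
 finally show ?thesis ..
qed

lemma l2_inner_sum_right: "f \<in> L2 c ==> (!!i. i \<in> I ==> g i \<in> L2 c) ==>
  l2_inner c f (%x. \<Sum>i\<in>I. g i x) = (\<Sum>i\<in>I. l2_inner c f (g i))"
 by (simp add: l2_inner_eq L2_sum cl_dot_sum L2_integrable_dot)

lemma l2_inner_self: "f \<in> L2 c ==> l2_inner c f f = of_real (LINT x|wmeasure c. (norm (f x))\<^sup>2)"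
 by (simp add: l2_inner_eq cl_dot_self integral_complex_of_real del: of_real_power)

lemma l2_norm_eq: "f \<in> L2 c ==> l2_norm c f = sqrt (LINT x|wmeasure c. (norm (f x))\<^sup>2)"
 by (simp add: l2_norm_def l2_inner_self)

lemma l2_norm_sq: "f \<in> L2 c ==> (l2_norm c f)\<^sup>2 = (LINT x|wmeasure c. (norm (f x))\<^sup>2)"
 by (simp add: l2_norm_eq)

lemma l2_inner_self_norm: "f \<in> L2 c ==> l2_inner c f f = of_real ((l2_norm c f)\<^sup>2)"
 by (simp only: l2_inner_self l2_norm_sq)

lemma l2_norm_nonneg: "f \<in> L2 c ==> l2_norm c f \<ge> 0"
 by (simp add: l2_norm_eq)

lemma l2_norm_nn: "f \<in> L2 c ==> (\<integral>\<^sup>+x. ennreal ((norm (f x))\<^sup>2) \<partial>wmeasure c) = ennreal ((l2_norm c f)\<^sup>2)"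
 unfolding l2_norm_sq by (rule nn_integral_eq_integral) (auto simp: L2_def)

lemma L2I_nn:
 assumes "f \<in> borel_measurable borel" "(\<integral>\<^sup>+x. ennreal ((norm (f x))\<^sup>2) \<partial>wmeasure c) < \<infinity>"
 shows "f \<in> L2 c"
proof -
 have [measurable]: "f \<in> borel_measurable borel" by (rule assms)
 have "integrable (wmeasure c) (%x. (norm (f x))\<^sup>2)"
  by (rule integrableI_nonneg) (use assms(2) in simp_all)
 then show ?thesis using assms(1) by (simp add: L2_def)
qed

lemma l2_norm_le_nn:
 assumes "f \<in> L2 c" "(\<integral>\<^sup>+x. ennreal ((norm (f x))\<^sup>2) \<partial>wmeasure c) <= ennreal (r\<^sup>2)" "r \<ge> 0"
 shows "l2_norm c f <= r"
proof (rule power2_le_imp_le)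
 show "(l2_norm c f)\<^sup>2 <= r\<^sup>2"
  using assms(2) unfolding l2_norm_nn[OF assms(1)] by (simp only: ennreal_le_iff zero_le_power2)
qed fact

lemma l2_norm_eq_0:
 assumes f: "f \<in> L2 c"
 shows "l2_norm c f = 0 \<longleftrightarrow> l2_eq c f (%_. 0)"
proof -
 have "l2_norm c f = 0 \<longleftrightarrow> (LINT x|wmeasure c. (norm (f x))\<^sup>2) = 0" using f by (simp add: l2_norm_eq)
 also have "... \<longleftrightarrow> (AE x in wmeasure c. (norm (f x))\<^sup>2 = 0)"
  by (rule integral_nonneg_eq_0_iff_AE) (use f in \<open>auto simp: L2_def\<close>)
 finally show ?thesis by (simp add: l2_eq_def)
qed

text \<open>The squared norm of f minus t <g,f> times g is a real quadratic in t. If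
  \<open>g\<close> has norm 0 the quadratic is affine and still nonnegative for all t, which forces
  <f,g> = 0.\<close>

lemma l2_cauchy_schwarz:
 assumes f: "f \<in> L2 c" and g: "g \<in> L2 c"
 shows "cmod (l2_inner c f g) <= l2_norm c f * l2_norm c g"
proof -
 let ?i = "l2_inner c f g"
 have gf: "l2_inner c g f = cnj ?i" using l2_inner_cnj[OF f g] by simp
 have key: "0 <= (l2_norm c f)\<^sup>2 - 2 * t * (cmod ?i)\<^sup>2 + t\<^sup>2 * (cmod ?i)\<^sup>2 * (l2_norm c g)\<^sup>2" for t :: real
 proof -
  let ?h = "%x. f x - (of_real t * cnj ?i) *s g x"
  have sg: "(%x. (of_real t * cnj ?i) *s g x) \<in> L2 c" by (rule L2_smult[OF g])
  have h: "?h \<in> L2 c" by (rule L2_diff[OF f sg])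
  have hf: "l2_inner c ?h f = cnj (l2_inner c f ?h)" "l2_inner c ?h g = cnj (l2_inner c g ?h)"
   using l2_inner_cnj[OF f h] l2_inner_cnj[OF g h] by simp_all
  have "l2_inner c ?h ?h = l2_inner c ?h f - of_real t * cnj ?i * l2_inner c ?h g"
   by (simp add: l2_inner_diff_right[OF h f sg] l2_inner_smult_right[OF h g])
  also have "... = of_real ((l2_norm c f)\<^sup>2) - 2 * of_real t * (?i * cnj ?i) + (of_real t)\<^sup>2 * (?i * cnj ?i) * of_real ((l2_norm c g)\<^sup>2)"
   unfolding hf l2_inner_diff_right[OF f f sg] l2_inner_diff_right[OF g f sg]
    l2_inner_smult_right[OF f g] l2_inner_smult_right[OF g g] gf
   by (simp add: l2_inner_self_norm[OF f] l2_inner_self_norm[OF g] algebra_simps power2_eq_square)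
  also have "... = of_real ((l2_norm c f)\<^sup>2 - 2 * t * (cmod ?i)\<^sup>2 + t\<^sup>2 * (cmod ?i)\<^sup>2 * (l2_norm c g)\<^sup>2)"
   unfolding complex_norm_square[symmetric] by simp
  finally have "of_real ((l2_norm c ?h)\<^sup>2) = (of_real ((l2_norm c f)\<^sup>2 - 2 * t * (cmod ?i)\<^sup>2 + t\<^sup>2 * (cmod ?i)\<^sup>2 * (l2_norm c g)\<^sup>2) :: complex)"
   unfolding l2_inner_self_norm[OF h] .
  then have "(l2_norm c ?h)\<^sup>2 = (l2_norm c f)\<^sup>2 - 2 * t * (cmod ?i)\<^sup>2 + t\<^sup>2 * (cmod ?i)\<^sup>2 * (l2_norm c g)\<^sup>2"
   by (simp only: of_real_eq_iff)
  then show ?thesis by (metis zero_le_power2)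
 qed
 have "(cmod ?i)\<^sup>2 <= (l2_norm c f * l2_norm c g)\<^sup>2"
 proof (cases "l2_norm c g = 0")
  case True
  have "(cmod ?i)\<^sup>2 = 0"
  proof (rule ccontr)
   assume "(cmod ?i)\<^sup>2 ~= 0"
   moreover have "0 <= (l2_norm c f)\<^sup>2 - 2 * t * (cmod ?i)\<^sup>2" for t using key[of t] True by simp
   from this[of "((l2_norm c f)\<^sup>2 + 1) / (2 * (cmod ?i)\<^sup>2)"] have "(cmod ?i)\<^sup>2 ~= 0 ==> False" by (simp add: field_simps)
   ultimately show False by blast
  qed
  then show ?thesis by simp
 next
  case False
  define G where "G = (l2_norm c g)\<^sup>2"
  have G: "G > 0" using False by (simp add: G_def)
  have "0 <= (l2_norm c f)\<^sup>2 - 2 * (1 / G) * (cmod ?i)\<^sup>2 + (1 / G)\<^sup>2 * (cmod ?i)\<^sup>2 * G" using key[of "1 / G"] by (simp add: G_def)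
  also have "... = (l2_norm c f)\<^sup>2 - (cmod ?i)\<^sup>2 / G" using G by (simp add: power2_eq_square field_simps)
  finally show ?thesis using G by (simp add: power_mult_distrib field_simps G_def)
 qed
 then show ?thesis by (rule power2_le_imp_le) (intro mult_nonneg_nonneg l2_norm_nonneg f g)
qed

lemma l2_norm_triangle:
 assumes f: "f \<in> L2 c" and g: "g \<in> L2 c"
 shows "l2_norm c (%x. f x + g x) <= l2_norm c f + l2_norm c g"
proof -
 have fg: "(%x. f x + g x) \<in> L2 c" by (rule L2_add[OF f g])
 have "l2_inner c (%x. f x + g x) (%x. f x + g x) = l2_inner c f f + l2_inner c g g + (l2_inner c f g + cnj (l2_inner c f g))"
 proof -
  have "l2_inner c (%x. f x + g x) f = cnj (l2_inner c f f + l2_inner c f g)" "l2_inner c (%x. f x + g x) g = cnj (l2_inner c g f + l2_inner c g g)"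
   using l2_inner_cnj[OF f fg] l2_inner_cnj[OF g fg] l2_inner_add_right[OF f f g] l2_inner_add_right[OF g f g] by simp_all
  then show ?thesis using l2_inner_add_right[OF fg f g] l2_inner_cnj[OF f f] l2_inner_cnj[OF g g] l2_inner_cnj[OF g f] l2_inner_cnj[OF f g] by simp
 qed
 then have "Re (l2_inner c (%x. f x + g x) (%x. f x + g x)) = (l2_norm c f)\<^sup>2 + (l2_norm c g)\<^sup>2 + 2 * Re (l2_inner c f g)"
  by (simp add: l2_inner_self_norm[OF f] l2_inner_self_norm[OF g])
 then have "(l2_norm c (%x. f x + g x))\<^sup>2 = (l2_norm c f)\<^sup>2 + (l2_norm c g)\<^sup>2 + 2 * Re (l2_inner c f g)"
  by (simp add: l2_inner_self_norm[OF fg])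
 also have "Re (l2_inner c f g) <= l2_norm c f * l2_norm c g"
  using l2_cauchy_schwarz[OF f g] complex_Re_le_cmod[of "l2_inner c f g"] by simp
 finally have "(l2_norm c (%x. f x + g x))\<^sup>2 <= (l2_norm c f + l2_norm c g)\<^sup>2" by (simp add: power2_sum)
 then show ?thesis by (rule power2_le_imp_le) (intro add_nonneg_nonneg l2_norm_nonneg f g)
qed

text \<open>Along a rapidly Cauchy subsequence \<open>\<Sum>\<^sub>k 2\<^sup>k |D\<^sub>k|\<^sup>2\<close> is integrable, so \<open>\<Sum>\<^sub>k |D\<^sub>k|\<close> converges a.e.; Fatou's lemma does the rest.\<close>

lemma riesz_fischer:
 fixes u :: "nat => 'n::{finite,linorder} clfun"
 assumes u: "!!n. u n \<in> L2 c"
  and cauchy: "!!e. e > 0 ==> \<exists>N. \<forall>m\<ge>N. \<forall>n\<ge>N. l2_norm c (%x. u m x - u n x) < e"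
 obtains g where "g \<in> L2 c" "(%n. l2_norm c (%x. u n x - g x)) \<longlonglongrightarrow> 0"
proof -
 have [measurable]: "u n \<in> borel_measurable borel" for n using u by (rule L2_measurable)
 have ud: "(%x. u m x - u n x) \<in> L2 c" for m n by (intro L2_diff u)
 have "\<exists>N. \<forall>m\<ge>N. \<forall>n\<ge>N. l2_norm c (%x. u m x - u n x) < (1 / 2) ^ k" for k :: nat
  by (rule cauchy) simp
 then obtain N0 where N0: "!!k m n. m \<ge> N0 k ==> n \<ge> N0 k ==> l2_norm c (%x. u m x - u n x) < (1 / 2) ^ k"
  by metis
 \<comment> \<open>Nondecreasing, at least \<open>N0 k\<close>, so that neighbouring terms are
   within 2^-k, and at least \<open>k\<close>, so that it tends to infinity.\<close>
 define r where "r k = (\<Sum>i\<le>k. N0 i) + k" for k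
 have r: "N0 k <= r k" "r k <= r (Suc k)" "k <= r k" for k
  by (auto simp: r_def intro: order_trans[OF member_le_sum[of k "{..k}" N0]])
 define D where "D k x = u (r (Suc k)) x - u (r k) x" for k x
 have DL: "D k \<in> L2 c" for k unfolding D_def[abs_def] by (rule ud)
 have [measurable]: "D k \<in> borel_measurable borel" for k by (rule L2_measurable[OF DL])
 have Dn: "(\<integral>\<^sup>+x. ennreal ((norm (D k x))\<^sup>2) \<partial>wmeasure c) <= ennreal ((1 / 4) ^ k)" for k
 proof -
  have "l2_norm c (D k) < (1 / 2) ^ k"
   unfolding D_def[abs_def] by (intro N0) (use r(1)[of k] r(2)[of k] in auto)
  then have "(l2_norm c (D k))\<^sup>2 <= ((1 / 2) ^ k)\<^sup>2" using l2_norm_nonneg[OF DL] by (intro power_mono) auto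
  also have "((1 / 2) ^ k)\<^sup>2 = (1 / 4 :: real) ^ k" by (simp add: power2_eq_square flip: power_mult_distrib)
  finally show ?thesis unfolding l2_norm_nn[OF DL] by (rule ennreal_leI)
 qed
 have "(\<integral>\<^sup>+x. (\<Sum>k. ennreal (2 ^ k * (norm (D k x))\<^sup>2)) \<partial>wmeasure c) = (\<Sum>k. \<integral>\<^sup>+x. ennreal (2 ^ k * (norm (D k x))\<^sup>2) \<partial>wmeasure c)"
  by (rule nn_integral_suminf) measurable
 also have "... <= (\<Sum>k. ennreal ((1 / 2) ^ k))"
 proof (intro suminf_le)
  fix k
  have "(\<integral>\<^sup>+x. ennreal (2 ^ k * (norm (D k x))\<^sup>2) \<partial>wmeasure c) = ennreal (2 ^ k) * (\<integral>\<^sup>+x. ennreal ((norm (D k x))\<^sup>2) \<partial>wmeasure c)"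
   by (subst nn_integral_cmult[symmetric]) (auto simp: ennreal_mult)
  also have "... <= ennreal (2 ^ k) * ennreal ((1 / 4) ^ k)" by (intro mult_left_mono Dn) auto
  also have "... = ennreal ((1 / 2) ^ k)" by (simp add: ennreal_mult[symmetric] power_mult_distrib[symmetric])
  finally show "(\<integral>\<^sup>+x. ennreal (2 ^ k * (norm (D k x))\<^sup>2) \<partial>wmeasure c) <= ennreal ((1 / 2) ^ k)" .
 qed auto
 also have "... < \<infinity>"
  by (subst suminf_ennreal2) (auto intro!: summable_geometric)
 finally have "(\<integral>\<^sup>+x. (\<Sum>k. ennreal (2 ^ k * (norm (D k x))\<^sup>2)) \<partial>wmeasure c) ~= \<infinity>" by simp
 then have "AE x in wmeasure c. (\<Sum>k. ennreal (2 ^ k * (norm (D k x))\<^sup>2)) ~= \<infinity>"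
  by (rule nn_integral_PInf_AE[rotated]) measurable
 then have conv: "AE x in wmeasure c. convergent (%k. u (r k) x)"
 proof eventually_elim
  fix x assume "(\<Sum>k. ennreal (2 ^ k * (norm (D k x))\<^sup>2)) ~= \<infinity>"
  then have s: "summable (%k. 2 ^ k * (norm (D k x))\<^sup>2)"
   by (intro summable_suminf_not_top) auto
  have "summable (%k. 2 ^ k * (norm (D k x))\<^sup>2 + (1 / 2) ^ k)"
   by (intro summable_add s summable_geometric) simp
  then have "summable (%k. D k x)"
  proof (rule summable_norm_cancel[OF summable_comparison_test'[where N = 0]])
   fix k
   define p where "p = (2 :: real) ^ k"
   have p: "p > 0" "(1 / 2) ^ k = 1 / p" by (simp_all add: p_def power_divide)
   \<comment> \<open>This square bounds |D_k| by 2^k |D_k|^2 + 2^-k, a sum of two summable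
     terms.\<close>
   have "0 <= (p * norm (D k x) - 1)\<^sup>2 / p" using p by simp
   also have "... = p * (norm (D k x))\<^sup>2 - 2 * norm (D k x) + 1 / p" using p by (simp add: power2_eq_square field_simps)
   finally have "norm (D k x) <= p * (norm (D k x))\<^sup>2 + 1 / p" using norm_ge_zero[of "D k x"] by linarith
   then show "norm (norm (D k x)) <= 2 ^ k * (norm (D k x))\<^sup>2 + (1 / 2) ^ k" unfolding p(2) p_def by simp
  qed
  then have "(%n. \<Sum>k<n. D k x) \<longlonglongrightarrow> suminf (%k. D k x)" by (rule summable_LIMSEQ)
  moreover have "(\<Sum>k<n. D k x) = u (r n) x - u (r 0) x" for n
   by (induction n) (auto simp: D_def)
  ultimately have "(%n. u (r n) x - u (r 0) x + u (r 0) x) \<longlonglongrightarrow> suminf (%k. D k x) + u (r 0) x"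
   by (intro tendsto_add tendsto_const) simp
  then show "convergent (%k. u (r k) x)" by (auto simp: convergent_def)
 qed
 define g where "g x = lim (%k. u (r k) x)" for x
 have [measurable]: "g \<in> borel_measurable borel" unfolding g_def[abs_def] by (rule borel_measurable_lim_metric) measurable
 have close: "(\<integral>\<^sup>+x. ennreal ((norm (u n x - g x))\<^sup>2) \<partial>wmeasure c) <= ennreal (((1 / 2) ^ k)\<^sup>2)" if n: "n \<ge> N0 k" for n k
 proof -
  have "(\<integral>\<^sup>+x. ennreal ((norm (u n x - g x))\<^sup>2) \<partial>wmeasure c) = (\<integral>\<^sup>+x. liminf (%i. ennreal ((norm (u n x - u (r i) x))\<^sup>2)) \<partial>wmeasure c)"
  proof (rule nn_integral_cong_AE)
   show "AE x in wmeasure c. ennreal ((norm (u n x - g x))\<^sup>2) = liminf (%i. ennreal ((norm (u n x - u (r i) x))\<^sup>2))"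
    using conv
   proof eventually_elim
    fix x assume "convergent (%k. u (r k) x)"
    then have "(%k. u (r k) x) \<longlonglongrightarrow> g x" by (simp add: convergent_LIMSEQ_iff g_def)
    then have "(%i. ennreal ((norm (u n x - u (r i) x))\<^sup>2)) \<longlonglongrightarrow> ennreal ((norm (u n x - g x))\<^sup>2)"
     by (intro tendsto_ennrealI tendsto_intros)
    then show "ennreal ((norm (u n x - g x))\<^sup>2) = liminf (%i. ennreal ((norm (u n x - u (r i) x))\<^sup>2))"
     by (intro lim_imp_Liminf[symmetric]) simp
   qed
  qed
  also have "... <= liminf (%i. \<integral>\<^sup>+x. ennreal ((norm (u n x - u (r i) x))\<^sup>2) \<partial>wmeasure c)"
   by (rule nn_integral_liminf) measurable
  also have "... <= ennreal (((1 / 2) ^ k)\<^sup>2)"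
  proof (rule Liminf_le)
   show "\<forall>\<^sub>F i in sequentially. (\<integral>\<^sup>+x. ennreal ((norm (u n x - u (r i) x))\<^sup>2) \<partial>wmeasure c) <= ennreal (((1 / 2) ^ k)\<^sup>2)"
    using eventually_ge_at_top[of "N0 k"]
   proof eventually_elim
    fix i assume "N0 k <= i"
    then have "l2_norm c (%x. u n x - u (r i) x) < (1 / 2) ^ k" using r(3)[of i] n by (intro N0) auto
    then show "(\<integral>\<^sup>+x. ennreal ((norm (u n x - u (r i) x))\<^sup>2) \<partial>wmeasure c) <= ennreal (((1 / 2) ^ k)\<^sup>2)"
     unfolding l2_norm_nn[OF ud] using l2_norm_nonneg[OF ud, of n "r i"] by (intro ennreal_leI power_mono) auto
   qed
  qed simp
  finally show ?thesis .
 qed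
 have dL: "(%x. u n x - g x) \<in> L2 c" if "n \<ge> N0 0" for n
 proof (rule L2I_nn)
  show "(\<integral>\<^sup>+x. ennreal ((norm (u n x - g x))\<^sup>2) \<partial>wmeasure c) < \<infinity>"
   using le_less_trans[OF close[OF that] ennreal_less_top] by simp
 qed measurable
 have "g \<in> L2 c" using L2_diff[OF u[of "N0 0"] dL[of "N0 0"]] by simp
 moreover have "(%n. l2_norm c (%x. u n x - g x)) \<longlonglongrightarrow> 0"
 proof (rule LIMSEQ_I)
  fix e :: real assume "e > 0"
  then obtain k where k: "(1 / 2) ^ k < e" using real_arch_pow_inv[of e "1 / 2"] by auto
  have "norm (l2_norm c (%x. u n x - g x) - 0) < e" if "n \<ge> N0 k" for n
  proof -
   have d: "(%x. u n x - g x) \<in> L2 c" by (rule L2_diff[OF u \<open>g \<in> L2 c\<close>])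
   have "l2_norm c (%x. u n x - g x) <= (1 / 2) ^ k" by (rule l2_norm_le_nn[OF d close[OF that]]) simp
   then show ?thesis using l2_norm_nonneg[OF d] k by simp
  qed
  then show "\<exists>no. \<forall>n\<ge>no. norm (l2_norm c (%x. u n x - g x) - 0) < e" by blast
 qed
 ultimately show thesis by (rule that)
qed

section \<open>Diagonal operators and their functional calculus\<close>

lemma l2_norm_minus_commute:
 assumes "f \<in> L2 c" "g \<in> L2 c"
 shows "l2_norm c (%x. f x - g x) = l2_norm c (%x. g x - f x)"
 unfolding l2_norm_eq[OF L2_diff[OF assms]] l2_norm_eq[OF L2_diff[OF assms(2,1)]]
 by (simp add: norm_minus_commute)

text \<open>\<open>V\<close> marks the valid indices: the basis labels are to be coded by all
  natural numbers, and a code without a label carries a vector of norm 0.\<close>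

locale l2_basis =
 fixes c :: real and e :: "nat => 'n::{finite,linorder} clfun" and V :: "nat => bool"
 assumes e_L2: "e i \<in> L2 c"
  and ortho: "l2_inner c (e i) (e j) = (if i = j \<and> V i then 1 else 0)"
  and complete: "f \<in> L2 c ==> (!!i. l2_inner c (e i) f = 0) ==> l2_norm c f = 0"
begin

abbreviation co :: "('n clfun) => nat => complex" where
 "co f i \<equiv> l2_inner c (e i) f"

definition psum :: "nat => (nat => complex) => 'n clfun" where
 "psum n a x = (\<Sum>i<n. a i *s e i x)"

lemma psum_L2: "psum n a \<in> L2 c"
 unfolding psum_def[abs_def] by (intro L2_sum L2_smult e_L2)

lemma inner_psum: "f \<in> L2 c ==> l2_inner c f (psum n a) = (\<Sum>i<n. a i * l2_inner c f (e i))"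
 unfolding psum_def[abs_def] by (simp add: l2_inner_sum_right L2_smult l2_inner_smult_right e_L2)

lemma co_psum: "co (psum n a) j = (if j < n \<and> V j then a j else 0)"
 unfolding inner_psum[OF e_L2] ortho by (simp add: if_distrib cong: if_cong) (auto intro!: sum.neutral)

lemma co_invalid: "\<not> V i ==> f \<in> L2 c ==> co f i = 0"
proof -
 assume i: "\<not> V i" and f: "f \<in> L2 c"
 have "(l2_norm c (e i))\<^sup>2 = 0"
  using l2_inner_self_norm[OF e_L2, of i] i by (simp add: ortho)
 then show ?thesis using l2_cauchy_schwarz[OF e_L2 f, of i] by simp
qed

lemma norm_psum: "(l2_norm c (psum n a))\<^sup>2 = (\<Sum>i<n. if V i then (cmod (a i))\<^sup>2 else 0)"
proof -
 have "of_real ((l2_norm c (psum n a))\<^sup>2) = (\<Sum>i<n. a i * cnj (co (psum n a) i))"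
  unfolding l2_inner_self_norm[OF psum_L2, symmetric] l2_inner_cnj[OF e_L2 psum_L2]
  by (rule inner_psum[OF psum_L2])
 also have "... = (\<Sum>i<n. of_real (if V i then (cmod (a i))\<^sup>2 else 0))"
  unfolding co_psum by (intro sum.cong refl) (auto simp: complex_norm_square simp del: of_real_power)
 also have "... = of_real (\<Sum>i<n. if V i then (cmod (a i))\<^sup>2 else 0)" by simp
 finally show ?thesis by (simp only: of_real_eq_iff)
qed

lemma norm_psum_diff:
 assumes "n <= m"
 shows "(l2_norm c (%x. psum m a x - psum n a x))\<^sup>2 <= (\<Sum>i\<in>{n..<m}. (cmod (a i))\<^sup>2)"
proof -
 have "psum m a x - psum n a x = psum m (%i. if i < n then 0 else a i) x" for x
 proof -
  have "psum m a x = psum n a x + (\<Sum>i\<in>{n..<m}. a i *s e i x)"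
   unfolding psum_def ivl_disj_un_one(2)[OF assms, symmetric] by (rule sum.union_disjoint) auto
  moreover have "psum m (%i. if i < n then 0 else a i) x = (\<Sum>i\<in>{n..<m}. a i *s e i x)"
   unfolding psum_def by (rule sum.mono_neutral_cong_right) auto
  ultimately show ?thesis by simp
 qed
 then have "(l2_norm c (%x. psum m a x - psum n a x))\<^sup>2 = (l2_norm c (psum m (%i. if i < n then 0 else a i)))\<^sup>2"
  by simp
 also have "... = (\<Sum>i\<in>{n..<m}. if V i then (cmod (a i))\<^sup>2 else 0)"
  unfolding norm_psum by (rule sum.mono_neutral_cong_right) auto
 also have "... <= (\<Sum>i\<in>{n..<m}. (cmod (a i))\<^sup>2)" by (rule sum_mono) auto
 finally show ?thesis .
qed

lemma norm_diff_psum: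
 assumes f: "f \<in> L2 c"
 shows "(l2_norm c (%x. f x - psum n (co f) x))\<^sup>2 = (l2_norm c f)\<^sup>2 - (\<Sum>i<n. (cmod (co f i))\<^sup>2)"
proof -
 let ?p = "psum n (co f)" and ?d = "%x. f x - psum n (co f) x"
 have d: "?d \<in> L2 c" by (rule L2_diff[OF f psum_L2])
 have cd: "co ?d i = 0" if "i < n" for i
  using that co_invalid[OF _ f, of i] by (simp add: l2_inner_diff_right[OF e_L2 f psum_L2] co_psum)
 have dp: "l2_inner c ?d ?p = 0"
  unfolding inner_psum[OF d] l2_inner_cnj[OF e_L2 d, symmetric] by (rule sum.neutral) (simp add: cd)
 have fp: "l2_inner c f ?p = of_real (\<Sum>i<n. (cmod (co f i))\<^sup>2)"
  unfolding inner_psum[OF f] l2_inner_cnj[OF e_L2 f, symmetric] of_real_sum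
  by (intro sum.cong refl) (simp only: complex_norm_square)
 have "l2_inner c ?d ?d = l2_inner c ?d f" using l2_inner_diff_right[OF d f psum_L2] dp by simp
 also have "... = cnj (l2_inner c f ?d)" by (rule l2_inner_cnj[OF f d, symmetric])
 also have "... = of_real ((l2_norm c f)\<^sup>2 - (\<Sum>i<n. (cmod (co f i))\<^sup>2))"
  unfolding l2_inner_diff_right[OF f f psum_L2] fp l2_inner_self_norm[OF f] by simp
 finally show ?thesis unfolding l2_inner_self_norm[OF d] of_real_eq_iff .
qed

lemma bessel: "f \<in> L2 c ==> (\<Sum>i<n. (cmod (co f i))\<^sup>2) <= (l2_norm c f)\<^sup>2"
 using norm_diff_psum[of f n] zero_le_power2[of "l2_norm c (%x. f x - psum n (co f) x)"] by simp

lemma summable_co: "f \<in> L2 c ==> summable (%i. (cmod (co f i))\<^sup>2)"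
 by (rule summableI_nonneg_bounded[where x = "(l2_norm c f)\<^sup>2"]) (auto intro: bessel)

lemma tendsto_inner:
 assumes u: "!!n. u n \<in> L2 c" and g: "g \<in> L2 c" and h: "h \<in> L2 c"
  and lim: "(%n. l2_norm c (%x. u n x - g x)) \<longlonglongrightarrow> 0"
 shows "(%n. l2_inner c h (u n)) \<longlonglongrightarrow> l2_inner c h g"
proof -
 have "(%n. l2_inner c h (u n) - l2_inner c h g) \<longlonglongrightarrow> 0"
 proof (rule Lim_null_comparison)
  show "\<forall>\<^sub>F n in sequentially. norm (l2_inner c h (u n) - l2_inner c h g) <= l2_norm c h * l2_norm c (%x. u n x - g x)"
   using l2_cauchy_schwarz[OF h L2_diff[OF u g]] l2_inner_diff_right[OF h u g] by simp
  show "(%n. l2_norm c h * l2_norm c (%x. u n x - g x)) \<longlonglongrightarrow> 0"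
   using tendsto_mult_right_zero[OF lim] .
 qed
 then show ?thesis by (simp add: LIM_zero_iff)
qed

text \<open>Orthogonality makes the partial sums Cauchy. Coefficients at invalid indices are lost,
  as the vectors there are null.\<close>

lemma synthesis:
 assumes a: "summable (%i. (cmod (a i))\<^sup>2)"
 obtains g where "g \<in> L2 c" "!!i. co g i = (if V i then a i else 0)" "(%n. l2_norm c (%x. psum n a x - g x)) \<longlonglongrightarrow> 0"
proof -
 have "\<exists>N. \<forall>m\<ge>N. \<forall>n\<ge>N. l2_norm c (%x. psum m a x - psum n a x) < r" if r: "r > 0" for r
 proof -
  from r have "r\<^sup>2 > 0" by simp
  then obtain N where N: "!!m n. m \<ge> N ==> norm (\<Sum>i\<in>{m..<n}. (cmod (a i))\<^sup>2) < r\<^sup>2"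
   using a unfolding summable_Cauchy by blast
  have *: "l2_norm c (%x. psum m a x - psum n a x) < r" if "n \<ge> N" "n <= m" for m n
  proof -
   have "(l2_norm c (%x. psum m a x - psum n a x))\<^sup>2 < r\<^sup>2"
    using norm_psum_diff[OF that(2), of a] N[OF that(1), of m] by simp
   then show ?thesis using r by (simp add: power_less_imp_less_base)
  qed
  have "l2_norm c (%x. psum m a x - psum n a x) < r" if "m \<ge> N" "n \<ge> N" for m n
   using *[of n m] *[of m n] that l2_norm_minus_commute[OF psum_L2 psum_L2, of n a m a] by (cases "n <= m") auto
  then show ?thesis by blast
 qed
 then obtain g where g: "g \<in> L2 c" "(%n. l2_norm c (%x. psum n a x - g x)) \<longlonglongrightarrow> 0"
  using riesz_fischer[of "%n. psum n a", OF psum_L2] by blast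
 have "co g i = (if V i then a i else 0)" for i
 proof (rule LIMSEQ_unique)
  show "(%n. co (psum n a) i) \<longlonglongrightarrow> co g i" by (rule tendsto_inner[OF psum_L2 g(1) e_L2 g(2)])
  have "\<forall>\<^sub>F n in sequentially. (if V i then a i else 0) = co (psum n a) i"
   using eventually_gt_at_top[of i] by eventually_elim (simp add: co_psum)
  then show "(%n. co (psum n a) i) \<longlonglongrightarrow> (if V i then a i else 0)"
   by (rule Lim_transform_eventually[OF tendsto_const])
 qed
 then show thesis using g that by blast
qed

lemma co_eq_norm:
 assumes f: "f \<in> L2 c" and g: "g \<in> L2 c" and "!!i. co f i = co g i"
 shows "l2_norm c (%x. f x - g x) = 0"
 using assms by (intro complete L2_diff) (simp_all add: l2_inner_diff_right e_L2)

lemma co_eq: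
 assumes f: "f \<in> L2 c" and g: "g \<in> L2 c" and "!!i. co f i = co g i"
 shows "l2_eq c f g"
 using co_eq_norm[OF assms] l2_norm_eq_0[OF L2_diff[OF f g]] by (simp add: l2_eq_def)

text \<open>The partial sums converge to some \<open>g\<close> by \<open>synthesis\<close>. It has
  the coefficients of \<open>f\<close>, so completeness makes g - f null.\<close>

lemma expansion:
 assumes f: "f \<in> L2 c"
 shows "(%n. l2_norm c (%x. psum n (co f) x - f x)) \<longlonglongrightarrow> 0"
proof -
 obtain g where g: "g \<in> L2 c" "!!i. co g i = (if V i then co f i else 0)" "(%n. l2_norm c (%x. psum n (co f) x - g x)) \<longlonglongrightarrow> 0"
  using synthesis[OF summable_co[OF f]] by blast
 have 0: "l2_norm c (%x. g x - f x) = 0"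
  by (rule co_eq_norm[OF g(1) f]) (simp add: g(2) co_invalid[OF _ f])
 show ?thesis
 proof (rule tendsto_sandwich[OF _ _ tendsto_const g(3)])
  show "\<forall>\<^sub>F n in sequentially. 0 <= l2_norm c (%x. psum n (co f) x - f x)"
   using l2_norm_nonneg[OF L2_diff[OF psum_L2 f]] by simp
  have "l2_norm c (%x. psum n (co f) x - f x) <= l2_norm c (%x. psum n (co f) x - g x)" for n
   using l2_norm_triangle[OF L2_diff[OF psum_L2[of n "co f"] g(1)] L2_diff[OF g(1) f]] 0 by simp
  then show "\<forall>\<^sub>F n in sequentially. l2_norm c (%x. psum n (co f) x - f x) <= l2_norm c (%x. psum n (co f) x - g x)"
   by simp
 qed
qed

lemma parseval:
 assumes f: "f \<in> L2 c"
 shows "(%i. (cmod (co f i))\<^sup>2) sums (l2_norm c f)\<^sup>2"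
proof -
 have "(%n. (l2_norm c (%x. psum n (co f) x - f x))\<^sup>2) \<longlonglongrightarrow> 0\<^sup>2"
  by (intro tendsto_power expansion f)
 then have "(%n. (l2_norm c f)\<^sup>2 - (\<Sum>i<n. (cmod (co f i))\<^sup>2)) \<longlonglongrightarrow> 0"
  unfolding l2_norm_minus_commute[OF psum_L2 f] norm_diff_psum[OF f] by simp
 from tendsto_diff[OF tendsto_const[of "(l2_norm c f)\<^sup>2"] this] show ?thesis by (simp add: sums_def)
qed

lemma inner_sums:
 assumes f: "f \<in> L2 c" and g: "g \<in> L2 c"
 shows "(%i. cnj (co f i) * co g i) sums l2_inner c f g"
proof -
 have "(%n. l2_inner c f (psum n (co g))) \<longlonglongrightarrow> l2_inner c f g"
  by (rule tendsto_inner[OF psum_L2 g f expansion[OF g]])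
 then show ?thesis
  unfolding inner_psum[OF f] l2_inner_cnj[OF e_L2 f, symmetric] sums_def by (simp add: mult.commute)
qed

lemma summable_co_mult:
 assumes f: "f \<in> L2 c" and g: "g \<in> L2 c"
 shows "summable (%i. norm (cnj (co f i) * co g i))"
proof (rule summable_comparison_test'[where N = 0])
 show "summable (%i. (cmod (co f i))\<^sup>2 + (cmod (co g i))\<^sup>2)" by (intro summable_add summable_co f g)
 fix i
 have "2 * cmod (co f i) * cmod (co g i) <= (cmod (co f i))\<^sup>2 + (cmod (co g i))\<^sup>2" by (rule sum_squares_bound)
 moreover have "0 <= cmod (co f i) * cmod (co g i)" by simp
 ultimately show "norm (norm (cnj (co f i) * co g i)) <= (cmod (co f i))\<^sup>2 + (cmod (co g i))\<^sup>2"
  unfolding norm_mult complex_mod_cnj real_norm_def abs_mult abs_norm_cancel by linarith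
qed

end

locale l2_eigenbasis = l2_basis c e V for c :: real and e :: "nat => 'n::{finite,linorder} clfun" and V +
 fixes \<mu> :: "nat => real"
begin

text \<open>The spectral projection, prescribed by coefficients. A choice is made because these
  determine a function only almost everywhere.\<close>

definition proj :: "real set => ('n clfun) => 'n clfun" where
 "proj S f = (SOME g. g \<in> L2 c \<and> (\<forall>i. co g i = (if \<mu> i \<in> S then co f i else 0)))"

lemma proj:
 assumes f: "f \<in> L2 c"
 shows "proj S f \<in> L2 c" "co (proj S f) i = (if \<mu> i \<in> S then co f i else 0)"
proof -
 have "summable (%i. (cmod (if \<mu> i \<in> S then co f i else 0))\<^sup>2)"
  by (rule summable_comparison_test'[OF summable_co[OF f], where N = 0]) auto
 then obtain g where "g \<in> L2 c" "!!i. co g i = (if V i then if \<mu> i \<in> S then co f i else 0 else 0)"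
  "(%n. l2_norm c (%x. psum n (%i. if \<mu> i \<in> S then co f i else 0) x - g x)) \<longlonglongrightarrow> 0"
  using synthesis[of "%i. if \<mu> i \<in> S then co f i else 0"] by blast
 then have "g \<in> L2 c \<and> (\<forall>i. co g i = (if \<mu> i \<in> S then co f i else 0))"
  using co_invalid[OF _ f] by simp
 then have "\<exists>g. g \<in> L2 c \<and> (\<forall>i. co g i = (if \<mu> i \<in> S then co f i else 0))" by (rule exI[of _ g])
 from someI_ex[OF this] show "proj S f \<in> L2 c" "co (proj S f) i = (if \<mu> i \<in> S then co f i else 0)"
  unfolding proj_def by blast+
qed

lemma inner_proj:
 assumes f: "f \<in> L2 c" and g: "g \<in> L2 c"
 shows "(%i. indicator S (\<mu> i) *r (cnj (co f i) * co g i)) sums l2_inner c f (proj S g)"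
proof -
 have "(%i. cnj (co f i) * co (proj S g) i) = (%i. indicator S (\<mu> i) *r (cnj (co f i) * co g i))"
  by (auto simp: fun_eq_iff proj(2)[OF g] indicator_def)
 then show ?thesis using inner_sums[OF f proj(1)[OF g], of S] by simp
qed

text \<open>Inner products are integrals over the counting measure, so countable additivity is
  dominated convergence with majorant |co f i * co g i|.\<close>

lemma proj_sums:
 assumes f: "f \<in> L2 c" and g: "g \<in> L2 c" and S: "disjoint_family (S :: nat => real set)"
 shows "(%n. l2_inner c f (proj (S n) g)) sums l2_inner c f (proj (\<Union>n. S n) g)"
proof -
 let ?h = "%i. cnj (co f i) * co g i"
 have h: "integrable (count_space UNIV) ?h"
  unfolding integrable_count_space_nat_iff by (rule summable_co_mult[OF f g])
 have ind: "integrable (count_space UNIV) (%i. w i *r ?h i)" if "!!i. \<bar>w i :: real\<bar> <= 1" for w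
  by (rule Bochner_Integration.integrable_bound[OF h]) (auto simp: that mult_left_le_one_le)
 have I: "l2_inner c f (proj T g) = (LINT i|count_space UNIV. indicator T (\<mu> i) *r ?h i)" for T
  unfolding integral_count_space_nat[OF ind[of "%i. indicator T (\<mu> i)", OF indicator_abs_le_1]]
  using inner_proj[OF f g] by (rule sums_unique)
 have d: "S i \<inter> S j = {}" if "i ~= j" for i j using S that by (auto simp: disjoint_family_on_def)
 have ind_sums: "(%n. indicator (S n) t :: real) sums indicator (\<Union>n. S n) t" for t
  by (rule indicator_sums) (use d in auto)
 have le: "\<bar>\<Sum>n<N. indicator (S n) t :: real\<bar> <= 1" for N t
 proof -
  have "(\<Sum>n<N. indicator (S n) t :: real) <= (\<Sum>n. indicator (S n) t)"
   by (rule sum_le_suminf[OF sums_summable[OF ind_sums]]) auto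
  also have "... = indicator (\<Union>n. S n) t" by (rule sums_unique[OF ind_sums, symmetric])
  also have "... <= 1" by (rule indicator_le_1)
  finally show ?thesis by (simp add: abs_of_nonneg sum_nonneg)
 qed
 have "(%N. LINT i|count_space UNIV. (\<Sum>n<N. indicator (S n) (\<mu> i)) *r ?h i)
   \<longlonglongrightarrow> (LINT i|count_space UNIV. indicator (\<Union>n. S n) (\<mu> i) *r ?h i)"
 proof (rule integral_dominated_convergence[where w = "%i. norm (?h i)"])
  show "integrable (count_space UNIV) (%i. norm (?h i))" using h by (rule integrable_norm)
  show "AE i in count_space UNIV. (%N. (\<Sum>n<N. indicator (S n) (\<mu> i)) *r ?h i) \<longlonglongrightarrow> indicator (\<Union>n. S n) (\<mu> i) *r ?h i"
   using ind_sums by (intro AE_I2 tendsto_scaleR tendsto_const) (simp add: sums_def)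
  show "AE i in count_space UNIV. norm ((\<Sum>n<N. indicator (S n) (\<mu> i)) *r ?h i) <= norm (?h i)" for N
   using le[where N = N] by (intro AE_I2) (simp add: mult_left_le_one_le)
 qed auto
 moreover have "(LINT i|count_space UNIV. (\<Sum>n<N. indicator (S n) (\<mu> i)) *r ?h i) = (\<Sum>n<N. l2_inner c f (proj (S n) g))" for N
  unfolding I scaleR_left.sum by (rule Bochner_Integration.integral_sum) (rule ind[OF indicator_abs_le_1])
 ultimately show ?thesis unfolding sums_def I[of "\<Union>n. S n"] by simp
qed

lemma resolution: "resolution_of_identity c proj"
 unfolding resolution_of_identity_def
proof (intro conjI ballI allI impI)
 fix S :: "real set" and f g :: "'n clfun" assume f: "f \<in> L2 c" and g: "g \<in> L2 c"
 show "l2_inner c (proj S f) g = l2_inner c f (proj S g)"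
 proof (rule sums_unique2)
  show "(%i. cnj (co (proj S f) i) * co g i) sums l2_inner c (proj S f) g" by (rule inner_sums[OF proj(1)[OF f] g])
  have "(%i. cnj (co (proj S f) i) * co g i) = (%i. cnj (co f i) * co (proj S g) i)"
   by (auto simp: fun_eq_iff proj(2)[OF f] proj(2)[OF g])
  then show "(%i. cnj (co (proj S f) i) * co g i) sums l2_inner c f (proj S g)"
   using inner_sums[OF f proj(1)[OF g], of S] by simp
 qed
next
 fix S S' :: "real set" and f :: "'n clfun" assume f: "f \<in> L2 c"
 show "l2_eq c (proj (S \<inter> S') f) (proj S (proj S' f))"
  by (rule co_eq) (simp_all add: proj f)
next
 fix f :: "'n clfun" assume f: "f \<in> L2 c"
 show "l2_eq c (proj UNIV f) f" by (rule co_eq) (simp_all add: proj f)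
next
 fix S :: "nat => real set" and f g :: "'n clfun"
 assume "disjoint_family S" "f \<in> L2 c" "g \<in> L2 c"
 then show "(%n. l2_inner c f (proj (S n) g)) sums l2_inner c f (proj (\<Union>n. S n) g)" by (intro proj_sums)
qed (rule proj(1))

text \<open>\<open>measure_of\<close> keeps its set function only if that is a measure. Here it is
  recognised as the image under \<mu> of the weights |co f i|^2.\<close>

lemma vector_measure_eq:
 assumes f: "f \<in> L2 c"
 shows "vector_measure c proj f = distr (density (count_space UNIV) (%i. ennreal ((cmod (co f i))\<^sup>2))) borel \<mu>"
proof -
 let ?D = "distr (density (count_space UNIV) (%i. ennreal ((cmod (co f i))\<^sup>2))) borel \<mu>"
 have "emeasure ?D S = ennreal (Re (l2_inner c f (proj S f)))" if S: "S \<in> sets borel" for S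
 proof -
  have "emeasure ?D S = emeasure (density (count_space UNIV) (%i. ennreal ((cmod (co f i))\<^sup>2))) (\<mu> -` S)"
   using S by (subst emeasure_distr) auto
  also have "... = (\<integral>\<^sup>+i. ennreal ((cmod (co f i))\<^sup>2) * indicator (\<mu> -` S) i \<partial>count_space UNIV)"
   by (subst emeasure_density) auto
  also have "... = (\<Sum>i. ennreal ((cmod (co f i))\<^sup>2) * indicator (\<mu> -` S) i)"
   by (rule nn_integral_count_space_nat)
  also have "... = (\<Sum>i. ennreal (indicator S (\<mu> i) * (cmod (co f i))\<^sup>2))"
   by (intro suminf_cong) (auto simp: indicator_def)
  also have "... = ennreal (\<Sum>i. indicator S (\<mu> i) * (cmod (co f i))\<^sup>2)"
   by (rule suminf_ennreal2) (auto intro!: summable_comparison_test'[OF summable_co[OF f], where N = 0] simp: indicator_def)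
  also have "(\<Sum>i. indicator S (\<mu> i) * (cmod (co f i))\<^sup>2) = Re (l2_inner c f (proj S f))"
  proof -
   have "(%i. Re (indicator S (\<mu> i) *r (cnj (co f i) * co f i))) sums Re (l2_inner c f (proj S f))"
    by (rule sums_Re[OF inner_proj[OF f f]])
   moreover have "Re (indicator S (\<mu> i) *r (cnj (co f i) * co f i)) = indicator S (\<mu> i) * (cmod (co f i))\<^sup>2" for i
    by (simp add: cmod_power2) (simp add: power2_eq_square algebra_simps)
   ultimately show ?thesis by (simp only: sums_iff)
  qed
  finally show ?thesis .
 qed
 then have "measure_of UNIV (sets borel) (%S. ennreal (Re (l2_inner c f (proj S f)))) = measure_of UNIV (sets borel) (emeasure ?D)"
  by (intro measure_of_eq) (auto simp: sets.sigma_sets_eq[of borel, simplified])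
 also have "... = ?D" using measure_of_of_measure[of ?D] by simp
 finally show ?thesis by (simp add: vector_measure_def)
qed

lemma nn_integral_vector_measure:
 assumes f: "f \<in> L2 c" and [measurable]: "h \<in> borel_measurable borel"
 shows "(\<integral>\<^sup>+t. h t \<partial>vector_measure c proj f) = (\<Sum>i. ennreal ((cmod (co f i))\<^sup>2) * h (\<mu> i))"
 unfolding vector_measure_eq[OF f]
 by (subst nn_integral_distr, simp, simp, subst nn_integral_density) (simp_all add: nn_integral_count_space_nat)

lemma spectral_sum:
 assumes f: "f \<in> L2 c" and s: "simple_function borel s"
 shows "(%x. \<Sum>a\<in>range s. a *s proj (s -` {a}) f x) \<in> L2 c"
  and "co (%x. \<Sum>a\<in>range s. a *s proj (s -` {a}) f x) i = s (\<mu> i) * co f i"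
proof -
 have fin: "finite (range s)" using simple_functionD(1)[OF s] by simp
 show "(%x. \<Sum>a\<in>range s. a *s proj (s -` {a}) f x) \<in> L2 c"
  by (intro L2_sum L2_smult proj(1) f)
 have "co (%x. \<Sum>a\<in>range s. a *s proj (s -` {a}) f x) i = (\<Sum>a\<in>range s. a * co (proj (s -` {a}) f) i)"
  by (simp add: l2_inner_sum_right e_L2 L2_smult proj(1) f l2_inner_smult_right)
 also have "... = (\<Sum>a\<in>range s. if a = s (\<mu> i) then s (\<mu> i) * co f i else 0)"
  by (intro sum.cong refl) (auto simp: proj(2)[OF f])
 also have "... = s (\<mu> i) * co f i" using fin by simp
 finally show "co (%x. \<Sum>a\<in>range s. a *s proj (s -` {a}) f x) i = s (\<mu> i) * co f i" .
qed

text \<open>The maximal diagonal operator with eigenvalues \<mu>; being given by coefficients, it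
  does not see null sets.\<close>

definition mult_graph :: "'n l2_graph" where
 "mult_graph = {(f, g). f \<in> L2 c \<and> g \<in> L2 c \<and> (\<forall>i. co g i = of_real (\<mu> i) * co f i)}"

text \<open>One term of a nonnegative series is at most its sum, so convergence in L^2 of the
  spectral measure gives convergence of every coefficient.\<close>

lemma spectral_integral_subset: "spectral_integral c proj of_real \<subseteq> mult_graph"
proof
 fix p assume "p \<in> spectral_integral c proj of_real"
 then obtain f g s where p: "p = (f, g)" and f: "f \<in> L2 c" and g: "g \<in> L2 c"
  and s: "!!n. simple_function borel (s n)"
  and nn: "(%n. \<integral>\<^sup>+t. ennreal ((cmod (s n t - of_real t))\<^sup>2) \<partial>vector_measure c proj f) \<longlonglongrightarrow> 0"
  and lim: "(%n. l2_norm c (%x. (\<Sum>a\<in>range (s n). a *s proj (s n -` {a}) f x) - g x)) \<longlonglongrightarrow> 0"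
  unfolding spectral_integral_def by blast
 have [measurable]: "s n \<in> borel_measurable borel" for n using s by (rule borel_measurable_simple_function)
 have "co g i = of_real (\<mu> i) * co f i" for i
 proof (rule LIMSEQ_unique)
  show "(%n. s n (\<mu> i) * co f i) \<longlonglongrightarrow> co g i"
   using tendsto_inner[OF spectral_sum(1)[OF f s] g e_L2 lim, of i] unfolding spectral_sum(2)[OF f s] .
  let ?r = "%n. (cmod (s n (\<mu> i) * co f i - of_real (\<mu> i) * co f i))\<^sup>2"
  have le: "ennreal (?r n) <= (\<integral>\<^sup>+t. ennreal ((cmod (s n t - of_real t))\<^sup>2) \<partial>vector_measure c proj f)" for n
  proof -
   have "ennreal (?r n) = ennreal ((cmod (co f i))\<^sup>2) * ennreal ((cmod (s n (\<mu> i) - of_real (\<mu> i)))\<^sup>2)"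
    unfolding left_diff_distrib[symmetric] norm_mult power_mult_distrib
    by (subst mult.commute, rule ennreal_mult) simp_all
   also have "... <= (\<Sum>i. ennreal ((cmod (co f i))\<^sup>2) * ennreal ((cmod (s n (\<mu> i) - of_real (\<mu> i)))\<^sup>2))"
    using sum_le_suminf[OF summableI, of "{i}" "%i. ennreal ((cmod (co f i))\<^sup>2) * ennreal ((cmod (s n (\<mu> i) - of_real (\<mu> i)))\<^sup>2)"] by simp
   also have "... = (\<integral>\<^sup>+t. ennreal ((cmod (s n t - of_real t))\<^sup>2) \<partial>vector_measure c proj f)"
    by (rule nn_integral_vector_measure[OF f, symmetric]) measurable
   finally show ?thesis .
  qed
  have "(%n. ennreal (?r n)) \<longlonglongrightarrow> ennreal 0"
   by (rule tendsto_sandwich[OF _ _ tendsto_const nn[folded ennreal_0]]) (simp_all add: le)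
  then have "?r \<longlonglongrightarrow> 0" by (subst (asm) tendsto_ennreal_iff) auto
  then have "(%n. sqrt (?r n)) \<longlonglongrightarrow> sqrt 0" by (rule tendsto_real_sqrt)
  then have "(%n. s n (\<mu> i) * co f i - of_real (\<mu> i) * co f i) \<longlonglongrightarrow> 0" by (simp add: tendsto_norm_zero_iff)
  then show "(%n. s n (\<mu> i) * co f i) \<longlonglongrightarrow> of_real (\<mu> i) * co f i" by (simp add: LIM_zero_iff)
 qed
 then show "p \<in> mult_graph" using f g by (simp add: p mult_graph_def)
qed

lemma spectral_integral_superset: "mult_graph \<subseteq> spectral_integral c proj of_real"
proof
 fix p assume "p \<in> mult_graph"
 then obtain f g where p: "p = (f, g)" and f: "f \<in> L2 c" and g: "g \<in> L2 c" and gi: "!!i. co g i = of_real (\<mu> i) * co f i"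
  unfolding mult_graph_def by blast
 \<comment> \<open>The identity on the first n eigenvalues and 0 elsewhere. It has finitely many
   values, and its error is at most a tail of the squared coefficients of \<open>g\<close>, however
   fast \<mu> grows.\<close>
 define s where "s n t = (if t \<in> \<mu> ` {..<n} then of_real t else 0 :: complex)" for n :: nat and t
 have [measurable]: "s n \<in> borel_measurable borel" for n
  unfolding s_def[abs_def] by (rule measurable_If_set) (auto intro!: borel_closed finite_imp_closed)
 have s: "simple_function borel (s n)" for n
 proof (rule simple_function_borel_measurable)
  have "range (s n) \<subseteq> insert 0 (of_real ` \<mu> ` {..<n})" by (auto simp: s_def)
  then show "finite (s n ` space borel)" by (simp add: finite_subset)
 qed measurable
 define F where "F n x = (\<Sum>a\<in>range (s n). a *s proj (s n -` {a}) f x)" for n x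
 have F: "F n \<in> L2 c" "co (F n) i = s n (\<mu> i) * co f i" for n i
  unfolding F_def[abs_def] by (rule spectral_sum[OF f s])+
 have d: "(%x. F n x - g x) \<in> L2 c" for n by (rule L2_diff[OF F(1) g])
 define T where "T n i = (cmod (s n (\<mu> i) - of_real (\<mu> i)))\<^sup>2 * (cmod (co f i))\<^sup>2" for n i
 have Tco: "T n i = (cmod (co (%x. F n x - g x) i))\<^sup>2" for n i
  unfolding l2_inner_diff_right[OF e_L2 F(1) g] F(2) gi T_def
  by (simp only: left_diff_distrib[symmetric] norm_mult power_mult_distrib)
 have Ts: "T n sums (l2_norm c (%x. F n x - g x))\<^sup>2" for n
  using parseval[OF d] unfolding Tco[symmetric] by simp
 have Tle: "T n i <= (cmod (co g i))\<^sup>2 - (if i \<in> {..<n} then (cmod (co g i))\<^sup>2 else 0)" for n i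
  by (auto simp: T_def s_def gi norm_mult power_mult_distrib)
 have R: "(%i. (cmod (co g i))\<^sup>2 - (if i \<in> {..<n} then (cmod (co g i))\<^sup>2 else 0)) sums ((l2_norm c g)\<^sup>2 - (\<Sum>i<n. (cmod (co g i))\<^sup>2))" for n
  by (intro sums_diff parseval[OF g] sums_If_finite_set) simp
 have le: "(l2_norm c (%x. F n x - g x))\<^sup>2 <= (l2_norm c g)\<^sup>2 - (\<Sum>i<n. (cmod (co g i))\<^sup>2)" for n
  by (rule sums_le[OF Tle Ts R])
 have "(%n. (l2_norm c g)\<^sup>2 - (\<Sum>i<n. (cmod (co g i))\<^sup>2)) \<longlonglongrightarrow> (l2_norm c g)\<^sup>2 - (l2_norm c g)\<^sup>2"
  using parseval[OF g] by (intro tendsto_diff tendsto_const) (simp add: sums_def)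
 then have lim2: "(%n. (l2_norm c (%x. F n x - g x))\<^sup>2) \<longlonglongrightarrow> 0"
  by (intro tendsto_sandwich[OF _ _ tendsto_const, of 0 "%n. (l2_norm c (%x. F n x - g x))\<^sup>2" sequentially "%n. (l2_norm c g)\<^sup>2 - (\<Sum>i<n. (cmod (co g i))\<^sup>2)"]) (simp_all add: le)
 have "(%n. sqrt ((l2_norm c (%x. F n x - g x))\<^sup>2)) \<longlonglongrightarrow> sqrt 0" by (rule tendsto_real_sqrt[OF lim2])
 then have lim: "(%n. l2_norm c (%x. F n x - g x)) \<longlonglongrightarrow> 0" using l2_norm_nonneg[OF d] by simp
 have "(\<integral>\<^sup>+t. ennreal ((cmod (s n t - of_real t))\<^sup>2) \<partial>vector_measure c proj f) = ennreal ((l2_norm c (%x. F n x - g x))\<^sup>2)" for n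
 proof -
  have "(\<integral>\<^sup>+t. ennreal ((cmod (s n t - of_real t))\<^sup>2) \<partial>vector_measure c proj f)
    = (\<Sum>i. ennreal ((cmod (co f i))\<^sup>2) * ennreal ((cmod (s n (\<mu> i) - of_real (\<mu> i)))\<^sup>2))"
   by (rule nn_integral_vector_measure[OF f]) measurable
  also have "... = (\<Sum>i. ennreal (T n i))"
   by (simp add: T_def ennreal_mult[symmetric] mult.commute)
  also have "... = ennreal (suminf (T n))"
   by (rule suminf_ennreal2[OF _ sums_summable[OF Ts]]) (simp add: T_def)
  also have "suminf (T n) = (l2_norm c (%x. F n x - g x))\<^sup>2" by (rule sums_unique[OF Ts, symmetric])
  finally show ?thesis .
 qed
 then have nn: "(%n. \<integral>\<^sup>+t. ennreal ((cmod (s n t - of_real t))\<^sup>2) \<partial>vector_measure c proj f) \<longlonglongrightarrow> 0"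
  using tendsto_ennrealI[OF lim2] by simp
 show "p \<in> spectral_integral c proj of_real"
  unfolding spectral_integral_def p mem_Collect_eq case_prod_conv
  by (intro conjI f g exI[of _ s] allI s nn lim[unfolded F_def])
qed

text \<open>For \<open>f\<close> in one eigenspace the spectral measure sits at the point
  \<open>t\<close>, so the constant simple function with value \<open>\<psi> t\<close> is already
  exact.\<close>

lemma spectral_integral_eigen:
 assumes f: "f \<in> L2 c" and ev: "!!i. co f i ~= 0 ==> \<mu> i = t" and [measurable]: "\<psi> \<in> borel_measurable borel"
 shows "(f, %x. \<psi> t *s f x) \<in> spectral_integral c proj \<psi>"
proof -
 define s where "s = (%(n :: nat) (_ :: real). \<psi> t)"
 have s: "simple_function borel (s n)" for n by (simp add: s_def)
 have "(\<integral>\<^sup>+r. ennreal ((cmod (s n r - \<psi> r))\<^sup>2) \<partial>vector_measure c proj f) = 0" for n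
 proof -
  have "(\<integral>\<^sup>+r. ennreal ((cmod (s n r - \<psi> r))\<^sup>2) \<partial>vector_measure c proj f)
    = (\<Sum>i. ennreal ((cmod (co f i))\<^sup>2) * ennreal ((cmod (s n (\<mu> i) - \<psi> (\<mu> i)))\<^sup>2))"
   unfolding s_def by (rule nn_integral_vector_measure[OF f]) measurable
  also have "... = (\<Sum>i. 0)" using ev by (intro suminf_cong) (auto simp: s_def)
  finally show ?thesis by simp
 qed
 moreover have "l2_norm c (%x. (\<Sum>a\<in>range (s n). a *s proj (s n -` {a}) f x) - \<psi> t *s f x) = 0" for n
  by (rule co_eq_norm[OF spectral_sum(1)[OF f s] L2_smult[OF f]])
   (simp only: spectral_sum(2)[OF f s] l2_inner_smult_right[OF e_L2 f], simp add: s_def)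
 ultimately show ?thesis
  unfolding spectral_integral_def using f L2_smult[OF f] s by (auto intro!: exI[of _ s])
qed

text \<open>Coefficients depend continuously on the function, so limits of the graph stay in the
  maximal operator. Conversely the expansions of \<open>f\<close> and of \<open>g\<close> are the
  two components of pairs in \<open>G\<close>.\<close>

lemma graph_closure_eq:
 assumes sub: "G \<subseteq> mult_graph" and fin: "!!n a. (psum n a, psum n (%i. of_real (\<mu> i) * a i)) \<in> G"
 shows "graph_closure c G = mult_graph"
proof
 show "graph_closure c G \<subseteq> mult_graph"
 proof
  fix p assume "p \<in> graph_closure c G"
  then obtain f g u v where p: "p = (f, g)" and f: "f \<in> L2 c" and g: "g \<in> L2 c" and uv: "!!n. (u n, v n) \<in> G"
   and u: "(%n. l2_norm c (%x. u n x - f x)) \<longlonglongrightarrow> 0" and v: "(%n. l2_norm c (%x. v n x - g x)) \<longlonglongrightarrow> 0"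
   unfolding graph_closure_def by blast
  have uL: "u n \<in> L2 c" and vL: "v n \<in> L2 c" and co: "co (v n) i = of_real (\<mu> i) * co (u n) i" for n i
   using sub uv[of n] by (auto simp: mult_graph_def)
  have "co g i = of_real (\<mu> i) * co f i" for i
  proof (rule LIMSEQ_unique)
   show "(%n. co (v n) i) \<longlonglongrightarrow> co g i" by (rule tendsto_inner[OF vL g e_L2 v])
   show "(%n. co (v n) i) \<longlonglongrightarrow> of_real (\<mu> i) * co f i"
    unfolding co by (intro tendsto_mult tendsto_const tendsto_inner[OF uL f e_L2 u])
  qed
  then show "p \<in> mult_graph" using f g by (simp add: p mult_graph_def)
 qed
 show "mult_graph \<subseteq> graph_closure c G"
 proof
  fix p assume "p \<in> mult_graph"
  then obtain f g where p: "p = (f, g)" and f: "f \<in> L2 c" and g: "g \<in> L2 c" and gi: "!!i. co g i = of_real (\<mu> i) * co f i"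
   unfolding mult_graph_def by blast
  have "(%i. of_real (\<mu> i) * co f i) = co g" using gi by auto
  then have "(%n. l2_norm c (%x. psum n (%i. of_real (\<mu> i) * co f i) x - g x)) \<longlonglongrightarrow> 0"
   using expansion[OF g] by simp
  then show "p \<in> graph_closure c G"
   unfolding graph_closure_def p mem_Collect_eq case_prod_conv
   using f g fin[of _ "co f"] expansion[OF f]
   by (intro conjI exI[of _ "%n. psum n (co f)"] exI[of _ "%n. psum n (%i. of_real (\<mu> i) * co f i)"] allI)
 qed
qed

theorem functional_calculus_eigen:
 assumes sub: "G \<subseteq> mult_graph" and fin: "!!n a. (psum n a, psum n (%i. of_real (\<mu> i) * a i)) \<in> G"
  and f: "f \<in> L2 c" and ev: "!!i. co f i ~= 0 ==> \<mu> i = t" and \<psi>: "\<psi> \<in> borel_measurable borel"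
 shows "(f, %x. \<psi> t *s f x) \<in> functional_calculus c (graph_closure c G) \<psi>"
proof -
 have "graph_closure c G = spectral_integral c proj of_real"
  using graph_closure_eq[OF sub fin] spectral_integral_subset spectral_integral_superset by simp
 then show ?thesis
  unfolding functional_calculus_def using resolution spectral_integral_eigen[OF f ev \<psi>] by blast
qed

end

section \<open>The oscillator\<close>

lemma has_pd_cong_nonzero:
 fixes x :: "'n::finite point"
 assumes f: "has_pd i f D x" and x: "x ~= 0" and eq: "!!y. y ~= 0 ==> f y = g y"
 shows "has_pd i g D x"
 unfolding has_pd_def
proof (rule has_vector_derivative_transform_within_open[OF f[unfolded has_pd_def]])
 show "open {t :: real. x + t *r axis i 1 ~= 0}"
  by (intro open_Collect_neq continuous_intros)
qed (use x eq in auto)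

text \<open>\<open>D\<close> is the deformed Dirac image of \<open>f\<close> off the origin, where
  all partial derivatives are required to exist. The origin is left out because of the powers of
  |x|; as a relation the notion can be iterated.\<close>

definition has_rdef :: "real => ('n::{finite,linorder} clfun) => ('n clfun) => bool" where
 "has_rdef c f D \<longleftrightarrow> (\<forall>x. x ~= 0 --> (\<exists>p. (\<forall>i. has_pd i f (p i) x) \<and>
   D x = (\<Sum>i\<in>UNIV. cl_gen i \<odot> p i) + (c / nsq x) *r (cl_vec x \<odot> (\<Sum>i\<in>UNIV. x $ i *r p i))))"

lemma rdef_dirac_eq: "has_rdef c f D ==> x ~= 0 ==> rdef_dirac c f x = D x"
proof -
 assume "has_rdef c f D" "x ~= 0"
 then obtain p where p: "!!i. has_pd i f (p i) x"
  and D: "D x = (\<Sum>i\<in>UNIV. cl_gen i \<odot> p i) + (c / nsq x) *r (cl_vec x \<odot> (\<Sum>i\<in>UNIV. x $ i *r p i))"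
  unfolding has_rdef_def by blast
 have "partial i f x = p i" for i by (rule partial_eq[OF p])
 then show ?thesis by (simp add: rdef_dirac_def dirac_def euler_def D)
qed

lemma has_rdef_cong:
 assumes "has_rdef c f D" and f: "!!x. x ~= 0 ==> f x = f' x" and D: "!!x. x ~= 0 ==> D x = D' x"
 shows "has_rdef c f' D'"
 unfolding has_rdef_def
proof (intro allI impI)
 fix x :: "'a point" assume x: "x ~= 0"
 with assms(1) obtain p where p: "!!i. has_pd i f (p i) x"
  and Dx: "D x = (\<Sum>i\<in>UNIV. cl_gen i \<odot> p i) + (c / nsq x) *r (cl_vec x \<odot> (\<Sum>i\<in>UNIV. x $ i *r p i))"
  unfolding has_rdef_def by blast
 show "\<exists>p. (\<forall>i. has_pd i f' (p i) x) \<and>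
   D' x = (\<Sum>i\<in>UNIV. cl_gen i \<odot> p i) + (c / nsq x) *r (cl_vec x \<odot> (\<Sum>i\<in>UNIV. x $ i *r p i))"
  using has_pd_cong_nonzero[OF p x f] Dx D[OF x] by (intro exI[of _ p]) auto
qed

lemma has_rdef_zero: "has_rdef c (%_. 0) (%_. 0)"
 unfolding has_rdef_def by (auto intro!: exI[of _ "%_. 0"] has_pd_const)

lemma has_rdef_add:
 assumes "has_rdef c f D" "has_rdef c g E"
 shows "has_rdef c (%x. f x + g x) (%x. D x + E x)"
 unfolding has_rdef_def
proof (intro allI impI)
 fix x :: "'a point" assume x: "x ~= 0"
 obtain p where p: "!!i. has_pd i f (p i) x"
  and D: "D x = (\<Sum>i\<in>UNIV. cl_gen i \<odot> p i) + (c / nsq x) *r (cl_vec x \<odot> (\<Sum>i\<in>UNIV. x $ i *r p i))"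
  using assms(1) x unfolding has_rdef_def by blast
 obtain q where q: "!!i. has_pd i g (q i) x"
  and E: "E x = (\<Sum>i\<in>UNIV. cl_gen i \<odot> q i) + (c / nsq x) *r (cl_vec x \<odot> (\<Sum>i\<in>UNIV. x $ i *r q i))"
  using assms(2) x unfolding has_rdef_def by blast
 have "D x + E x = (\<Sum>i\<in>UNIV. cl_gen i \<odot> (p i + q i)) + (c / nsq x) *r (cl_vec x \<odot> (\<Sum>i\<in>UNIV. x $ i *r (p i + q i)))"
  unfolding D E by (simp add: cl_mult_add_right scaleR_add_right sum.distrib)
 then show "\<exists>p. (\<forall>i. has_pd i (%x. f x + g x) (p i) x) \<and>
   D x + E x = (\<Sum>i\<in>UNIV. cl_gen i \<odot> p i) + (c / nsq x) *r (cl_vec x \<odot> (\<Sum>i\<in>UNIV. x $ i *r p i))"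
  using has_pd_add[OF p q] by (intro exI[of _ "%i. p i + q i"]) auto
qed

lemma has_rdef_smult:
 assumes "has_rdef c f D"
 shows "has_rdef c (%x. s *s f x) (%x. s *s D x)"
 unfolding has_rdef_def
proof (intro allI impI)
 fix x :: "'a point" assume x: "x ~= 0"
 obtain p where p: "!!i. has_pd i f (p i) x"
  and D: "D x = (\<Sum>i\<in>UNIV. cl_gen i \<odot> p i) + (c / nsq x) *r (cl_vec x \<odot> (\<Sum>i\<in>UNIV. x $ i *r p i))"
  using assms(1) x unfolding has_rdef_def by blast
 have "s *s D x = (\<Sum>i\<in>UNIV. cl_gen i \<odot> (s *s p i)) + (c / nsq x) *r (cl_vec x \<odot> (\<Sum>i\<in>UNIV. x $ i *r (s *s p i)))"
  unfolding D vector_add_ldistrib smult_scaleR[symmetric] vec.scale_sum_right[symmetric] cl_mult_scale_right ..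
 then show "\<exists>p. (\<forall>i. has_pd i (%x. s *s f x) (p i) x) \<and>
   s *s D x = (\<Sum>i\<in>UNIV. cl_gen i \<odot> p i) + (c / nsq x) *r (cl_vec x \<odot> (\<Sum>i\<in>UNIV. x $ i *r p i))"
  using has_pd_linear[OF bounded_linear_smult p] by (intro exI[of _ "%i. s *s p i"]) auto
qed

lemma has_rdef_sum: "(!!i. i \<in> I ==> has_rdef c (f i) (D i)) ==> has_rdef c (%x. \<Sum>i\<in>I. f i x) (%x. \<Sum>i\<in>I. D i x)"
 by (induction I rule: infinite_finite_induct) (simp_all add: has_rdef_zero has_rdef_add)

text \<open>The outer derivative at \<open>x\<close> sees only nearby points, which are nonzero and
  where the inner image equals \<open>D\<close>.\<close>

lemma oscillator_eq:
 assumes D: "has_rdef c f D" and E: "has_rdef c D E" and x: "x ~= 0"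
 shows "oscillator c f x = E x + ((1 + c) * norm x)\<^sup>2 *r f x"
proof -
 have "has_rdef c (rdef_dirac c f) E"
  by (rule has_rdef_cong[OF E]) (simp_all add: rdef_dirac_eq[OF D])
 from rdef_dirac_eq[OF this x] show ?thesis
  by (simp add: oscillator_def cl_vec_square power_mult_distrib)
qed

text \<open>Product rule: besides the Dirac image of \<open>H\<close>, the Dirac part gives 2 G' x
  H, and the Euler part gives c/u times k G + 2 u G' in front of x H, where u = |x|^2.\<close>

lemma has_rdef_radial:
 assumes H: "hpoly k H" and G: "!!u. u > 0 ==> (G has_real_derivative G' u) (at u)"
 shows "has_rdef c (%x. G (nsq x) *r H x) (%x. G (nsq x) *r dirac H x
  + (2 * (1 + c) * G' (nsq x) + c * real k * G (nsq x) / nsq x) *r (cl_vec x \<odot> H x))"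
 unfolding has_rdef_def
proof (intro allI impI exI conjI)
 fix x :: "'a point" and i assume x: "x ~= 0"
 let ?p = "%i. G (nsq x) *r partial i H x + (G' (nsq x) * (2 * x $ i)) *r H x"
 show "has_pd i (%x. G (nsq x) *r H x) (?p i) x"
  by (rule has_pd_scaleR[OF has_pd_chain[OF has_pd_normsq G] hpoly_has_pd[OF H]]) (use x in simp)
 have e: "(\<Sum>i\<in>UNIV. x $ i *r ?p i) = G (nsq x) *r euler H x + (2 * G' (nsq x) * nsq x) *r H x"
 proof -
  have 1: "(\<Sum>i\<in>UNIV. x $ i * (s * (2 * x $ i))) = 2 * s * nsq x" for s
   by (simp add: power2_norm_eq_inner inner_vec_def sum_distrib_left mult_ac)
  have "(\<Sum>i\<in>UNIV. x $ i *r ?p i) = (\<Sum>i\<in>UNIV. G (nsq x) *r (x $ i *r partial i H x) + (x $ i * (G' (nsq x) * (2 * x $ i))) *r H x)"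
   by (simp add: scaleR_add_right mult_ac)
  then show ?thesis
   unfolding sum.distrib scaleR_sum_right[symmetric] scaleR_sum_left[symmetric] 1 euler_def .
 qed
 have d: "(\<Sum>i\<in>UNIV. cl_gen i \<odot> ?p i) = G (nsq x) *r dirac H x + (2 * G' (nsq x)) *r (cl_vec x \<odot> H x)"
  by (simp add: dirac_def cl_vec_mult_sum cl_mult_add_right sum.distrib cl_mult_scaleR_right scaleR_sum_right mult_ac)
 show "G (nsq x) *r dirac H x
  + (2 * (1 + c) * G' (nsq x) + c * real k * G (nsq x) / nsq x) *r (cl_vec x \<odot> H x)
   = (\<Sum>i\<in>UNIV. cl_gen i \<odot> ?p i) + (c / nsq x) *r (cl_vec x \<odot> (\<Sum>i\<in>UNIV. x $ i *r ?p i))"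
 proof -
  have "2 * (1 + c) * g' + c * k * g / u = 2 * g' + c / u * (g * k + 2 * g' * u)" if "u ~= 0" for g g' k u :: real
   using that by (simp add: field_simps)
  then have S: "2 * (1 + c) * G' (nsq x) + c * real k * G (nsq x) / nsq x
    = 2 * G' (nsq x) + c / nsq x * (G (nsq x) * real k + 2 * G' (nsq x) * nsq x)"
   using x by simp
  show ?thesis
   unfolding S d e hpoly_euler[OF H]
   by (simp only: cl_mult_add_right cl_mult_scaleR_right scaleR_add_left scaleR_add_right distrib_left scaleR_scaleR add.assoc)
 qed
qed

lemma powr_half_deriv:
 assumes "u > 0" "(Q has_real_derivative Q') (at u)"
 shows "((%u. u powr b * Q u) has_real_derivative u powr b * (Q' + b / u * Q u)) (at u)"
 by (rule DERIV_cong[OF DERIV_mult[OF has_real_derivative_powr[OF assms(1)] assms(2)]])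
  (use assms(1) in \<open>simp add: powr_diff field_simps\<close>)

lemma
 fixes M :: "'n::{finite,linorder} clfun"
 assumes M: "monogenic l M" and c: "c > -1" and Q: "!!u. u > 0 ==> (Q has_real_derivative Q' u) (at u)"
 defines "b \<equiv> beta c (real l) / 2" and "\<gamma> \<equiv> gam CARD('n) c (real l)"
 shows rdef_monogenic: "has_rdef c (%x. (nsq x powr b * Q (nsq x)) *r M x)
   (%x. (nsq x powr b * (2 * (1 + c) * Q' (nsq x))) *r (cl_vec x \<odot> M x))"
  and rdef_vec_monogenic: "has_rdef c (%x. (nsq x powr b * Q (nsq x)) *r (cl_vec x \<odot> M x))
   (%x. (nsq x powr b * (- (1 + c) * (2 * nsq x * Q' (nsq x) + \<gamma> * Q (nsq x)))) *r M x)"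
proof -
 have hM: "hpoly l M" and dM: "dirac M x = 0" for x using M by (auto simp: monogenic_def)
 \<comment> \<open>The exponent beta is made for this: the terms with 1/u cancel. Likewise gamma in
   \<open>cg\<close> collects m + 2 l from the anticommutator and c from the Euler term.\<close>
 have cb: "2 * (1 + c) * b = - c * real l"
 proof -
  have *: "2 * e * ((- (c / e) * k) / 2) = - c * k" if "e ~= 0" for e k :: real using that by simp
  show ?thesis unfolding b_def beta_def by (rule *) (use c in simp)
 qed
 have cg: "(1 + c) * \<gamma> = 2 * real l + real CARD('n) + c"
 proof -
  have "e * (2 / e * X + Y / e) = 2 * X + Y" if "e ~= 0" for e X Y :: real using that by (simp add: field_simps)
  from this[of "1 + c" "real l + (real CARD('n) - 2) / 2" "c + 2"]
  have "(1 + c) * \<gamma> = 2 * (real l + (real CARD('n) - 2) / 2) + (c + 2)"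
   unfolding \<gamma>_def gam_def using c by simp
  moreover have "2 * (real l + (real CARD('n) - 2) / 2) = 2 * real l + real CARD('n) - 2" by (simp add: field_simps)
  ultimately show ?thesis by linarith
 qed
 note D = powr_half_deriv[OF _ Q, of _ b]
 show "has_rdef c (%x. (nsq x powr b * Q (nsq x)) *r M x)
   (%x. (nsq x powr b * (2 * (1 + c) * Q' (nsq x))) *r (cl_vec x \<odot> M x))"
 proof (rule has_rdef_cong[OF has_rdef_radial[OF hM D]])
  fix x :: "'n point" assume x: "x ~= 0"
  let ?u = "nsq x"
  have "2 * (1 + c) * (?u powr b * (Q' ?u + b / ?u * Q ?u)) + c * real l * (?u powr b * Q ?u) / ?u
    = ?u powr b * (2 * (1 + c) * Q' ?u) + ?u powr b * Q ?u / ?u * (2 * (1 + c) * b + c * real l)"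
   by (simp add: algebra_simps add_divide_distrib)
  also have "... = ?u powr b * (2 * (1 + c) * Q' ?u)" unfolding cb by simp
  finally show "(?u powr b * Q ?u) *r dirac M x + (2 * (1 + c) * (?u powr b * (Q' ?u + b / ?u * Q ?u)) + c * real l * (?u powr b * Q ?u) / ?u) *r (cl_vec x \<odot> M x)
    = (?u powr b * (2 * (1 + c) * Q' ?u)) *r (cl_vec x \<odot> M x)"
   by (simp only: dM scaleR_zero_right add_0_left)
 qed auto
 show "has_rdef c (%x. (nsq x powr b * Q (nsq x)) *r (cl_vec x \<odot> M x))
   (%x. (nsq x powr b * (- (1 + c) * (2 * nsq x * Q' (nsq x) + \<gamma> * Q (nsq x)))) *r M x)"
 proof (rule has_rdef_cong[OF has_rdef_radial[OF hpoly_vec[OF hM] D]])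
  fix x :: "'n point" assume x: "x ~= 0"
  let ?u = "nsq x"
  define S where "S = 2 * (1 + c) * (?u powr b * (Q' ?u + b / ?u * Q ?u)) + c * real (Suc l) * (?u powr b * Q ?u) / ?u"
  have "- (?u powr b * Q ?u) * (real CARD('n) + 2 * real l) - S * ?u
    = ?u powr b * (- 2 * (1 + c) * ?u * Q' ?u - Q ?u * (2 * (1 + c) * b + c * real l) - Q ?u * (real CARD('n) + 2 * real l + c))"
  proof -
   have e: "(Q' ?u + b / ?u * Q ?u) * ?u = Q' ?u * ?u + b * Q ?u" "c * real (Suc l) * (?u powr b * Q ?u) / ?u * ?u = c * real (Suc l) * (?u powr b * Q ?u)"
    using x by (simp_all add: distrib_right)
   have "S * ?u = 2 * (1 + c) * ?u powr b * ((Q' ?u + b / ?u * Q ?u) * ?u) + c * real (Suc l) * (?u powr b * Q ?u) / ?u * ?u"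
    unfolding S_def by (simp only: distrib_right mult.assoc)
   then show ?thesis unfolding e by (simp add: algebra_simps)
  qed
  also have "... = ?u powr b * (- 2 * (1 + c) * ?u * Q' ?u - Q ?u * ((1 + c) * \<gamma>))" unfolding cb cg by (simp add: algebra_simps)
  finally have *: "?u powr b * (- (1 + c) * (2 * ?u * Q' ?u + \<gamma> * Q ?u)) = - (?u powr b * Q ?u) * (real CARD('n) + 2 * real l) - S * ?u"
   by (simp add: algebra_simps)
  have fin: "(?u powr b * Q ?u) *r dirac (%x. cl_vec x \<odot> M x) x + S *r (cl_vec x \<odot> (cl_vec x \<odot> M x))
    = (?u powr b * (- (1 + c) * (2 * ?u * Q' ?u + \<gamma> * Q ?u))) *r M x"
   unfolding * monogenic_dirac_vec[OF M] cl_vec_square scaleR_minus_right scaleR_scaleR scaleR_diff_left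
   by (simp only: mult_minus_left mult_minus_right scaleR_minus_left diff_conv_add_uminus)
  show "(?u powr b * Q ?u) *r dirac (%x. cl_vec x \<odot> M x) x + (2 * (1 + c) * (?u powr b * (Q' ?u + b / ?u * Q ?u)) + c * real (Suc l) * (?u powr b * Q ?u) / ?u) *r (cl_vec x \<odot> (cl_vec x \<odot> M x))
    = (?u powr b * (- (1 + c) * (2 * ?u * Q' ?u + \<gamma> * Q ?u))) *r M x"
   using fin unfolding S_def .
 qed (auto simp del: of_nat_Suc)
qed

lemma norm_square_powr: "nsq x powr (b / 2) = norm x powr b"
 by (cases "norm x = 0") (simp_all add: powr_powr flip: powr_numeral)

section \<open>Laguerre functions and the eigenfunction property\<close>

definition lag_exp :: "nat => real => real => real" where
 "lag_exp t av u = laguerre t av u * exp (- u / 2)"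

lemma DERIV_exp_half: "((%u. exp (- u / 2)) has_real_derivative - (1 / 2) * exp (- u / 2)) (at u :: real filter)"
 by (auto intro!: derivative_eq_intros)

lemma lag_exp_deriv:
 "(lag_exp t av has_real_derivative (laguerre_d1 t av u - laguerre t av u / 2) * exp (- u / 2)) (at u)"
 unfolding lag_exp_def[abs_def]
 by (rule DERIV_cong[OF DERIV_mult[OF DERIV_laguerre DERIV_exp_half]]) (simp add: algebra_simps)

lemma lag_exp_deriv2:
 "((%u. (laguerre_d1 t av u - laguerre t av u / 2) * exp (- u / 2)) has_real_derivative
   (laguerre_d2 t av u - laguerre_d1 t av u + laguerre t av u / 4) * exp (- u / 2)) (at u)"
 by (rule DERIV_cong[OF DERIV_mult[OF DERIV_diff[OF DERIV_laguerre_d1 DERIV_cdivide[OF DERIV_laguerre]] DERIV_exp_half]]) (simp add: field_simps)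

text \<open>Laguerre's equation conjugated by exp(-u/2) and multiplied by 4, the form in which the
  oscillator produces it.\<close>

lemma lag_exp_ode:
 "4 * u * ((laguerre_d2 t av u - laguerre_d1 t av u + laguerre t av u / 4) * exp (- u / 2))
  + 4 * (av + 1) * ((laguerre_d1 t av u - laguerre t av u / 2) * exp (- u / 2)) - u * lag_exp t av u
  = - (4 * real t + 2 * (av + 1)) * lag_exp t av u"
proof -
 have "4 * u * (d2 - d1 + L / 4) + 4 * (av + 1) * (d1 - L / 2) - u * L + (4 * real t + 2 * (av + 1)) * L
   = 4 * (u * d2 + (av + 1 - u) * d1 + real t * L)" for d2 d1 L :: real
  by (simp add: algebra_simps)
 from this[of "laguerre_d2 t av u" "laguerre_d1 t av u" "laguerre t av u", unfolded laguerre_ode]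
 have "(4 * u * (laguerre_d2 t av u - laguerre_d1 t av u + laguerre t av u / 4) + 4 * (av + 1) * (laguerre_d1 t av u - laguerre t av u / 2)
   - u * laguerre t av u + (4 * real t + 2 * (av + 1)) * laguerre t av u) * exp (- u / 2) = 0" by simp
 moreover have "4 * u * (X * E) + 4 * (av + 1) * (Y * E) - u * (L * E) + K * (L * E)
   = (4 * u * X + 4 * (av + 1) * Y - u * L + K * L) * E" for X Y L K E :: real
  by (simp add: algebra_simps)
 ultimately show ?thesis unfolding lag_exp_def mult_minus_left by (simp only: eq_neg_iff_add_eq_0)
qed

text \<open>\<open>phi_coeff\<close>, \<open>phi_index\<close> and \<open>phi_angular\<close> bring
  the even and the odd basis functions to the single formula \<open>phi_eq\<close>.\<close>

definition phi_coeff :: "real => nat => real" where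
 "phi_coeff c n = (if even n then 1 else -1) * 2 ^ n * (1 + c) ^ n * fact (n div 2)"

definition phi_index :: "real => nat => real" where
 "phi_index \<gamma> n = (if even n then \<gamma> / 2 - 1 else \<gamma> / 2)"

definition phi_angular :: "nat => ('n::{finite,linorder} clfun) => 'n clfun" where
 "phi_angular n M x = (if even n then M x else cl_vec x \<odot> M x)"

lemma phi_eq:
 fixes M :: "nat => nat => 'n::{finite,linorder} clfun"
 shows "phi c M n l j x = (nsq x powr (beta c (real l) / 2) * (phi_coeff c n
   * lag_exp (n div 2) (phi_index (gam CARD('n) c (real l)) n) (nsq x))) *r phi_angular n (M l j) x"
 by (simp add: phi_def phi_coeff_def phi_index_def phi_angular_def lag_exp_def norm_square_powr Let_def mult_ac)

text \<open>Both parities give the same eigenvalue, since 4 t + 2 (av + 1) = 2 n + \<gamma>: for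
  even n one has n = 2 t and \<gamma> = 2 (av + 1), for odd n one has n = 2 t + 1 and \<gamma> = 2
  av.\<close>

lemma phi_rdef:
 fixes M :: "nat => nat => 'n::{finite,linorder} clfun"
 assumes M: "monogenic l (M l j)" and c: "c > -1"
 shows "\<exists>D E. has_rdef c (phi c M n l j) D \<and> has_rdef c D E \<and> (\<forall>x. E x + ((1 + c) * norm x)\<^sup>2 *r phi c M n l j x
   = ((1 + c)\<^sup>2 * (2 * real n + gam CARD('n) c (real l))) *r phi c M n l j x)"
proof -
 define \<gamma> where "\<gamma> = gam CARD('n) c (real l)"
 define b where "b = beta c (real l) / 2"
 define t where "t = n div 2"
 define av where "av = phi_index \<gamma> n"
 define kp where "kp = phi_coeff c n"
 define Q where "Q = lag_exp t av"
 define Q1 where "Q1 u = (laguerre_d1 t av u - laguerre t av u / 2) * exp (- u / 2)" for u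
 define Q2 where "Q2 u = (laguerre_d2 t av u - laguerre_d1 t av u + laguerre t av u / 4) * exp (- u / 2)" for u
 have d1: "(Q has_real_derivative Q1 u) (at u)" for u unfolding Q_def Q1_def by (rule lag_exp_deriv)
 have d2: "(Q1 has_real_derivative Q2 u) (at u)" for u unfolding Q1_def Q2_def by (rule lag_exp_deriv2)
 have ode: "4 * u * Q2 u + 4 * (av + 1) * Q1 u - u * Q u = - (4 * real t + 2 * (av + 1)) * Q u" for u
  unfolding Q_def Q1_def Q2_def by (rule lag_exp_ode)
 show ?thesis
 proof (cases "even n")
  case True
  have av: "\<gamma> = 2 * (av + 1)" and n: "real n = 2 * real t" using True by (auto simp: av_def phi_index_def t_def elim: evenE)
  have phi: "phi c M n l j = (%x. (nsq x powr b * (kp * Q (nsq x))) *r M l j x)"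
   using True by (simp add: fun_eq_iff phi_eq b_def kp_def Q_def av_def t_def \<gamma>_def phi_angular_def)
  note D = rdef_monogenic[where Q = "%u. kp * Q u", OF M c DERIV_cmult[OF d1], folded b_def]
  note E = rdef_vec_monogenic[where Q = "%u. 2 * (1 + c) * (kp * Q1 u)", OF M c DERIV_cmult[OF DERIV_cmult[OF d2]], folded b_def \<gamma>_def]
  show ?thesis unfolding phi \<gamma>_def[symmetric]
  proof (intro exI conjI allI, rule D, rule E)
   fix x :: "'n point"
   let ?u = "nsq x"
   have "?u powr b * (- (1 + c) * (2 * ?u * (2 * (1 + c) * (kp * Q2 ?u)) + \<gamma> * (2 * (1 + c) * (kp * Q1 ?u)))) + ((1 + c) * norm x)\<^sup>2 * (?u powr b * (kp * Q ?u))
    = - (?u powr b * kp * (1 + c)\<^sup>2) * (4 * ?u * Q2 ?u + 4 * (av + 1) * Q1 ?u - ?u * Q ?u)"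
    unfolding av by (simp add: power_mult_distrib) (simp add: algebra_simps power2_eq_square)
   also have "... = ((1 + c)\<^sup>2 * (2 * real n + \<gamma>)) * (?u powr b * (kp * Q ?u))"
    unfolding ode av n by (simp add: algebra_simps)
   finally show "(?u powr b * (- (1 + c) * (2 * ?u * (2 * (1 + c) * (kp * Q2 ?u)) + \<gamma> * (2 * (1 + c) * (kp * Q1 ?u))))) *r M l j x
     + ((1 + c) * norm x)\<^sup>2 *r ((?u powr b * (kp * Q ?u)) *r M l j x)
     = ((1 + c)\<^sup>2 * (2 * real n + \<gamma>)) *r ((?u powr b * (kp * Q ?u)) *r M l j x)"
    unfolding scaleR_scaleR scaleR_add_left[symmetric] by (rule arg_cong)
  qed
 next
  case False
  have av: "\<gamma> = 2 * av" and n: "real n = 2 * real t + 1" using False by (auto simp: av_def phi_index_def t_def elim: oddE)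
  have phi: "phi c M n l j = (%x. (nsq x powr b * (kp * Q (nsq x))) *r (cl_vec x \<odot> M l j x))"
   using False by (simp add: fun_eq_iff phi_eq b_def kp_def Q_def av_def t_def \<gamma>_def phi_angular_def)
  note D = rdef_vec_monogenic[where Q = "%u. kp * Q u", OF M c DERIV_cmult[OF d1], folded b_def \<gamma>_def]
  have d3: "((%u. - (1 + c) * (2 * u * (kp * Q1 u) + \<gamma> * (kp * Q u))) has_real_derivative
    - (1 + c) * kp * (2 * u * Q2 u + (\<gamma> + 2) * Q1 u)) (at u)" for u
   by (auto intro!: derivative_eq_intros d1 d2 simp: algebra_simps)
  note E = rdef_monogenic[OF M c d3, folded b_def]
  show ?thesis unfolding phi \<gamma>_def[symmetric]
  proof (intro exI conjI allI, rule D, rule E)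
   fix x :: "'n point"
   let ?u = "nsq x"
   have "?u powr b * (2 * (1 + c) * (- (1 + c) * kp * (2 * ?u * Q2 ?u + (\<gamma> + 2) * Q1 ?u))) + ((1 + c) * norm x)\<^sup>2 * (?u powr b * (kp * Q ?u))
    = - (?u powr b * kp * (1 + c)\<^sup>2) * (4 * ?u * Q2 ?u + 4 * (av + 1) * Q1 ?u - ?u * Q ?u)"
    unfolding av by (simp add: power_mult_distrib) (simp add: algebra_simps power2_eq_square)
   also have "... = ((1 + c)\<^sup>2 * (2 * real n + \<gamma>)) * (?u powr b * (kp * Q ?u))"
    unfolding ode av n by (simp add: algebra_simps)
   finally show "(?u powr b * (2 * (1 + c) * (- (1 + c) * kp * (2 * ?u * Q2 ?u + (\<gamma> + 2) * Q1 ?u)))) *r (cl_vec x \<odot> M l j x)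
     + ((1 + c) * norm x)\<^sup>2 *r ((?u powr b * (kp * Q ?u)) *r (cl_vec x \<odot> M l j x))
     = ((1 + c)\<^sup>2 * (2 * real n + \<gamma>)) *r ((?u powr b * (kp * Q ?u)) *r (cl_vec x \<odot> M l j x))"
    unfolding scaleR_scaleR scaleR_add_left[symmetric] by (rule arg_cong)
  qed
 qed
qed

text \<open>\<open>oscillator\<close> is built on \<open>vector_derivative\<close>, so linearity has
  to be earned by differentiability; the witnesses of \<open>phi_rdef\<close> supply it off the
  origin.\<close>

lemma oscillator_phi_sum:
 fixes M :: "nat => nat => 'n::{finite,linorder} clfun"
 assumes M: "!!n l j. (n, l, j) \<in> I ==> monogenic l (M l j)" and c: "c > -1" and x: "x ~= 0"
 shows "oscillator c (%x. \<Sum>(n, l, j)\<in>I. a (n, l, j) *s phi c M n l j x) x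
   = (\<Sum>(n, l, j)\<in>I. (of_real ((1 + c)\<^sup>2 * (2 * real n + gam CARD('n) c (real l))) * a (n, l, j)) *s phi c M n l j x)"
proof -
 let ?\<phi> = "%(n, l, j). phi c M n l j"
 let ?\<mu> = "%(n, l :: nat, j :: nat). (1 + c)\<^sup>2 * (2 * real n + gam CARD('n) c (real l))"
 have "\<forall>i\<in>I. \<exists>D E. has_rdef c (?\<phi> i) D \<and> has_rdef c D E \<and> (\<forall>x. E x + ((1 + c) * norm x)\<^sup>2 *r ?\<phi> i x = ?\<mu> i *r ?\<phi> i x)"
 proof
  fix i assume "i \<in> I"
  then show "\<exists>D E. has_rdef c (?\<phi> i) D \<and> has_rdef c D E \<and> (\<forall>x. E x + ((1 + c) * norm x)\<^sup>2 *r ?\<phi> i x = ?\<mu> i *r ?\<phi> i x)"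
   using phi_rdef[where M = M and l = "fst (snd i)" and j = "snd (snd i)" and n = "fst i", OF M[of "fst i"] c] by (simp add: case_prod_unfold)
 qed
 then obtain D E where D: "!!i. i \<in> I ==> has_rdef c (?\<phi> i) (D i)" and E: "!!i. i \<in> I ==> has_rdef c (D i) (E i)"
  and eq: "!!i x. i \<in> I ==> E i x + ((1 + c) * norm x)\<^sup>2 *r ?\<phi> i x = ?\<mu> i *r ?\<phi> i x"
  unfolding bchoice_iff by metis
 have "oscillator c (%x. \<Sum>i\<in>I. a i *s ?\<phi> i x) x
   = (\<Sum>i\<in>I. a i *s E i x) + ((1 + c) * norm x)\<^sup>2 *r (\<Sum>i\<in>I. a i *s ?\<phi> i x)"
  by (rule oscillator_eq[OF has_rdef_sum[OF has_rdef_smult[OF D]] has_rdef_sum[OF has_rdef_smult[OF E]] x])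
 also have "... = (\<Sum>i\<in>I. a i *s (E i x + ((1 + c) * norm x)\<^sup>2 *r ?\<phi> i x))"
  by (simp add: scaleR_sum_right sum.distrib[symmetric] vector_add_ldistrib smult_scaleR)
 also have "... = (\<Sum>i\<in>I. (of_real (?\<mu> i) * a i) *s ?\<phi> i x)"
  by (intro sum.cong refl) (simp only: eq, simp only: scaleR_eq_smult vector_smult_assoc mult.commute)
 finally show ?thesis by (simp add: case_prod_unfold)
qed

section \<open>Determinacy of moments\<close>

lemma sum_exp_series_le:
 fixes a :: real
 assumes "a \<ge> 0"
 shows "(\<Sum>j<N. a ^ j / fact j) <= exp a"
proof -
 have s: "(%j. a ^ j / fact j) sums exp a" using exp_converges[of a] by (simp add: divide_inverse mult.commute)
 have "(\<Sum>j<N. a ^ j / fact j) <= (\<Sum>j. a ^ j / fact j)"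
  using s assms by (intro sum_le_suminf) (auto simp: sums_iff)
 then show ?thesis using s by (simp add: sums_iff)
qed

lemma exp_power_bound:
 fixes t ep h :: real
 assumes "ep > 0" "\<bar>h\<bar> <= ep / 2"
 shows "exp (\<bar>h\<bar> * \<bar>t\<bar>) * \<bar>t\<bar> ^ k <= fact k * (2 / ep) ^ k * exp (ep * \<bar>t\<bar>)"
proof -
 have "(ep / 2 * \<bar>t\<bar>) ^ k <= fact k * exp (ep / 2 * \<bar>t\<bar>)" using assms by (intro power_le_fact_exp) simp
 then have "(2 / ep) ^ k * (ep / 2 * \<bar>t\<bar>) ^ k <= (2 / ep) ^ k * (fact k * exp (ep / 2 * \<bar>t\<bar>))"
  using assms by (intro mult_left_mono) auto
 also have "(2 / ep) ^ k * (ep / 2 * \<bar>t\<bar>) ^ k = \<bar>t\<bar> ^ k"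
  using assms by (simp add: power_mult_distrib[symmetric])
 finally have k: "\<bar>t\<bar> ^ k <= (2 / ep) ^ k * (fact k * exp (ep / 2 * \<bar>t\<bar>))" .
 have e: "exp (\<bar>h\<bar> * \<bar>t\<bar>) <= exp (ep / 2 * \<bar>t\<bar>)" using mult_right_mono[OF assms(2), of "\<bar>t\<bar>"] by simp
 have "exp (\<bar>h\<bar> * \<bar>t\<bar>) * \<bar>t\<bar> ^ k <= exp (ep / 2 * \<bar>t\<bar>) * ((2 / ep) ^ k * (fact k * exp (ep / 2 * \<bar>t\<bar>)))"
  using assms by (intro mult_mono e k) auto
 also have "... = fact k * (2 / ep) ^ k * (exp (ep / 2 * \<bar>t\<bar>) * exp (ep / 2 * \<bar>t\<bar>))" by (simp only: mult_ac)
 also have "exp (ep / 2 * \<bar>t\<bar>) * exp (ep / 2 * \<bar>t\<bar>) = exp (ep * \<bar>t\<bar>)" by (simp add: exp_add[symmetric])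
 finally show ?thesis .
qed

definition moment_free :: "'a measure => ('a => real) => ('a => complex) => bool" where
 "moment_free M T H \<longleftrightarrow> (\<forall>k. (LINT x|M. of_real (T x ^ k) * H x) = 0)"

text \<open>The exponential series of e^(i h T) is integrated term by term. With |h| at most ep/2,
  half of the exponent dominates the series and the other half the power T^k.\<close>

lemma moment_free_step:
 assumes [measurable]: "T \<in> borel_measurable M" "H \<in> borel_measurable M" and ep: "ep > 0" "\<bar>h\<bar> <= ep / 2"
  and I: "integrable M (%x. exp (ep * \<bar>T x\<bar>) * norm (H x))" and m: "moment_free M T H"
 shows "moment_free M T (%x. iexp (h * T x) * H x)"
 unfolding moment_free_def
proof
 fix k
 define c where "c j = (\<i> * complex_of_real h) ^ j / fact j" for j
 have dom: "integrable M (%x. (fact k * (2 / ep) ^ k) * (exp (ep * \<bar>T x\<bar>) * norm (H x)))"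
  using I by simp
 have Ij: "integrable M (%x. complex_of_real (T x ^ j) * H x)" for j
 proof (rule Bochner_Integration.integrable_bound)
  show "integrable M (%x. (fact j * (2 / ep) ^ j) * (exp (ep * \<bar>T x\<bar>) * norm (H x)))" using I by simp
  show "AE x in M. norm (complex_of_real (T x ^ j) * H x) <= norm ((fact j * (2 / ep) ^ j) * (exp (ep * \<bar>T x\<bar>) * norm (H x)))"
  proof (rule AE_I2)
   fix x
   have "\<bar>T x\<bar> ^ j * norm (H x) <= (fact j * (2 / ep) ^ j * exp (ep * \<bar>T x\<bar>)) * norm (H x)"
    using exp_power_bound[OF ep(1), of 0 "T x" j] ep by (intro mult_right_mono) auto
   then show "norm (complex_of_real (T x ^ j) * H x) <= norm ((fact j * (2 / ep) ^ j) * (exp (ep * \<bar>T x\<bar>) * norm (H x)))"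
    using ep by (simp add: norm_mult norm_power abs_mult mult_ac)
  qed
 qed measurable
 have lim: "(%N. LINT x|M. (\<Sum>j<N. c j * (complex_of_real (T x ^ (j + k)) * H x)))
   \<longlonglongrightarrow> (LINT x|M. complex_of_real (T x ^ k) * (iexp (h * T x) * H x))"
 proof (rule integral_dominated_convergence[where w = "%x. (fact k * (2 / ep) ^ k) * (exp (ep * \<bar>T x\<bar>) * norm (H x))"])
  have eq: "c j * (complex_of_real (T x ^ (j + k)) * H x) = (\<i> * complex_of_real (h * T x)) ^ j / fact j * (complex_of_real (T x ^ k) * H x)" for j x
   by (simp add: c_def power_mult_distrib power_add)
  show "AE x in M. (%N. \<Sum>j<N. c j * (complex_of_real (T x ^ (j + k)) * H x)) \<longlonglongrightarrow> complex_of_real (T x ^ k) * (iexp (h * T x) * H x)"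
  proof (rule AE_I2)
   fix x
   have "(%j. (\<i> * complex_of_real (h * T x)) ^ j / fact j * (complex_of_real (T x ^ k) * H x)) sums (iexp (h * T x) * (complex_of_real (T x ^ k) * H x))"
    by (rule sums_mult2) (use exp_converges[of "\<i> * complex_of_real (h * T x)"] in \<open>simp add: scaleR_conv_of_real divide_inverse mult.commute\<close>)
   then show "(%N. \<Sum>j<N. c j * (complex_of_real (T x ^ (j + k)) * H x)) \<longlonglongrightarrow> complex_of_real (T x ^ k) * (iexp (h * T x) * H x)"
    unfolding eq sums_def by (simp only: mult.left_commute)
  qed
  show "AE x in M. norm (\<Sum>j<N. c j * (complex_of_real (T x ^ (j + k)) * H x)) <= (fact k * (2 / ep) ^ k) * (exp (ep * \<bar>T x\<bar>) * norm (H x))" for N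
  proof (rule AE_I2)
   fix x
   have "norm (\<Sum>j<N. c j * (complex_of_real (T x ^ (j + k)) * H x)) <= (\<Sum>j<N. (\<bar>h\<bar> * \<bar>T x\<bar>) ^ j / fact j * (\<bar>T x\<bar> ^ k * norm (H x)))"
    unfolding eq by (intro sum_norm_le) (simp add: norm_mult norm_divide norm_power abs_mult)
   also have "... = (\<Sum>j<N. (\<bar>h\<bar> * \<bar>T x\<bar>) ^ j / fact j) * (\<bar>T x\<bar> ^ k * norm (H x))"
    by (simp only: sum_distrib_right)
   also have "... <= exp (\<bar>h\<bar> * \<bar>T x\<bar>) * (\<bar>T x\<bar> ^ k * norm (H x))"
    by (intro mult_right_mono sum_exp_series_le) auto
   also have "... = (exp (\<bar>h\<bar> * \<bar>T x\<bar>) * \<bar>T x\<bar> ^ k) * norm (H x)" by simp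
   also have "... <= (fact k * (2 / ep) ^ k * exp (ep * \<bar>T x\<bar>)) * norm (H x)"
    by (intro mult_right_mono exp_power_bound ep) simp
   finally show "norm (\<Sum>j<N. c j * (complex_of_real (T x ^ (j + k)) * H x)) <= (fact k * (2 / ep) ^ k) * (exp (ep * \<bar>T x\<bar>) * norm (H x))" by (simp add: mult_ac)
  qed
 qed (use dom in \<open>simp_all\<close>)
 have "(LINT x|M. (\<Sum>j<N. c j * (complex_of_real (T x ^ (j + k)) * H x))) = 0" for N
 proof -
  have "(LINT x|M. (\<Sum>j<N. c j * (complex_of_real (T x ^ (j + k)) * H x))) = (\<Sum>j<N. c j * (LINT x|M. complex_of_real (T x ^ (j + k)) * H x))"
   using Ij by (subst Bochner_Integration.integral_sum) (simp_all del: of_real_power)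
  also have "... = 0" using m by (simp add: moment_free_def del: of_real_power)
  finally show ?thesis .
 qed
 then show "(LINT x|M. complex_of_real (T x ^ k) * (iexp (h * T x) * H x)) = 0"
  using lim by (simp add: LIMSEQ_const_iff del: of_real_power)
qed

text \<open>The weight exp(ep |T|) admits only short steps, but |e^(i h T)| = 1 means that a step
  preserves its own hypotheses. Then n steps of length s/n reach s.\<close>

lemma moment_free_char:
 assumes [measurable]: "T \<in> borel_measurable M" "H \<in> borel_measurable M" and ep: "ep > 0"
  and I: "integrable M (%x. exp (ep * \<bar>T x\<bar>) * norm (H x))" and m: "moment_free M T H"
 shows "(LINT x|M. iexp (s * T x) * H x) = 0"
proof -
 obtain n :: nat where n: "\<bar>s\<bar> * 2 / ep < real n" using reals_Archimedean2 by blast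
 then have n0: "real n > 0" using ep by (smt (verit) divide_nonneg_pos abs_ge_zero)
 define h where "h = s / real n"
 have h: "\<bar>h\<bar> <= ep / 2" "real n * h = s" using n n0 ep by (simp_all add: h_def abs_div field_simps)
 have "moment_free M T (%x. iexp (real j * h * T x) * H x)" for j :: nat
 proof (induction j)
  case 0 then show ?case using m by simp
 next
  case (Suc j)
  have "moment_free M T (%x. iexp (h * T x) * (iexp (real j * h * T x) * H x))"
   by (rule moment_free_step[OF _ _ ep h(1) _ Suc]) (use I in \<open>simp_all add: norm_mult\<close>)
  moreover have "iexp (h * T x) * (iexp (real j * h * T x) * H x) = iexp (real (Suc j) * h * T x) * H x" for x
   unfolding mult.assoc[symmetric] exp_add[symmetric] by (simp add: algebra_simps)
  ultimately show ?case by (simp only:)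
 qed
 from this[of n] show ?thesis unfolding h(2) moment_free_def by (auto dest: spec[of _ 0])
qed

text \<open>The moment of order 0 gives the positive and negative part of F the same mass. If it is
  not 0, both are normalised and pushed forward along T; their characteristic functions agree, and
  Levy's uniqueness theorem identifies them.\<close>

lemma integral_comp_zero_of_moments:
 fixes T F :: "'a => real"
 assumes [measurable]: "T \<in> borel_measurable M" "F \<in> borel_measurable M" and ep: "ep > 0"
  and I: "integrable M (%x. exp (ep * \<bar>T x\<bar>) * \<bar>F x\<bar>)" and m: "!!k. (LINT x|M. T x ^ k * F x) = 0"
  and [measurable]: "g \<in> borel_measurable borel" and G: "integrable M (%x. g (T x) * F x)"
 shows "(LINT x|M. g (T x) * F x) = 0"
proof -
 have F: "integrable M F"
  by (rule Bochner_Integration.integrable_bound[OF I]) (use ep in \<open>auto simp: abs_mult mult_le_cancel_right1\<close>)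
 have mf: "moment_free M T (%x. complex_of_real (F x))"
  unfolding moment_free_def of_real_mult[symmetric] by (simp add: integral_complex_of_real m del: of_real_mult of_real_power)
 have chr: "(LINT x|M. iexp (s * T x) * complex_of_real (F x)) = 0" for s
  by (rule moment_free_char[OF _ _ ep _ mf]) (use I in simp_all)
 define P where "P x = max 0 (F x)" for x
 define N where "N x = max 0 (- F x)" for x
 have [measurable]: "P \<in> borel_measurable M" "N \<in> borel_measurable M" unfolding P_def[abs_def] N_def[abs_def] by measurable
 have PN: "P x \<ge> 0" "N x \<ge> 0" "F x = P x - N x" "\<bar>P x\<bar> <= \<bar>F x\<bar>" "\<bar>N x\<bar> <= \<bar>F x\<bar>" for x
  by (auto simp: P_def N_def)
 have Pi: "integrable M P" and Ni: "integrable M N"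
  by (rule Bochner_Integration.integrable_bound[OF F]; use PN in simp)+
 define c where "c = integral\<^sup>L M P"
 have cN: "integral\<^sup>L M N = c"
 proof -
  have "0 = integral\<^sup>L M F" using m[of 0] by simp
  also have "... = c - integral\<^sup>L M N" unfolding PN(3) c_def using Pi Ni by simp
  finally show ?thesis by simp
 qed
 show ?thesis
 proof (cases "c = 0")
  case True
  have "AE x in M. P x = 0" "AE x in M. N x = 0"
   using True cN integral_nonneg_eq_0_iff_AE[OF Pi] integral_nonneg_eq_0_iff_AE[OF Ni] PN(1,2) by (simp_all add: c_def)
  then have "AE x in M. g (T x) * F x = 0" by eventually_elim (simp add: PN(3))
  then show ?thesis by (rule integral_eq_zero_AE)
 next
  case False
  then have c: "c > 0" using integral_nonneg_AE[of P M] PN by (simp add: c_def order_less_le)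
  define \<nu> where "\<nu> Q = distr (density M (%x. ennreal (Q x / c))) borel T" for Q :: "'a => real"
  have int: "(LINT t|\<nu> Q. f t) = (LINT x|M. (Q x / c) *r f (T x))"
   if [measurable]: "f \<in> borel_measurable borel" "Q \<in> borel_measurable M" and "!!x. Q x \<ge> 0"
   for f :: "real => 'b :: {banach, second_countable_topology}" and Q
   unfolding \<nu>_def using that(3) c by (subst integral_distr, simp, simp, subst integral_density) auto
  have rd: "real_distribution (\<nu> Q)" if [measurable]: "Q \<in> borel_measurable M" and Q: "!!x. Q x \<ge> 0" "integrable M Q" "integral\<^sup>L M Q = c" for Q
  proof -
   have "emeasure (\<nu> Q) (space (\<nu> Q)) = (\<integral>\<^sup>+x. ennreal (Q x / c) \<partial>M)"
    unfolding \<nu>_def by (subst emeasure_distr) (auto simp: emeasure_density cong: nn_integral_cong)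
   also have "... = ennreal (LINT x|M. Q x / c)"
    by (rule nn_integral_eq_integral) (use Q c in auto)
   also have "... = 1" using Q c by simp
   finally have "prob_space (\<nu> Q)" by (rule prob_spaceI)
   then show ?thesis by (simp add: real_distribution_def real_distribution_axioms_def \<nu>_def)
  qed
  have "char (\<nu> P) = char (\<nu> N)"
  proof
   fix s
   have ie: "integrable M (%x. (Q x / c) *r iexp (s * T x))" if [measurable]: "integrable M Q" for Q
   proof (rule Bochner_Integration.integrable_bound)
    show "integrable M (%x. Q x / c)" using that by simp
   qed auto
   have "char (\<nu> P) s - char (\<nu> N) s = (LINT x|M. (P x / c) *r iexp (s * T x) - (N x / c) *r iexp (s * T x))"
   proof -
    have "char (\<nu> Q) s = (LINT x|M. (Q x / c) *r iexp (s * T x))" if [measurable]: "Q \<in> borel_measurable M" and "!!x. Q x \<ge> 0" for Q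
     unfolding char_def by (rule int) (use that in measurable)
    then show ?thesis using PN(1,2) by (simp only: Bochner_Integration.integral_diff[OF ie[OF Pi] ie[OF Ni]] \<open>P \<in> borel_measurable M\<close> \<open>N \<in> borel_measurable M\<close>)
   qed
   also have "... = (LINT x|M. (1 / of_real c) * (iexp (s * T x) * complex_of_real (F x)))"
    by (intro Bochner_Integration.integral_cong refl) (simp add: PN(3) scaleR_conv_of_real diff_divide_distrib algebra_simps)
   also have "... = 0" unfolding integral_mult_right_zero chr by simp
   finally show "char (\<nu> P) s = char (\<nu> N) s" by simp
  qed
  then have eq: "\<nu> P = \<nu> N"
   by (intro Levy_uniqueness rd) (use PN Pi Ni cN c_def in auto)
  have Ig: "integrable M (%x. (Q x / c) *r g (T x))" if [measurable]: "Q \<in> borel_measurable M" and "!!x. \<bar>Q x\<bar> <= \<bar>F x\<bar>" for Q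
  proof (rule Bochner_Integration.integrable_bound)
   show "integrable M (%x. g (T x) * F x / c)" using G by simp
   have "\<bar>Q x\<bar> / c * \<bar>g (T x)\<bar> <= \<bar>F x\<bar> / c * \<bar>g (T x)\<bar>" for x
    using that(2) c by (intro mult_right_mono divide_right_mono) auto
   then show "AE x in M. norm ((Q x / c) *r g (T x)) <= norm (g (T x) * F x / c)"
    using c by (intro AE_I2) (simp add: abs_mult mult.commute)
  qed measurable
  have "(LINT x|M. g (T x) * F x) = (LINT x|M. c * ((P x / c) *r g (T x) - (N x / c) *r g (T x)))"
   using c by (intro Bochner_Integration.integral_cong refl) (simp add: PN(3) field_simps)
  also have "... = c * ((LINT x|M. (P x / c) *r g (T x)) - (LINT x|M. (N x / c) *r g (T x)))"
  proof -
   have "integrable M (%x. (P x / c) *r g (T x))" "integrable M (%x. (N x / c) *r g (T x))"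
    by (rule Ig; use PN(4,5) in measurable)+
   then show ?thesis by (simp only: integral_mult_right_zero Bochner_Integration.integral_diff)
  qed
  also have "... = c * ((LINT t|\<nu> P. g t) - (LINT t|\<nu> N. g t))" by (simp add: int PN(1,2))
  also have "... = 0" unfolding eq by simp
  finally show ?thesis .
 qed
qed

lemma abs_coord_power_le: "\<bar>x $ i\<bar> ^ k <= fact k * exp (norm (x :: 'n::finite point))"
proof -
 have "\<bar>x $ i\<bar> ^ k <= norm x ^ k" using component_le_norm_cart[of x i] by (intro power_mono) auto
 also have "... <= fact k * exp (norm x)" by (rule power_le_fact_exp) simp
 finally show ?thesis .
qed

lemma prod_power_le: "finite I ==> \<exists>C\<ge>0. \<forall>x :: 'n::finite point. (\<Prod>i\<in>I. \<bar>x $ i\<bar> ^ p i) <= C * exp (real (card I) * norm x)"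
proof (induction I rule: finite_induct)
 case empty then show ?case by (auto intro!: exI[of _ 1])
next
 case (insert i I)
 then obtain C where C: "C \<ge> 0" "!!x :: 'n point. (\<Prod>i\<in>I. \<bar>x $ i\<bar> ^ p i) <= C * exp (real (card I) * norm x)" by blast
 have "(\<Prod>i\<in>insert i I. \<bar>x $ i\<bar> ^ p i) <= (fact (p i) * C) * exp (real (card (insert i I)) * norm x)" for x :: "'n point"
 proof -
  have "\<bar>x $ i\<bar> ^ p i * (\<Prod>i\<in>I. \<bar>x $ i\<bar> ^ p i) <= (fact (p i) * exp (norm x)) * (C * exp (real (card I) * norm x))"
   by (intro mult_mono abs_coord_power_le C prod_nonneg) auto
  also have "... = (fact (p i) * C) * exp (real (card (insert i I)) * norm x)"
   using insert.hyps by (simp add: distrib_right exp_add)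
  finally show ?thesis using insert.hyps by simp
 qed
 then show ?case using C(1) by (intro exI[of _ "fact (p i) * C"]) auto
qed

text \<open>The powers of one coordinate at a time are replaced by an indicator, the other factors
  being joined to F. The exponents \<open>p\<close> stay arbitrary, so that all moments in the next
  coordinate are at hand.\<close>

lemma box_integral_zero:
 fixes F :: "'n::finite point => real"
 assumes [measurable]: "F \<in> borel_measurable borel"
  and I: "!!D. integrable lborel (%x. exp (D * norm x) * F x)"
  and m: "!!p. (LINT x|lborel. (\<Prod>i\<in>UNIV. x $ i ^ p i) * F x) = 0"
  and B: "!!i. B i \<in> sets borel"
 shows "(LINT x|lborel. (\<Prod>i\<in>J. indicator (B i) (x $ i)) * (\<Prod>i\<in>- J. x $ i ^ p i) * F x) = 0"
proof -
 have [measurable]: "(%x :: 'n point. indicator (B i) (x $ i) :: real) \<in> borel_measurable borel" for i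
  using B by measurable
 have dom: "integrable lborel (%x. exp (\<bar>x $ j\<bar>) * \<bar>(\<Prod>i\<in>J. indicator (B i) (x $ i)) * (\<Prod>i\<in>K. x $ i ^ p i) * F x\<bar>)" for J K :: "'n set" and p and j
 proof -
  obtain C where C: "C \<ge> 0" "!!x :: 'n point. (\<Prod>i\<in>K. \<bar>x $ i\<bar> ^ p i) <= C * exp (real (card K) * norm x)"
   using prod_power_le[of K] by auto
  show ?thesis
  proof (rule Bochner_Integration.integrable_bound)
   show "integrable lborel (%x. C * (exp ((1 + real (card K)) * norm x) * F x))" using I by simp
   show "AE x in lborel. norm (exp (\<bar>x $ j\<bar>) * \<bar>(\<Prod>i\<in>J. indicator (B i) (x $ i)) * (\<Prod>i\<in>K. x $ i ^ p i) * F x\<bar>) <= norm (C * (exp ((1 + real (card K)) * norm x) * F x))"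
   proof (rule AE_I2)
    fix x :: "'n point"
    have "\<bar>\<Prod>i\<in>J. indicator (B i) (x $ i) :: real\<bar> <= 1"
     unfolding abs_prod by (rule prod_le_1) (auto simp: indicator_def)
    then have "\<bar>\<Prod>i\<in>J. indicator (B i) (x $ i)\<bar> * (\<Prod>i\<in>K. \<bar>x $ i\<bar> ^ p i) <= 1 * (C * exp (real (card K) * norm x))"
     by (intro mult_mono C prod_nonneg) auto
    then have "exp \<bar>x $ j\<bar> * (\<bar>\<Prod>i\<in>J. indicator (B i) (x $ i)\<bar> * (\<Prod>i\<in>K. \<bar>x $ i\<bar> ^ p i)) * \<bar>F x\<bar> <= exp (norm x) * (1 * (C * exp (real (card K) * norm x))) * \<bar>F x\<bar>"
     using component_le_norm_cart[of x j] C(1) by (intro mult_right_mono mult_mono[where a = "exp \<bar>x $ j\<bar>"]) (auto intro!: mult_nonneg_nonneg prod_nonneg)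
    then show "norm (exp (\<bar>x $ j\<bar>) * \<bar>(\<Prod>i\<in>J. indicator (B i) (x $ i)) * (\<Prod>i\<in>K. x $ i ^ p i) * F x\<bar>) <= norm (C * (exp ((1 + real (card K)) * norm x) * F x))"
     using C(1) unfolding distrib_right exp_add by (simp add: abs_mult abs_prod power_abs mult_ac)
   qed
  qed measurable
 qed
 have "finite J" by simp
 then show ?thesis
 proof (induction J arbitrary: p rule: finite_induct)
  case empty then show ?case using m by simp
 next
  case (insert j J)
  let ?F = "%x. (\<Prod>i\<in>J. indicator (B i) (x $ i)) * (\<Prod>i\<in>- insert j J. x $ i ^ p i) * F x"
  have cJ: "- J = insert j (- insert j J)" using insert.hyps by auto
  have "(LINT x|lborel. indicator (B j) (x $ j) * ?F x) = 0"
  proof (rule integral_comp_zero_of_moments[where ep = 1 and T = "%x. x $ j" and g = "indicator (B j)"])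
   show "integrable lborel (%x. exp (1 * \<bar>x $ j\<bar>) * \<bar>?F x\<bar>)" using dom by simp
   fix k
   have "(LINT x|lborel. x $ j ^ k * ?F x) = (LINT x|lborel. (\<Prod>i\<in>J. indicator (B i) (x $ i)) * (\<Prod>i\<in>- J. x $ i ^ (p(j := k)) i) * F x)"
    by (intro Bochner_Integration.integral_cong refl) (simp add: cJ mult_ac)
   also have "... = 0" by (rule insert.IH)
   finally show "(LINT x|lborel. x $ j ^ k * ?F x) = 0" .
  next
   have "integrable lborel (%x. exp \<bar>x $ j\<bar> * \<bar>?F x\<bar>)" by (rule dom)
   then show "integrable lborel (%x. indicator (B j) (x $ j) * ?F x)"
   proof (rule Bochner_Integration.integrable_bound)
    have "\<bar>indicator (B j) (x $ j) * r\<bar> <= \<bar>exp \<bar>x $ j\<bar> * \<bar>r\<bar>\<bar>" for x :: "'n point" and r :: real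
    proof -
     have "\<bar>indicator (B j) (x $ j) * r\<bar> <= 1 * \<bar>r\<bar>" unfolding abs_mult by (intro mult_right_mono) (auto simp: indicator_def)
     also have "... <= exp \<bar>x $ j\<bar> * \<bar>r\<bar>" by (intro mult_right_mono) auto
     finally show ?thesis by simp
    qed
    then show "AE x in lborel. norm (indicator (B j) (x $ j) * ?F x) <= norm (exp \<bar>x $ j\<bar> * \<bar>?F x\<bar>)" unfolding real_norm_def by blast
   qed measurable
  qed (use B in measurable)
  then show ?case using insert.hyps by (simp add: mult_ac)
 qed
qed

text \<open>Boxes are stable under intersection and generate the Borel sets, so the positive and the
  negative part of F are densities of the same measure.\<close>

lemma AE_zero_of_moments:
 fixes F :: "'n::finite point => real"
 assumes [measurable]: "F \<in> borel_measurable borel"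
  and I: "!!D. integrable lborel (%x. exp (D * norm x) * F x)"
  and m: "!!p. (LINT x|lborel. (\<Prod>i\<in>UNIV. x $ i ^ p i) * F x) = 0"
 shows "AE x in lborel. F x = 0"
proof -
 have F: "integrable lborel F" using I[of 0] by simp
 have box: "(LINT x|lborel. indicator (box a b) x * F x) = 0" for a b :: "'n point"
 proof -
  have "(\<Prod>i\<in>UNIV. indicator {a $ i<..<b $ i} (x $ i) :: real) = indicator (box a b) x" for x
   unfolding indicator_def mem_box_cart by (auto simp: prod_zero_iff)
  then show ?thesis using box_integral_zero[OF _ I m, of "%i. {a $ i<..<b $ i}" UNIV] by simp
 qed
 have split: "ennreal (F x) = ennreal (max 0 (F x))" "F x = max 0 (F x) - max 0 (- F x)" for x by (auto simp: max_def ennreal_neg)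
 have em: "emeasure (density lborel (%x. ennreal (max 0 (s * F x)))) A = ennreal (LINT x|lborel. indicator A x * max 0 (s * F x))" if [measurable]: "A \<in> sets borel" for A s
 proof -
  have "integrable lborel (%x. indicator A x * max 0 (s * F x))"
   by (rule Bochner_Integration.integrable_bound[OF integrable_mult_right[of s, OF F]]) (auto simp: indicator_def max_def)
  then show ?thesis
   by (subst emeasure_density) (auto simp: nn_integral_eq_integral[symmetric] ennreal_mult'' ennreal_indicator mult.commute intro!: nn_integral_cong split: split_indicator)
 qed
 have "density lborel (%x. ennreal (max 0 (1 * F x))) = density lborel (%x. ennreal (max 0 (- 1 * F x)))"
 proof (rule measure_eqI_generator_eq[where E = "range (%(a, b). box a b)" and \<Omega> = UNIV and A = "%n :: nat. box (- (\<chi> i. real n)) (\<chi> i. real n)"])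
  show "Int_stable (range (%(a, b). box a b :: 'n point set))" by (auto simp: Int_stable_def box_Int_box)
  have i: "integrable lborel (%x. indicator (box a b) x * max 0 (s * F x))" for a b and s :: real
   by (rule Bochner_Integration.integrable_bound[OF integrable_mult_right[of s, OF F]]) (auto simp: indicator_def max_def)
  fix X :: "'n point set" assume "X \<in> range (%(a, b). box a b)"
  then obtain a b where X: "X = box a b" by auto
  have "0 = (LINT x|lborel. indicator (box a b) x * max 0 (1 * F x) - indicator (box a b) x * max 0 (- 1 * F x))"
   by (subst box[of a b, symmetric], intro Bochner_Integration.integral_cong refl) (auto simp: max_def)
  then show "emeasure (density lborel (%x. ennreal (max 0 (1 * F x)))) X = emeasure (density lborel (%x. ennreal (max 0 (- 1 * F x)))) X"
   unfolding X em[OF borel_open[OF open_box]] by (subst (asm) Bochner_Integration.integral_diff[OF i i]) simp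
 next
  show "sets (density lborel (%x. ennreal (max 0 (1 * F x)))) = sigma_sets UNIV (range (%(a, b). box a b))"
   "sets (density lborel (%x. ennreal (max 0 (- 1 * F x)))) = sigma_sets UNIV (range (%(a, b). box a b))"
   by (simp_all add: borel_eq_box)
  show "range (%n :: nat. box (- (\<chi> i. real n)) (\<chi> i. real n)) \<subseteq> range (%(a, b). box a b :: 'n point set)" by auto
  show "(\<Union>n :: nat. box (- (\<chi> i. real n)) (\<chi> i. real n)) = (UNIV :: 'n point set)"
  proof (intro set_eqI iffI UNIV_I)
   fix x :: "'n point"
   obtain n :: nat where n: "norm x < real n" using reals_Archimedean2 by blast
   have "\<bar>x $ i\<bar> < real n" for i using component_le_norm_cart[of x i] n by linarith
   then have "x \<in> box (- (\<chi> i. real n)) (\<chi> i. real n)" unfolding mem_box_cart by (simp add: abs_less_iff) (metis neg_less_iff_less minus_minus)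
   then show "x \<in> (\<Union>n :: nat. box (- (\<chi> i. real n)) (\<chi> i. real n))" by blast
  qed
  show "emeasure (density lborel (%x. ennreal (max 0 (1 * F x)))) (box (- (\<chi> i. real n)) (\<chi> i. real n)) ~= \<infinity>" for n :: nat
   by (subst em) auto
 qed auto
 then have "AE x in lborel. ennreal (max 0 (1 * F x)) = ennreal (max 0 (- 1 * F x))"
  by (subst (asm) finite_density_unique) (use em[of UNIV 1] in \<open>auto simp: emeasure_density\<close>)
 then show ?thesis by eventually_elim (auto simp: max_def split: if_splits)
qed

section \<open>Completeness of the basis functions\<close>

lemma weight_measurable [measurable]: "(%x :: 'n::finite point. weight m c (norm x)) \<in> borel_measurable borel"
 unfolding weight_def by measurable

lemma weight_nonneg: "weight m c r \<ge> 0"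
 by (simp add: weight_def)

lemma weight_eq: "c > -1 ==> weight m c r = r powr (delta m c - real m)"
 unfolding weight_def delta_def by (rule arg_cong[where f = "%s. r powr s"]) (simp add: field_simps)

lemma
 fixes g :: "'n::{finite,linorder} point => 'b::{banach,second_countable_topology}"
 assumes [measurable]: "g \<in> borel_measurable borel"
 shows integral_wmeasure: "(LINT x|wmeasure c. g x) = (LINT x|lborel. weight CARD('n) c (norm x) *r g x)"
  and integrable_wmeasure: "integrable (wmeasure c) g \<longleftrightarrow> integrable lborel (%x. weight CARD('n) c (norm x) *r g x)"
 unfolding wmeasure_def by (simp_all add: integral_density integrable_density weight_nonneg)

lemma AE_wmeasure:
 fixes P :: "'n::{finite,linorder} point => bool"
 shows "AE x in lborel. weight CARD('n) c (norm x) > 0 --> P x ==> AE x in wmeasure c. P x"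
 unfolding wmeasure_def by (subst AE_density) auto

lemma powr_times_even: "r \<ge> 0 ==> r powr b * (r\<^sup>2) ^ i = r powr (b + 2 * real i)"
proof (cases "r = 0")
 case False
 assume "r \<ge> 0"
 with False have r: "r > 0" by simp
 have "r powr (2 * real i) = (r\<^sup>2) ^ i" using powr_realpow[OF r, of "2 * i"] by (simp add: power_mult)
 then show ?thesis by (simp add: powr_add)
qed simp

text \<open>Near the origin the weight r^(delta - m) is integrable because delta > 0; at infinity
  the Gaussian decides.\<close>

lemma L2_bound:
 fixes f :: "'n::{finite,linorder} clfun"
 assumes c: "c > -1" and m: "CARD('n) \<ge> 2" and [measurable]: "f \<in> borel_measurable borel" and kp: "kp > 0" and s: "s \<ge> 0"
  and b: "!!x. x ~= 0 ==> norm (f x) <= C * (norm x powr s * exp (b * norm x - kp * nsq x))"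
 shows "f \<in> L2 c"
proof -
 let ?d = "delta CARD('n) c"
 have d: "?d > 0" by (rule delta_pos[OF c m])
 have "integrable lborel (%x :: 'n point. weight CARD('n) c (norm x) *r (norm (f x))\<^sup>2)"
 proof (rule Bochner_Integration.integrable_bound)
  show "integrable lborel (%x :: 'n point. C\<^sup>2 * (norm x powr (?d - real CARD('n) + 2 * s) * exp (2 * b * norm x - 2 * kp * nsq x)))"
   by (intro integrable_mult_right integrable_norm_powr_gauss) (use d s kp in auto)
  have "norm (weight CARD('n) c (norm x) *r (norm (f x))\<^sup>2) <= norm (C\<^sup>2 * (norm x powr (?d - real CARD('n) + 2 * s) * exp (2 * b * norm x - 2 * kp * nsq x)))" if x: "x ~= 0" for x
  proof -
   have "(norm (f x))\<^sup>2 <= (C * (norm x powr s * exp (b * norm x - kp * nsq x)))\<^sup>2"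
    by (rule power_mono[OF b[OF x]]) simp
   also have "... = C\<^sup>2 * (norm x powr (2 * s) * exp (2 * b * norm x - 2 * kp * nsq x))"
   proof -
    have "(norm x powr s)\<^sup>2 = norm x powr (2 * s)" by (simp add: power2_eq_square powr_add[symmetric])
    moreover have "(exp (b * norm x - kp * nsq x))\<^sup>2 = exp (2 * b * norm x - 2 * kp * nsq x)"
     by (simp add: power2_eq_square exp_add[symmetric] algebra_simps)
    ultimately show ?thesis by (simp add: power_mult_distrib)
   qed
   finally have "weight CARD('n) c (norm x) * (norm (f x))\<^sup>2 <= weight CARD('n) c (norm x) * (C\<^sup>2 * (norm x powr (2 * s) * exp (2 * b * norm x - 2 * kp * nsq x)))"
    by (rule mult_left_mono) (rule weight_nonneg)
   then show ?thesis by (simp add: weight_eq[OF c] powr_add abs_mult mult_ac)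
  qed
  then show "AE x in lborel. norm (weight CARD('n) c (norm x) *r (norm (f x))\<^sup>2) <= norm (C\<^sup>2 * (norm x powr (?d - real CARD('n) + 2 * s) * exp (2 * b * norm x - 2 * kp * nsq x)))"
   using AE_lborel_singleton[of "0 :: 'n point"] by (auto elim: eventually_mono)
 qed measurable
 then show ?thesis by (simp add: L2_def integrable_wmeasure)
qed

definition gauss_radial :: "real => real => ('n::{finite,linorder} clfun) => 'n clfun" where
 "gauss_radial kp r H x = (norm x powr r * exp (- kp * nsq x)) *r H x"

lemma gauss_radial_L2:
 fixes H :: "'n::{finite,linorder} clfun"
 assumes c: "c > -1" and m: "CARD('n) \<ge> 2" and H: "hpoly k H" and r: "r + real k \<ge> 0" and kp: "kp > 0"
 shows "gauss_radial kp r H \<in> L2 c"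
proof -
 obtain C where C: "C \<ge> 0" "!!x. norm (H x) <= C * norm x ^ k" using hpoly_bound[OF H] by blast
 have [measurable]: "H \<in> borel_measurable borel" by (rule hpoly_measurable[OF H])
 show ?thesis
 proof (rule L2_bound[OF c m _ kp r])
  show "gauss_radial kp r H \<in> borel_measurable borel" unfolding gauss_radial_def[abs_def] by measurable
  fix x :: "'n point" assume x: "x ~= 0"
  have "norm (gauss_radial kp r H x) <= norm x powr r * exp (- kp * nsq x) * (C * norm x ^ k)"
   unfolding gauss_radial_def by (simp add: abs_mult C mult_left_mono)
  also have "... = C * (norm x powr (r + real k) * exp (0 * norm x - kp * nsq x))"
   using x by (simp add: powr_add powr_realpow)
  finally show "norm (gauss_radial kp r H x) <= C * (norm x powr (r + real k) * exp (0 * norm x - kp * nsq x))" .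
 qed
qed

lemma phi_angular_hpoly: "hpoly l M ==> hpoly (l + n mod 2) (phi_angular n M)"
proof (cases "even n")
 case False
 then have "n mod 2 = 1" by presburger
 moreover assume "hpoly l M"
 ultimately show ?thesis using False by (simp add: phi_angular_def[abs_def] hpoly_vec)
qed (simp add: phi_angular_def[abs_def])

lemma phi_gauss_radial:
 fixes M :: "nat => nat => 'n::{finite,linorder} clfun"
 shows "phi c M n l j x = (\<Sum>i\<le>n div 2. of_real (phi_coeff c n * laguerre_coeff (n div 2) (phi_index (gam CARD('n) c (real l)) n) i)
   *s gauss_radial (1 / 2) (beta c (real l) + 2 * real i) (phi_angular n (M l j)) x)"
proof -
 let ?e = "exp (- (1 / 2) * nsq x)" and ?b = "beta c (real l)" and ?av = "phi_index (gam CARD('n) c (real l)) n"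
 have "(norm x powr ?b * (phi_coeff c n * lag_exp (n div 2) ?av (nsq x)))
   = (\<Sum>i\<le>n div 2. phi_coeff c n * laguerre_coeff (n div 2) ?av i * (norm x powr (?b + 2 * real i) * ?e))"
  unfolding lag_exp_def laguerre_eq powr_times_even[OF norm_ge_zero, symmetric]
  by (simp add: sum_distrib_left sum_distrib_right mult_ac)
 then show ?thesis
  unfolding phi_eq norm_square_powr gauss_radial_def scaleR_eq_smult[symmetric] scaleR_scaleR
  by (simp add: scaleR_sum_left)
qed

lemma beta_plus: "c > -1 ==> beta c k + k = k / (1 + c)"
 by (simp add: beta_def field_simps)

lemma phi_L2:
 fixes M :: "nat => nat => 'n::{finite,linorder} clfun"
 assumes c: "c > -1" and m: "CARD('n) \<ge> 2" and M: "hpoly l (M l j)"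
 shows "phi c M n l j \<in> L2 c"
proof -
 have "beta c (real l) + real l \<ge> 0" using c by (simp add: beta_plus)
 then show ?thesis
  unfolding phi_gauss_radial[abs_def]
  by (intro L2_sum L2_smult gauss_radial_L2[OF c m phi_angular_hpoly[OF M]]) auto
qed

text \<open>A triangular system: the top coefficient of each Laguerre polynomial is nonzero, so the
  powers are reached one after another.\<close>

lemma gauss_radial_moments_of_laguerre:
 fixes A :: "'n::{finite,linorder} clfun"
 assumes g: "!!i :: nat. gauss_radial (1 / 2) (b + 2 * real i) A \<in> L2 c" and f: "f \<in> L2 c"
  and z: "!!t. l2_inner c f (%x. \<Sum>i\<le>t. of_real (kp t * laguerre_coeff t av i) *s gauss_radial (1 / 2) (b + 2 * real i) A x) = 0"
  and kp: "!!t :: nat. kp t ~= 0"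
 shows "l2_inner c f (gauss_radial (1 / 2) (b + 2 * real t) A) = 0"
proof (induction t rule: less_induct)
 case (less t)
 have "0 = (\<Sum>i\<le>t. of_real (kp t * laguerre_coeff t av i) * l2_inner c f (gauss_radial (1 / 2) (b + 2 * real i) A))"
  unfolding z[of t, symmetric] by (simp add: l2_inner_sum_right L2_smult l2_inner_smult_right f g)
 also have "... = (\<Sum>i\<in>{t}. of_real (kp t * laguerre_coeff t av i) * l2_inner c f (gauss_radial (1 / 2) (b + 2 * real i) A))"
  by (rule sum.mono_neutral_right) (auto simp: less)
 finally show ?case using kp[of t] by (simp add: laguerre_coeff_def)
qed

text \<open>From the powers b + 2 t to any admissible real power s: the former are moments in |x|^2,
  and \<open>integral_comp_zero_of_moments\<close> allows the function v^((s - b)/2) of v =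
  |x|^2.\<close>

lemma gauss_radial_inner_zero:
 fixes A :: "'n::{finite,linorder} clfun"
 assumes c: "c > -1" and m: "CARD('n) \<ge> 2" and A: "hpoly k A" and b: "b + real k \<ge> 0" and s: "s + real k \<ge> 0"
  and f: "f \<in> L2 c" and z: "!!t. l2_inner c f (gauss_radial (1 / 2) (b + 2 * real t) A) = 0"
 shows "l2_inner c f (gauss_radial (1 / 2) s A) = 0"
proof -
 have [measurable]: "A \<in> borel_measurable borel" "f \<in> borel_measurable borel"
  using hpoly_measurable[OF A] L2_measurable[OF f] by auto
 note L = gauss_radial_L2[OF c m A]
 let ?D = "%x. cl_dot (f x) (A x)"
 have dot: "cl_dot (f x) (gauss_radial kp r A x) = (norm x powr r * exp (- kp * nsq x)) *r ?D x" for kp r x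
  by (simp add: gauss_radial_def cl_dot_scaleR)
 \<comment> \<open>The moment lemma is about real functions; \<open>p\<close> stands for the real
   and the imaginary part.\<close>
 have "p (l2_inner c f (gauss_radial (1 / 2) s A)) = 0" if p: "bounded_linear p" for p :: "complex => real"
 proof -
  have [measurable]: "p \<in> borel_measurable borel"
   by (rule borel_measurable_continuous_onI[OF linear_continuous_on[OF p]])
  have ps: "p (r *r z) = r * p z" for r z using linear_simps(5)[OF p] by simp
  have int: "integrable (wmeasure c) (%x. norm x powr r * exp (- kp * nsq x) * p (?D x))" if "r + real k \<ge> 0" "kp > 0" for r kp
   using integrable_bounded_linear[OF p L2_integrable_dot[OF f L[OF that]]] by (simp add: dot ps)
  have lint: "p (l2_inner c f (gauss_radial (1 / 2) r A)) = (LINT x|wmeasure c. norm x powr r * exp (- (1 / 2) * nsq x) * p (?D x))" if "r + real k \<ge> 0" for r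
   using integral_bounded_linear[OF p L2_integrable_dot[OF f L[OF that, of "1 / 2"]]] f L[OF that, of "1 / 2"]
   by (simp add: l2_inner_eq dot ps)
  let ?F = "%x. norm x powr b * exp (- (1 / 2) * nsq x) * p (?D x)"
  have g: "(nsq x) powr ((s - b) / 2) * ?F x = norm x powr s * exp (- (1 / 2) * nsq x) * p (?D x)" for x
   unfolding norm_square_powr by (simp add: mult.assoc[symmetric] powr_add[symmetric])
  have "(LINT x|wmeasure c. (nsq x) powr ((s - b) / 2) * ?F x) = 0"
  \<comment> \<open>With ep = 1/4 half of the Gaussian exp(-|x|^2/2) is spent on the exponential
    weight, and the other half keeps the integral finite.\<close>
  proof (rule integral_comp_zero_of_moments[where T = "%x. nsq x" and g = "%v. v powr ((s - b) / 2)" and ep = "1 / 4"])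
   have "exp (1 / 4 * \<bar>nsq x\<bar>) * \<bar>?F x\<bar> = \<bar>norm x powr b * exp (- (1 / 4) * nsq x) * p (?D x)\<bar>" for x
   proof -
    have "exp (- (1 / 4) * nsq x) = exp (1 / 4 * nsq x) * exp (- (1 / 2) * nsq x)"
     unfolding exp_add[symmetric] by simp
    then show ?thesis by (simp only: abs_mult abs_power2 abs_exp_cancel mult_ac)
   qed
   then show "integrable (wmeasure c) (%x. exp (1 / 4 * \<bar>nsq x\<bar>) * \<bar>?F x\<bar>)"
    using integrable_abs[OF int[OF b, of "1 / 4"]] by simp
   fix t
   have teq: "nsq x ^ t * ?F x = norm x powr (b + 2 * real t) * exp (- (1 / 2) * nsq x) * p (?D x)" for x :: "'n point"
    unfolding powr_times_even[OF norm_ge_zero, symmetric] by (simp only: mult_ac)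
   have "(LINT x|wmeasure c. nsq x ^ t * ?F x) = p (l2_inner c f (gauss_radial (1 / 2) (b + 2 * real t) A))"
    unfolding teq by (rule lint[symmetric]) (use b in simp)
   then show "(LINT x|wmeasure c. nsq x ^ t * ?F x) = 0"
    unfolding z linear_simps(3)[OF p] .
  next
   show "integrable (wmeasure c) (%x. (nsq x) powr ((s - b) / 2) * ?F x)" unfolding g by (rule int[OF s]) simp
   show "0 < (1 / 4 :: real)" by simp
  qed measurable
  then show ?thesis unfolding g lint[OF s] .
 qed
 from this[OF bounded_linear_Re] this[OF bounded_linear_Im] show ?thesis by (simp add: complex_eq_iff)
qed

section \<open>Complex monogenics in terms of the real bases\<close>

lemma cl_cnj_gen: "cl_cnj (cl_gen i) = cl_gen i"
 by (simp add: cl_cnj_def cl_gen_def cl_basis_def axis_def vec_eq_iff)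

lemma cl_cnj_cnj: "cl_cnj (cl_cnj a) = a"
 by (simp add: cl_cnj_def vec_eq_iff)

lemma cl_real_iff: "a \<in> cl_real \<longleftrightarrow> cl_cnj a = a"
 by (simp add: cl_real_def cl_cnj_def vec_eq_iff Reals_cnj_iff)

lemma monogenic_cnj:
 assumes N: "monogenic l N"
 shows "monogenic l (%x. cl_cnj (N x))"
proof -
 have h: "hpoly l N" and d: "dirac N x = 0" for x using N by (auto simp: monogenic_def)
 have "dirac (%x. cl_cnj (N x)) x = cl_cnj (dirac N x)" for x
  by (rule dirac_linear[OF h bounded_linear_cl_cnj]) (simp add: cl_cnj_mult cl_cnj_gen)
 then show ?thesis
  using hpoly_linear[OF h bounded_linear.linear[OF bounded_linear_cl_cnj]] linear_simps(3)[OF bounded_linear_cl_cnj]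
  by (simp add: monogenic_def d)
qed

lemma monogenic_add: "monogenic l f ==> monogenic l g ==> monogenic l (%x. f x + g x)"
 by (auto simp: monogenic_def hpoly.add dirac_add)

lemma monogenic_smult: "monogenic l f ==> monogenic l (%x. s *s f x)"
proof -
 assume f: "monogenic l f"
 then have h: "hpoly l f" by (simp add: monogenic_def)
 have "dirac (%x. s *s f x) x = s *s dirac f x" for x
  by (rule dirac_linear[OF h bounded_linear_smult]) (simp add: cl_mult_scale_right)
 then show ?thesis using f hpoly_smult[OF h] by (simp add: monogenic_def)
qed

lemma monogenics_monogenic: "M \<in> monogenics l ==> monogenic l M"
 by (simp add: monogenics_iff monogenic_def)

lemma monogenic_span:
 assumes B: "orthonormal_bases d M" and N: "monogenic l N"
 shows "\<exists>a :: nat => complex. \<forall>x. N x = (\<Sum>j<d l. a j *s M l j x)"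
proof -
 \<comment> \<open>The two conditions make s (N + t conj N) equal to its own conjugate. The choices
   (1/2, 1) and (-i/2, -1) below give the real and the imaginary part of \<open>N\<close>.\<close>
 have real: "\<exists>a :: nat => real. \<forall>x. s *s (N x + t *s cl_cnj (N x)) = (\<Sum>j<d l. a j *r M l j x)"
  if st: "cnj s = s * t" "t * cnj t = 1" for s t
 proof -
  have mono: "monogenic l (%x. s *s (N x + t *s cl_cnj (N x)))"
   by (intro monogenic_smult monogenic_add N monogenic_cnj)
  have c: "cl_cnj (u *s a) = cnj u *s cl_cnj a" "cl_cnj (a + b) = cl_cnj a + cl_cnj b" for u and a b :: "'a cliff"
   by (simp_all add: cl_cnj_def vec_eq_iff)
  have st': "cnj s * cnj t = s" using st by (metis mult.assoc mult.right_neutral)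
  have "cl_cnj (s *s (N x + t *s cl_cnj (N x))) = s *s (N x + t *s cl_cnj (N x))" for x
   using st(1) st' by (simp add: c cl_cnj_cnj vector_add_ldistrib vector_smult_assoc add.commute)
  then have "(%x. s *s (N x + t *s cl_cnj (N x))) \<in> monogenics l"
   using mono by (auto simp: monogenics_iff monogenic_def cl_real_iff)
  moreover have "\<forall>N\<in>monogenics l. \<exists>a :: nat => real. \<forall>x. N x = (\<Sum>j<d l. a j *r M l j x)"
   using B by (simp add: orthonormal_bases_def)
  ultimately show ?thesis by (auto dest: bspec)
 qed
 obtain a where a: "!!x. (1 / 2) *s (N x + 1 *s cl_cnj (N x)) = (\<Sum>j<d l. a j *r M l j x)"
  using real[of "1 / 2" 1] by auto
 obtain b where b: "!!x. (- \<i> / 2) *s (N x + (- 1) *s cl_cnj (N x)) = (\<Sum>j<d l. b j *r M l j x)"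
  using real[of "- \<i> / 2" "- 1"] by auto
 have "N x = (\<Sum>j<d l. (of_real (a j) + \<i> * of_real (b j)) *s M l j x)" for x
 proof -
  have "N x = (1 / 2) *s (N x + 1 *s cl_cnj (N x)) + \<i> *s ((- \<i> / 2) *s (N x + (- 1) *s cl_cnj (N x)))"
   by (simp add: vec_eq_iff cl_cnj_def algebra_simps)
  also have "... = (\<Sum>j<d l. (of_real (a j) + \<i> * of_real (b j)) *s M l j x)"
   unfolding a b scaleR_eq_smult vec.scale_sum_right sum.distrib[symmetric]
   by (simp add: vector_smult_assoc vector_sadd_rdistrib)
  finally show ?thesis .
 qed
 then show ?thesis by (intro exI[of _ "%j. of_real (a j) + \<i> * of_real (b j)"]) simp
qed

lemma vpow_eq:
 "vpow (2 * i) x a = (- 1) ^ i *r ((norm x ^ 2) ^ i *r a)"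
 "vpow (Suc (2 * i)) x a = (- 1) ^ i *r ((norm x ^ 2) ^ i *r (cl_vec x \<odot> a))"
proof -
 show 1: "vpow (2 * i) x a = (- 1) ^ i *r ((norm x ^ 2) ^ i *r a)"
  by (induction i) (simp_all add: vpow_Suc cl_vec_square cl_mult_scaleR_right)
 show "vpow (Suc (2 * i)) x a = (- 1) ^ i *r ((norm x ^ 2) ^ i *r (cl_vec x \<odot> a))"
  unfolding vpow_Suc 1 cl_mult_scaleR_right ..
qed

lemma phi_complete:
 fixes M :: "nat => nat => 'n::{finite,linorder} clfun"
 assumes c: "c > -1" and m: "CARD('n) \<ge> 2" and B: "orthonormal_bases d M" and f: "f \<in> L2 c"
  and z: "!!n l j. j < d l ==> l2_inner c f (phi c M n l j) = 0"
 shows "l2_norm c f = 0"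
proof -
 have M: "hpoly l (M l j)" if "j < d l" for l j
  using B that unfolding orthonormal_bases_def by (auto simp: monogenics_iff)
 have bl: "beta c (real l) + real l \<ge> 0" for l using c by (simp add: beta_plus)
 \<comment> \<open>The exponent beta depends on l; passing to an arbitrary power \<open>s\<close>
   makes the Fischer components accessible.\<close>
 have basis: "l2_inner c f (gauss_radial (1 / 2) s (phi_angular p (M l j))) = 0" if j: "j < d l" and p: "p < 2" and s: "s \<ge> 0" for l j p s
 proof -
  note h = phi_angular_hpoly[OF M[OF j], of p]
  show ?thesis
  proof (rule gauss_radial_inner_zero[OF c m h _ _ f])
   show "beta c (real l) + real (l + p mod 2) \<ge> 0" "s + real (l + p mod 2) \<ge> 0" using bl[of l] s by auto
   fix t
   show "l2_inner c f (gauss_radial (1 / 2) (beta c (real l) + 2 * real t) (phi_angular p (M l j))) = 0"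
   proof (rule gauss_radial_moments_of_laguerre[OF _ f, where kp = "%t. phi_coeff c (2 * t + p)" and av = "phi_index (gam CARD('n) c (real l)) p"])
    show "gauss_radial (1 / 2) (beta c (real l) + 2 * real i) (phi_angular p (M l j)) \<in> L2 c" for i
     by (rule gauss_radial_L2[OF c m h]) (use bl[of l] in auto)
    show "phi_coeff c (2 * t + p) ~= 0" for t using c by (simp add: phi_coeff_def)
    fix t
    have t: "(2 * t + p) div 2 = t" "phi_angular (2 * t + p) (M l j) = phi_angular p (M l j)" "phi_index \<gamma> (2 * t + p) = phi_index \<gamma> p" for \<gamma>
     using p by (auto simp: phi_angular_def fun_eq_iff phi_index_def)
    show "l2_inner c f (%x. \<Sum>i\<le>t. of_real (phi_coeff c (2 * t + p) * laguerre_coeff t (phi_index (gam CARD('n) c (real l)) p) i)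
       *s gauss_radial (1 / 2) (beta c (real l) + 2 * real i) (phi_angular p (M l j)) x) = 0"
     using z[OF j, of "2 * t + p"] unfolding phi_gauss_radial[abs_def] t .
   qed
  qed
 qed
 have mono: "l2_inner c f (gauss_radial (1 / 2) s (phi_angular p N)) = 0" if N: "monogenic l N" and p: "p < 2" and s: "s \<ge> 0" for l N p s
 proof -
  obtain a where a: "!!x. N x = (\<Sum>j<d l. a j *s M l j x)" using monogenic_span[OF B N] by blast
  have "phi_angular p N x = (\<Sum>j<d l. a j *s phi_angular p (M l j) x)" for x
   by (simp add: phi_angular_def a cl_mult_sum_right cl_mult_scale_right)
  then have "gauss_radial (1 / 2) s (phi_angular p N) = (%x. \<Sum>j<d l. a j *s gauss_radial (1 / 2) s (phi_angular p (M l j)) x)"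
   by (simp add: fun_eq_iff gauss_radial_def scaleR_sum_right smult_scaleR)
  moreover have "gauss_radial (1 / 2) s (phi_angular p (M l j)) \<in> L2 c" if "j < d l" for j
   by (rule gauss_radial_L2[OF c m phi_angular_hpoly[OF M[OF that]]]) (use s in auto)
  ultimately have "l2_inner c f (gauss_radial (1 / 2) s (phi_angular p N))
    = (\<Sum>j<d l. a j * l2_inner c f (gauss_radial (1 / 2) s (phi_angular p (M l j))))"
   using f by (simp only:, subst l2_inner_sum_right) (auto intro!: L2_smult sum.cong l2_inner_smult_right)
  then show ?thesis using basis[OF _ p s] by simp
 qed
 \<comment> \<open>An even power of the vector variable is a power of |x|^2 up to sign, so each
   Fischer component is a radial power times M or x M.\<close>
 have poly: "l2_inner c f (gauss_radial (1 / 2) 0 P) = 0" if "hpoly k P" for k P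
  using fischer_decomposition[OF that]
 proof (induction rule: fischer.induct)
  case (vpow l N s)
  define i where "i = s div 2"
  define p where "p = s mod 2"
  have s: "s = 2 * i + p" and p: "p < 2" by (simp_all add: i_def p_def)
  have N: "monogenic l N" using vpow by (simp add: monogenic_def)
  have "gauss_radial (1 / 2) 0 (%x. vpow s x (N x)) x = of_real ((- 1) ^ i) *s gauss_radial (1 / 2) (2 * real i) (phi_angular p N) x" for x
  proof -
   have "vpow s x (N x) = (- 1) ^ i *r ((norm x ^ 2) ^ i *r phi_angular p N x)"
   proof (cases "p = 0")
    case True
    show ?thesis unfolding s True add_0_right vpow_eq by (simp add: phi_angular_def)
   next
    case False
    then have p: "p = 1" using p by simp
    show ?thesis unfolding s p add_Suc_right One_nat_def add_0_right vpow_eq by (simp add: phi_angular_def)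
   qed
   moreover have "norm x powr (2 * real i) = norm x powr 0 * (norm x ^ 2) ^ i"
    using powr_times_even[of "norm x" 0 i] by simp
   ultimately show ?thesis
    unfolding gauss_radial_def scaleR_eq_smult[symmetric] by (simp add: mult_ac)
  qed
  then have "gauss_radial (1 / 2) 0 (%x. vpow s x (N x)) = (%x. of_real ((- 1) ^ i) *s gauss_radial (1 / 2) (2 * real i) (phi_angular p N) x)" by (rule ext)
  moreover have "gauss_radial (1 / 2) (2 * real i) (phi_angular p N) \<in> L2 c"
   by (rule gauss_radial_L2[OF c m phi_angular_hpoly[OF vpow(1)]]) auto
  ultimately show ?case using mono[OF N p, of "2 * real i"] f by (simp only: l2_inner_smult_right) simp
 next
  case (add k g h)
  have "gauss_radial (1 / 2) 0 (%x. g x + h x) = (%x. gauss_radial (1 / 2) 0 g x + gauss_radial (1 / 2) 0 h x)"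
   by (simp add: fun_eq_iff gauss_radial_def scaleR_add_right)
  then show ?case
   using l2_inner_add_right[OF f gauss_radial_L2[OF c m fischer_hpoly[OF add(1)]] gauss_radial_L2[OF c m fischer_hpoly[OF add(2)]], of 0 "1 / 2" 0 "1 / 2"] add by simp
 qed
 have [measurable]: "f \<in> borel_measurable borel" using f by (rule L2_measurable)
 have comp: "(%x. f x $ A) \<in> borel_measurable borel" for A
  by (rule borel_measurable_continuous_on[OF linear_continuous_on[OF bounded_linear_vec_nth]]) measurable
 \<comment> \<open>Every coordinate is tested separately, with \<open>q\<close> the real or
   imaginary part. Weight and Gaussian become part of the function whose moments vanish.\<close>
 have zero: "AE x in lborel. weight CARD('n) c (norm x) * exp (- (1 / 2) * nsq x) * q (cnj (f x $ A)) = 0" if q: "bounded_linear q" for q :: "complex => real" and A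
 proof (rule AE_zero_of_moments)
  have [measurable]: "q \<in> borel_measurable borel"
   by (rule borel_measurable_continuous_onI[OF linear_continuous_on[OF q]])
  have [measurable]: "(%x. cnj (f x $ A)) \<in> borel_measurable borel"
   using comp by (rule borel_measurable_continuous_on[OF linear_continuous_on[OF bounded_linear_cnj]])
  show "(%x. weight CARD('n) c (norm x) * exp (- (1 / 2) * nsq x) * q (cnj (f x $ A))) \<in> borel_measurable borel"
   by measurable
  have qs: "q (r *r z) = r * q z" for r z using linear_simps(5)[OF q] by simp
  have dot: "cl_dot (f x) (r *r axis A 1) = r *r cnj (f x $ A)" for r x
   by (simp add: cl_dot_scaleR cl_dot_def axis_def if_distrib cong: if_cong)
  have int: "integrable lborel (%x. weight CARD('n) c (norm x) * (r x * q (cnj (f x $ A))))"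
   "q (l2_inner c f (%x. r x *r axis A 1)) = (LINT x|lborel. weight CARD('n) c (norm x) * (r x * q (cnj (f x $ A))))"
   if L: "(%x. r x *r axis A 1) \<in> L2 c" and [measurable]: "r \<in> borel_measurable borel" for r
   using integrable_bounded_linear[OF q L2_integrable_dot[OF f L]] integral_bounded_linear[OF q L2_integrable_dot[OF f L]] l2_inner_eq[OF f L]
   by (simp_all add: dot qs integrable_wmeasure integral_wmeasure)
  show "integrable lborel (%x. exp (D * norm x) * (weight CARD('n) c (norm x) * exp (- (1 / 2) * nsq x) * q (cnj (f x $ A))))" for D
  proof -
   have "(%x. exp (D * norm x - (1 / 2) * nsq x) *r axis A 1) \<in> L2 c"
    by (rule L2_bound[OF c m, where kp = "1 / 2" and s = 0 and C = 1 and b = D]) auto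
   moreover have "exp (D * norm x) * (W * exp (- (1 / 2) * nsq x) * Q) = W * (exp (D * norm x - (1 / 2) * nsq x) * Q)" for x :: "'n point" and W Q :: real
   proof -
    have "exp (D * norm x - (1 / 2) * nsq x) = exp (D * norm x) * exp (- (1 / 2) * nsq x)"
     unfolding exp_add[symmetric] by simp
    then show ?thesis by (simp only: mult_ac)
   qed
   ultimately show ?thesis using int(1) by (simp only:) measurable
  qed
  show "(LINT x|lborel. (\<Prod>i\<in>UNIV. x $ i ^ p i) * (weight CARD('n) c (norm x) * exp (- (1 / 2) * nsq x) * q (cnj (f x $ A)))) = 0" for p
  proof -
   have h: "finite I ==> hpoly (\<Sum>i\<in>I. p i) (%x. (\<Prod>i\<in>I. x $ i ^ p i) *r axis A 1)" for I
   proof (induction I rule: finite_induct)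
    case empty then show ?case by (simp add: hpoly.const)
   next
    case (insert i I)
    have "hpoly (k + (\<Sum>i\<in>I. p i)) (%x. (x $ i) ^ k *r ((\<Prod>i\<in>I. x $ i ^ p i) *r axis A 1))" for k
    proof (induction k)
     case 0 then show ?case using insert by simp
    next
     case (Suc k) from hpoly.coord[OF this, of i] show ?case by (simp add: mult.assoc)
    qed
    from this[of "p i"] show ?case using insert.hyps by simp
   qed
   let ?r = "%x. norm x powr 0 * exp (- (1 / 2) * nsq x) * (\<Prod>i\<in>UNIV. x $ i ^ p i)"
   have e: "gauss_radial (1 / 2) 0 (%x. (\<Prod>i\<in>UNIV. x $ i ^ p i) *r axis A 1) = (%x. ?r x *r axis A 1)"
    by (simp add: gauss_radial_def fun_eq_iff)
   have L: "(%x. ?r x *r axis A 1) \<in> L2 c"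
    unfolding e[symmetric] by (rule gauss_radial_L2[OF c m h]) (auto intro!: sum_nonneg)
   have "0 = q (l2_inner c f (%x. ?r x *r axis A 1))"
    unfolding e[symmetric] poly[OF h[OF finite]] linear_simps(3)[OF q] ..
   also have "... = (LINT x|lborel. weight CARD('n) c (norm x) * (?r x * q (cnj (f x $ A))))"
    by (rule int(2)[OF L]) measurable
   also have "... = (LINT x|lborel. (\<Prod>i\<in>UNIV. x $ i ^ p i) * (weight CARD('n) c (norm x) * exp (- (1 / 2) * nsq x) * q (cnj (f x $ A))))"
    by (rule integral_cong_AE, measurable, rule eventually_mono[OF AE_lborel_singleton[of "0 :: 'n point"]]) (simp add: mult_ac)
   finally show ?thesis by simp
  qed
 qed
 have "AE x in lborel. \<forall>A. weight CARD('n) c (norm x) * exp (- (1 / 2) * nsq x) * Re (cnj (f x $ A)) = 0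
   \<and> weight CARD('n) c (norm x) * exp (- (1 / 2) * nsq x) * Im (cnj (f x $ A)) = 0"
  unfolding AE_all_countable using zero[OF bounded_linear_Re] zero[OF bounded_linear_Im] by auto
 then have "AE x in lborel. weight CARD('n) c (norm x) > 0 --> f x = 0"
  by eventually_elim (auto simp: vec_eq_iff complex_eq_iff)
 then have "l2_eq c f (%_. 0)" unfolding l2_eq_def by (rule AE_wmeasure)
 then show ?thesis using l2_norm_eq_0[OF f] by simp
qed

section \<open>Orthogonality of the basis functions\<close>

lemma exp_bounded_dot: "hpoly k P ==> hpoly l Q ==> exp_bounded (%x. cl_dot (P x) (Q x))"
 by (intro exp_bounded_bilinear[OF bounded_bilinear_cl_dot] hpoly_exp_bounded)

text \<open>Generators are skew-Hermitian, so Gaussian integration by parts moves the Dirac operator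
  to the other argument with a minus sign.\<close>

lemma gint_dirac_adjoint:
 fixes P Q :: "'n::{finite,linorder} clfun"
 assumes P: "hpoly k P" and Q: "hpoly l Q"
 shows "gint (%x. cl_dot (P x) (cl_vec x \<odot> Q x)) = gint (%x. cl_dot (P x) (dirac Q x)) - gint (%x. cl_dot (dirac P x) (Q x))"
proof -
 note d = exp_bounded_dot
 have i: "gint (%x. x $ i *r cl_dot (P x) (cl_gen i \<odot> Q x))
   = gint (%x. cl_dot (P x) (cl_gen i \<odot> partial i Q x)) - gint (%x. cl_dot (cl_gen i \<odot> partial i P x) (Q x))" for i
 proof -
  have "gint (%x. x $ i *r cl_dot (P x) (cl_gen i \<odot> Q x))
    = gint (%x. cl_dot (P x) (cl_gen i \<odot> partial i Q x) + cl_dot (partial i P x) (cl_gen i \<odot> Q x))"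
   unfolding gint_def
  proof (rule gauss_ibp)
   show "has_pd i (%x. cl_dot (P x) (cl_gen i \<odot> Q x)) (cl_dot (P x) (cl_gen i \<odot> partial i Q x) + cl_dot (partial i P x) (cl_gen i \<odot> Q x)) x" for x
    by (intro has_pd_bilinear[OF bounded_bilinear_cl_dot] hpoly_has_pd[OF P]
      has_pd_linear[OF bounded_bilinear.bounded_linear_right[OF bounded_bilinear_cl_mult]] hpoly_has_pd[OF Q])
   show "exp_bounded (%x. cl_dot (P x) (cl_gen i \<odot> Q x))" by (rule d[OF P hpoly_mult[OF Q]])
   show "exp_bounded (%x. cl_dot (P x) (cl_gen i \<odot> partial i Q x) + cl_dot (partial i P x) (cl_gen i \<odot> Q x))"
    by (rule exp_bounded_add[OF d[OF P hpoly_mult[OF hpoly_partial[OF Q]]] d[OF hpoly_partial[OF P] hpoly_mult[OF Q]]])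
  qed
  also have "... = gint (%x. cl_dot (P x) (cl_gen i \<odot> partial i Q x)) + gint (%x. cl_dot (partial i P x) (cl_gen i \<odot> Q x))"
   by (rule gint_add[OF d[OF P hpoly_mult[OF hpoly_partial[OF Q]]] d[OF hpoly_partial[OF P] hpoly_mult[OF Q]]])
  also have "gint (%x. cl_dot (partial i P x) (cl_gen i \<odot> Q x)) = - gint (%x. cl_dot (cl_gen i \<odot> partial i P x) (Q x))"
   by (simp add: cl_dot_gen gint_def)
  finally show ?thesis by simp
 qed
 have "gint (%x. cl_dot (P x) (cl_vec x \<odot> Q x)) = (\<Sum>i\<in>UNIV. gint (%x. x $ i *r cl_dot (P x) (cl_gen i \<odot> Q x)))"
  unfolding cl_vec_mult_sum cl_dot_sum cl_dot_scaleR
  by (intro gint_sum exp_bounded_bilinear[OF bounded_bilinear_scaleR exp_bounded_coord] d[OF P hpoly_mult[OF Q]])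
 also have "... = (\<Sum>i\<in>UNIV. gint (%x. cl_dot (P x) (cl_gen i \<odot> partial i Q x))) - (\<Sum>i\<in>UNIV. gint (%x. cl_dot (cl_gen i \<odot> partial i P x) (Q x)))"
  unfolding i sum_subtractf ..
 also have "(\<Sum>i\<in>UNIV. gint (%x. cl_dot (P x) (cl_gen i \<odot> partial i Q x))) = gint (%x. cl_dot (P x) (dirac Q x))"
  unfolding dirac_def cl_dot_sum by (rule gint_sum[symmetric], rule d[OF P hpoly_mult[OF hpoly_partial[OF Q]]])
 also have "(\<Sum>i\<in>UNIV. gint (%x. cl_dot (cl_gen i \<odot> partial i P x) (Q x))) = gint (%x. cl_dot (dirac P x) (Q x))"
  unfolding dirac_def cl_dot_sum by (rule gint_sum[symmetric], rule d[OF hpoly_mult[OF hpoly_partial[OF P]] Q])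
 finally show ?thesis .
qed

lemma continuous_dot: "hpoly k P ==> hpoly l Q ==> continuous_on S (%x. cl_dot (P x) (Q x))"
 by (intro bounded_bilinear.continuous_on[OF bounded_bilinear_cl_dot] hpoly_continuous)

lemma dot_scale_arg:
 "hpoly k P ==> hpoly l Q ==> cl_dot (P (t *r x)) (Q (t *r x)) = t ^ (k + l) *r cl_dot (P x) (Q x)"
 by (simp add: hpoly_scale_arg cl_dot_scaleR power_add)

lemma gint_dot_polar:
 fixes P Q :: "'n::{finite,linorder} clfun"
 assumes P: "hpoly k P" and Q: "hpoly l Q"
 shows "gint (%x. cl_dot (P x) (Q x)) = rad_gauss CARD('n) (k + l) *r sint (%x. cl_dot (P x) (Q x))"
 by (rule gint_polar[OF continuous_dot[OF P Q] dot_scale_arg[OF P Q]])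

lemma rad_gauss_add_2: "m > 0 ==> rad_gauss m (k + 2) = (real m + real k) * rad_gauss m k"
proof -
 assume m: "m > 0"
 have e: "(real m + real (k + 2)) / 2 = (real m + real k) / 2 + 1" by (simp add: field_simps)
 have "Gamma ((real m + real k) / 2 + 1) = (real m + real k) / 2 * Gamma ((real m + real k) / 2)"
  using m by (intro Gamma_plus1) (auto dest!: nonpos_Ints_nonpos)
 then show ?thesis unfolding rad_gauss_eq[OF m] e by (simp add: powr_add)
qed

lemma gint_normsq_dot:
 fixes P Q :: "'n::{finite,linorder} clfun"
 assumes P: "hpoly k P" and Q: "hpoly l Q"
 shows "gint (%x. nsq x *r cl_dot (P x) (Q x)) = (real CARD('n) + real (k + l)) *r gint (%x. cl_dot (P x) (Q x))"
proof -
 have c: "continuous_on UNIV (%x. nsq x *r cl_dot (P x) (Q x))"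
  by (intro continuous_intros continuous_dot[OF P Q])
 have "gint (%x. nsq x *r cl_dot (P x) (Q x)) = rad_gauss CARD('n) (k + l + 2) *r sint (%x. nsq x *r cl_dot (P x) (Q x))"
  by (rule gint_polar[OF c]) (simp add: dot_scale_arg[OF P Q] power_add power2_eq_square power_mult_distrib mult_ac)
 also have "sint (%x. nsq x *r cl_dot (P x) (Q x)) = sint (%x. cl_dot (P x) (Q x))"
  by (rule sint_cong) (auto intro!: borel_measurable_continuous_onI c continuous_dot[OF P Q])
 finally show ?thesis unfolding gint_dot_polar[OF P Q] rad_gauss_add_2[OF zero_less_card_finite] by simp
qed

lemma sint_zero_of_gint:
 fixes P Q :: "'n::{finite,linorder} clfun"
 assumes "hpoly k P" "hpoly l Q" "gint (%x. cl_dot (P x) (Q x)) = 0"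
 shows "sint (%x. cl_dot (P x) (Q x)) = 0"
 using assms(3) rad_gauss_pos[of "CARD('n)" "k + l"] unfolding gint_dot_polar[OF assms(1,2)] by simp

text \<open>In the adjoint formula both Dirac images vanish.\<close>

lemma sint_monogenic_vec_orthogonal:
 assumes M: "monogenic l M" and N: "monogenic l' N"
 shows "sint (%x. cl_dot (M x) (cl_vec x \<odot> N x)) = 0"
proof (rule sint_zero_of_gint)
 have h: "hpoly l M" "hpoly l' N" and d: "!!x. dirac M x = 0" "!!x. dirac N x = 0" using M N by (auto simp: monogenic_def)
 show "hpoly l M" "hpoly (Suc l') (%x. cl_vec x \<odot> N x)" using h by (auto simp: hpoly_vec)
 show "gint (%x. cl_dot (M x) (cl_vec x \<odot> N x)) = 0"
  unfolding gint_dirac_adjoint[OF h] d cl_dot_zero by simp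
qed

text \<open>The Gaussian integral of |x|^2 <M,N> is computed twice: homogeneity gives the factor m +
  l + l', and the adjoint formula gives m + 2 l'.\<close>

lemma sint_monogenic_orthogonal:
 fixes M N :: "'n::{finite,linorder} clfun"
 assumes M: "monogenic l M" and N: "monogenic l' N" and l: "l ~= l'"
 shows "sint (%x. cl_dot (M x) (N x)) = 0"
proof (rule sint_zero_of_gint)
 have h: "hpoly l M" "hpoly l' N" and d: "!!x. dirac M x = 0" using M N by (auto simp: monogenic_def)
 show "hpoly l M" "hpoly l' N" by (fact h)+
 let ?G = "gint (%x. cl_dot (M x) (N x))"
 have "gint (%x. cl_dot (M x) (cl_vec x \<odot> (cl_vec x \<odot> N x))) = gint (%x. (- (real CARD('n) + 2 * real l')) *r cl_dot (M x) (N x))"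
  unfolding gint_dirac_adjoint[OF h(1) hpoly_vec[OF h(2)]] monogenic_dirac_vec[OF N] d cl_dot_zero cl_dot_scaleR by (simp add: gint_def)
 also have "... = (- (real CARD('n) + 2 * real l')) *r ?G"
  by (rule gint_scaleR[OF exp_bounded_dot[OF h]])
 finally have "- gint (%x. nsq x *r cl_dot (M x) (N x)) = (- (real CARD('n) + 2 * real l')) *r ?G"
  unfolding cl_vec_square cl_dot_minus cl_dot_scaleR by (simp add: gint_def)
 then have "((real CARD('n) + real (l + l')) - (real CARD('n) + 2 * real l')) *r ?G = 0"
  unfolding gint_normsq_dot[OF h] by (simp only: scaleR_diff_left scaleR_minus_left neg_equal_iff_equal diff_self)
 then show "?G = 0" using l by simp
qed

text \<open>\<open>sphere_inner\<close> does not conjugate coefficients; it agrees with the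
  Hermitian form because \<open>M\<close> is real valued.\<close>

lemma sphere_inner_eq:
 fixes M N :: "'n::{finite,linorder} clfun"
 assumes M: "hpoly k M" "range M \<subseteq> cl_real" and N: "hpoly l N"
 shows "sphere_inner M N = sint (%x. cl_dot (M x) (N x))"
proof -
 have r: "cl_cnj (M x) = M x" for x using M(2) cl_real_iff by blast
 have c: "continuous_on UNIV (%x. cl_bar (cl_cnj (M x)) \<odot> N x)"
  by (intro bounded_bilinear.continuous_on[OF bounded_bilinear_bar_cnj_mult] hpoly_continuous[OF M(1)] hpoly_continuous[OF N])
 have "sphere_inner M N = cl_scalar_part (sint (%x. cl_bar (cl_cnj (M x)) \<odot> N x))"
  by (simp add: sphere_inner_def r)
 also have "... = sint (%x. cl_scalar_part (cl_bar (cl_cnj (M x)) \<odot> N x))"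
  by (rule integral_bounded_linear[OF bounded_linear_scalar_part sphere_integrable[OF c], symmetric])
 finally show ?thesis by (simp add: cl_scalar_part_bar_mult cl_dot_def)
qed

lemma sint_vec_dot:
 fixes M N :: "'n::{finite,linorder} clfun"
 assumes M: "hpoly k M" and N: "hpoly l N"
 shows "sint (%x. cl_dot (cl_vec x \<odot> M x) (cl_vec x \<odot> N x)) = sint (%x. cl_dot (M x) (N x))"
 by (rule sint_cong[OF _ borel_measurable_continuous_onI[OF continuous_dot[OF hpoly_vec[OF M] hpoly_vec[OF N]]]
   borel_measurable_continuous_onI[OF continuous_dot[OF M N]]])
  (simp add: cl_dot_vec cl_vec_square cl_dot_minus)

lemma sint_phi_angular:
 fixes M :: "nat => nat => 'n::{finite,linorder} clfun"
 assumes B: "orthonormal_bases d M" and j: "j < d l" "j' < d l'"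
 shows "sint (%x. cl_dot (phi_angular n (M l j) x) (phi_angular n' (M l' j') x)) = (if even n = even n' \<and> l = l' \<and> j = j' then 1 else 0)"
proof -
 have M: "M l j \<in> monogenics l" "M l' j' \<in> monogenics l'" using B j by (auto simp: orthonormal_bases_def)
 then have mono: "monogenic l (M l j)" "monogenic l' (M l' j')" by (auto intro: monogenics_monogenic)
 have h: "hpoly l (M l j)" "hpoly l' (M l' j')" using mono by (auto simp: monogenic_def)
 have eq: "sint (%x. cl_dot (M l j x) (M l' j' x)) = (if l = l' \<and> j = j' then 1 else 0)"
 proof (cases "l = l'")
  case True
  have "sphere_inner (M l j) (M l j') = (if j = j' then 1 else 0)"
   using B j True by (simp add: orthonormal_bases_def)
  moreover have "range (M l j) \<subseteq> cl_real" using M(1) by (simp add: monogenics_iff)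
  ultimately show ?thesis using True sphere_inner_eq[OF h(1) _ h(2)] by metis
 qed (simp add: sint_monogenic_orthogonal[OF mono])
 have vz: "sint (%x. cl_dot (cl_vec x \<odot> M l j x) (M l' j' x)) = 0"
  unfolding cl_dot_vec using sint_monogenic_vec_orthogonal[OF mono] by simp
 show ?thesis
  by (cases "even n"; cases "even n'") (simp_all add: phi_angular_def eq vz sint_monogenic_vec_orthogonal[OF mono] sint_vec_dot[OF h])
qed

section \<open>Radial orthogonality and the inner products of the basis functions\<close>

lemma integrable_powr_laguerre:
 assumes e: "e > -1"
 shows "integrable lborel (%u. indicator {0<..} u * (u powr e * laguerre s av u * laguerre t \<beta> u * exp (- u)))"
proof -
 have "indicator {0<..} u * (u powr e * laguerre s av u * laguerre t \<beta> u * exp (- u))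
   = (\<Sum>i\<le>s. \<Sum>j\<le>t. (laguerre_coeff s av i * laguerre_coeff t \<beta> j) * (indicator {0<..} u * (u powr (e + real i + real j) * exp (- 1 * u))))" for u :: real
 proof (cases "u > 0")
  case True
  then have "u powr (e + real i + real j) = u powr e * u ^ i * u ^ j" for i j by (simp add: powr_add powr_realpow)
  then show ?thesis by (simp add: laguerre_eq sum_distrib_left sum_distrib_right mult_ac)
 qed simp
 then show ?thesis
  by (simp only:) (intro Bochner_Integration.integrable_sum integrable_mult_right integrable_powr_exp, use e in auto)
qed

text \<open>The polynomial of smaller degree is expanded: by \<open>laguerre_moment\<close> only a
  power of degree at least t has a nonzero moment, and s \<le> t leaves at most i = t.\<close>

lemma laguerre_orthogonal_aux:
 assumes av: "av > -1" and st: "s <= t"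
 shows "(LINT u|lborel. indicator {0<..} u * (u powr av * laguerre s av u * laguerre t av u * exp (- u)))
   = (if s = t then Gamma (av + real t + 1) / fact t else 0)"
proof -
 have "indicator {0<..} u * (u powr av * laguerre s av u * laguerre t av u * exp (- u))
   = (\<Sum>i\<le>s. laguerre_coeff s av i * (indicator {0<..} u * (u powr (av + real i) * laguerre t av u * exp (- u))))" for u :: real
 proof (cases "u > 0")
  case True
  then have "u powr (av + real i) = u powr av * u ^ i" for i by (simp add: powr_add powr_realpow)
  then show ?thesis by (simp add: laguerre_eq[of s] sum_distrib_left sum_distrib_right mult_ac)
 qed simp
 then have "(LINT u|lborel. indicator {0<..} u * (u powr av * laguerre s av u * laguerre t av u * exp (- u)))
   = (\<Sum>i\<le>s. laguerre_coeff s av i * (Gamma (av + real i + 1) * (-1) ^ t * real (i choose t)))"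
  by (simp add: laguerre_moment[OF av])
 also have "... = (\<Sum>i\<in>(if s = t then {t} else {}). laguerre_coeff s av i * (Gamma (av + real i + 1) * (-1) ^ t * real (i choose t)))"
  using st by (intro sum.mono_neutral_right) (auto simp: binomial_eq_0_iff split: if_splits)
 also have "... = (if s = t then Gamma (av + real t + 1) / fact t else 0)"
  by (simp add: laguerre_coeff_def power_add[symmetric] mult_ac)
 finally show ?thesis .
qed

lemma laguerre_orthogonal:
 assumes av: "av > -1"
 shows "(LINT u|lborel. indicator {0<..} u * (u powr av * laguerre s av u * laguerre t av u * exp (- u)))
   = (if s = t then Gamma (av + real t + 1) / fact t else 0)"
proof (cases "s <= t")
 case False
 then show ?thesis using laguerre_orthogonal_aux[OF av, of t s] by (simp add: mult_ac)
qed (rule laguerre_orthogonal_aux[OF av])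

text \<open>In both parities the Laguerre index is fixed by the total homogeneity beta + k of the
  angular factor. Equal angular types therefore meet exactly their Laguerre weight.\<close>

lemma phi_index_eq:
 assumes c: "c > -1" and k: "k = real l + real (n mod 2)"
 shows "phi_index (gam m c (real l)) n = delta m c / 2 - 1 + (beta c (real l) + k)"
proof -
 have "gam m c (real l) / 2 = beta c (real l) + real l + delta m c / 2" using gam_half[OF c] beta_plus[OF c, of "real l"] by simp
 then show ?thesis using k by (cases "even n") (auto simp: phi_index_def odd_iff_mod_2_eq_one even_iff_mod_2_eq_zero)
qed

lemma phi_inner:
 fixes M :: "nat => nat => 'n::{finite,linorder} clfun"
 assumes c: "c > -1" and m: "CARD('n) \<ge> 2" and B: "orthonormal_bases d M" and j: "j < d l" "j' < d l'"
 shows "\<exists>N > 0. l2_inner c (phi c M n l j) (phi c M n' l' j') = (if n = n' \<and> l = l' \<and> j = j' then complex_of_real N else 0)"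
proof -
 define k where "k = l + n mod 2"
 define k' where "k' = l' + n' mod 2"
 define A where "A = phi_angular n (M l j)"
 define A' where "A' = phi_angular n' (M l' j')"
 define av where "av = phi_index (gam CARD('n) c (real l)) n"
 define av' where "av' = phi_index (gam CARD('n) c (real l')) n'"
 define b where "b = beta c (real l)"
 define b' where "b' = beta c (real l')"
 define kp where "kp = phi_coeff c n * phi_coeff c n'"
 define t where "t = n div 2"
 define t' where "t' = n' div 2"
 let ?d = "delta CARD('n) c"
 \<comment> \<open>Each factor contributes half of its homogeneity. For equal angular types
   \<open>e\<close> is the common Laguerre index; otherwise the integral over the sphere is
   0.\<close>
 define e where "e = ?d / 2 - 1 + (b + real k) / 2 + (b' + real k') / 2"
 have hM: "hpoly l (M l j)" "hpoly l' (M l' j')" using B j by (auto simp: orthonormal_bases_def monogenics_iff)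
 have h: "hpoly k A" "hpoly k' A'" unfolding k_def A_def k'_def A'_def by (intro phi_angular_hpoly hM)+
 have d: "?d > 0" by (rule delta_pos[OF c m])
 have bl: "b + real l \<ge> 0" "b' + real l' \<ge> 0" unfolding b_def b'_def using c by (simp_all add: beta_plus)
 then have e1: "e > -1" using d
 proof -
  have "b + real k \<ge> 0" "b' + real k' \<ge> 0" using bl by (simp_all add: k_def k'_def)
  then show ?thesis using d unfolding e_def by argo
 qed
 have av: "av = ?d / 2 - 1 + (b + real k)" "av' = ?d / 2 - 1 + (b' + real k')"
  unfolding av_def av'_def b_def b'_def by (rule phi_index_eq[OF c]; simp add: k_def k'_def)+
 then have av1: "av > -1" using d bl by (simp add: k_def)
 define F where "F u = u powr ((?d - real CARD('n) + b + b' + real k + real k') / 2) * (kp * (lag_exp t av u * lag_exp t' av' u))" for u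
 have [measurable]: "lag_exp s a \<in> borel_measurable borel" for s a unfolding lag_exp_def[abs_def] by measurable
 have Fm [measurable]: "F \<in> borel_measurable borel" unfolding F_def[abs_def] by measurable
 have dens: "(indicator {0<..} u * (u powr (real CARD('n) / 2 - 1) / 2)) *r F u
   = kp / 2 * (indicator {0<..} u * (u powr e * laguerre t av u * laguerre t' av' u * exp (- u)))" for u :: real
 proof (cases "u > 0")
  case True
  have "exp (- u / 2) * exp (- u / 2) = exp (- u)" by (simp add: exp_add[symmetric])
  moreover have "u powr e = u powr (real CARD('n) / 2 - 1) * u powr ((?d - real CARD('n) + b + b' + real k + real k') / 2)"
   unfolding e_def powr_add[symmetric] by (rule arg_cong) (simp add: field_simps)
  ultimately show ?thesis using True by (simp add: F_def lag_exp_def)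
 qed simp
 have Fi: "integrable (radial CARD('n)) F"
  unfolding integrable_radial_iff[OF Fm] dens by (intro integrable_mult_right integrable_powr_laguerre e1)
 have Fv: "integral\<^sup>L (radial CARD('n)) F = kp / 2 * (LINT u|lborel. indicator {0<..} u * (u powr e * laguerre t av u * laguerre t' av' u * exp (- u)))"
  unfolding integral_radial[OF Fm] dens by simp
 have [measurable]: "A \<in> borel_measurable borel" "A' \<in> borel_measurable borel" using h by (auto intro: hpoly_measurable)
 have L: "phi c M n l j \<in> L2 c" "phi c M n' l' j' \<in> L2 c" by (intro phi_L2[OF c m] hM)+
 have [measurable]: "phi c M n l j \<in> borel_measurable borel" "phi c M n' l' j' \<in> borel_measurable borel"
  using L by (auto intro: L2_measurable)
 have pt: "weight CARD('n) c (norm x) *r cl_dot (phi c M n l j x) (phi c M n' l' j' x) = F (nsq x) *r cl_dot (A (sgn x)) (A' (sgn x))" if x: "x ~= 0" for x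
 proof -
  have xs: "x = norm x *r sgn x" using x by (simp add: sgn_div_norm)
  have Ax: "cl_dot (A x) (A' x) = norm x ^ (k + k') *r cl_dot (A (sgn x)) (A' (sgn x))"
   by (subst xs, subst (3) xs) (rule dot_scale_arg[OF h])
  have F: "F (nsq x) = norm x powr (?d - real CARD('n)) * norm x powr b * norm x powr b' * norm x ^ (k + k') * kp
    * (lag_exp t av (nsq x) * lag_exp t' av' (nsq x))"
   unfolding F_def norm_square_powr using x by (simp add: powr_add powr_realpow power_add)
  show ?thesis
   unfolding phi_eq norm_square_powr cl_dot_scaleR A_def[symmetric] A'_def[symmetric] Ax weight_eq[OF c]
    av_def[symmetric] av'_def[symmetric] t_def[symmetric] t'_def[symmetric] b_def[symmetric] b'_def[symmetric] scaleR_scaleR F kp_def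
   by (rule arg_cong[where f = "%r. r *r _"]) (simp only: mult_ac)
 qed
 have "l2_inner c (phi c M n l j) (phi c M n' l' j') = (LINT x|lborel. weight CARD('n) c (norm x) *r cl_dot (phi c M n l j x) (phi c M n' l' j' x))"
  unfolding l2_inner_eq[OF L] by (rule integral_wmeasure) measurable
 also have "... = (LINT x|lborel. F (nsq x) *r cl_dot (A (sgn x)) (A' (sgn x)))"
  by (rule integral_cong_AE, measurable, rule eventually_mono[OF AE_lborel_singleton[of "0 :: 'n point"]], rule pt)
 also have "... = integral\<^sup>L (radial CARD('n)) F *r sint (%x. cl_dot (A x) (A' x))"
  by (rule polar_bilinear(2)[OF bounded_bilinear_scaleR Fi sphere_integrable[OF continuous_dot[OF h]]])
 finally have inner: "l2_inner c (phi c M n l j) (phi c M n' l' j') = (if even n = even n' \<and> l = l' \<and> j = j' then complex_of_real (integral\<^sup>L (radial CARD('n)) F) else 0)"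
  unfolding A_def A'_def sint_phi_angular[OF B j] by (simp add: scaleR_conv_of_real)
 show ?thesis
 proof (cases "even n = even n' \<and> l = l' \<and> j = j'")
  case True
  then have k: "k = k'" "b = b'" by (auto simp: k_def k'_def b_def b'_def even_iff_mod_2_eq_zero)
  then have "e = av" "av' = av" unfolding av e_def by simp_all
  then have F: "integral\<^sup>L (radial CARD('n)) F = kp / 2 * (if t = t' then Gamma (av + real t' + 1) / fact t' else 0)"
   unfolding Fv using laguerre_orthogonal[OF av1, of t t'] by simp
  have tn: "t = t' \<longleftrightarrow> n = n'"
   using True unfolding t_def t'_def by (metis even_two_times_div_two odd_two_times_div_two_succ)
  have G: "Gamma (av + real t' + 1) > 0" using av1 by (intro Gamma_real_pos) simp
  have p: "phi_coeff c n ~= 0" using c by (simp add: phi_coeff_def)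
  show ?thesis
  proof (cases "n = n'")
   case eq: True
   have "kp / 2 * (Gamma (av + real t' + 1) / fact t') > 0"
   proof -
    have "kp > 0" using p unfolding kp_def eq[symmetric] power2_eq_square[symmetric] by simp
    then show ?thesis using G by simp
   qed
   then show ?thesis using True eq tn inner F by (intro exI[of _ "kp / 2 * (Gamma (av + real t' + 1) / fact t')"]) simp
  next
   case False
   then show ?thesis using tn inner F True by (intro exI[of _ 1]) simp
  qed
 next
  case False
  then show ?thesis using inner by (intro exI[of _ 1]) auto
 qed
qed

lemma l2_inner_cong:
 assumes "f \<in> L2 c" "g \<in> L2 c" "g' \<in> L2 c" "l2_eq c g g'"
 shows "l2_inner c f g = l2_inner c f g'"
proof -
 have [measurable]: "f \<in> borel_measurable borel" "g \<in> borel_measurable borel" "g' \<in> borel_measurable borel"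
  using assms by (auto intro: L2_measurable)
 have "AE x in wmeasure c. cl_dot (f x) (g x) = cl_dot (f x) (g' x)"
  using assms(4) unfolding l2_eq_def by eventually_elim simp
 then show ?thesis unfolding l2_inner_eq[OF assms(1,2)] l2_inner_eq[OF assms(1,3)] by (rule integral_cong_AE[rotated 2]) measurable
qed

text \<open>Codes the labels (n, l, j) by natural numbers, the index type of
  \<open>l2_basis\<close>.\<close>

definition triple :: "nat => nat \<times> nat \<times> nat" where
 "triple i = (fst (prod_decode i), prod_decode (snd (prod_decode i)))"

definition untriple :: "nat \<times> nat \<times> nat => nat" where
 "untriple p = prod_encode (fst p, prod_encode (snd p))"

lemma triple_untriple [simp]: "triple (untriple p) = p" and untriple_triple [simp]: "untriple (triple i) = i"
 by (simp_all add: triple_def untriple_def)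

lemma phi_functional_calculus:
 fixes M :: "nat => nat => 'n::{finite,linorder} clfun"
 assumes c: "c > -1" and m: "CARD('n) \<ge> 2" and B: "orthonormal_bases d M" and j: "j < d l" and \<psi>: "\<psi> \<in> borel_measurable borel"
 shows "(phi c M n l j, %x. \<psi> ((1 + c)\<^sup>2 * (2 * real n + gam CARD('n) c (real l))) *s phi c M n l j x)
   \<in> functional_calculus c (graph_closure c (oscillator_graph c d M)) \<psi>"
proof -
 define \<Phi> where "\<Phi> = (%(n, l, j). phi c M n l j)"
 define \<mu> where "\<mu> = (%(n, l :: nat, j :: nat). (1 + c)\<^sup>2 * (2 * real n + gam CARD('n) c (real l)))"
 define I where "I = {(n :: nat, l, j). j < d l}"
 define \<nu> where "\<nu> p = (if p \<in> I then complex_of_real (1 / l2_norm c (\<Phi> p)) else 0)" for p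
 define e where "e i x = \<nu> (triple i) *s (if triple i \<in> I then \<Phi> (triple i) x else 0)" for i x
 have hM: "hpoly l (M l j)" if "j < d l" for l j using B that by (auto simp: orthonormal_bases_def monogenics_iff)
 have mono: "monogenic l (M l j)" if "j < d l" for l j using B that by (auto simp: orthonormal_bases_def intro: monogenics_monogenic)
 have L: "\<Phi> p \<in> L2 c" if "p \<in> I" for p
  using that phi_L2[where M = M, OF c m hM] by (auto simp: \<Phi>_def I_def)
 have inner: "\<exists>N>0. l2_inner c (\<Phi> p) (\<Phi> q) = (if p = q then complex_of_real N else 0)" if p: "p \<in> I" and q: "q \<in> I" for p q
  using that phi_inner[where M = M, OF c m B, of "snd (snd p)" "fst (snd p)" "snd (snd q)" "fst (snd q)" "fst p" "fst q"]
  by (auto simp: \<Phi>_def I_def prod_eq_iff case_prod_unfold)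
 have self: "l2_inner c (\<Phi> p) (\<Phi> p) = complex_of_real ((l2_norm c (\<Phi> p))\<^sup>2)" "l2_norm c (\<Phi> p) > 0" if p: "p \<in> I" for p
 proof -
  show 1: "l2_inner c (\<Phi> p) (\<Phi> p) = complex_of_real ((l2_norm c (\<Phi> p))\<^sup>2)" by (rule l2_inner_self_norm[OF L[OF p]])
  obtain N where "N > 0" "l2_inner c (\<Phi> p) (\<Phi> p) = complex_of_real N" using inner[OF p p] by auto
  then have "(l2_norm c (\<Phi> p))\<^sup>2 > 0" using 1 by (simp only: of_real_eq_iff)
  then show "l2_norm c (\<Phi> p) > 0" using l2_norm_nonneg[OF L[OF p]] by (simp add: less_le)
 qed
 have eL: "e i \<in> L2 c" for i
  unfolding e_def[abs_def] using L by (cases "triple i \<in> I") (simp_all add: L2_smult L2_zero)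
 have einner: "l2_inner c f (e i) = (if triple i \<in> I then \<nu> (triple i) * l2_inner c f (\<Phi> (triple i)) else 0)" if f: "f \<in> L2 c" for f i
 proof (cases "triple i \<in> I")
  case True
  then show ?thesis unfolding e_def[abs_def] using l2_inner_smult_right[OF f L[OF True]] by simp
 next
  case False
  then have "e i = (%x. 0 *s 0)" by (simp add: e_def[abs_def])
  then show ?thesis using False l2_inner_smult_right[OF f L2_zero, of 0] by simp
 qed
 have e\<Phi>: "l2_inner c (e i) (\<Phi> p) = (if triple i = p then complex_of_real (l2_norm c (\<Phi> p)) else 0)" if p: "p \<in> I" for i p
 proof -
  have "l2_inner c (e i) (\<Phi> p) = cnj (l2_inner c (\<Phi> p) (e i))" by (rule l2_inner_cnj[OF L[OF p] eL, symmetric])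
  also have "... = (if triple i = p then complex_of_real (l2_norm c (\<Phi> p)) else 0)"
  proof (cases "triple i \<in> I")
   case True
   then show ?thesis
    unfolding einner[OF L[OF p]] using inner[OF p True] self[OF p] p
    by (auto simp: \<nu>_def power2_eq_square)
  next
   case False
   then show ?thesis using p unfolding einner[OF L[OF p]] by auto
  qed
  finally show ?thesis .
 qed
 interpret l2_eigenbasis c e "%i. triple i \<in> I" "%i. \<mu> (triple i)"
 proof unfold_locales
  show "e i \<in> L2 c" for i by (rule eL)
  show "l2_inner c (e i) (e k) = (if i = k \<and> triple i \<in> I then 1 else 0)" for i k
  proof (cases "triple k \<in> I")
   case True
   have "triple i = triple k \<longleftrightarrow> i = k" by (metis untriple_triple)
   then show ?thesis using True self(2)[OF True] by (auto simp: einner[OF eL] e\<Phi> \<nu>_def)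
  qed (auto simp: einner[OF eL])
  fix f :: "'n clfun" assume f: "f \<in> L2 c" and z: "!!i. l2_inner c (e i) f = 0"
  show "l2_norm c f = 0"
  proof (rule phi_complete[OF c m B f])
   fix n l j assume "j < d l"
   then have p: "(n, l, j) \<in> I" by (simp add: I_def)
   have "0 = l2_inner c f (e (untriple (n, l, j)))"
    using z[of "untriple (n, l, j)"] l2_inner_cnj[OF eL f, of "untriple (n, l, j)"] by simp
   then show "l2_inner c f (phi c M n l j) = 0"
    using p self(2)[OF p] unfolding einner[OF f] by (auto simp: \<nu>_def \<Phi>_def)
  qed
 qed
 have osc: "oscillator c (%x. \<Sum>p\<in>J. a p *s \<Phi> p x) x = (\<Sum>p\<in>J. (of_real (\<mu> p) * a p) *s \<Phi> p x)"
  if J: "J \<subseteq> I" and x: "x ~= 0" for J a x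
  using oscillator_phi_sum[where M = M and I = J and a = a, OF mono c x] J
  by (auto simp: I_def \<Phi>_def \<mu>_def case_prod_unfold subset_iff)
 have nz: "AE x in wmeasure c. x ~= (0 :: 'n point)"
  by (rule AE_wmeasure) (use AE_lborel_singleton[of "0 :: 'n point"] in \<open>auto elim: eventually_mono\<close>)
 have osc_eq: "l2_eq c (%x. \<Sum>p\<in>J. (of_real (\<mu> p) * a p) *s \<Phi> p x) (oscillator c (%x. \<Sum>p\<in>J. a p *s \<Phi> p x))"
  if J: "J \<subseteq> I" for J a
  unfolding l2_eq_def using nz by eventually_elim (simp add: osc[OF J])
 have SL: "(%x. \<Sum>p\<in>J. a p *s \<Phi> p x) \<in> L2 c" if "J \<subseteq> I" for J a
  by (intro L2_sum L2_smult L) (use that in auto)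
 have coS: "co (%x. \<Sum>p\<in>J. a p *s \<Phi> p x) i = (if triple i \<in> J then a (triple i) * complex_of_real (l2_norm c (\<Phi> (triple i))) else 0)"
  if J: "J \<subseteq> I" "finite J" for J a i
 proof -
  have "co (%x. \<Sum>p\<in>J. a p *s \<Phi> p x) i = (\<Sum>p\<in>J. a p * co (\<Phi> p) i)"
   using J L by (subst l2_inner_sum_right[OF eL]) (auto intro!: L2_smult sum.cong l2_inner_smult_right eL)
  also have "... = (\<Sum>p\<in>J. if triple i = p then a p * complex_of_real (l2_norm c (\<Phi> p)) else 0)"
   using J by (intro sum.cong refl) (auto simp: e\<Phi> subset_iff)
  finally show ?thesis using J by simp
 qed
 \<comment> \<open>Members of the graph agree with a finite combination and its oscillator image
   only almost everywhere, so the comparison is made on coefficients.\<close>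
 have sub: "oscillator_graph c d M \<subseteq> mult_graph"
 proof
  fix p assume "p \<in> oscillator_graph c d M"
  then obtain f g u where p: "p = (f, g)" and f: "f \<in> L2 c" and g: "g \<in> L2 c" and u: "u \<in> phi_span c d M"
   and fu: "l2_eq c f u" and gu: "l2_eq c g (oscillator c u)"
   unfolding oscillator_graph_def by blast
  obtain J a where J: "finite J" "J \<subseteq> I" and ua: "u = (%x. \<Sum>p\<in>J. a p *s \<Phi> p x)"
   using u unfolding phi_span_def I_def \<Phi>_def by (auto simp: case_prod_unfold)
  have gu': "l2_eq c g (%x. \<Sum>p\<in>J. (of_real (\<mu> p) * a p) *s \<Phi> p x)"
   using gu osc_eq[OF J(2), of a] unfolding ua l2_eq_def by eventually_elim simp
  have "co g i = of_real (\<mu> (triple i)) * co f i" for i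
   unfolding l2_inner_cong[OF eL g SL[OF J(2)] gu'] l2_inner_cong[OF eL f SL[OF J(2)] fu[unfolded ua]] coS[OF J(2,1)] by simp
  then show "p \<in> mult_graph" using f g by (simp add: p mult_graph_def)
 qed
 have psum: "psum n a = (%x. \<Sum>p\<in>{p \<in> I. untriple p < n}. (a (untriple p) * \<nu> p) *s \<Phi> p x)" for n a
 proof
  fix x
  have "psum n a x = (\<Sum>i\<in>{i. i < n \<and> triple i \<in> I}. a i *s e i x)"
   unfolding psum_def by (rule sum.mono_neutral_right) (auto simp: e_def)
  also have "... = (\<Sum>p\<in>{p \<in> I. untriple p < n}. (a (untriple p) * \<nu> p) *s \<Phi> p x)"
   by (rule sum.reindex_bij_witness[of _ untriple triple]) (auto simp: e_def vector_smult_assoc)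
  finally show "psum n a x = (\<Sum>p\<in>{p \<in> I. untriple p < n}. (a (untriple p) * \<nu> p) *s \<Phi> p x)" .
 qed
 have fin: "finite {p \<in> I. untriple p < n}" for n
 proof (rule finite_subset)
  show "{p \<in> I. untriple p < n} \<subseteq> triple ` {..<n}" by (auto intro!: image_eqI[of _ triple "untriple _"])
 qed simp
 have graph: "(psum n a, psum n (%i. of_real (\<mu> (triple i)) * a i)) \<in> oscillator_graph c d M" for n a
 proof -
  let ?J = "{p \<in> I. untriple p < n}"
  have "psum n a \<in> phi_span c d M"
   unfolding psum phi_span_def mem_Collect_eq
   by (intro exI[of _ ?J] exI[of _ "%p. a (untriple p) * \<nu> p"] conjI fin) (auto simp: I_def \<Phi>_def case_prod_unfold)
  moreover have "l2_eq c (psum n (%i. of_real (\<mu> (triple i)) * a i)) (oscillator c (psum n a))"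
   using osc_eq[of ?J "%p. a (untriple p) * \<nu> p"] unfolding psum by (simp add: mult.assoc)
  ultimately show ?thesis
   unfolding oscillator_graph_def using psum_L2 by (auto simp: l2_eq_def)
 qed
 have p: "(n, l, j) \<in> I" using j by (simp add: I_def)
 have "(\<Phi> (n, l, j), %x. \<psi> (\<mu> (n, l, j)) *s \<Phi> (n, l, j) x) \<in> functional_calculus c (graph_closure c (oscillator_graph c d M)) \<psi>"
  by (rule functional_calculus_eigen[OF sub graph L[OF p] _ \<psi>]) (simp add: e\<Phi>[OF p] split: if_splits)
 then show ?thesis by (simp add: \<Phi>_def \<mu>_def)
qed

section \<open>The kernel transform\<close>

lemma borel_measurable_bilinear:
 fixes f :: "'a => 'b::{second_countable_topology, real_normed_vector}" and g :: "'a => 'c::{second_countable_topology, real_normed_vector}"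
  and B :: "'b => 'c => 'd::real_normed_vector"
 assumes "bounded_bilinear B" "f \<in> borel_measurable M" "g \<in> borel_measurable M"
 shows "(%x. B (f x) (g x)) \<in> borel_measurable M"
 by (rule borel_measurable_continuous_Pair[OF assms(2,3), where H = B])
  (intro bounded_bilinear.continuous_on[OF assms(1)] continuous_intros)

lemma bessel_Jt_measurable [measurable]: "bessel_Jt \<nu> \<in> borel_measurable borel"
 unfolding bessel_Jt_def[abs_def] by measurable

lemma mode_measurable [measurable]: "mode_p m c om k \<in> borel_measurable borel" "mode_m m c om k \<in> borel_measurable borel"
 unfolding mode_p_def[abs_def] mode_m_def[abs_def] by measurable

lemma gegen_measurable [measurable]:
 "gegen_a k kp \<in> borel_measurable borel" "gegen_b k kp \<in> borel_measurable borel" "gegenbauer k kp \<in> borel_measurable borel"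
proof -
 have [measurable]: "gegen_quot k kp \<in> borel_measurable borel" unfolding gegen_quot_def[abs_def] by measurable
 show "gegenbauer k kp \<in> borel_measurable borel" unfolding gegenbauer_def[abs_def] by measurable
 have "gegen_a k kp \<in> borel_measurable borel \<and> gegen_b k kp \<in> borel_measurable borel"
 proof (cases "k = 0")
  case True
  then have "gegen_a k kp = (%_. 1)" "gegen_b k kp = (%_. 0)" by (auto simp: gegen_a_0 gegen_b_0)
  then show ?thesis by simp
 next
  case False
  then have "gegen_a k kp = (%w. (real k + 2 * kp) / 2 * gegen_quot k kp w)" "gegen_b k kp = (%w. real k * gegen_quot k kp w)"
   by (auto simp: gegen_a_eq gegen_b_eq)
  then show ?thesis by simp
 qed
 then show "gegen_a k kp \<in> borel_measurable borel" "gegen_b k kp \<in> borel_measurable borel" by auto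
qed

lemma kernel_measurable: "(%x. kernel c om x y) \<in> borel_measurable borel"
proof -
 have [measurable]: "(%x :: 'a point. A_term m c om (norm x * norm y) ((x \<bullet> y) / (norm x * norm y)) k) \<in> borel_measurable borel" for m k
  unfolding A_term_modes by measurable
 have [measurable]: "(%x :: 'a point. B_term m c om (norm x * norm y) ((x \<bullet> y) / (norm x * norm y)) k) \<in> borel_measurable borel" for m k
  unfolding B_term_def by measurable
 have [measurable]: "(%x. cl_wedge x y) \<in> borel_measurable borel"
  using borel_measurable_continuous_onI[OF continuous_wedge[of "%_. cl_one" y, OF continuous_on_const]] by simp
 show ?thesis
  unfolding kernel_def Let_def A_series_def B_series_def
  by (intro borel_measurable_bilinear[OF bounded_bilinear_smult] borel_measurable_add) measurable
qed

text \<open>The k-th term of both series together, without the Gaussian and applied to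
  \<open>a\<close>, regrouped by zonal functions.\<close>

definition kernel_term :: "real => complex => nat => 'n point => 'n point => 'n::{finite,linorder} cliff => 'n cliff" where
 "kernel_term c om k x y a = mode_p CARD('n) c om k (norm x * norm y) *s zonal_p k (sgn x) (sgn y) a
   + mode_m CARD('n) c om k (norm x * norm y) *s zonal_m k (sgn x) (sgn y) a"

text \<open>The wedge is bilinear, so passing from \<open>x\<close> and \<open>y\<close> to their
  directions costs the factor z, which \<open>B_term_modes\<close> supplies.\<close>

lemma kernel_term_eq:
 fixes x y :: "'n::{finite,linorder} point"
 assumes x: "x ~= 0" and y: "y ~= 0"
 defines "z \<equiv> norm x * norm y"
 defines "w \<equiv> (x \<bullet> y) / z"
 shows "kernel_term c om k x y a = A_term CARD('n) c om z w k *s a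
  + (if k = 0 then 0 else B_term CARD('n) c om z w k *s (cl_wedge x y \<odot> a))"
proof -
 let ?P = "mode_p CARD('n) c om k z" and ?Q = "mode_m CARD('n) c om k z" and ?W = "cl_wedge (sgn x) (sgn y) \<odot> a"
 have z: "z > 0" using x y by (simp add: z_def)
 have w: "sgn x \<bullet> sgn y = w" by (simp add: w_def z_def sgn_div_norm inverse_eq_divide)
 have xs: "x = norm x *r sgn x" "y = norm y *r sgn y" using x y by (simp_all add: sgn_div_norm)
 have "cl_wedge (r *r u) (s *r v) = (r * s) *r cl_wedge u v" for r s and u v :: "'n point"
  by (simp add: cl_wedge_eq cl_vec_scaleR cl_mult_scaleR_left cl_mult_scaleR_right scaleR_add_right mult_ac)
 from this[of "norm x" "sgn x" "norm y" "sgn y"] have W: "cl_wedge x y \<odot> a = z *r ?W"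
  unfolding xs[symmetric] by (simp add: cl_mult_scaleR_left z_def)
 have B: "B_term CARD('n) c om z w k *s (cl_wedge x y \<odot> a) = ((- ?P + ?Q) * of_real (gegenbauer (k - 1) (lam CARD('n) + 1) w)) *s ?W"
  unfolding W scaleR_eq_smult vector_smult_assoc B_term_modes[OF z, symmetric] by (simp only: mult.commute)
 have 1: "P *s (g *r a - h *r W) + Q *s (q *r a + h *r W) = (P * of_real g + Q * of_real q) *s a + ((- P + Q) * of_real h) *s W"
  for P Q g h q and W :: "'n cliff" by (simp add: scaleR_eq_smult vec_eq_iff algebra_simps)
 have 2: "P *s (g *r a - 0) + Q *s (q *r a + 0) = (P * of_real g + Q * of_real q) *s a + 0"
  for P Q g q by (simp add: scaleR_eq_smult vec_eq_iff algebra_simps)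
 show ?thesis
  unfolding kernel_term_def z_def[symmetric] zonal_p_def zonal_m_def w A_term_modes B
  by (cases "k = 0") (simp_all only: if_True if_False 1 2 refl)
qed

lemma norm_wedge_le: "norm (cl_wedge \<xi> \<eta> \<odot> a) <= 2 * norm \<xi> * norm \<eta> * norm a"
proof -
 have "norm (cl_wedge \<xi> \<eta> \<odot> a) <= norm (cl_vec \<eta> \<odot> (cl_vec \<xi> \<odot> a)) + norm ((\<xi> \<bullet> \<eta>) *r a)"
  unfolding cl_wedge_mult by (rule order_trans[OF norm_triangle_ineq4]) simp
 also have "... <= norm \<eta> * (norm \<xi> * norm a) + (norm \<xi> * norm \<eta>) * norm a"
  unfolding norm_cl_vec_mult norm_scaleR by (intro add_mono mult_right_mono Cauchy_Schwarz_ineq2) auto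
 finally show ?thesis by (simp add: mult_ac)
qed

lemma cosine_le_1: "\<bar>(x \<bullet> y) / (norm x * norm y)\<bar> <= 1"
 using Cauchy_Schwarz_ineq2[of x y] by (cases "norm x * norm y = 0") (auto simp: divide_le_eq_1 abs_mult)

text \<open>6 is 2 modes times 3, and 3 is 1 for the scalar part of a zonal function plus 2 for the
  wedge part. The B terms are kept with a factor z, which avoids a negative power of z.\<close>

lemma term_bounds:
 assumes om: "Re om > 0" and c: "c > -1" and m: "CARD('n) \<ge> 2"
 shows "\<exists>K D. K \<ge> 0 \<and> (\<forall>(x :: 'n::{finite,linorder} point) y k a. x ~= 0 --> y ~= 0 -->
   norm (A_term CARD('n) c om (norm x * norm y) ((x \<bullet> y) / (norm x * norm y)) k) <= K * exp (D * (norm x * norm y)) * (1 / 2) ^ k \<and>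
   norm (B_term CARD('n) c om (norm x * norm y) ((x \<bullet> y) / (norm x * norm y)) (Suc k)) * (norm x * norm y) <= K * exp (D * (norm x * norm y)) * (1 / 2) ^ k \<and>
   norm (kernel_term c om k x y a) <= K * exp (D * (norm x * norm y)) * (1 / 2) ^ k * norm a)"
proof -
 have "lam CARD('n) \<ge> 0" using m by (simp add: lam_def)
 then obtain G where G0: "G \<ge> 0" "\<forall>k w. \<bar>w\<bar> <= 1 --> \<bar>gegen_a k (lam CARD('n)) w\<bar> <= G * 32 ^ k \<and> \<bar>gegen_b k (lam CARD('n)) w\<bar> <= G * 32 ^ k
   \<and> (k > 0 --> \<bar>gegenbauer (k - 1) (lam CARD('n) + 1) w\<bar> <= G * 32 ^ k)"
  by (rule gegen_bounds[THEN exE]) (elim conjE, rule that)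
 then have G: "G \<ge> 0" "!!k w. \<bar>w\<bar> <= 1 ==> \<bar>gegen_a k (lam CARD('n)) w\<bar> <= G * 32 ^ k"
  "!!k w. \<bar>w\<bar> <= 1 ==> \<bar>gegen_b k (lam CARD('n)) w\<bar> <= G * 32 ^ k"
  "!!k w. \<bar>w\<bar> <= 1 ==> k > 0 ==> \<bar>gegenbauer (k - 1) (lam CARD('n) + 1) w\<bar> <= G * 32 ^ k"
  by simp_all
 obtain C D where C: "!!k z. z > 0 ==> 32 ^ k * norm (mode_p CARD('n) c om k z) <= C * exp (D * z) * (1 / 2) ^ k"
  "!!k z. z > 0 ==> 32 ^ k * norm (mode_m CARD('n) c om k z) <= C * exp (D * z) * (1 / 2) ^ k"
  using mode_bounds[OF om c m] by blast
 have C0: "C \<ge> 0"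
 proof -
  have "0 <= C * exp D" using order_trans[OF norm_ge_zero, of "mode_p CARD('n) c om 0 1"] C(1)[of 1 0] by simp
  then show ?thesis by (simp add: zero_le_mult_iff)
 qed
 have prod: "norm p * g <= s * G * (C * exp (D * z) * (1 / 2) ^ k)"
  if "32 ^ k * norm p <= C * exp (D * z) * (1 / 2) ^ k" "g <= s * G * 32 ^ k" "s \<ge> 0" for p :: complex and g s z k
 proof -
  have "norm p * g <= norm p * (s * G * 32 ^ k)" by (intro mult_left_mono that) simp
  also have "... = s * G * (32 ^ k * norm p)" by simp
  also have "... <= s * G * (C * exp (D * z) * (1 / 2) ^ k)" using that G(1) by (intro mult_left_mono) auto
  finally show ?thesis .
 qed
 show ?thesis
 proof (rule exI[of _ "6 * G * C"], rule exI[of _ D], intro conjI allI impI)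
  show "0 <= 6 * G * C" using G C0 by simp
  fix x y :: "'n point" and k a assume x: "x ~= 0" and y: "y ~= 0"
  let ?z = "norm x * norm y" and ?w = "(x \<bullet> y) / (norm x * norm y)"
  let ?P = "%k. mode_p CARD('n) c om k ?z" and ?Q = "%k. mode_m CARD('n) c om k ?z" and ?E = "%k. C * exp (D * ?z) * (1 / 2) ^ k"
  have z: "?z > 0" using x y by simp
  have w: "\<bar>?w\<bar> <= 1" by (rule cosine_le_1)
  have w': "sgn x \<bullet> sgn y = ?w" by (simp add: sgn_div_norm inverse_eq_divide)
  have E: "?E k \<ge> 0" for k using C0 by simp
  have GE: "0 <= G * ?E k" for k using G(1) E by (rule mult_nonneg_nonneg)
  note P = C(1)[OF z] and Q = C(2)[OF z]
  have "norm (A_term CARD('n) c om ?z ?w k) <= norm (?P k) * \<bar>gegen_a k (lam CARD('n)) ?w\<bar> + norm (?Q k) * (\<bar>gegen_b k (lam CARD('n)) ?w\<bar> / 2)"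
   unfolding A_term_modes by (rule order_trans[OF norm_triangle_ineq]) (simp add: norm_mult)
  also have "... <= 1 * G * ?E k + 1 * G * ?E k"
   by (intro add_mono prod P Q) (use G(2)[OF w, of k] G(3)[OF w, of k] in auto)
  also have "... <= 6 * G * C * exp (D * ?z) * (1 / 2) ^ k" using GE[of k] by (simp add: mult_ac)
  finally show "norm (A_term CARD('n) c om ?z ?w k) <= 6 * G * C * exp (D * ?z) * (1 / 2) ^ k" .
  have "norm (B_term CARD('n) c om ?z ?w (Suc k)) * ?z = norm (of_real ?z * B_term CARD('n) c om ?z ?w (Suc k))"
   using z by (simp add: norm_mult mult_ac)
  also have "... <= (norm (?P (Suc k)) + norm (?Q (Suc k))) * \<bar>gegenbauer k (lam CARD('n) + 1) ?w\<bar>"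
   unfolding B_term_modes[OF z] norm_mult using norm_triangle_ineq[of "- ?P (Suc k)" "?Q (Suc k)"]
   by (intro mult_mono) auto
  also have "... <= 1 * G * ?E (Suc k) + 1 * G * ?E (Suc k)"
   unfolding distrib_right by (intro add_mono prod P Q) (use G(4)[OF w, of "Suc k"] in auto)
  also have "... <= 6 * G * C * exp (D * ?z) * (1 / 2) ^ k" using GE[of k] by (simp add: mult_ac)
  finally show "norm (B_term CARD('n) c om ?z ?w (Suc k)) * ?z <= 6 * G * C * exp (D * ?z) * (1 / 2) ^ k" .
  have W: "norm (cl_wedge (sgn x) (sgn y) \<odot> a) <= 2 * norm a"
   using norm_wedge_le[of "sgn x" "sgn y" a] x y by (simp add: norm_sgn)
  have gW: "norm (if k = 0 then 0 else gegenbauer (k - 1) (lam CARD('n) + 1) ?w *r (cl_wedge (sgn x) (sgn y) \<odot> a)) <= G * 32 ^ k * (2 * norm a)"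
   using G(1) G(4)[OF w, of k] W by (cases "k = 0") (auto intro!: mult_mono)
  have zp: "norm (zonal_p k (sgn x) (sgn y) a) <= (3 * norm a) * G * 32 ^ k"
  proof -
   have "norm (zonal_p k (sgn x) (sgn y) a) <= G * 32 ^ k * norm a + G * 32 ^ k * (2 * norm a)"
    unfolding zonal_p_def w' using G(2)[OF w, of k]
    by (intro order_trans[OF norm_triangle_ineq4] add_mono gW) (auto intro: mult_right_mono)
   then show ?thesis by (simp add: mult_ac)
  qed
  have zm: "norm (zonal_m k (sgn x) (sgn y) a) <= (3 * norm a) * G * 32 ^ k"
  proof -
   have "\<bar>gegen_b k (lam CARD('n)) ?w / 2\<bar> <= G * 32 ^ k" using G(3)[OF w, of k] by simp
   then have "norm (zonal_m k (sgn x) (sgn y) a) <= G * 32 ^ k * norm a + G * 32 ^ k * (2 * norm a)"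
    unfolding zonal_m_def w'
    by (intro order_trans[OF norm_triangle_ineq] add_mono gW) (simp only: norm_scaleR, rule mult_right_mono, auto)
   then show ?thesis by (simp add: mult_ac)
  qed
  have "norm (kernel_term c om k x y a) <= norm (?P k) * norm (zonal_p k (sgn x) (sgn y) a) + norm (?Q k) * norm (zonal_m k (sgn x) (sgn y) a)"
   unfolding kernel_term_def by (rule order_trans[OF norm_triangle_ineq]) (simp add: norm_smult)
  also have "... <= (3 * norm a) * G * ?E k + (3 * norm a) * G * ?E k"
   by (intro add_mono prod P Q zp zm) auto
  finally show "norm (kernel_term c om k x y a) <= 6 * G * C * exp (D * ?z) * (1 / 2) ^ k * norm a" by (simp add: mult_ac)
 qed
qed

section \<open>Summation and domination of the kernel\<close>

definition gauss_factor :: "complex => real => complex" where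
 "gauss_factor om u = exp (- (cosh om / sinh om) / 2 * of_real u)"

lemma norm_gauss_factor: "norm (gauss_factor om u) = exp (- (Re (cosh om / sinh om) / 2) * u)"
proof -
 have "- (cosh om / sinh om) / 2 * of_real u = (- (u / 2)) *r (cosh om / sinh om)" by (simp add: scaleR_conv_of_real mult.commute)
 then show ?thesis unfolding gauss_factor_def norm_exp_eq_Re by simp
qed

lemma half_power_summable: "summable (%k. K * (1 / 2 :: real) ^ k)"
 by (intro summable_mult summable_geometric) simp

lemma series_summable:
 fixes x y :: "'n::{finite,linorder} point"
 assumes om: "Re om > 0" and c: "c > -1" and m: "CARD('n) \<ge> 2" and x: "x ~= 0" and y: "y ~= 0"
 defines "z \<equiv> norm x * norm y"
 defines "w \<equiv> (x \<bullet> y) / z"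
 shows "summable (%k. A_term CARD('n) c om z w k)" "summable (%k. B_term CARD('n) c om z w (Suc k))"
  and "(%k. gauss_factor om (nsq x + nsq y) *s kernel_term c om k x y a) sums (kernel c om x y \<odot> a)"
proof -
 have z: "z > 0" using x y by (simp add: z_def)
 obtain K D where K: "!!k. norm (A_term CARD('n) c om z w k) <= K * exp (D * z) * (1 / 2) ^ k"
  "!!k. norm (B_term CARD('n) c om z w (Suc k)) * z <= K * exp (D * z) * (1 / 2) ^ k"
  using term_bounds[OF om c m] x y unfolding z_def w_def by meson
 show A: "summable (%k. A_term CARD('n) c om z w k)"
  by (rule summable_comparison_test'[OF half_power_summable[of "K * exp (D * z)"], of 0]) (rule K)
 have "norm (B_term CARD('n) c om z w (Suc k)) <= K * exp (D * z) / z * (1 / 2) ^ k" for k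
  using K(2)[of k] z by (simp add: field_simps)
 then show B: "summable (%k. B_term CARD('n) c om z w (Suc k))"
  by (intro summable_comparison_test'[OF half_power_summable[of "K * exp (D * z) / z"], of 0])
 let ?W = "cl_wedge x y \<odot> a"
 let ?b = "%k. if k = 0 then 0 else B_term CARD('n) c om z w k *s ?W"
 have "(%k. ?b (Suc k)) sums (B_series CARD('n) c om z w *s ?W)"
  unfolding B_series_def using bounded_linear.sums[OF bounded_bilinear.bounded_linear_left[OF bounded_bilinear_smult] summable_sums[OF B]] by simp
 then have b: "?b sums (B_series CARD('n) c om z w *s ?W)" using sums_Suc_iff[of ?b] by simp
 have "(%k. A_term CARD('n) c om z w k *s a) sums (A_series CARD('n) c om z w *s a)"
  unfolding A_series_def by (rule bounded_linear.sums[OF bounded_bilinear.bounded_linear_left[OF bounded_bilinear_smult] summable_sums[OF A]])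
 from sums_add[OF this b] have "kernel_term c om k x y a = kernel_term c om k x y a ==>
   (%k. kernel_term c om k x y a) sums (A_series CARD('n) c om z w *s a + B_series CARD('n) c om z w *s ?W)" for k
  unfolding kernel_term_eq[OF x y, folded z_def, folded w_def] .
 then have "(%k. kernel_term c om k x y a) sums (A_series CARD('n) c om z w *s a + B_series CARD('n) c om z w *s ?W)" by simp
 from bounded_linear.sums[OF bounded_linear_smult this]
 show "(%k. gauss_factor om (nsq x + nsq y) *s kernel_term c om k x y a) sums (kernel c om x y \<odot> a)"
  by (simp add: kernel_def gauss_factor_def z_def[symmetric] w_def[symmetric] cl_mult_scale_left cl_mult_add_left)
qed

text \<open>Since Re coth > 0, the Gaussian absorbs exp(D |x| |y|) and leaves a square integrable
  function of \<open>x\<close>, whose product with \<open>f\<close> is integrable. The factor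
  (1/2)^k serves the exchange of sum and integral.\<close>

lemma kernel_dominated:
 fixes f :: "'n::{finite,linorder} clfun"
 assumes om: "Re om > 0" and c: "c > -1" and m: "CARD('n) \<ge> 2" and y: "y ~= 0" and f: "f \<in> L2 c"
 shows "\<exists>g. integrable lborel g \<and> (\<forall>x k. x ~= 0 --> norm (weight CARD('n) c (norm x) *r
  (gauss_factor om (nsq x + nsq y) *s kernel_term c om k x y (f x))) <= g x * (1 / 2) ^ k)"
proof -
 obtain K D where K: "K \<ge> 0" "!!x k a. x ~= 0 ==> norm (kernel_term c om k x y a) <= K * exp (D * (norm x * norm y)) * (1 / 2) ^ k * norm a"
  using term_bounds[OF om c m] y by meson
 define kp where "kp = Re (cosh om / sinh om) / 2"
 have kp: "kp > 0" using Re_coth[OF om] by (simp add: kp_def)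
 let ?e = "%x :: 'n point. exp (D * norm y * norm x - kp * nsq x)"
 have L: "(%x. ?e x *r axis {} 1) \<in> L2 c"
  by (rule L2_bound[OF c m _ kp, where s = 0 and C = 1 and b = "D * norm y"]) auto
 have [measurable]: "f \<in> borel_measurable borel" using f by (rule L2_measurable)
 define g where "g x = K * (weight CARD('n) c (norm x) * (norm (f x) * ?e x))" for x
 have "integrable lborel g"
  unfolding g_def[abs_def] using L2_integrable_norm_mult[OF f L]
  by (intro integrable_mult_right) (simp add: integrable_wmeasure)
 moreover have "norm (weight CARD('n) c (norm x) *r (gauss_factor om (nsq x + nsq y) *s kernel_term c om k x y (f x))) <= g x * (1 / 2) ^ k"
  if x: "x ~= 0" for x k
 proof -
  have "norm (gauss_factor om (nsq x + nsq y)) <= exp (- kp * nsq x)"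
   using kp unfolding norm_gauss_factor kp_def[symmetric] by (simp add: distrib_left)
  then have "norm (gauss_factor om (nsq x + nsq y)) * norm (kernel_term c om k x y (f x))
    <= exp (- kp * nsq x) * (K * exp (D * (norm x * norm y)) * (1 / 2) ^ k * norm (f x))"
   by (intro mult_mono K x) auto
  also have "... = K * (norm (f x) * ?e x) * (1 / 2) ^ k"
   unfolding diff_conv_add_uminus exp_add by (simp add: mult_ac)
  finally have "weight CARD('n) c (norm x) * (norm (gauss_factor om (nsq x + nsq y)) * norm (kernel_term c om k x y (f x)))
    <= weight CARD('n) c (norm x) * (K * (norm (f x) * ?e x) * (1 / 2) ^ k)"
   by (rule mult_left_mono[OF _ weight_nonneg])
  then show ?thesis by (simp add: g_def norm_smult weight_nonneg mult_ac)
 qed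
 ultimately show ?thesis by blast
qed

lemma kernel_integrable:
 fixes f :: "'n::{finite,linorder} clfun"
 assumes om: "Re om > 0" and c: "c > -1" and m: "CARD('n) \<ge> 2" and y: "y ~= 0" and f: "f \<in> L2 c"
 shows "integrable lborel (%x. weight CARD('n) c (norm x) *r (kernel c om x y \<odot> f x))"
proof -
 obtain g where g: "integrable lborel g" and b: "!!x k. x ~= 0 ==> norm (weight CARD('n) c (norm x) *r
  (gauss_factor om (nsq x + nsq y) *s kernel_term c om k x y (f x))) <= g x * (1 / 2) ^ k"
  using kernel_dominated[OF assms] by blast
 have [measurable]: "(%x. kernel c om x y \<odot> f x) \<in> borel_measurable borel"
  by (rule borel_measurable_bilinear[OF bounded_bilinear_cl_mult kernel_measurable L2_measurable[OF f]])
 have "norm (weight CARD('n) c (norm x) *r (kernel c om x y \<odot> f x)) <= norm (2 * g x)" if x: "x ~= 0" for x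
 proof -
  note s = bounded_linear.sums[OF bounded_linear_scaleR_right series_summable(3)[OF om c m x y]]
  have g2: "(%k. g x * (1 / 2) ^ k) sums (g x * 2)" by (intro sums_mult) (use geometric_sums[of "1 / 2 :: real"] in simp)
  have "norm (weight CARD('n) c (norm x) *r (kernel c om x y \<odot> f x)) <= g x * 2"
   by (rule norm_sums_le[OF s g2 b[OF x]])
  then show ?thesis by simp
 qed
 then have "AE x in lborel. norm (weight CARD('n) c (norm x) *r (kernel c om x y \<odot> f x)) <= norm (2 * g x)"
  using AE_lborel_singleton[of "0 :: 'n point"] by (auto elim: eventually_mono)
 then show ?thesis
  by (rule Bochner_Integration.integrable_bound[OF integrable_mult_right[OF g], rotated]) measurable
qed

section \<open>Radial integrals of the modes and the transform of a basis function\<close>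

lemma radial_integrable_bound:
 fixes F :: "real => complex"
 assumes [measurable]: "F \<in> borel_measurable borel" and s: "s + real m / 2 > 0" and kp: "kp > 0"
  and b: "!!u. u > 0 ==> norm (F u) <= C * (u powr s * exp (b * sqrt u - kp * u))"
 shows "integrable (radial m) F"
proof -
 have C: "C \<ge> 0" using order_trans[OF norm_ge_zero b[of 1]] by (simp add: zero_le_mult_iff)
 let ?K = "C * exp (b\<^sup>2 / (2 * kp)) / 2"
 have "norm ((indicator {0<..} u * (u powr (real m / 2 - 1) / 2)) *r F u)
   <= norm (?K * (indicator {0<..} u * (u powr (real m / 2 - 1 + s) * exp (- (kp / 2) * u))))" for u
 proof (cases "u > 0")
  case True
  have "b * sqrt u <= kp / 2 * (sqrt u)\<^sup>2 + b\<^sup>2 / (4 * (kp / 2))" using kp by (intro absorb_linear) simp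
  then have "b * sqrt u - kp * u <= b\<^sup>2 / (2 * kp) + - (kp / 2) * u" using True by simp
  then have "exp (b * sqrt u - kp * u) <= exp (b\<^sup>2 / (2 * kp)) * exp (- (kp / 2) * u)"
   unfolding exp_add[symmetric] exp_le_cancel_iff .
  then have "C * (u powr s * exp (b * sqrt u - kp * u)) <= C * (u powr s * (exp (b\<^sup>2 / (2 * kp)) * exp (- (kp / 2) * u)))"
   using C by (intro mult_left_mono) auto
  with b[OF True] have "norm (F u) <= C * (u powr s * (exp (b\<^sup>2 / (2 * kp)) * exp (- (kp / 2) * u)))" by linarith
  then have "u powr (real m / 2 - 1) / 2 * norm (F u) <= u powr (real m / 2 - 1) / 2 * (C * (u powr s * (exp (b\<^sup>2 / (2 * kp)) * exp (- (kp / 2) * u))))"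
   by (intro mult_left_mono) auto
  then show ?thesis using True C by (simp add: powr_add mult_ac)
 qed simp
 then show ?thesis
  unfolding integrable_radial_iff[OF assms(1)]
  by (intro Bochner_Integration.integrable_bound[OF integrable_mult_right[OF integrable_powr_exp[of "real m / 2 - 1 + s" "kp / 2"], of ?K]])
   (use s kp in auto)
qed

text \<open>The bound is exponential in sqrt u rather than in u, so it joins the linear exponent in
  |x| and leaves the Gaussian intact.\<close>

lemma laguerre_exp_bound: "\<exists>C\<ge>0. \<forall>u\<ge>0. \<bar>laguerre t av u\<bar> <= C * exp (sqrt u)"
proof (intro exI conjI allI impI)
 show "0 <= (\<Sum>i\<le>t. \<bar>laguerre_coeff t av i\<bar> * fact (2 * i))" by (intro sum_nonneg) auto
 fix u :: real assume u: "u \<ge> 0"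
 have "\<bar>laguerre t av u\<bar> <= (\<Sum>i\<le>t. \<bar>laguerre_coeff t av i * u ^ i\<bar>)" unfolding laguerre_eq by (rule sum_abs)
 also have "... <= (\<Sum>i\<le>t. \<bar>laguerre_coeff t av i\<bar> * fact (2 * i) * exp (sqrt u))"
 proof (rule sum_mono)
  fix i
  have "u ^ i = sqrt u ^ (2 * i)" using u by (simp add: power_mult)
  also have "... <= fact (2 * i) * exp (sqrt u)" using u by (intro power_le_fact_exp) simp
  finally show "\<bar>laguerre_coeff t av i * u ^ i\<bar> <= \<bar>laguerre_coeff t av i\<bar> * fact (2 * i) * exp (sqrt u)"
   using u by (simp add: abs_mult mult_left_mono mult.assoc)
 qed
 finally show "\<bar>laguerre t av u\<bar> <= (\<Sum>i\<le>t. \<bar>laguerre_coeff t av i\<bar> * fact (2 * i)) * exp (sqrt u)"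
  by (simp add: sum_distrib_right)
qed

text \<open>The integrand in u = |x|^2 for a basis function and one mode \<open>P\<close>.
  \<open>r\<close> is |y|, and \<open>s\<close> collects the powers from the weight and the basis
  function; the power in the mode stays inside \<open>P\<close>.\<close>

definition radial_part :: "complex => real => real => nat => real => real => (real => complex) => real => complex" where
 "radial_part om s kp t av r P u = (u powr s * (kp * lag_exp t av u)) *r (gauss_factor om (u + r\<^sup>2) * P (sqrt u * r))"

lemma radial_part_measurable: "P \<in> borel_measurable borel ==> radial_part om s kp t av r P \<in> borel_measurable borel"
proof -
 assume [measurable]: "P \<in> borel_measurable borel"
 show ?thesis unfolding radial_part_def[abs_def] lag_exp_def gauss_factor_def by measurable
qed

lemma radial_part_integrable:
 assumes om: "Re om > 0" and P: "P \<in> borel_measurable borel" and s: "s + real m / 2 > 0" and r: "r > 0"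
  and b: "!!z. z > 0 ==> norm (P z) <= C * exp (D * z)"
 shows "integrable (radial m) (radial_part om s kp t av r P)"
proof -
 obtain L where L: "L \<ge> 0" "!!u. u \<ge> 0 ==> \<bar>laguerre t av u\<bar> <= L * exp (sqrt u)" using laguerre_exp_bound by blast
 show ?thesis
 proof (rule radial_integrable_bound[OF radial_part_measurable[OF P] s, of "1 / 2"])
  fix u :: real assume u: "u > 0"
  have g: "norm (gauss_factor om (u + r\<^sup>2)) <= 1"
   unfolding norm_gauss_factor using Re_coth[OF om] u by simp
  have "norm (radial_part om s kp t av r P u) = u powr s * (\<bar>kp\<bar> * (\<bar>laguerre t av u\<bar> * exp (- u / 2))) * (norm (gauss_factor om (u + r\<^sup>2)) * norm (P (sqrt u * r)))"
   by (simp add: radial_part_def lag_exp_def abs_mult norm_mult)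
  also have "... <= u powr s * (\<bar>kp\<bar> * ((L * exp (sqrt u)) * exp (- u / 2))) * (1 * (C * exp (D * (sqrt u * r))))"
   using u r L by (intro mult_mono mult_left_mono mult_right_mono g b mult_nonneg_nonneg) auto
  also have "... = \<bar>kp\<bar> * L * C * (u powr s * (exp (sqrt u) * exp (- u / 2) * exp (D * (sqrt u * r))))" by simp
  also have "exp (sqrt u) * exp (- u / 2) * exp (D * (sqrt u * r)) = exp ((1 + D * r) * sqrt u - 1 / 2 * u)"
   unfolding exp_add[symmetric] by (rule arg_cong[where f = exp]) (simp add: algebra_simps)
  finally show "norm (radial_part om s kp t av r P u) <= \<bar>kp\<bar> * L * C * (u powr s * exp ((1 + D * r) * sqrt u - 1 / 2 * u))" .
 qed simp
qed

text \<open>The powers from the density, from \<open>s\<close> and from the mode add up to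
  \<open>av\<close>, the common index of the Laguerre polynomial and the Bessel function, as
  \<open>laguerre_bessel_integral\<close> demands.\<close>

lemma radial_part_integral:
 fixes om :: complex
 defines "q \<equiv> exp (- 2 * om)"
 assumes om: "Re om > 0" and Pm: "P \<in> borel_measurable borel" and r: "r > 0" and av: "av > -1" "s + p / 2 + real m / 2 - 1 = av"
  and P: "!!z. z > 0 ==> P z = A * of_real (z powr p) * bessel_Jt av (\<i> * of_real z / sinh om)"
 shows "integral\<^sup>L (radial m) (radial_part om s kp t av r P)
   = A / 2 * (1 - q) powr of_real (av + 1) * q ^ t * of_real (kp * r powr p * lag_exp t av (r\<^sup>2))"
proof -
 have nz: "1 - q ~= 0" unfolding q_def by (rule one_minus_exp_nz[OF om])
 have ch: "cosh om / sinh om / 2 = q / (1 - q) + 1 / 2" unfolding q_def by (rule coth_half[OF om])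
 have gf: "gauss_factor om u = exp (- (q / (1 - q) + 1 / 2) * of_real u)" for u
  unfolding gauss_factor_def minus_divide_left[symmetric] ch ..
 have gu: "of_real (exp (- u / 2)) * gauss_factor om u = exp (- (1 / (1 - q)) * of_real u)" for u
 proof -
  have "1 / (1 - q) = q / (1 - q) + 1" using nz by (simp add: field_simps)
  then show ?thesis unfolding gf exp_of_real[symmetric] exp_add[symmetric] by (simp add: algebra_simps)
 qed
 \<comment> \<open>On the side of \<open>y\<close> the exponential produced by the integral meets
   the kernel's Gaussian, and exp(-v/2) of the basis function is restored.\<close>
 have gv: "gauss_factor om v * exp (of_real v * q / (1 - q)) = of_real (exp (- v / 2))" for v
  unfolding gf exp_of_real[symmetric] exp_add[symmetric] by (rule arg_cong[where f = exp]) (simp add: algebra_simps)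
 let ?I = "%u. (indicator {0<..} u * (u powr av * laguerre t av u)) *r
   (exp (- (1 / (1 - q)) * of_real u) * bessel_Jt av (\<i> * of_real (sqrt (u * r\<^sup>2)) / sinh om))"
 have "(indicator {0<..} u * (u powr (real m / 2 - 1) / 2)) *r radial_part om s kp t av r P u
   = (A / 2 * of_real (kp * r powr p) * gauss_factor om (r\<^sup>2)) * ?I u" for u
 proof (cases "u > 0")
  case True
  have ua: "u powr av = u powr (real m / 2 - 1) * u powr s * sqrt u powr p"
   using True by (simp add: av(2)[symmetric] powr_half_sqrt[symmetric] powr_powr powr_add[symmetric] algebra_simps)
  have g2: "gauss_factor om (u + r\<^sup>2) = gauss_factor om u * gauss_factor om (r\<^sup>2)"
   by (simp add: gf exp_add[symmetric] distrib_left)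
  have sq: "sqrt (u * r\<^sup>2) = sqrt u * r" using r by (simp add: real_sqrt_mult)
  have P: "P (sqrt u * r) = A * of_real (sqrt u powr p * r powr p) * bessel_Jt av (\<i> * of_real (sqrt u * r) / sinh om)"
   using P[of "sqrt u * r"] True r by (simp add: powr_mult)
  show ?thesis using True
   unfolding radial_part_def P g2 gu[symmetric] ua sq lag_exp_def
   by (simp add: scaleR_conv_of_real)
 qed simp
 then have "integral\<^sup>L (radial m) (radial_part om s kp t av r P) = (A / 2 * of_real (kp * r powr p) * gauss_factor om (r\<^sup>2)) * integral\<^sup>L lborel ?I"
  unfolding integral_radial[OF radial_part_measurable[OF Pm]] by (simp only: integral_mult_right_zero)
 also have "integral\<^sup>L lborel ?I = (1 - q) powr of_real (av + 1) * q ^ t * of_real (laguerre t av (r\<^sup>2)) * exp (of_real (r\<^sup>2) * q / (1 - q))"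
  unfolding q_def by (rule laguerre_bessel_integral[OF om av(1)]) simp
 also have "(A / 2 * of_real (kp * r powr p) * gauss_factor om (r\<^sup>2)) * ...
   = A / 2 * (1 - q) powr of_real (av + 1) * q ^ t * of_real (kp * r powr p * laguerre t av (r\<^sup>2)) * (gauss_factor om (r\<^sup>2) * exp (of_real (r\<^sup>2) * q / (1 - q)))"
  by (simp add: mult_ac)
 finally show ?thesis unfolding gv by (simp add: lag_exp_def mult_ac)
qed

text \<open>Opposite principal powers of 1 - exp(-2 om) cancel, and delta/2 - gamma/2 = -l/(1 +
  c).\<close>

lemma alpha_cancel:
 assumes om: "Re om > 0" and c: "c > -1"
 shows "alpha m c om (int l) / 2 * (1 - exp (- 2 * om)) powr of_real (gam m c (real l) / 2) = exp (- om * of_real (real l / (1 + c)))"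
proof -
 let ?g = "gam m c (real l) / 2"
 have "(1 - exp (- 2 * om)) powr of_real (- ?g) * (1 - exp (- 2 * om)) powr of_real ?g = 1"
  unfolding powr_add[symmetric] using one_minus_exp_nz[OF om] by simp
 moreover have "exp (om * of_real (delta m c) / 2) * exp (om * of_real (- ?g)) = exp (- om * of_real (real l / (1 + c)))"
  unfolding exp_add[symmetric] gam_half[OF c] by (rule arg_cong[where f = exp]) (simp add: algebra_simps)
 moreover have "alpha m c om (int l) / 2 * (1 - exp (- 2 * om)) powr of_real ?g
   = (exp (om * of_real (delta m c) / 2) * exp (om * of_real (- ?g))) * ((1 - exp (- 2 * om)) powr of_real (- ?g) * (1 - exp (- 2 * om)) powr of_real ?g)"
  by (simp add: alpha_def two_sinh_powr_def)
 ultimately show ?thesis by simp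
qed

lemma zonal_scaleR: "zonal_p k \<xi> \<eta> (\<rho> *r a) = \<rho> *r zonal_p k \<xi> \<eta> a" "zonal_m k \<xi> \<eta> (\<rho> *r a) = \<rho> *r zonal_m k \<xi> \<eta> a"
 by (simp_all add: zonal_p_def zonal_m_def cl_mult_scaleR_right scaleR_diff_right scaleR_add_right mult_ac)

lemma integral_transform_phi:
 fixes M :: "nat => nat => 'n::{finite,linorder} clfun"
 assumes om: "Re om > 0" and c: "c > -1" and m: "CARD('n) \<ge> 2" and M: "monogenic l (M l j)" and y: "y ~= 0"
 shows "integral_transform c om (phi c M n l j) y = exp (- om * of_real (real n + real l / (1 + c))) *s phi c M n l j y"
proof -
 define k0 where "k0 = l + n mod 2"
 define A where "A = phi_angular n (M l j)"
 define av where "av = phi_index (gam CARD('n) c (real l)) n"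
 define b where "b = beta c (real l)"
 define kp where "kp = phi_coeff c n"
 define t where "t = n div 2"
 define r where "r = norm y"
 define \<eta> where "\<eta> = sgn y"
 let ?d = "delta CARD('n) c" and ?\<sigma> = "sphere_area CARD('n)"
 define s where "s = (?d - real CARD('n) + b + real k0) / 2"
 let ?P = "mode_p CARD('n) c om" and ?Q = "mode_m CARD('n) c om"
 define F where "F = radial_part om s kp t av r"
 have hM: "hpoly l (M l j)" using M by (simp add: monogenic_def)
 have h: "hpoly k0 A" unfolding k0_def A_def by (rule phi_angular_hpoly[OF hM])
 have d: "?d > 0" by (rule delta_pos[OF c m])
 have bl: "b + real l = real l / (1 + c)" unfolding b_def by (rule beta_plus[OF c])
 then have bl0: "b + real l \<ge> 0" using c by simp
 have r: "r > 0" and \<eta>: "norm \<eta> = 1" using y by (simp_all add: r_def \<eta>_def norm_sgn)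
 have av: "av = ?d / 2 - 1 + (b + real k0)" unfolding av_def b_def by (rule phi_index_eq[OF c]) (simp add: k0_def)
 have av1: "av > -1" using d bl0 unfolding av k0_def by simp
 have sm: "s + real CARD('n) / 2 > 0" using d bl0 unfolding s_def k0_def by (simp add: field_simps)
 have sav: "s + (b + real k0) / 2 + real CARD('n) / 2 - 1 = av" unfolding s_def av by (simp add: field_simps)
 obtain C D where C: "!!k z. z > 0 ==> 32 ^ k * norm (?P k z) <= C * exp (D * z) * (1 / 2) ^ k"
  "!!k z. z > 0 ==> 32 ^ k * norm (?Q k z) <= C * exp (D * z) * (1 / 2) ^ k"
  using mode_bounds[OF om c m] by blast
 have FP: "integrable (radial CARD('n)) (F (?P k))" and FQ: "integrable (radial CARD('n)) (F (?Q k))" for k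
  unfolding F_def
  by (rule radial_part_integrable[OF om mode_measurable(1) sm r, where C = "C * (1 / 2) ^ k / 32 ^ k" and D = D]
    radial_part_integrable[OF om mode_measurable(2) sm r, where C = "C * (1 / 2) ^ k / 32 ^ k" and D = D],
   use C[of _ k] in \<open>simp add: field_simps\<close>)+
 have Z: "integrable sphere_measure (%\<xi>. zonal_p k \<xi> \<eta> (A \<xi>)) \<and> integrable sphere_measure (%\<xi>. zonal_m k \<xi> \<eta> (A \<xi>))
  \<and> sint (%\<xi>. zonal_p k \<xi> \<eta> (A \<xi>)) = (if even n \<and> k = k0 then ?\<sigma> else 0) *r A \<eta>
  \<and> sint (%\<xi>. zonal_m k \<xi> \<eta> (A \<xi>)) = (if odd n \<and> k = k0 then ?\<sigma> else 0) *r A \<eta>" for k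
 proof (cases "even n")
  case True
  then have "A = M l j" "k0 = l" by (auto simp: A_def phi_angular_def[abs_def] k0_def)
  note e = this zonal_monogenic_integrable[OF M \<eta> m] zonal_p_monogenic[OF M \<eta> m] zonal_m_monogenic[OF M \<eta> m]
  show ?thesis using e True by simp
 next
  case False
  then have "n mod 2 = 1" by presburger
  with False have "A = (%x. cl_vec x \<odot> M l j x)" "k0 = Suc l" by (auto simp: A_def phi_angular_def[abs_def] k0_def)
  note e = this zonal_vec_monogenic_integrable[OF M \<eta> m] zonal_p_vec_monogenic[OF M \<eta> m] zonal_m_vec_monogenic[OF M \<eta> m]
  show ?thesis using e False by simp
 qed
 note Z = Z[THEN conjunct1] Z[THEN conjunct2, THEN conjunct1] Z[THEN conjunct2, THEN conjunct2, THEN conjunct1]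
  Z[THEN conjunct2, THEN conjunct2, THEN conjunct2]
 let ?t = "%k x. weight CARD('n) c (norm x) *r (gauss_factor om (nsq x + nsq y) *s kernel_term c om k x y (phi c M n l j x))"
 have phi: "phi c M n l j x = (norm x powr (b + real k0) * (kp * lag_exp t av (nsq x))) *r A (sgn x)" if x: "x ~= 0" for x
 proof -
  have "A x = norm x ^ k0 *r A (sgn x)"
   using hpoly_scale_arg[OF h, of "norm x" "sgn x"] x by (simp add: sgn_div_norm)
  then show ?thesis using x
   unfolding phi_eq norm_square_powr A_def[symmetric] av_def[symmetric] kp_def[symmetric] t_def[symmetric] b_def[symmetric]
   by (simp add: powr_add powr_realpow mult_ac)
 qed
 have pt: "?t k x = F (?P k) (nsq x) *s zonal_p k (sgn x) \<eta> (A (sgn x)) + F (?Q k) (nsq x) *s zonal_m k (sgn x) \<eta> (A (sgn x))" for k x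
 \<comment> \<open>At the origin both sides are 0, because \<open>powr\<close> with base 0 is
   0.\<close>
 proof (cases "x = 0")
  case True
  then show ?thesis by (simp add: weight_def F_def radial_part_def)
 next
  case False
  have "nsq x powr s = norm x powr (?d - real CARD('n)) * norm x powr (b + real k0)"
   unfolding s_def norm_square_powr powr_add[symmetric] by (simp add: add.assoc)
  then show ?thesis
   unfolding phi[OF False] kernel_term_def zonal_scaleR F_def radial_part_def \<eta>_def[symmetric] r_def[symmetric] weight_eq[OF c]
   by (simp add: vector_add_ldistrib scaleR_add_right scaleR_eq_smult scaleR_conv_of_real[where 'a = complex] vector_smult_assoc mult_ac)
 qed
 note pP = polar_bilinear[OF bounded_bilinear_smult FP Z(1)] and pQ = polar_bilinear[OF bounded_bilinear_smult FQ Z(2)]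
 have ti: "integrable lborel (?t k)" for k unfolding pt by (intro Bochner_Integration.integrable_add pP pQ)
 \<comment> \<open>By \<open>Z\<close> only k = k0 contributes, through \<open>mode_p\<close> for
   even n and through \<open>mode_m\<close> for odd n.\<close>
 define V where "V = (if even n then integral\<^sup>L (radial CARD('n)) (F (?P k0)) else integral\<^sup>L (radial CARD('n)) (F (?Q k0)))"
 have tv: "integral\<^sup>L lborel (?t k) = (if k = k0 then V *s (?\<sigma> *r A \<eta>) else 0)" for k
  unfolding pt Bochner_Integration.integral_add[OF pP(1) pQ(1)] pP(2) pQ(2) Z(3,4) by (simp add: V_def)
 have phiL: "phi c M n l j \<in> L2 c" by (rule phi_L2[where M = M, OF c m hM])
 obtain g where g: "integrable lborel g" "!!x k. x ~= 0 ==> norm (?t k x) <= g x * (1 / 2) ^ k"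
  using kernel_dominated[OF om c m y phiL] by blast
 have AE0: "AE x in lborel. x ~= (0 :: 'n point)" by (rule AE_lborel_singleton)
 have gs: "summable (%k. a * (1 / 2 :: real) ^ k)" for a by (rule half_power_summable)
 have "(%k. integral\<^sup>L lborel (?t k)) sums (LINT x|lborel. (\<Sum>k. ?t k x))"
 proof (rule sums_integral[OF ti])
  show "AE x in lborel. summable (%k. norm (?t k x))"
   using AE0 by (rule eventually_mono) (rule summable_comparison_test'[OF gs, of 0], unfold real_norm_def abs_norm_cancel, rule g)
  show "summable (%k. LINT x|lborel. norm (?t k x))"
  proof (rule summable_comparison_test'[OF gs, of 0])
   fix k
   have "(LINT x|lborel. norm (?t k x)) <= (LINT x|lborel. g x * (1 / 2) ^ k)"
    by (rule integral_mono_AE[OF integrable_norm[OF ti]]) (use g(1) eventually_mono[OF AE0 g(2)] in auto)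
   then show "norm (LINT x|lborel. norm (?t k x)) <= integral\<^sup>L lborel g * (1 / 2) ^ k" by simp
  qed
 qed
 then have "(LINT x|lborel. (\<Sum>k. ?t k x)) = V *s (?\<sigma> *r A \<eta>)"
  unfolding tv using sums_single[of k0 "%_. V *s (?\<sigma> *r A \<eta>)"] by (rule sums_unique2)
 moreover have "(LINT x|lborel. (\<Sum>k. ?t k x)) = (LINT x|lborel. weight CARD('n) c (norm x) *r (kernel c om x y \<odot> phi c M n l j x))"
 proof (rule integral_cong_AE)
  show "(%x. \<Sum>k. ?t k x) \<in> borel_measurable lborel"
   by (intro borel_measurable_suminf borel_measurable_integrable ti)
  show "(%x. weight CARD('n) c (norm x) *r (kernel c om x y \<odot> phi c M n l j x)) \<in> borel_measurable lborel"
   by (rule borel_measurable_integrable[OF kernel_integrable[OF om c m y phiL]])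
  show "AE x in lborel. (\<Sum>k. ?t k x) = weight CARD('n) c (norm x) *r (kernel c om x y \<odot> phi c M n l j x)"
   using AE0 by (rule eventually_mono)
    (rule sums_unique[symmetric], rule bounded_linear.sums[OF bounded_linear_scaleR_right series_summable(3)[OF om c m _ y]])
 qed
 ultimately have "integral_transform c om (phi c M n l j) y = inverse ?\<sigma> *r (V *s (?\<sigma> *r A \<eta>))"
  by (simp add: integral_transform_def)
 also have "... = V *s A \<eta>" using sphere_area_pos[of "CARD('n)"] by (simp add: smult_scaleR)
 also have "V = exp (- om * of_real (real n + real l / (1 + c))) * of_real (kp * r powr (b + real k0) * lag_exp t av (r\<^sup>2))"
 proof (cases "even n")
  case True
  then have k: "k0 = l" and n: "n = 2 * t" by (auto simp: k0_def t_def)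
  have g: "av = gam CARD('n) c (real l) / 2 - 1" using True by (simp add: av_def phi_index_def)
  have "V = alpha CARD('n) c om (int l) / 2 * (1 - exp (- 2 * om)) powr of_real (av + 1) * exp (- 2 * om) ^ t * of_real (kp * r powr (b + real k0) * lag_exp t av (r\<^sup>2))"
   unfolding V_def F_def if_P[OF True]
   by (rule radial_part_integral[OF om mode_measurable(1) r av1 sav]) (simp add: mode_p_def k bl g)
  also have "av + 1 = gam CARD('n) c (real l) / 2" by (simp add: g)
  also have "exp (- 2 * om) ^ t = exp (- om * of_real (real n))"
   unfolding exp_of_nat_mult[symmetric] n by (rule arg_cong[where f = exp]) simp
  finally show ?thesis unfolding alpha_cancel[OF om c] exp_add[symmetric] by (simp add: algebra_simps)
 next
  case False
  then have "n mod 2 = 1" by presburger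
  then have k: "k0 = Suc l" and n: "n = 2 * t + 1" unfolding k0_def t_def by (simp, presburger)
  have g: "av = gam CARD('n) c (real l) / 2" using False by (simp add: av_def phi_index_def)
  have p: "(real (Suc l) + c) / (1 + c) = b + real k0" using bl c unfolding k by (simp add: field_simps)
  let ?q = "exp (- 2 * om)"
  have "V = alpha CARD('n) c om (int l) / (2 * sinh om) / 2 * (1 - ?q) powr of_real (av + 1) * ?q ^ t * of_real (kp * r powr (b + real k0) * lag_exp t av (r\<^sup>2))"
   unfolding V_def F_def if_not_P[OF False]
   by (rule radial_part_integral[OF om mode_measurable(2) r av1 sav]) (unfold mode_m_def k p[unfolded k] g, simp)
  \<comment> \<open>For odd n the Laguerre index is gamma/2 instead of gamma/2 - 1. The surplus
    factor 1 - q cancels against 2 sinh om = exp om (1 - q) and leaves exp(-om), the odd step of the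
    eigenvalue.\<close>
  also have "(1 - ?q) powr of_real (av + 1) = (1 - ?q) powr of_real (gam CARD('n) c (real l) / 2) * (1 - ?q)"
   unfolding g using one_minus_exp_nz[OF om] by (simp add: powr_add)
  also have "alpha CARD('n) c om (int l) / (2 * sinh om) / 2 * ((1 - ?q) powr of_real (gam CARD('n) c (real l) / 2) * (1 - ?q))
    = (alpha CARD('n) c om (int l) / 2 * (1 - ?q) powr of_real (gam CARD('n) c (real l) / 2)) * exp (- om)"
   unfolding two_sinh[OF om] using one_minus_exp_nz[OF om] by (simp add: exp_minus field_simps)
  also have "... * ?q ^ t = exp (- om * of_real (real n + real l / (1 + c)))"
   unfolding alpha_cancel[OF om c] exp_of_nat_mult[symmetric] exp_add[symmetric] n by (rule arg_cong[where f = exp]) (simp add: algebra_simps)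
  finally show ?thesis .
 qed
 also have "(exp (- om * of_real (real n + real l / (1 + c))) * of_real (kp * r powr (b + real k0) * lag_exp t av (r\<^sup>2))) *s A \<eta>
   = exp (- om * of_real (real n + real l / (1 + c))) *s phi c M n l j y"
  unfolding phi[OF y] \<eta>_def[symmetric] r_def[symmetric] scaleR_eq_smult vector_smult_assoc by (simp add: mult_ac)
 finally show ?thesis .
qed

text \<open>The transform is evaluated for \<open>y\<close> other than 0 only; its value at the
  origin concerns a single point and affects neither measurability nor the class in L^2.\<close>

lemma L2_cong_nonzero:
 fixes f g :: "'n::{finite,linorder} clfun"
 assumes f: "f \<in> L2 c" and eq: "!!x. x ~= 0 ==> g x = f x"
 shows "g \<in> L2 c" and "l2_eq c g f"
proof -
 have [measurable]: "f \<in> borel_measurable borel" by (rule L2_measurable[OF f])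
 have "g = (%x. if x = 0 then g 0 else f x)" using eq by auto
 also have "... \<in> borel_measurable borel" by measurable
 finally have [measurable]: "g \<in> borel_measurable borel" .
 have "AE x in wmeasure c. x ~= (0 :: 'n point)"
  by (rule AE_wmeasure) (use AE_lborel_singleton[of "0 :: 'n point"] in \<open>auto elim: eventually_mono\<close>)
 then show ae: "l2_eq c g f" unfolding l2_eq_def by (rule eventually_mono) (rule eq)
 have "integrable (wmeasure c) (%x. (norm (g x))\<^sup>2) \<longleftrightarrow> integrable (wmeasure c) (%x. (norm (f x))\<^sup>2)"
  by (rule integrable_cong_AE, measurable) (use ae[unfolded l2_eq_def] in \<open>auto elim: eventually_mono\<close>)
 then show "g \<in> L2 c" using f by (simp add: L2_def)
qed

no_notation scaleR (infixr "*r" 75)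

theorem theorem6p2:
  fixes c :: real and \<omega> :: complex
    and d :: "nat \<Rightarrow> nat"
    and M :: "nat \<Rightarrow> nat \<Rightarrow> 'n point \<Rightarrow> 'n::{finite,linorder} cliff"
  assumes "CARD('n) \<ge> 2" and "Re \<omega> > 0" and "c > -1"
    and "orthonormal_bases d M"
  shows "(\<forall>x y :: 'n point. x \<noteq> 0 \<longrightarrow> y \<noteq> 0 \<longrightarrow>
            (let z = norm x * norm y; w = (x \<bullet> y) / z in
              summable (\<lambda>k. A_term CARD('n) c \<omega> z w k) \<and>
              summable (\<lambda>k. B_term CARD('n) c \<omega> z w (Suc k)))) \<and>
         (\<forall>f \<in> (L2 c :: ('n point \<Rightarrow> 'n cliff) set). \<forall>y. y \<noteq> 0 \<longrightarrow>
            integrable lborel (\<lambda>x. weight CARD('n) c (norm x) *\<^sub>R (kernel c \<omega> x y \<odot> f x))) \<and>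
         (\<forall>n l j. j < d l \<longrightarrow>
            (phi c M n l j, integral_transform c \<omega> (phi c M n l j)) \<in> exponential_transform c \<omega> d M)"
proof (intro conjI ballI allI impI)
  note m = assms(1) and \<omega> = assms(2) and c = assms(3) and B = assms(4)
  {
    fix x y :: "'n point" assume "x \<noteq> 0" "y \<noteq> 0"
    then show "let z = norm x * norm y; w = (x \<bullet> y) / z in
        summable (\<lambda>k. A_term CARD('n) c \<omega> z w k) \<and> summable (\<lambda>k. B_term CARD('n) c \<omega> z w (Suc k))"
      using series_summable(1,2)[OF \<omega> c m] by (simp add: Let_def)
  next
    fix f :: "'n point \<Rightarrow> 'n cliff" and y :: "'n point" assume "f \<in> L2 c" "y \<noteq> 0"
    then show "integrable lborel (\<lambda>x. weight CARD('n) c (norm x) *\<^sub>R (kernel c \<omega> x y \<odot> f x))"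
      by (intro kernel_integrable \<omega> c m)
  next
    fix n l j assume j: "j < d l"
    let ?\<phi> = "phi c M n l j" and ?\<mu> = "(1 + c)\<^sup>2 * (2 * real n + gam CARD('n) c (real l))"
    let ?\<psi> = "\<lambda>t. exp (- (\<omega> / (2 * (1 + complex_of_real c)\<^sup>2)) * complex_of_real t)"
    have M: "monogenic l (M l j)"
      using B j by (auto simp: orthonormal_bases_def intro: monogenics_monogenic)
    have L: "?\<phi> \<in> L2 c" by (rule phi_L2[OF c m]) (use M in \<open>simp add: monogenic_def\<close>)
    \<comment> \<open>The factor (1 + c)^2 of the eigenvalue cancels and leaves the exponent -
      \<omega> (n + gamma/2). The prefactor with delta/2 then removes the constant part of gamma/2 =
      l/(1 + c) + delta/2.\<close>
    have "(2 * (1 + complex_of_real c)\<^sup>2) \<noteq> 0" using c by (simp add: complex_eq_iff)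
    then have "- (\<omega> / (2 * (1 + complex_of_real c)\<^sup>2)) * complex_of_real ?\<mu> = - \<omega> * of_real (real n + gam CARD('n) c (real l) / 2)"
      by (simp add: field_simps)
    then have "exp (\<omega> * of_real (delta CARD('n) c) / 2) * ?\<psi> ?\<mu> = exp (- \<omega> * of_real (real n + real l / (1 + c)))"
      unfolding exp_add[symmetric] gam_half[OF c] by (intro arg_cong[where f = exp]) (simp add: algebra_simps)
    then have eq: "integral_transform c \<omega> ?\<phi> y = exp (\<omega> * of_real (delta CARD('n) c) / 2) *s (?\<psi> ?\<mu> *s ?\<phi> y)" if "y \<noteq> 0" for y
      unfolding vector_smult_assoc integral_transform_phi[where M = M, OF \<omega> c m M that] by simp
    have "(?\<phi>, \<lambda>x. ?\<psi> ?\<mu> *s ?\<phi> x) \<in> functional_calculus c (graph_closure c (oscillator_graph c d M)) ?\<psi>"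
      by (rule phi_functional_calculus[OF c m B j]) measurable
    then show "(?\<phi>, integral_transform c \<omega> ?\<phi>) \<in> exponential_transform c \<omega> d M"
      unfolding exponential_transform_def using L2_cong_nonzero[OF L2_smult[OF L2_smult[OF L]] eq] by blast
  }
qed

end
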